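(* Let $H$ be an iterated Hopf Ore extension (IHOE) of $\Bbbk$. Then every Hopf subalgebra of $H$ is an IHOE of $\Bbbk$, and for every Hopf ideal $\mathfrak a\subset H$ the quotient Hopf algebra $H/\mathfrak a$ is an IHOE of $\Bbbk$.
   Context: $\Bbbk$ is a field of characteristic zero; all algebras, Hopf algebras and tensor products are over $\Bbbk$. Ore extension: an algebra $H$ containing an algebra $R$ as a subalgebra is an Ore extension of $R$ if there are $X\in H$, an algebra automorphism $\sigma$ of $R$ and a $\sigma$-derivation $\delta$ of $R$ (so $\delta(rs)=\delta(r)s+\sigma(r)\delta(s)$) such that $H$ is a free left $R$-module with basis $\{1,X,X^2,\dots\}$ and $Xr=\sigma(r)X+\delta(r)$ for all $r\in R$. IHOE: for an integer $n\ge 0$, an $n$-step iterated Hopf Ore extension of a Hopf algebra $R$ is a Hopf algebra $H$ with a chain of Hopf subalgebras $R=H_0\subset H_1\subset\cdots\subset H_n=H$ such that, as an algebra, $H_i$ is an Ore extension of $H_{i-1}$ for $1\le i\le n$. $H$ is an IHOE of $R$ if it is an $n$-step one for some $n\ge 0$. *)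

theory Defs
  imports "HOL-Algebra.Algebra" "HOL.Hull"
begin

section \<open>Algebras and linear maps over a field\<close>

text \<open>The library locale \<open>algebra\<close> is restricted to commutative algebras; Hopf algebras need not
  be commutative.\<close>

locale k_algebra = K: field k + V: module k A + A: ring A
  for k :: "('k, 'l) ring_scheme" and A :: "('k, 'a, 'm) module_scheme" +
  assumes smult_mult_left:
      "\<lbrakk>c \<in> carrier k; x \<in> carrier A; y \<in> carrier A\<rbrakk>
        \<Longrightarrow> (c \<odot>\<^bsub>A\<^esub> x) \<otimes>\<^bsub>A\<^esub> y = c \<odot>\<^bsub>A\<^esub> (x \<otimes>\<^bsub>A\<^esub> y)"
    and smult_mult_right:
      "\<lbrakk>c \<in> carrier k; x \<in> carrier A; y \<in> carrier A\<rbrakk>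
        \<Longrightarrow> x \<otimes>\<^bsub>A\<^esub> (c \<odot>\<^bsub>A\<^esub> y) = c \<odot>\<^bsub>A\<^esub> (x \<otimes>\<^bsub>A\<^esub> y)"

definition linear_map ::
  "('k, 'l) ring_scheme \<Rightarrow> ('k, 'a, 'm) module_scheme \<Rightarrow> ('k, 'b, 'n) module_scheme
    \<Rightarrow> ('a \<Rightarrow> 'b) set" where
  "linear_map k V W = {f. f \<in> carrier V \<rightarrow> carrier W
     \<and> (\<forall>x\<in>carrier V. \<forall>y\<in>carrier V. f (x \<oplus>\<^bsub>V\<^esub> y) = f x \<oplus>\<^bsub>W\<^esub> f y)
     \<and> (\<forall>c\<in>carrier k. \<forall>x\<in>carrier V. f (c \<odot>\<^bsub>V\<^esub> x) = c \<odot>\<^bsub>W\<^esub> f x)}"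

definition subalg ::
  "('k, 'l) ring_scheme \<Rightarrow> ('k, 'a, 'm) module_scheme \<Rightarrow> 'a set \<Rightarrow> bool" where
  "subalg k A B \<longleftrightarrow> subring B A \<and> submodule B k A"

text \<open>The quotient by a two-sided ideal: \<open>FactRing\<close>, with the scalar multiplication on cosets.\<close>

definition quot_alg ::
  "('k, 'a, 'm) module_scheme \<Rightarrow> 'a set \<Rightarrow> ('k, 'a set) module" where
  "quot_alg A I =
    \<lparr>carrier = carrier (A Quot I), monoid.mult = monoid.mult (A Quot I),
     monoid.one = monoid.one (A Quot I),
     ring.zero = ring.zero (A Quot I), ring.add = ring.add (A Quot I),
     smult = (\<lambda>c T. \<Union>x\<in>T. I +>\<^bsub>A\<^esub> (c \<odot>\<^bsub>A\<^esub> x))\<rparr>"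


section \<open>Tensor products\<close>

text \<open>The monoid algebra \<open>k[G]\<close>: as a vector space, the free one on \<open>carrier G\<close>, realised as the
  finitely supported functions; the product is convolution.\<close>

definition free_alg ::
  "('k, 'l) ring_scheme \<Rightarrow> ('g, 'n) monoid_scheme \<Rightarrow> ('k, 'g \<Rightarrow> 'k) module" where
  "free_alg k G =
     \<lparr>carrier = {f. range f \<subseteq> carrier k \<and> finite {s. f s \<noteq> \<zero>\<^bsub>k\<^esub>}
        \<and> {s. f s \<noteq> \<zero>\<^bsub>k\<^esub>} \<subseteq> carrier G},
      monoid.mult = (\<lambda>f g s. \<Oplus>\<^bsub>k\<^esub>p\<in>{(u, v). f u \<noteq> \<zero>\<^bsub>k\<^esub> \<and> g v \<noteq> \<zero>\<^bsub>k\<^esub> \<and> u \<otimes>\<^bsub>G\<^esub> v = s}.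
        f (fst p) \<otimes>\<^bsub>k\<^esub> g (snd p)),
      monoid.one = (\<lambda>s. if s = \<one>\<^bsub>G\<^esub> then \<one>\<^bsub>k\<^esub> else \<zero>\<^bsub>k\<^esub>),
      ring.zero = (\<lambda>s. \<zero>\<^bsub>k\<^esub>),
      ring.add = (\<lambda>f g s. f s \<oplus>\<^bsub>k\<^esub> g s),
      smult = (\<lambda>c f s. c \<otimes>\<^bsub>k\<^esub> f s)\<rparr>"

definition basis_vec :: "('k, 'l) ring_scheme \<Rightarrow> 's \<Rightarrow> 's \<Rightarrow> 'k" where
  "basis_vec k s = (\<lambda>t. if t = s then \<one>\<^bsub>k\<^esub> else \<zero>\<^bsub>k\<^esub>)"

abbreviation pair_alg where
  "pair_alg k A B \<equiv> free_alg k (A \<times>\<times> B)"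

text \<open>The subspace of \<open>k[A \<times> B]\<close> spanned by the bilinearity relations. When \<open>A\<close> and \<open>B\<close> are
  algebras it is a two-sided ideal, because their multiplications are bilinear.\<close>

definition bilin_rels ::
  "('k, 'l) ring_scheme \<Rightarrow> ('k, 'a, 'm) module_scheme \<Rightarrow> ('k, 'b, 'n) module_scheme
    \<Rightarrow> ('a \<times> 'b \<Rightarrow> 'k) set" where
  "bilin_rels k A B = (let F = pair_alg k A B; e = (\<lambda>a b. basis_vec k (a, b)) in
     (\<lambda>N. submodule N k F) hull
      ({e (a \<oplus>\<^bsub>A\<^esub> a') b \<ominus>\<^bsub>F\<^esub> (e a b \<oplus>\<^bsub>F\<^esub> e a' b) | a a' b.
          a \<in> carrier A \<and> a' \<in> carrier A \<and> b \<in> carrier B}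
       \<union> {e a (b \<oplus>\<^bsub>B\<^esub> b') \<ominus>\<^bsub>F\<^esub> (e a b \<oplus>\<^bsub>F\<^esub> e a b') | a b b'.
          a \<in> carrier A \<and> b \<in> carrier B \<and> b' \<in> carrier B}
       \<union> {e (c \<odot>\<^bsub>A\<^esub> a) b \<ominus>\<^bsub>F\<^esub> c \<odot>\<^bsub>F\<^esub> e a b | c a b.
          c \<in> carrier k \<and> a \<in> carrier A \<and> b \<in> carrier B}
       \<union> {e a (c \<odot>\<^bsub>B\<^esub> b) \<ominus>\<^bsub>F\<^esub> c \<odot>\<^bsub>F\<^esub> e a b | c a b.
          c \<in> carrier k \<and> a \<in> carrier A \<and> b \<in> carrier B}))"

definition tensor ::
  "('k, 'l) ring_scheme \<Rightarrow> ('k, 'a, 'm) module_scheme \<Rightarrow> ('k, 'b, 'n) module_scheme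
    \<Rightarrow> ('k, ('a \<times> 'b \<Rightarrow> 'k) set) module" where
  "tensor k A B = quot_alg (pair_alg k A B) (bilin_rels k A B)"

definition pure_tensor ::
  "('k, 'l) ring_scheme \<Rightarrow> ('k, 'a, 'm) module_scheme \<Rightarrow> ('k, 'b, 'n) module_scheme
    \<Rightarrow> 'a \<Rightarrow> 'b \<Rightarrow> ('a \<times> 'b \<Rightarrow> 'k) set" where
  "pure_tensor k A B a b = bilin_rels k A B +>\<^bsub>pair_alg k A B\<^esub> basis_vec k (a, b)"

text \<open>The linear map out of a tensor product induced by a bilinear map \<open>f\<close> into \<open>U\<close>. It is evaluated
  on a chosen representative of the class \<open>t\<close>; for bilinear \<open>f\<close> the choice does not matter.\<close>

definition tensor_lift ::
  "('k, 'l) ring_scheme \<Rightarrow> ('k, 'u, 'm) module_scheme \<Rightarrow> ('a \<Rightarrow> 'b \<Rightarrow> 'u)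
    \<Rightarrow> ('a \<times> 'b \<Rightarrow> 'k) set \<Rightarrow> 'u" where
  "tensor_lift k U f t = (let r = (SOME r. r \<in> t) in
     \<Oplus>\<^bsub>U\<^esub>p\<in>{p. r p \<noteq> \<zero>\<^bsub>k\<^esub>}. r p \<odot>\<^bsub>U\<^esub> f (fst p) (snd p))"

text \<open>The map \<open>f \<otimes> g\<close> with values in \<open>A \<otimes> B\<close>.\<close>

definition tensor_map ::
  "('k, 'l) ring_scheme \<Rightarrow> ('k, 'a, 'm) module_scheme \<Rightarrow> ('k, 'b, 'n) module_scheme
    \<Rightarrow> ('c \<Rightarrow> 'a) \<Rightarrow> ('d \<Rightarrow> 'b) \<Rightarrow> ('c \<times> 'd \<Rightarrow> 'k) set \<Rightarrow> ('a \<times> 'b \<Rightarrow> 'k) set" where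
  "tensor_map k A B f g = tensor_lift k (tensor k A B) (\<lambda>x y. pure_tensor k A B (f x) (g y))"

text \<open>The canonical map from \<open>(A \<otimes> B) \<otimes> C\<close> to \<open>A \<otimes> (B \<otimes> C)\<close>.\<close>

definition tensor_assoc ::
  "('k, 'l) ring_scheme \<Rightarrow> ('k, 'a, 'm) module_scheme \<Rightarrow> ('k, 'b, 'n) module_scheme
    \<Rightarrow> ('k, 'c, 'o) module_scheme
    \<Rightarrow> (('a \<times> 'b \<Rightarrow> 'k) set \<times> 'c \<Rightarrow> 'k) set \<Rightarrow> ('a \<times> ('b \<times> 'c \<Rightarrow> 'k) set \<Rightarrow> 'k) set" where
  "tensor_assoc k A B C = tensor_lift k (tensor k A (tensor k B C))
     (\<lambda>s c. tensor_lift k (tensor k A (tensor k B C))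
        (\<lambda>a b. pure_tensor k A (tensor k B C) a (pure_tensor k B C b c)) s)"

text \<open>The image of \<open>V \<otimes> W\<close> in \<open>A \<otimes> B\<close>, for subspaces \<open>V\<close> of \<open>A\<close> and \<open>W\<close> of \<open>B\<close>.\<close>

definition tensor_sub ::
  "('k, 'l) ring_scheme \<Rightarrow> ('k, 'a, 'm) module_scheme \<Rightarrow> ('k, 'b, 'n) module_scheme
    \<Rightarrow> 'a set \<Rightarrow> 'b set \<Rightarrow> ('a \<times> 'b \<Rightarrow> 'k) set set" where
  "tensor_sub k A B V W =
     (\<lambda>N. submodule N k (tensor k A B)) hull {pure_tensor k A B v w | v w. v \<in> V \<and> w \<in> W}"


section \<open>Hopf algebras, Hopf subalgebras and quotients\<close>

record ('k, 'a) hopf = "('k, 'a) module" +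
  comul :: "'a \<Rightarrow> ('a \<times> 'a \<Rightarrow> 'k) set"
  counit :: "'a \<Rightarrow> 'k"
  antipode :: "'a \<Rightarrow> 'a"

locale hopf_algebra = k_algebra k H
  for k :: "('k, 'l) ring_scheme" and H :: "('k, 'a, 'm) hopf_scheme" +
  assumes comul_linear: "comul H \<in> linear_map k H (tensor k H H)"
    and comul_hom: "comul H \<in> ring_hom H (tensor k H H)"
    and counit_hom: "counit H \<in> ring_hom H k"
    and counit_linear:
      "\<lbrakk>c \<in> carrier k; x \<in> carrier H\<rbrakk> \<Longrightarrow> counit H (c \<odot>\<^bsub>H\<^esub> x) = c \<otimes>\<^bsub>k\<^esub> counit H x"
    and antipode_linear: "antipode H \<in> linear_map k H H"
    and coassoc:
      "x \<in> carrier H \<Longrightarrow>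
        tensor_assoc k H H H (tensor_map k (tensor k H H) H (comul H) id (comul H x))
        = tensor_map k H (tensor k H H) id (comul H) (comul H x)"
    and counit_left:
      "x \<in> carrier H \<Longrightarrow> tensor_lift k H (\<lambda>a b. counit H a \<odot>\<^bsub>H\<^esub> b) (comul H x) = x"
    and counit_right:
      "x \<in> carrier H \<Longrightarrow> tensor_lift k H (\<lambda>a b. counit H b \<odot>\<^bsub>H\<^esub> a) (comul H x) = x"
    and antipode_left:
      "x \<in> carrier H \<Longrightarrow>
        tensor_lift k H (\<lambda>a b. antipode H a \<otimes>\<^bsub>H\<^esub> b) (comul H x) = counit H x \<odot>\<^bsub>H\<^esub> \<one>\<^bsub>H\<^esub>"
    and antipode_right:
      "x \<in> carrier H \<Longrightarrow>
        tensor_lift k H (\<lambda>a b. a \<otimes>\<^bsub>H\<^esub> antipode H b) (comul H x) = counit H x \<odot>\<^bsub>H\<^esub> \<one>\<^bsub>H\<^esub>"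

definition hopf_subalgebra ::
  "('k, 'l) ring_scheme \<Rightarrow> ('k, 'a, 'm) hopf_scheme \<Rightarrow> 'a set \<Rightarrow> bool" where
  "hopf_subalgebra k H B \<longleftrightarrow> subalg k H B
     \<and> comul H ` B \<subseteq> tensor_sub k H H B B \<and> antipode H ` B \<subseteq> B"

text \<open>A Hopf subalgebra as a Hopf algebra in its own right. Its comultiplication takes values in
  \<open>B \<otimes> B\<close>, which is a different set of cosets from its image in \<open>H \<otimes> H\<close>, so the values of
  \<open>comul H\<close> are pulled back along the (injective) map induced by the inclusion.\<close>

definition sub_hopf ::
  "('k, 'l) ring_scheme \<Rightarrow> ('k, 'a, 'm) hopf_scheme \<Rightarrow> 'a set \<Rightarrow> ('k, 'a) hopf" where
  "sub_hopf k H B = (let B' = H\<lparr>carrier := B\<rparr> in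
     \<lparr>carrier = B, monoid.mult = monoid.mult H, monoid.one = monoid.one H,
      ring.zero = ring.zero H, ring.add = ring.add H, smult = smult H,
      comul = (\<lambda>x. inv_into (carrier (tensor k B' B')) (tensor_map k H H id id) (comul H x)),
      counit = counit H, antipode = antipode H\<rparr>)"

definition hopf_ideal ::
  "('k, 'l) ring_scheme \<Rightarrow> ('k, 'a, 'm) hopf_scheme \<Rightarrow> 'a set \<Rightarrow> bool" where
  "hopf_ideal k H I \<longleftrightarrow> ideal I H \<and> submodule I k H
     \<and> comul H ` I \<subseteq> tensor_sub k H H I (carrier H) <+>\<^bsub>tensor k H H\<^esub> tensor_sub k H H (carrier H) I
     \<and> counit H ` I \<subseteq> {\<zero>\<^bsub>k\<^esub>} \<and> antipode H ` I \<subseteq> I"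

text \<open>The structure maps of \<open>H/I\<close> are evaluated on a chosen representative of the coset \<open>T\<close>; for a
  Hopf ideal the choice does not matter.\<close>

definition quot_hopf ::
  "('k, 'l) ring_scheme \<Rightarrow> ('k, 'a, 'm) hopf_scheme \<Rightarrow> 'a set \<Rightarrow> ('k, 'a set) hopf" where
  "quot_hopf k H I = (let Q = quot_alg H I; proj = (\<lambda>x. I +>\<^bsub>H\<^esub> x) in
     \<lparr>carrier = carrier Q, monoid.mult = monoid.mult Q, monoid.one = monoid.one Q,
      ring.zero = ring.zero Q, ring.add = ring.add Q, smult = smult Q,
      comul = (\<lambda>T. tensor_map k Q Q proj proj (comul H (SOME x. x \<in> T))),
      counit = (\<lambda>T. counit H (SOME x. x \<in> T)),
      antipode = (\<lambda>T. proj (antipode H (SOME x. x \<in> T)))\<rparr>)"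


section \<open>Ore extensions and iterated Hopf Ore extensions\<close>

text \<open>Automorphisms of algebras and skew derivations are linear over the ground field, as all
  structure is over \<open>k\<close>. Freeness of the left \<open>R\<close>-module \<open>A\<close> on the powers of \<open>t\<close> is unique
  representability as a finite left combination.\<close>

definition algebra_auto ::
  "('k, 'l) ring_scheme \<Rightarrow> ('k, 'a, 'm) module_scheme \<Rightarrow> ('a \<Rightarrow> 'a) set" where
  "algebra_auto k R = ring_iso R R \<inter> linear_map k R R"

definition skew_derivation ::
  "('k, 'l) ring_scheme \<Rightarrow> ('k, 'a, 'm) module_scheme \<Rightarrow> ('a \<Rightarrow> 'a) \<Rightarrow> ('a \<Rightarrow> 'a) set" where
  "skew_derivation k R \<sigma> = {\<delta>. \<delta> \<in> linear_map k R R \<and>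
     (\<forall>r\<in>carrier R. \<forall>s\<in>carrier R. \<delta> (r \<otimes>\<^bsub>R\<^esub> s) = \<delta> r \<otimes>\<^bsub>R\<^esub> s \<oplus>\<^bsub>R\<^esub> \<sigma> r \<otimes>\<^bsub>R\<^esub> \<delta> s)}"

definition ore_extension ::
  "('k, 'l) ring_scheme \<Rightarrow> ('k, 'a, 'm) module_scheme \<Rightarrow> 'a set \<Rightarrow> bool" where
  "ore_extension k A R \<longleftrightarrow> k_algebra k A \<and> subalg k A R \<and>
     (\<exists>t\<in>carrier A. \<exists>\<sigma>\<in>algebra_auto k (A\<lparr>carrier := R\<rparr>).
      \<exists>\<delta>\<in>skew_derivation k (A\<lparr>carrier := R\<rparr>) \<sigma>.
        (\<forall>h\<in>carrier A. \<exists>!c. (\<forall>i::nat. c i \<in> R) \<and> finite {i. c i \<noteq> \<zero>\<^bsub>A\<^esub>} \<and>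
           h = (\<Oplus>\<^bsub>A\<^esub>i\<in>{i. c i \<noteq> \<zero>\<^bsub>A\<^esub>}. c i \<otimes>\<^bsub>A\<^esub> t [^]\<^bsub>A\<^esub> i)) \<and>
        (\<forall>r\<in>R. t \<otimes>\<^bsub>A\<^esub> r = \<sigma> r \<otimes>\<^bsub>A\<^esub> t \<oplus>\<^bsub>A\<^esub> \<delta> r))"

definition ihoe_steps ::
  "('k, 'l) ring_scheme \<Rightarrow> ('k, 'a, 'm) hopf_scheme \<Rightarrow> 'a set \<Rightarrow> nat \<Rightarrow> bool" where
  "ihoe_steps k H R n \<longleftrightarrow> hopf_algebra k H \<and>
     (\<exists>C :: nat \<Rightarrow> 'a set. C 0 = R \<and> C n = carrier H \<and>
       (\<forall>i\<le>n. hopf_subalgebra k H (C i)) \<and>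
       (\<forall>i<n. C i \<subseteq> C (Suc i) \<and> ore_extension k (H\<lparr>carrier := C (Suc i)\<rparr>) (C i)))"

definition ihoe ::
  "('k, 'l) ring_scheme \<Rightarrow> ('k, 'a, 'm) hopf_scheme \<Rightarrow> 'a set \<Rightarrow> bool" where
  "ihoe k H R \<longleftrightarrow> (\<exists>n. ihoe_steps k H R n)"

text \<open>The ground field, as a Hopf subalgebra of \<open>H\<close>, is the set of scalar multiples of the unit.\<close>

definition scalars :: "('k, 'l) ring_scheme \<Rightarrow> ('k, 'a, 'm) module_scheme \<Rightarrow> 'a set" where
  "scalars k A = (\<lambda>c. c \<odot>\<^bsub>A\<^esub> \<one>\<^bsub>A\<^esub>) ` carrier k"

definition ihoe_of_field :: "('k, 'l) ring_scheme \<Rightarrow> ('k, 'a, 'm) hopf_scheme \<Rightarrow> bool" where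
  "ihoe_of_field k H \<longleftrightarrow> ihoe k H (scalars k H)"

end

theory Submission
  imports Defs
begin

text \<open>
  Tensors are handled through their slices \<open>(f \<otimes> id) t\<close> and \<open>(id \<otimes> g) t\<close> by linear functionals, so
  that a subalgebra \<open>C\<close> is a Hopf subalgebra as soon as it is stable under the antipode and the slices
  of \<open>\<Delta>\<close>.

  Let \<open>Q \<subseteq> C\<close> be a step \<open>C = Q[x; \<sigma>, \<delta>]\<close> of the given chain. Comparing degrees in the coassociativity
  law, and using that all algebras \<open>H \<otimes> Q\<close> are domains and that one-sided inverses are scalars, one finds
  \<open>\<Delta>(x) = x \<otimes> 1 + 1 \<otimes> x + w\<close> with \<open>w \<in> Q \<otimes> Q\<close>. Hence \<open>\<Delta>(x\<^sup>n)\<close> is \<open>x\<^sup>n \<otimes> 1 + n x\<^sup>n\<^sup>-\<^sup>1 \<otimes> x\<close>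
  up to terms in \<open>F n \<otimes> Q + F (n - 1) \<otimes> C\<close>, where \<open>F n\<close> consists of the elements of degree below \<open>n\<close>;
  the coefficient \<open>n\<close> is invertible in characteristic zero.

  For a Hopf subalgebra \<open>B\<close>, slicing \<open>\<Delta>(b)\<close> by a functional that picks out the degree below the top one
  gives elements of degree one in \<open>B \<inter> C\<close> if \<open>B \<inter> C \<noteq> B \<inter> Q\<close>. Their right leading coefficients form a
  nonzero right ideal and right coideal of \<open>B \<inter> Q\<close>, so it contains \<open>1\<close>, and \<open>B \<inter> C\<close> is an Ore extension
  of \<open>B \<inter> Q\<close> with a variable \<open>x + s\<close>, \<open>s \<in> Q\<close>. For a Hopf ideal, either \<open>x\<close> becomes an element of the
  image of \<open>Q\<close>, or the powers of its image stay independent over the image of \<open>Q\<close>. Steps at which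
  nothing is added are dropped from the chain.\<close>

section \<open>Subspaces, spans and functionals\<close>

text \<open>In general an Ore variable of a Hopf algebra can satisfy \<Delta>(x) = a \<otimes> x + x
  \<otimes> b + w with group-like a and b. Here these are trivial: a one-sided factor of 1 is a
  scalar, and the counit forces the scalar to be 1. That H \<otimes> Q is a domain makes the degree
  of a power of \<Delta>(x) an exact multiple of the degree of \<Delta>(x), which is what bounds the
  latter. Characteristic zero is essential: in characteristic p, with x primitive in k[x], the p-th
  power of x generates a Hopf ideal whose quotient has dimension p, whereas an IHOE of the field is
  the field itself or infinite-dimensional. For a Hopf ideal, the kernel of the projection is never
  compared with the filtration by degree. Independence of the powers is proved afresh in the
  quotient, from the shape of \<Delta>(x) alone. The expansion of \<Delta>(x^n) is therefore derived
  without freeness, and leading coefficients form a relation instead of a function.\<close>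

abbreviation lspan where
  "lspan k A S \<equiv> (\<lambda>N. submodule N k A) hull S"

text \<open>The field \<open>k\<close> is a ring record without a scalar multiplication, so it
  cannot be the target in \<open>linear_map\<close>.\<close>

definition functional ::
  "('k, 'l) ring_scheme \<Rightarrow> ('k, 'a, 'm) module_scheme \<Rightarrow> ('a \<Rightarrow> 'k) set" where
  "functional k A = {f. f \<in> carrier A \<rightarrow> carrier k
     \<and> (\<forall>x\<in>carrier A. \<forall>y\<in>carrier A. f (x \<oplus>\<^bsub>A\<^esub> y) = f x \<oplus>\<^bsub>k\<^esub> f y)
     \<and> (\<forall>c\<in>carrier k. \<forall>x\<in>carrier A. f (c \<odot>\<^bsub>A\<^esub> x) = c \<otimes>\<^bsub>k\<^esub> f x)}"

lemma functionalD:
  assumes "f \<in> functional k A"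
  shows "x \<in> carrier A \<Longrightarrow> f x \<in> carrier k"
    and "\<lbrakk>x \<in> carrier A; y \<in> carrier A\<rbrakk> \<Longrightarrow> f (x \<oplus>\<^bsub>A\<^esub> y) = f x \<oplus>\<^bsub>k\<^esub> f y"
    and "\<lbrakk>c \<in> carrier k; x \<in> carrier A\<rbrakk> \<Longrightarrow> f (c \<odot>\<^bsub>A\<^esub> x) = c \<otimes>\<^bsub>k\<^esub> f x"
  using assms by (auto simp: functional_def)

lemma linear_mapD:
  assumes "f \<in> linear_map k V W"
  shows "x \<in> carrier V \<Longrightarrow> f x \<in> carrier W"
    and "\<lbrakk>x \<in> carrier V; y \<in> carrier V\<rbrakk> \<Longrightarrow> f (x \<oplus>\<^bsub>V\<^esub> y) = f x \<oplus>\<^bsub>W\<^esub> f y"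
    and "\<lbrakk>c \<in> carrier k; x \<in> carrier V\<rbrakk> \<Longrightarrow> f (c \<odot>\<^bsub>V\<^esub> x) = c \<odot>\<^bsub>W\<^esub> f x"
  using assms by (auto simp: linear_map_def)

lemma linear_mapI:
  assumes "\<And>x. x \<in> carrier V \<Longrightarrow> f x \<in> carrier W"
    and "\<And>x y. \<lbrakk>x \<in> carrier V; y \<in> carrier V\<rbrakk> \<Longrightarrow> f (x \<oplus>\<^bsub>V\<^esub> y) = f x \<oplus>\<^bsub>W\<^esub> f y"
    and "\<And>c x. \<lbrakk>c \<in> carrier k; x \<in> carrier V\<rbrakk> \<Longrightarrow> f (c \<odot>\<^bsub>V\<^esub> x) = c \<odot>\<^bsub>W\<^esub> f x"
  shows "f \<in> linear_map k V W"
  using assms by (auto simp: linear_map_def)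

lemma linear_map_id: "id \<in> linear_map k V V"
  by (auto simp: linear_map_def)

lemma linear_map_comp:
  assumes "f \<in> linear_map k U V" "g \<in> linear_map k V W"
  shows "(\<lambda>x. g (f x)) \<in> linear_map k U W"
  by (intro linear_mapI) (simp_all add: linear_mapD[OF assms(1)] linear_mapD[OF assms(2)])

context k_algebra
begin

lemma submod_sub: "\<lbrakk>submodule N k A; x \<in> N\<rbrakk> \<Longrightarrow> x \<in> carrier A"
  using V.submoduleE(1) by blast

lemma submod_zero: "submodule N k A \<Longrightarrow> \<zero>\<^bsub>A\<^esub> \<in> N"
  using submodule.axioms(1)[THEN subgroup.one_closed] by fastforce

lemma submod_add: "\<lbrakk>submodule N k A; x \<in> N; y \<in> N\<rbrakk> \<Longrightarrow> x \<oplus>\<^bsub>A\<^esub> y \<in> N"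
  by (rule V.submoduleE(5))

lemma submod_smult: "\<lbrakk>submodule N k A; c \<in> carrier k; x \<in> N\<rbrakk> \<Longrightarrow> c \<odot>\<^bsub>A\<^esub> x \<in> N"
  by (rule V.submoduleE(4))

lemma submod_neg: "\<lbrakk>submodule N k A; x \<in> N\<rbrakk> \<Longrightarrow> \<ominus>\<^bsub>A\<^esub> x \<in> N"
  by (rule V.submoduleE(3))

lemma submod_diff: "\<lbrakk>submodule N k A; x \<in> N; y \<in> N\<rbrakk> \<Longrightarrow> x \<ominus>\<^bsub>A\<^esub> y \<in> N"
  by (simp add: a_minus_def submod_add submod_neg)

lemmas submod = submod_zero submod_add submod_smult submod_neg submod_diff

lemma neg_eq_smult: "x \<in> carrier A \<Longrightarrow> \<ominus>\<^bsub>A\<^esub> x = (\<ominus>\<^bsub>k\<^esub> \<one>\<^bsub>k\<^esub>) \<odot>\<^bsub>A\<^esub> x"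
  by (simp add: V.smult_l_minus)

lemma submoduleI':
  assumes "\<And>x. x \<in> N \<Longrightarrow> x \<in> carrier A" "\<zero>\<^bsub>A\<^esub> \<in> N"
    and "\<And>x y. \<lbrakk>x \<in> N; y \<in> N\<rbrakk> \<Longrightarrow> x \<oplus>\<^bsub>A\<^esub> y \<in> N"
    and "\<And>c x. \<lbrakk>c \<in> carrier k; x \<in> N\<rbrakk> \<Longrightarrow> c \<odot>\<^bsub>A\<^esub> x \<in> N"
  shows "submodule N k A"
  by (rule V.submoduleI) (use assms in \<open>auto simp: neg_eq_smult\<close>)

lemma submodule_carrier: "submodule (carrier A) k A"
  by (rule submoduleI') auto

lemma submodule_zero: "submodule {\<zero>\<^bsub>A\<^esub>} k A"
  by (rule submoduleI') auto

lemma submodule_Int: "\<lbrakk>submodule M k A; submodule N k A\<rbrakk> \<Longrightarrow> submodule (M \<inter> N) k A"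
  by (rule submoduleI') (auto simp: submod submod_sub)

lemma submod_add_cancel:
  assumes "submodule N k A" "x \<in> N" "y \<in> carrier A" "x \<oplus>\<^bsub>A\<^esub> y \<in> N"
  shows "y \<in> N"
proof -
  have x: "x \<in> carrier A" by (rule submod_sub[OF assms(1,2)])
  have "y = (x \<oplus>\<^bsub>A\<^esub> y) \<ominus>\<^bsub>A\<^esub> x"
    using x assms(3) by algebra
  with submod_diff[OF assms(1,4,2)] show ?thesis by simp
qed

lemma lspan_submodule:
  assumes "S \<subseteq> carrier A"
  shows "submodule (lspan k A S) k A"
proof (rule submoduleI')
  show "x \<in> carrier A" if "x \<in> lspan k A S" for x
    using that hull_minimal[of S "carrier A" "\<lambda>N. submodule N k A"] assms submodule_carrier by blast
qed (auto simp: hull_def submod)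

lemma lspan_sub: "\<lbrakk>S \<subseteq> carrier A; x \<in> lspan k A S\<rbrakk> \<Longrightarrow> x \<in> carrier A"
  using lspan_submodule submod_sub by blast

lemma lspan_induct:
  assumes "x \<in> lspan k A S" "S \<subseteq> carrier A"
    and "P \<zero>\<^bsub>A\<^esub>" "\<And>x. x \<in> S \<Longrightarrow> P x"
    and "\<And>x y. \<lbrakk>x \<in> carrier A; y \<in> carrier A; P x; P y\<rbrakk> \<Longrightarrow> P (x \<oplus>\<^bsub>A\<^esub> y)"
    and "\<And>c x. \<lbrakk>c \<in> carrier k; x \<in> carrier A; P x\<rbrakk> \<Longrightarrow> P (c \<odot>\<^bsub>A\<^esub> x)"
  shows "P x"
proof -
  have "submodule {x \<in> carrier A. P x} k A"
    by (rule submoduleI') (use assms in auto)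
  moreover have "S \<subseteq> {x \<in> carrier A. P x}" using assms by auto
  ultimately show ?thesis
    using hull_minimal[of S "{x \<in> carrier A. P x}" "\<lambda>N. submodule N k A"] assms(1) by blast
qed

lemma lspan_le: "\<lbrakk>submodule N k A; S \<subseteq> N\<rbrakk> \<Longrightarrow> lspan k A S \<subseteq> N"
  by (rule hull_minimal)

lemma functional_zero: "f \<in> functional k A \<Longrightarrow> f \<zero>\<^bsub>A\<^esub> = \<zero>\<^bsub>k\<^esub>"
  using functionalD(1,3)[of f k A] by (metis V.M.zero_closed K.zero_closed K.l_null V.smult_r_null)

text \<open>By Zorn's lemma there is a subspace \<open>M\<close> maximal among those that contain
  \<open>N\<close> and avoid \<open>a\<close>. Maximality makes \<open>M\<close> a complement of the
  line through \<open>a\<close>, and \<open>f\<close> is the coordinate along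
  \<open>a\<close>.\<close>

lemma ex_functional:
  assumes N: "submodule N k A" and a: "a \<in> carrier A" "a \<notin> N"
  obtains f where "f \<in> functional k A" "\<And>x. x \<in> N \<Longrightarrow> f x = \<zero>\<^bsub>k\<^esub>" "f a = \<one>\<^bsub>k\<^esub>"
proof -
  define SS where "SS = {M. submodule M k A \<and> N \<subseteq> M \<and> a \<notin> M}"
  have "\<exists>M\<in>SS. \<forall>Z\<in>SS. M \<subseteq> Z \<longrightarrow> Z = M"
  proof (rule subset_Zorn_nonempty)
    show "SS \<noteq> {}" using N a by (auto simp: SS_def)
    fix CC assume c: "CC \<noteq> {}" "subset.chain SS CC"
    then have cs: "CC \<subseteq> SS" by (auto simp: subset.chain_def)
    have "submodule (\<Union>CC) k A"
    proof (rule submoduleI')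
      show "x \<oplus>\<^bsub>A\<^esub> y \<in> \<Union>CC" if "x \<in> \<Union>CC" "y \<in> \<Union>CC" for x y
      proof -
        from that obtain Z Y where XY: "Z \<in> CC" "Y \<in> CC" "x \<in> Z" "y \<in> Y" by blast
        then have "Z \<subseteq> Y \<or> Y \<subseteq> Z" using c(2) by (auto simp: subset.chain_def)
        then have "\<exists>W\<in>CC. x \<in> W \<and> y \<in> W" using XY by blast
        then show ?thesis using cs submod_add unfolding SS_def by blast
      qed
    next
      obtain Z where "Z \<in> CC" using c(1) by blast
      then show "\<zero>\<^bsub>A\<^esub> \<in> \<Union>CC" using cs submod_zero unfolding SS_def by blast
    next
      show "c \<odot>\<^bsub>A\<^esub> x \<in> \<Union>CC" if "c \<in> carrier k" "x \<in> \<Union>CC" for c x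
        using that cs submod_smult unfolding SS_def by blast
      show "x \<in> carrier A" if "x \<in> \<Union>CC" for x
        using that cs submod_sub unfolding SS_def by blast
    qed
    then show "\<Union>CC \<in> SS" using c(1) cs by (auto simp: SS_def)
  qed
  then obtain M where M: "submodule M k A" "N \<subseteq> M" "a \<notin> M"
    and max: "\<And>Z. \<lbrakk>submodule Z k A; N \<subseteq> Z; a \<notin> Z; M \<subseteq> Z\<rbrakk> \<Longrightarrow> Z = M"
    by (auto simp: SS_def)
  note Mc = submod_sub[OF M(1)]
  \<comment> \<open>If \<open>x\<close> is not in \<open>M\<close>, then \<open>M + k x\<close>
    contains \<open>a\<close> by maximality. Solving \<open>a = m + c x\<close> for \<open>x\<close>
    needs \<open>c\<close> nonzero, which holds because \<open>a\<close> is not in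
    \<open>M\<close>.\<close>
  have ex: "\<exists>c\<in>carrier k. x \<ominus>\<^bsub>A\<^esub> c \<odot>\<^bsub>A\<^esub> a \<in> M" if x: "x \<in> carrier A" for x
  proof (cases "x \<in> M")
    case True
    then show ?thesis using a Mc by (intro bexI[of _ "\<zero>\<^bsub>k\<^esub>"]) (auto simp: a_minus_def)
  next
    case False
    define Z where "Z = {m \<oplus>\<^bsub>A\<^esub> c \<odot>\<^bsub>A\<^esub> x | m c. m \<in> M \<and> c \<in> carrier k}"
    have Z: "submodule Z k A"
    proof (rule submoduleI')
      fix u v assume "u \<in> Z" "v \<in> Z"
      then obtain m c m' c' where *: "m \<in> M" "c \<in> carrier k" "u = m \<oplus>\<^bsub>A\<^esub> c \<odot>\<^bsub>A\<^esub> x"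
        "m' \<in> M" "c' \<in> carrier k" "v = m' \<oplus>\<^bsub>A\<^esub> c' \<odot>\<^bsub>A\<^esub> x" by (auto simp: Z_def)
      then have "u \<oplus>\<^bsub>A\<^esub> v = (m \<oplus>\<^bsub>A\<^esub> m') \<oplus>\<^bsub>A\<^esub> (c \<oplus>\<^bsub>k\<^esub> c') \<odot>\<^bsub>A\<^esub> x"
        using x by (simp add: V.smult_l_distr V.M.a_ac Mc)
      then show "u \<oplus>\<^bsub>A\<^esub> v \<in> Z" using * submod_add[OF M(1)] unfolding Z_def by blast
    next
      fix d u assume d: "d \<in> carrier k" and "u \<in> Z"
      then obtain m c where *: "m \<in> M" "c \<in> carrier k" "u = m \<oplus>\<^bsub>A\<^esub> c \<odot>\<^bsub>A\<^esub> x" by (auto simp: Z_def)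
      then have "d \<odot>\<^bsub>A\<^esub> u = d \<odot>\<^bsub>A\<^esub> m \<oplus>\<^bsub>A\<^esub> (d \<otimes>\<^bsub>k\<^esub> c) \<odot>\<^bsub>A\<^esub> x"
        using x d by (simp add: V.smult_r_distr V.smult_assoc1 Mc)
      then show "d \<odot>\<^bsub>A\<^esub> u \<in> Z" using * d submod_smult[OF M(1)] unfolding Z_def by blast
    next
      have "\<zero>\<^bsub>A\<^esub> = \<zero>\<^bsub>A\<^esub> \<oplus>\<^bsub>A\<^esub> \<zero>\<^bsub>k\<^esub> \<odot>\<^bsub>A\<^esub> x" using x by simp
      then show "\<zero>\<^bsub>A\<^esub> \<in> Z" using submod_zero[OF M(1)] unfolding Z_def by blast
    qed (use x Mc in \<open>auto simp: Z_def\<close>)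
    have MX: "M \<subseteq> Z"
    proof
      fix m assume "m \<in> M"
      then have "m = m \<oplus>\<^bsub>A\<^esub> \<zero>\<^bsub>k\<^esub> \<odot>\<^bsub>A\<^esub> x" using x Mc by simp
      with \<open>m \<in> M\<close> show "m \<in> Z" unfolding Z_def by blast
    qed
    have "x = \<zero>\<^bsub>A\<^esub> \<oplus>\<^bsub>A\<^esub> \<one>\<^bsub>k\<^esub> \<odot>\<^bsub>A\<^esub> x" using x by simp
    then have "x \<in> Z" using submod_zero[OF M(1)] unfolding Z_def by blast
    with False have "a \<in> Z" using max[OF Z] MX M(2) by blast
    then obtain m c where mc: "m \<in> M" "c \<in> carrier k" "a = m \<oplus>\<^bsub>A\<^esub> c \<odot>\<^bsub>A\<^esub> x" by (auto simp: Z_def)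
    have c0: "c \<noteq> \<zero>\<^bsub>k\<^esub>" using mc x M(3) Mc by auto
    then have ci: "inv\<^bsub>k\<^esub> c \<in> carrier k" "inv\<^bsub>k\<^esub> c \<otimes>\<^bsub>k\<^esub> c = \<one>\<^bsub>k\<^esub>"
      using mc(2) K.field_Units by (auto intro: K.Units_inv_closed K.Units_l_inv)
    have "inv\<^bsub>k\<^esub> c \<odot>\<^bsub>A\<^esub> a = inv\<^bsub>k\<^esub> c \<odot>\<^bsub>A\<^esub> m \<oplus>\<^bsub>A\<^esub> x"
      using mc x ci Mc by (simp add: V.smult_r_distr V.smult_assoc1[symmetric])
    then have "x \<ominus>\<^bsub>A\<^esub> inv\<^bsub>k\<^esub> c \<odot>\<^bsub>A\<^esub> a = \<ominus>\<^bsub>A\<^esub> (inv\<^bsub>k\<^esub> c \<odot>\<^bsub>A\<^esub> m)"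
      using mc x ci Mc a by (simp add: a_minus_def V.M.minus_add V.M.a_ac V.M.r_neg V.M.r_neg1 V.M.r_neg2)
    then show ?thesis using mc(1) ci submod[OF M(1)] by (intro bexI[of _ "inv\<^bsub>k\<^esub> c"]) auto
  qed
  \<comment> \<open>Two different coordinates would put a nonzero multiple of \<open>a\<close> into
    \<open>M\<close>.\<close>
  have uniq: "c = d" if "c \<in> carrier k" "d \<in> carrier k" "x \<in> carrier A"
    "x \<ominus>\<^bsub>A\<^esub> c \<odot>\<^bsub>A\<^esub> a \<in> M" "x \<ominus>\<^bsub>A\<^esub> d \<odot>\<^bsub>A\<^esub> a \<in> M" for x c d
  proof (rule ccontr)
    assume "c \<noteq> d"
    define e where "e = d \<ominus>\<^bsub>k\<^esub> c"
    have e: "e \<in> carrier k" "e \<noteq> \<zero>\<^bsub>k\<^esub>" using that \<open>c \<noteq> d\<close> by (auto simp: e_def)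
    then have ei: "inv\<^bsub>k\<^esub> e \<in> carrier k" "inv\<^bsub>k\<^esub> e \<otimes>\<^bsub>k\<^esub> e = \<one>\<^bsub>k\<^esub>"
      using K.field_Units by (auto intro: K.Units_inv_closed K.Units_l_inv)
    have "e \<odot>\<^bsub>A\<^esub> a = (x \<ominus>\<^bsub>A\<^esub> c \<odot>\<^bsub>A\<^esub> a) \<ominus>\<^bsub>A\<^esub> (x \<ominus>\<^bsub>A\<^esub> d \<odot>\<^bsub>A\<^esub> a)"
      using that a by (simp add: e_def a_minus_def V.smult_l_distr V.smult_l_minus V.M.minus_add V.M.a_ac V.M.r_neg V.M.r_neg1 V.M.r_neg2)
    then have "e \<odot>\<^bsub>A\<^esub> a \<in> M" using that submod_diff[OF M(1)] by simp
    then have "inv\<^bsub>k\<^esub> e \<odot>\<^bsub>A\<^esub> (e \<odot>\<^bsub>A\<^esub> a) \<in> M" using ei submod_smult[OF M(1)] by blast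
    then show False using ei e a M(3) by (simp add: V.smult_assoc1[symmetric])
  qed
  define f where "f x = (THE c. c \<in> carrier k \<and> x \<ominus>\<^bsub>A\<^esub> c \<odot>\<^bsub>A\<^esub> a \<in> M)" for x
  have f: "f x \<in> carrier k \<and> x \<ominus>\<^bsub>A\<^esub> f x \<odot>\<^bsub>A\<^esub> a \<in> M" if "x \<in> carrier A" for x
    unfolding f_def by (rule theI') (use ex[OF that] uniq[OF _ _ that] in blast)
  have f_eq: "f x = c" if "x \<in> carrier A" "c \<in> carrier k" "x \<ominus>\<^bsub>A\<^esub> c \<odot>\<^bsub>A\<^esub> a \<in> M" for x c
    using f[OF that(1)] uniq that by blast
  have "f \<in> functional k A"
    unfolding functional_def
  proof (intro CollectI conjI ballI)
    show "f \<in> carrier A \<rightarrow> carrier k" using f by auto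
    fix x assume x: "x \<in> carrier A"
    show "f (x \<oplus>\<^bsub>A\<^esub> y) = f x \<oplus>\<^bsub>k\<^esub> f y" if y: "y \<in> carrier A" for y
    proof (rule f_eq)
      have "x \<oplus>\<^bsub>A\<^esub> y \<ominus>\<^bsub>A\<^esub> (f x \<oplus>\<^bsub>k\<^esub> f y) \<odot>\<^bsub>A\<^esub> a
        = (x \<ominus>\<^bsub>A\<^esub> f x \<odot>\<^bsub>A\<^esub> a) \<oplus>\<^bsub>A\<^esub> (y \<ominus>\<^bsub>A\<^esub> f y \<odot>\<^bsub>A\<^esub> a)"
        using x y f a by (simp add: a_minus_def V.smult_l_distr V.M.minus_add V.M.a_ac)
      then show "x \<oplus>\<^bsub>A\<^esub> y \<ominus>\<^bsub>A\<^esub> (f x \<oplus>\<^bsub>k\<^esub> f y) \<odot>\<^bsub>A\<^esub> a \<in> M"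
        using x y f submod_add[OF M(1)] by simp
    qed (use x y f in auto)
    show "f (c \<odot>\<^bsub>A\<^esub> x) = c \<otimes>\<^bsub>k\<^esub> f x" if c: "c \<in> carrier k" for c
    proof (rule f_eq)
      have "c \<odot>\<^bsub>A\<^esub> x \<ominus>\<^bsub>A\<^esub> (c \<otimes>\<^bsub>k\<^esub> f x) \<odot>\<^bsub>A\<^esub> a = c \<odot>\<^bsub>A\<^esub> (x \<ominus>\<^bsub>A\<^esub> f x \<odot>\<^bsub>A\<^esub> a)"
        using x c f a by (simp add: a_minus_def V.smult_r_distr V.smult_assoc1 V.smult_r_minus)
      then show "c \<odot>\<^bsub>A\<^esub> x \<ominus>\<^bsub>A\<^esub> (c \<otimes>\<^bsub>k\<^esub> f x) \<odot>\<^bsub>A\<^esub> a \<in> M"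
        using x c f submod_smult[OF M(1)] by simp
    qed (use x c f in auto)
  qed
  moreover have "f x = \<zero>\<^bsub>k\<^esub>" if "x \<in> N" for x
    by (rule f_eq) (use that M(2) Mc a in \<open>auto simp: a_minus_def\<close>)
  moreover have "f a = \<one>\<^bsub>k\<^esub>"
    by (rule f_eq) (use a submod_zero[OF M(1)] in \<open>auto simp: a_minus_def V.M.r_neg\<close>)
  ultimately show ?thesis using that by blast
qed

end

section \<open>Linear maps between algebras, images and preimages of subspaces\<close>

lemma linear_map_zero:
  assumes "k_algebra k V" "k_algebra k W" "f \<in> linear_map k V W"
  shows "f \<zero>\<^bsub>V\<^esub> = \<zero>\<^bsub>W\<^esub>"
proof -
  interpret V: k_algebra k V by fact
  interpret W: k_algebra k W by fact
  have "f \<zero>\<^bsub>V\<^esub> = f (\<zero>\<^bsub>k\<^esub> \<odot>\<^bsub>V\<^esub> \<zero>\<^bsub>V\<^esub>)" by simp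
  also have "\<dots> = \<zero>\<^bsub>k\<^esub> \<odot>\<^bsub>W\<^esub> f \<zero>\<^bsub>V\<^esub>"
    by (rule linear_mapD(3)[OF assms(3)]) auto
  finally show ?thesis using linear_mapD(1)[OF assms(3), of "\<zero>\<^bsub>V\<^esub>"] by simp
qed

lemma linear_map_neg:
  assumes "k_algebra k V" "k_algebra k W" "f \<in> linear_map k V W" "x \<in> carrier V"
  shows "f (\<ominus>\<^bsub>V\<^esub> x) = \<ominus>\<^bsub>W\<^esub> f x"
proof -
  interpret V: k_algebra k V by fact
  interpret W: k_algebra k W by fact
  show ?thesis using linear_mapD[OF assms(3)] assms(4)
    by (simp add: V.neg_eq_smult W.neg_eq_smult)
qed

lemma linear_map_diff:
  assumes "k_algebra k V" "k_algebra k W" "f \<in> linear_map k V W" "x \<in> carrier V" "y \<in> carrier V"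
  shows "f (x \<ominus>\<^bsub>V\<^esub> y) = f x \<ominus>\<^bsub>W\<^esub> f y"
proof -
  interpret V: k_algebra k V by fact
  interpret W: k_algebra k W by fact
  show ?thesis using linear_mapD[OF assms(3)] assms(4,5) linear_map_neg[OF assms(1-3)]
    by (simp add: a_minus_def)
qed

lemma submodule_preimage:
  assumes "k_algebra k V" "k_algebra k W" "f \<in> linear_map k V W" "submodule N k W"
  shows "submodule {x \<in> carrier V. f x \<in> N} k V"
proof -
  interpret V: k_algebra k V by fact
  interpret W: k_algebra k W by fact
  show ?thesis
    by (rule V.submoduleI')
      (auto simp: linear_map_zero[OF assms(1-3)] linear_mapD[OF assms(3)] W.submod[OF assms(4)])
qed

lemma submodule_image:
  assumes "k_algebra k V" "k_algebra k W" "f \<in> linear_map k V W" "submodule M k V"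
  shows "submodule (f ` M) k W"
proof -
  interpret V: k_algebra k V by fact
  interpret W: k_algebra k W by fact
  note l = linear_mapD[OF assms(3)] and s = V.submod_sub[OF assms(4)] and m = V.submod[OF assms(4)]
  show ?thesis
  proof (rule W.submoduleI')
    show "\<zero>\<^bsub>W\<^esub> \<in> f ` M" using linear_map_zero[OF assms(1-3)] m(1) by (metis imageI)
    fix x assume "x \<in> f ` M"
    then obtain u where u: "u \<in> M" "x = f u" by blast
    show "x \<oplus>\<^bsub>W\<^esub> y \<in> f ` M" if y: "y \<in> f ` M" for y
    proof -
      obtain v where v: "v \<in> M" "y = f v" using y by blast
      then have "x \<oplus>\<^bsub>W\<^esub> y = f (u \<oplus>\<^bsub>V\<^esub> v)" using u by (simp add: l(2) s)
      then show ?thesis using m(2) u v by blast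
    qed
    show "c \<odot>\<^bsub>W\<^esub> x \<in> f ` M" if "c \<in> carrier k" for c
    proof -
      have "c \<odot>\<^bsub>W\<^esub> x = f (c \<odot>\<^bsub>V\<^esub> u)" using u s that by (simp add: l(3))
      then show ?thesis using m(3) u that by blast
    qed
  qed (use l s in auto)
qed

lemma linear_map_lspan:
  assumes "k_algebra k V" "k_algebra k W" "f \<in> linear_map k V W" "submodule N k W"
    and "S \<subseteq> carrier V" "\<And>x. x \<in> S \<Longrightarrow> f x \<in> N" "x \<in> lspan k V S"
  shows "f x \<in> N"
proof -
  interpret V: k_algebra k V by fact
  have "lspan k V S \<subseteq> {x \<in> carrier V. f x \<in> N}"
    by (rule V.lspan_le[OF submodule_preimage[OF assms(1-4)]]) (use assms in auto)
  then show ?thesis using assms(7) by auto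
qed

section \<open>Monoid algebras and quotient algebras\<close>

lemma k_algebraI:
  assumes "field k" "ring A"
    and "\<And>c x. \<lbrakk>c \<in> carrier k; x \<in> carrier A\<rbrakk> \<Longrightarrow> c \<odot>\<^bsub>A\<^esub> x \<in> carrier A"
    and "\<And>c d x. \<lbrakk>c \<in> carrier k; d \<in> carrier k; x \<in> carrier A\<rbrakk>
      \<Longrightarrow> (c \<oplus>\<^bsub>k\<^esub> d) \<odot>\<^bsub>A\<^esub> x = c \<odot>\<^bsub>A\<^esub> x \<oplus>\<^bsub>A\<^esub> d \<odot>\<^bsub>A\<^esub> x"
    and "\<And>c x y. \<lbrakk>c \<in> carrier k; x \<in> carrier A; y \<in> carrier A\<rbrakk>
      \<Longrightarrow> c \<odot>\<^bsub>A\<^esub> (x \<oplus>\<^bsub>A\<^esub> y) = c \<odot>\<^bsub>A\<^esub> x \<oplus>\<^bsub>A\<^esub> c \<odot>\<^bsub>A\<^esub> y"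
    and "\<And>c d x. \<lbrakk>c \<in> carrier k; d \<in> carrier k; x \<in> carrier A\<rbrakk>
      \<Longrightarrow> (c \<otimes>\<^bsub>k\<^esub> d) \<odot>\<^bsub>A\<^esub> x = c \<odot>\<^bsub>A\<^esub> (d \<odot>\<^bsub>A\<^esub> x)"
    and "\<And>x. x \<in> carrier A \<Longrightarrow> \<one>\<^bsub>k\<^esub> \<odot>\<^bsub>A\<^esub> x = x"
    and "\<And>c x y. \<lbrakk>c \<in> carrier k; x \<in> carrier A; y \<in> carrier A\<rbrakk>
      \<Longrightarrow> (c \<odot>\<^bsub>A\<^esub> x) \<otimes>\<^bsub>A\<^esub> y = c \<odot>\<^bsub>A\<^esub> (x \<otimes>\<^bsub>A\<^esub> y)"
    and "\<And>c x y. \<lbrakk>c \<in> carrier k; x \<in> carrier A; y \<in> carrier A\<rbrakk>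
      \<Longrightarrow> x \<otimes>\<^bsub>A\<^esub> (c \<odot>\<^bsub>A\<^esub> y) = c \<odot>\<^bsub>A\<^esub> (x \<otimes>\<^bsub>A\<^esub> y)"
  shows "k_algebra k A"
proof -
  interpret K: field k by fact
  interpret A: ring A by fact
  have "module k A"
    by (rule moduleI) (use assms K.is_cring A.abelian_group_axioms in auto)
  then show ?thesis
    unfolding k_algebra_def k_algebra_axioms_def using assms by auto
qed

locale free_algebra = K: field k + G: monoid G
  for k :: "('k, 'l) ring_scheme" and G :: "('g, 'n) monoid_scheme"
begin

abbreviation "F \<equiv> free_alg k G"
abbreviation "e \<equiv> basis_vec k"
abbreviation supp :: "('g \<Rightarrow> 'k) \<Rightarrow> 'g set" where "supp f \<equiv> {s. f s \<noteq> \<zero>\<^bsub>k\<^esub>}"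

lemma free_carrier:
  "f \<in> carrier F \<longleftrightarrow> (\<forall>s. f s \<in> carrier k) \<and> finite (supp f) \<and> supp f \<subseteq> carrier G"
  by (auto simp: free_alg_def)

lemma free_val: "f \<in> carrier F \<Longrightarrow> f s \<in> carrier k"
  by (simp add: free_carrier)

lemma free_fields:
  "\<zero>\<^bsub>F\<^esub> = (\<lambda>s. \<zero>\<^bsub>k\<^esub>)" "f \<oplus>\<^bsub>F\<^esub> g = (\<lambda>s. f s \<oplus>\<^bsub>k\<^esub> g s)" "c \<odot>\<^bsub>F\<^esub> f = (\<lambda>s. c \<otimes>\<^bsub>k\<^esub> f s)"
  "\<one>\<^bsub>F\<^esub> = e \<one>\<^bsub>G\<^esub>"
  by (auto simp: free_alg_def basis_vec_def)

lemma free_zero_closed: "\<zero>\<^bsub>F\<^esub> \<in> carrier F"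
  by (simp add: free_carrier free_fields)

lemma free_add_closed:
  assumes "f \<in> carrier F" "g \<in> carrier F" shows "f \<oplus>\<^bsub>F\<^esub> g \<in> carrier F"
proof -
  have "supp (f \<oplus>\<^bsub>F\<^esub> g) \<subseteq> supp f \<union> supp g" by (auto simp: free_fields)
  then show ?thesis using assms
    by (auto simp: free_carrier free_fields intro: finite_subset)
qed

lemma free_smult_closed:
  assumes "c \<in> carrier k" "f \<in> carrier F" shows "c \<odot>\<^bsub>F\<^esub> f \<in> carrier F"
proof -
  have "supp (c \<odot>\<^bsub>F\<^esub> f) \<subseteq> supp f" using assms by (auto simp: free_fields)
  then show ?thesis using assms
    by (auto simp: free_carrier free_fields intro: finite_subset)
qed

lemma basis_closed: "s \<in> carrier G \<Longrightarrow> e s \<in> carrier F"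
  by (auto simp: free_carrier basis_vec_def)

text \<open>In the definition the index set of the convolution depends on the exact supports.
  Summing over a fixed rectangle that contains the supports, with zeros filled in, lets the sums for
  different factors be added termwise.\<close>

lemma free_mult_eq:
  assumes "f \<in> carrier F" "g \<in> carrier F" "finite S" "finite U" "supp f \<subseteq> S" "supp g \<subseteq> U"
  shows "(f \<otimes>\<^bsub>F\<^esub> g) s = (\<Oplus>\<^bsub>k\<^esub>p\<in>S \<times> U.
    if fst p \<otimes>\<^bsub>G\<^esub> snd p = s then f (fst p) \<otimes>\<^bsub>k\<^esub> g (snd p) else \<zero>\<^bsub>k\<^esub>)"
proof -
  have "(f \<otimes>\<^bsub>F\<^esub> g) s = (\<Oplus>\<^bsub>k\<^esub>p\<in>{(u, v). f u \<noteq> \<zero>\<^bsub>k\<^esub> \<and> g v \<noteq> \<zero>\<^bsub>k\<^esub> \<and> u \<otimes>\<^bsub>G\<^esub> v = s}.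
        f (fst p) \<otimes>\<^bsub>k\<^esub> g (snd p))"
    by (simp add: free_alg_def)
  also have "\<dots> = (\<Oplus>\<^bsub>k\<^esub>p\<in>S \<times> U.
    if fst p \<otimes>\<^bsub>G\<^esub> snd p = s then f (fst p) \<otimes>\<^bsub>k\<^esub> g (snd p) else \<zero>\<^bsub>k\<^esub>)"
    by (rule K.add.finprod_mono_neutral_cong_left)
      (use assms in \<open>auto simp: free_val\<close>)
  finally show ?thesis .
qed

lemma free_mult_closed:
  assumes "f \<in> carrier F" "g \<in> carrier F" shows "f \<otimes>\<^bsub>F\<^esub> g \<in> carrier F"
proof -
  have fg: "finite (supp f)" "finite (supp g)" "supp f \<subseteq> carrier G" "supp g \<subseteq> carrier G"
    using assms by (auto simp: free_carrier)
  note eq = free_mult_eq[OF assms fg(1,2) subset_refl subset_refl]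
  have "(f \<otimes>\<^bsub>F\<^esub> g) s = \<zero>\<^bsub>k\<^esub>" if "s \<notin> (\<lambda>p. fst p \<otimes>\<^bsub>G\<^esub> snd p) ` (supp f \<times> supp g)" for s
    unfolding eq by (rule K.add.finprod_one_eqI) (use that in force)
  then have "supp (f \<otimes>\<^bsub>F\<^esub> g) \<subseteq> (\<lambda>p. fst p \<otimes>\<^bsub>G\<^esub> snd p) ` (supp f \<times> supp g)" by blast
  moreover have "(\<lambda>p. fst p \<otimes>\<^bsub>G\<^esub> snd p) ` (supp f \<times> supp g) \<subseteq> carrier G" using fg by (auto intro!: G.m_closed)
  moreover have "(f \<otimes>\<^bsub>F\<^esub> g) s \<in> carrier k" for s
    unfolding eq by (rule K.finsum_closed) (use assms in \<open>auto simp: free_val\<close>)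
  ultimately show ?thesis using fg by (simp add: free_carrier finite_subset subset_trans)
qed

lemma free_add_mult:
  assumes "f \<in> carrier F" "f' \<in> carrier F" "g \<in> carrier F"
  shows "(f \<oplus>\<^bsub>F\<^esub> f') \<otimes>\<^bsub>F\<^esub> g = f \<otimes>\<^bsub>F\<^esub> g \<oplus>\<^bsub>F\<^esub> f' \<otimes>\<^bsub>F\<^esub> g"
proof
  fix s
  have fin: "finite (supp f \<union> supp f')" "finite (supp g)" using assms by (auto simp: free_carrier)
  have sub: "supp (f \<oplus>\<^bsub>F\<^esub> f') \<subseteq> supp f \<union> supp f'" by (auto simp: free_fields)
  note [simp] = assms[THEN free_val]
  show "((f \<oplus>\<^bsub>F\<^esub> f') \<otimes>\<^bsub>F\<^esub> g) s = (f \<otimes>\<^bsub>F\<^esub> g \<oplus>\<^bsub>F\<^esub> f' \<otimes>\<^bsub>F\<^esub> g) s"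
    unfolding free_fields(2)[of "f \<otimes>\<^bsub>F\<^esub> g"]
      free_mult_eq[OF free_add_closed[OF assms(1,2)] assms(3) fin sub subset_refl]
      free_mult_eq[OF assms(1,3) fin Un_upper1 subset_refl]
      free_mult_eq[OF assms(2,3) fin Un_upper2 subset_refl]
    by (rule trans[OF K.finsum_cong'[OF refl] K.finsum_addf])
      (auto simp: free_fields K.l_distr)
qed

lemma free_mult_add:
  assumes "f \<in> carrier F" "f' \<in> carrier F" "g \<in> carrier F"
  shows "g \<otimes>\<^bsub>F\<^esub> (f \<oplus>\<^bsub>F\<^esub> f') = g \<otimes>\<^bsub>F\<^esub> f \<oplus>\<^bsub>F\<^esub> g \<otimes>\<^bsub>F\<^esub> f'"
proof
  fix s
  have fin: "finite (supp g)" "finite (supp f \<union> supp f')" using assms by (auto simp: free_carrier)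
  have sub: "supp (f \<oplus>\<^bsub>F\<^esub> f') \<subseteq> supp f \<union> supp f'" by (auto simp: free_fields)
  note [simp] = assms[THEN free_val]
  show "(g \<otimes>\<^bsub>F\<^esub> (f \<oplus>\<^bsub>F\<^esub> f')) s = (g \<otimes>\<^bsub>F\<^esub> f \<oplus>\<^bsub>F\<^esub> g \<otimes>\<^bsub>F\<^esub> f') s"
    unfolding free_fields(2)[of "g \<otimes>\<^bsub>F\<^esub> f"]
      free_mult_eq[OF assms(3) free_add_closed[OF assms(1,2)] fin subset_refl sub]
      free_mult_eq[OF assms(3,1) fin subset_refl Un_upper1]
      free_mult_eq[OF assms(3,2) fin subset_refl Un_upper2]
    by (rule trans[OF K.finsum_cong'[OF refl] K.finsum_addf])
      (auto simp: free_fields K.r_distr)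
qed

lemma free_smult_mult:
  assumes "c \<in> carrier k" "f \<in> carrier F" "g \<in> carrier F"
  shows "(c \<odot>\<^bsub>F\<^esub> f) \<otimes>\<^bsub>F\<^esub> g = c \<odot>\<^bsub>F\<^esub> (f \<otimes>\<^bsub>F\<^esub> g)"
    and "g \<otimes>\<^bsub>F\<^esub> (c \<odot>\<^bsub>F\<^esub> f) = c \<odot>\<^bsub>F\<^esub> (g \<otimes>\<^bsub>F\<^esub> f)"
proof -
  have fin: "finite (supp f)" "finite (supp g)" using assms by (auto simp: free_carrier)
  have sub: "supp (c \<odot>\<^bsub>F\<^esub> f) \<subseteq> supp f" using assms(1) by (auto simp: free_fields)
  note [simp] = assms(2,3)[THEN free_val] assms(1)
  show "(c \<odot>\<^bsub>F\<^esub> f) \<otimes>\<^bsub>F\<^esub> g = c \<odot>\<^bsub>F\<^esub> (f \<otimes>\<^bsub>F\<^esub> g)"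
  proof
    fix s show "((c \<odot>\<^bsub>F\<^esub> f) \<otimes>\<^bsub>F\<^esub> g) s = (c \<odot>\<^bsub>F\<^esub> (f \<otimes>\<^bsub>F\<^esub> g)) s"
      unfolding free_fields(3)[of c "f \<otimes>\<^bsub>F\<^esub> g"]
        free_mult_eq[OF free_smult_closed[OF assms(1,2)] assms(3) fin sub subset_refl]
        free_mult_eq[OF assms(2,3) fin subset_refl subset_refl]
      by (subst K.finsum_rdistr) (use fin in \<open>auto simp: free_fields K.m_assoc intro!: K.finsum_cong'\<close>)
  qed
  show "g \<otimes>\<^bsub>F\<^esub> (c \<odot>\<^bsub>F\<^esub> f) = c \<odot>\<^bsub>F\<^esub> (g \<otimes>\<^bsub>F\<^esub> f)"
  proof
    fix s show "(g \<otimes>\<^bsub>F\<^esub> (c \<odot>\<^bsub>F\<^esub> f)) s = (c \<odot>\<^bsub>F\<^esub> (g \<otimes>\<^bsub>F\<^esub> f)) s"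
      unfolding free_fields(3)[of c "g \<otimes>\<^bsub>F\<^esub> f"]
        free_mult_eq[OF assms(3) free_smult_closed[OF assms(1,2)] fin(2,1) subset_refl sub]
        free_mult_eq[OF assms(3,2) fin(2,1) subset_refl subset_refl]
      by (subst K.finsum_rdistr) (use fin in \<open>auto simp: free_fields K.m_lcomm intro!: K.finsum_cong'\<close>)
  qed
qed

lemma free_mult_basis:
  assumes "s \<in> carrier G" "t \<in> carrier G"
  shows "e s \<otimes>\<^bsub>F\<^esub> e t = e (s \<otimes>\<^bsub>G\<^esub> t)"
proof
  fix u
  have "supp (e s) \<subseteq> {s}" "supp (e t) \<subseteq> {t}" by (auto simp: basis_vec_def)
  note eq = free_mult_eq[OF basis_closed[OF assms(1)] basis_closed[OF assms(2)] _ _ this]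
  have "{s} \<times> {t} = {(s, t)}" by auto
  then show "(e s \<otimes>\<^bsub>F\<^esub> e t) u = e (s \<otimes>\<^bsub>G\<^esub> t) u"
    by (subst eq) (auto simp: basis_vec_def K.add.finprod_insert)
qed

text \<open>Induction on the size of the support, deleting one point at a time. Multilinear
  identities in the monoid algebra are thereby reduced to basis vectors.\<close>

lemma free_induct [consumes 1, case_names zero add]:
  assumes "f \<in> carrier F" "P \<zero>\<^bsub>F\<^esub>"
    and "\<And>f c s. \<lbrakk>f \<in> carrier F; P f; c \<in> carrier k; s \<in> carrier G\<rbrakk> \<Longrightarrow> P (f \<oplus>\<^bsub>F\<^esub> c \<odot>\<^bsub>F\<^esub> e s)"
  shows "P f"
  using assms(1)
proof (induction "card (supp f)" arbitrary: f)
  case 0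
  then have "f = \<zero>\<^bsub>F\<^esub>" by (auto simp: free_carrier free_fields)
  then show ?case using assms(2) by simp
next
  case (Suc n)
  then obtain s where s: "s \<in> supp f" by fastforce
  have fin: "finite (supp f)" using Suc.prems by (simp add: free_carrier)
  define g where "g = f(s := \<zero>\<^bsub>k\<^esub>)"
  have sg: "supp g = supp f - {s}" by (auto simp: g_def)
  then have g: "g \<in> carrier F" using Suc.prems by (auto simp: free_carrier g_def)
  have "card (supp g) = n" using Suc(2) fin s by (simp add: sg)
  then have "P g" using Suc.hyps(1) g by blast
  moreover have "f = g \<oplus>\<^bsub>F\<^esub> f s \<odot>\<^bsub>F\<^esub> e s"
    using Suc.prems by (auto simp: g_def free_fields basis_vec_def free_carrier)
  moreover have "f s \<in> carrier k" "s \<in> carrier G" using Suc.prems s by (auto simp: free_carrier)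
  ultimately show ?case using assms(3)[OF g] by metis
qed

lemma free_zero_mult:
  assumes "f \<in> carrier F" shows "\<zero>\<^bsub>F\<^esub> \<otimes>\<^bsub>F\<^esub> f = \<zero>\<^bsub>F\<^esub>" "f \<otimes>\<^bsub>F\<^esub> \<zero>\<^bsub>F\<^esub> = \<zero>\<^bsub>F\<^esub>"
  by (auto simp: free_alg_def)

lemmas free_bilin = free_add_mult free_mult_add free_smult_mult free_zero_mult
  free_add_closed free_smult_closed free_mult_closed basis_closed free_zero_closed free_mult_basis

text \<open>The factors are expanded one at a time; the innermost case is associativity in the
  monoid \<open>G\<close>.\<close>

lemma free_assoc:
  assumes "f \<in> carrier F" "g \<in> carrier F" "h \<in> carrier F"
  shows "(f \<otimes>\<^bsub>F\<^esub> g) \<otimes>\<^bsub>F\<^esub> h = f \<otimes>\<^bsub>F\<^esub> (g \<otimes>\<^bsub>F\<^esub> h)"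
proof -
  have 1: "(e s \<otimes>\<^bsub>F\<^esub> e t) \<otimes>\<^bsub>F\<^esub> h = e s \<otimes>\<^bsub>F\<^esub> (e t \<otimes>\<^bsub>F\<^esub> h)"
    if "s \<in> carrier G" "t \<in> carrier G" for s t
    using assms(3) by (induction rule: free_induct) (use that in \<open>simp_all add: free_bilin G.m_assoc\<close>)
  have 2: "(e s \<otimes>\<^bsub>F\<^esub> g) \<otimes>\<^bsub>F\<^esub> h = e s \<otimes>\<^bsub>F\<^esub> (g \<otimes>\<^bsub>F\<^esub> h)" if "s \<in> carrier G" for s
    using assms(2) by (induction rule: free_induct)
      (use that assms(3) 1 in \<open>simp_all add: free_bilin del: free_mult_basis\<close>)
  show ?thesis
    using assms(1) by (induction rule: free_induct)
      (use assms(2,3) 2 in \<open>simp_all add: free_bilin\<close>)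
qed

lemma free_one_mult:
  assumes "f \<in> carrier F" shows "\<one>\<^bsub>F\<^esub> \<otimes>\<^bsub>F\<^esub> f = f" "f \<otimes>\<^bsub>F\<^esub> \<one>\<^bsub>F\<^esub> = f"
  using assms by (induction rule: free_induct) (simp_all add: free_bilin free_fields(4))

lemma free_k_algebra: "k_algebra k F"
proof (rule k_algebraI)
  show "ring F"
  proof (rule ringI)
    show "abelian_group F"
    proof (rule abelian_groupI)
      fix f assume f: "f \<in> carrier F"
      then show "\<exists>g\<in>carrier F. g \<oplus>\<^bsub>F\<^esub> f = \<zero>\<^bsub>F\<^esub>"
        using free_smult_closed[of "\<ominus>\<^bsub>k\<^esub> \<one>\<^bsub>k\<^esub>" f]
        by (intro bexI[of _ "(\<ominus>\<^bsub>k\<^esub> \<one>\<^bsub>k\<^esub>) \<odot>\<^bsub>F\<^esub> f"]) (auto simp: free_fields K.l_minus free_val K.l_neg)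
    qed (simp_all add: free_add_closed free_zero_closed, auto simp: free_fields free_val K.a_ac)
    show "Group.monoid F"
      by (rule monoidI) (simp_all add: free_mult_closed free_assoc free_one_mult, simp add: free_fields(4) basis_closed)
  qed (simp_all add: free_add_mult free_mult_add)
qed (simp_all add: free_smult_mult free_smult_closed K.field_axioms,
    simp_all add: free_fields(2,3) free_val K.l_distr K.r_distr K.m_assoc)

text \<open>The linear extension of \<beta> from the basis vectors. It is the sum that occurs in
  \<open>tensor_lift\<close>, which is therefore \<open>ext\<close> evaluated at a representative of
  the class.\<close>

definition ext :: "('k, 'u, 'm) module_scheme \<Rightarrow> ('g \<Rightarrow> 'u) \<Rightarrow> ('g \<Rightarrow> 'k) \<Rightarrow> 'u" where
  "ext U \<beta> r = (\<Oplus>\<^bsub>U\<^esub>p\<in>supp r. r p \<odot>\<^bsub>U\<^esub> \<beta> p)"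

lemma ext_eq:
  assumes "k_algebra k U" "r \<in> carrier F" "\<beta> \<in> carrier G \<rightarrow> carrier U"
    and "finite S" "supp r \<subseteq> S" "S \<subseteq> carrier G"
  shows "ext U \<beta> r = (\<Oplus>\<^bsub>U\<^esub>p\<in>S. r p \<odot>\<^bsub>U\<^esub> \<beta> p)"
proof -
  interpret U: k_algebra k U by fact
  show ?thesis unfolding ext_def
  proof (rule U.V.M.add.finprod_mono_neutral_cong_left)
    show "r i \<odot>\<^bsub>U\<^esub> \<beta> i = \<zero>\<^bsub>U\<^esub>" if "i \<in> S - supp r" for i
      using assms that by (auto intro!: U.V.smult_l_null)
    show "(\<lambda>i. r i \<odot>\<^bsub>U\<^esub> \<beta> i) \<in> S \<rightarrow> carrier U"
      using assms by (intro Pi_I U.V.smult_closed) (auto simp: free_val)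
  qed (use assms in auto)
qed

lemma ext_linear:
  assumes U: "k_algebra k U" and \<beta>: "\<beta> \<in> carrier G \<rightarrow> carrier U"
  shows "ext U \<beta> \<in> linear_map k F U"
proof (rule linear_mapI)
  interpret U: k_algebra k U by fact
  have t: "r p \<odot>\<^bsub>U\<^esub> \<beta> p \<in> carrier U" if "r \<in> carrier F" "p \<in> carrier G" for r p
    using that \<beta> by (intro U.V.smult_closed) (auto simp: free_val)
  fix f assume f: "f \<in> carrier F"
  then have ff: "finite (supp f)" "supp f \<subseteq> carrier G" by (auto simp: free_carrier)
  show "ext U \<beta> f \<in> carrier U"
    unfolding ext_def by (rule U.V.M.finsum_closed) (use f ff t in auto)
  show "ext U \<beta> (f \<oplus>\<^bsub>F\<^esub> g) = ext U \<beta> f \<oplus>\<^bsub>U\<^esub> ext U \<beta> g" if g: "g \<in> carrier F" for g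
  proof -
    have gg: "finite (supp g)" "supp g \<subseteq> carrier G" using g by (auto simp: free_carrier)
    define S where "S = supp f \<union> supp g"
    have S: "finite S" "S \<subseteq> carrier G" "supp f \<subseteq> S" "supp g \<subseteq> S" "supp (f \<oplus>\<^bsub>F\<^esub> g) \<subseteq> S"
      using ff gg by (auto simp: S_def free_fields)
    have "ext U \<beta> (f \<oplus>\<^bsub>F\<^esub> g) = (\<Oplus>\<^bsub>U\<^esub>p\<in>S. f p \<odot>\<^bsub>U\<^esub> \<beta> p \<oplus>\<^bsub>U\<^esub> g p \<odot>\<^bsub>U\<^esub> \<beta> p)"
      unfolding ext_eq[OF U free_add_closed[OF f g] \<beta> S(1,5,2)]
      by (rule U.V.M.finsum_cong') (use S \<beta> t f g in \<open>auto simp: free_fields free_val U.V.smult_l_distr subset_iff Pi_def\<close>)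
    also have "\<dots> = ext U \<beta> f \<oplus>\<^bsub>U\<^esub> ext U \<beta> g"
      unfolding ext_eq[OF U f \<beta> S(1,3,2)] ext_eq[OF U g \<beta> S(1,4,2)]
      by (rule U.V.M.finsum_addf) (use S t f g in auto)
    finally show ?thesis .
  qed
  show "ext U \<beta> (c \<odot>\<^bsub>F\<^esub> f) = c \<odot>\<^bsub>U\<^esub> ext U \<beta> f" if c: "c \<in> carrier k" for c
  proof -
    have S: "supp (c \<odot>\<^bsub>F\<^esub> f) \<subseteq> supp f" using c by (auto simp: free_fields)
    have "ext U \<beta> (c \<odot>\<^bsub>F\<^esub> f) = (\<Oplus>\<^bsub>U\<^esub>p\<in>supp f. c \<odot>\<^bsub>U\<^esub> (f p \<odot>\<^bsub>U\<^esub> \<beta> p))"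
      unfolding ext_eq[OF U free_smult_closed[OF c f] \<beta> ff(1) S ff(2)]
      by (rule U.V.M.finsum_cong') (use ff \<beta> t f c in \<open>auto simp: free_fields free_val U.V.smult_assoc1 subset_iff Pi_def\<close>)
    then show ?thesis unfolding ext_def using c ff t f
      by (subst U.V.finsum_smult_ldistr) auto
  qed
qed

lemma ext_basis:
  assumes "k_algebra k U" "\<beta> \<in> carrier G \<rightarrow> carrier U" "s \<in> carrier G"
  shows "ext U \<beta> (e s) = \<beta> s"
proof -
  interpret U: k_algebra k U by fact
  have b: "\<beta> s \<in> carrier U" using assms by auto
  have "ext U \<beta> (e s) = (\<Oplus>\<^bsub>U\<^esub>p\<in>{s}. e s p \<odot>\<^bsub>U\<^esub> \<beta> p)"
    by (rule ext_eq) (use assms basis_closed in \<open>auto simp: basis_vec_def\<close>)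
  also have "\<dots> = \<beta> s"
    using b by (subst U.V.M.finsum_insert) (auto simp: basis_vec_def)
  finally show ?thesis .
qed

end

section \<open>Quotients by two-sided ideals that are subspaces\<close>

context
  fixes k :: "('k, 'l) ring_scheme" and A :: "('k, 'a, 'm) module_scheme" and I
  assumes A: "k_algebra k A" and I: "ideal I A" and IS: "submodule I k A"
begin

interpretation A: k_algebra k A by (rule A)
interpretation I: ideal I A by (rule I)

lemma quot_carrier: "carrier (quot_alg A I) = (\<lambda>x. I +>\<^bsub>A\<^esub> x) ` carrier A"
  by (auto simp: quot_alg_def FactRing_def A_RCOSETS_def' )

lemma quot_coset_closed: "x \<in> carrier A \<Longrightarrow> I +>\<^bsub>A\<^esub> x \<in> carrier (quot_alg A I)"
  by (simp add: quot_carrier)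

lemma quot_coset_eq_iff:
  assumes "x \<in> carrier A" "y \<in> carrier A"
  shows "I +>\<^bsub>A\<^esub> x = I +>\<^bsub>A\<^esub> y \<longleftrightarrow> x \<ominus>\<^bsub>A\<^esub> y \<in> I"
proof
  assume "I +>\<^bsub>A\<^esub> x = I +>\<^bsub>A\<^esub> y"
  then have "x \<in> I +>\<^bsub>A\<^esub> y" using I.a_rcos_self[OF assms(1)] by simp
  then obtain i where "i \<in> I" "x = i \<oplus>\<^bsub>A\<^esub> y" by (auto simp: a_r_coset_def')
  moreover then have "x \<ominus>\<^bsub>A\<^esub> y = i" using assms A.submod_sub[OF IS]
    by (simp add: a_minus_def A.V.M.a_assoc A.V.M.r_neg)
  ultimately show "x \<ominus>\<^bsub>A\<^esub> y \<in> I" by simp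
next
  assume i: "x \<ominus>\<^bsub>A\<^esub> y \<in> I"
  have "x = (x \<ominus>\<^bsub>A\<^esub> y) \<oplus>\<^bsub>A\<^esub> y" using assms
    by (simp add: a_minus_def A.V.M.a_assoc A.V.M.l_neg)
  with i have "x \<in> I +>\<^bsub>A\<^esub> y" by (auto simp: a_r_coset_def')
  then show "I +>\<^bsub>A\<^esub> x = I +>\<^bsub>A\<^esub> y"
    using A.V.M.a_repr_independence[OF _ assms(2)] I.a_subgroup by metis
qed

lemma quot_ops:
  "\<lbrakk>x \<in> carrier A; y \<in> carrier A\<rbrakk> \<Longrightarrow> (I +>\<^bsub>A\<^esub> x) \<oplus>\<^bsub>quot_alg A I\<^esub> (I +>\<^bsub>A\<^esub> y) = I +>\<^bsub>A\<^esub> (x \<oplus>\<^bsub>A\<^esub> y)"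
  "\<lbrakk>x \<in> carrier A; y \<in> carrier A\<rbrakk> \<Longrightarrow> (I +>\<^bsub>A\<^esub> x) \<otimes>\<^bsub>quot_alg A I\<^esub> (I +>\<^bsub>A\<^esub> y) = I +>\<^bsub>A\<^esub> (x \<otimes>\<^bsub>A\<^esub> y)"
  "\<one>\<^bsub>quot_alg A I\<^esub> = I +>\<^bsub>A\<^esub> \<one>\<^bsub>A\<^esub>" "\<zero>\<^bsub>quot_alg A I\<^esub> = I"
  by (simp_all add: quot_alg_def FactRing_def I.rcoset_mult_add I.a_rcos_sum)

text \<open>All members of the union that defines the scalar multiple of a coset are the same coset,
  because \<open>I\<close> is stable under scalars.\<close>

lemma quot_smult:
  assumes "c \<in> carrier k" "x \<in> carrier A"
  shows "c \<odot>\<^bsub>quot_alg A I\<^esub> (I +>\<^bsub>A\<^esub> x) = I +>\<^bsub>A\<^esub> (c \<odot>\<^bsub>A\<^esub> x)"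
proof -
  have "I +>\<^bsub>A\<^esub> (c \<odot>\<^bsub>A\<^esub> y) = I +>\<^bsub>A\<^esub> (c \<odot>\<^bsub>A\<^esub> x)" if "y \<in> I +>\<^bsub>A\<^esub> x" for y
  proof -
    from that obtain i where i: "i \<in> I" "y = i \<oplus>\<^bsub>A\<^esub> x" by (auto simp: a_r_coset_def')
    note ic = A.submod_sub[OF IS i(1)]
    have "c \<odot>\<^bsub>A\<^esub> y \<ominus>\<^bsub>A\<^esub> c \<odot>\<^bsub>A\<^esub> x = c \<odot>\<^bsub>A\<^esub> i"
      using assms i ic by (simp add: A.V.smult_r_distr a_minus_def A.V.M.a_assoc A.V.M.r_neg)
    then show ?thesis
      using quot_coset_eq_iff assms i ic A.submod_smult[OF IS assms(1) i(1)] by simp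
  qed
  then have "(\<Union>y\<in>I +>\<^bsub>A\<^esub> x. I +>\<^bsub>A\<^esub> (c \<odot>\<^bsub>A\<^esub> y)) = (\<Union>y\<in>I +>\<^bsub>A\<^esub> x. I +>\<^bsub>A\<^esub> (c \<odot>\<^bsub>A\<^esub> x))"
    by (rule SUP_cong[OF refl])
  also have "\<dots> = I +>\<^bsub>A\<^esub> (c \<odot>\<^bsub>A\<^esub> x)" using I.a_rcos_self[OF assms(2)] by blast
  finally show ?thesis by (simp add: quot_alg_def)
qed

lemma quot_zero_coset: "\<zero>\<^bsub>quot_alg A I\<^esub> = I +>\<^bsub>A\<^esub> \<zero>\<^bsub>A\<^esub>"
  by (simp add: quot_ops A.V.M.a_coset_add_zero I.a_subset)

lemma quot_k_algebra: "k_algebra k (quot_alg A I)"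
proof (rule k_algebraI)
  show "ring (quot_alg A I)"
  proof (rule ringI)
    show "abelian_group (quot_alg A I)"
    proof (rule abelian_groupI)
      fix t assume "t \<in> carrier (quot_alg A I)"
      then obtain x where "x \<in> carrier A" "t = I +>\<^bsub>A\<^esub> x" by (auto simp: quot_carrier)
      then show "\<exists>u\<in>carrier (quot_alg A I). u \<oplus>\<^bsub>quot_alg A I\<^esub> t = \<zero>\<^bsub>quot_alg A I\<^esub>"
        by (intro bexI[of _ "I +>\<^bsub>A\<^esub> \<ominus>\<^bsub>A\<^esub> x"])
          (simp_all add: quot_coset_closed quot_ops(1) quot_zero_coset A.V.M.l_neg)
    qed (auto simp: quot_carrier quot_ops(1) quot_zero_coset A.V.M.a_ac)
    show "Group.monoid (quot_alg A I)"
      by (rule monoidI) (auto simp: quot_carrier quot_ops(2,3) A.A.m_assoc)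
  qed (auto simp: quot_carrier quot_ops(1,2) A.A.l_distr A.A.r_distr)
qed (simp add: A.K.field_axioms, (unfold quot_carrier, (elim imageE, hypsubst, simp add: quot_smult quot_ops(1,2)
    A.V.smult_l_distr A.V.smult_r_distr A.V.smult_assoc1 A.smult_mult_left A.smult_mult_right)+))

lemma quot_linear: "(\<lambda>x. I +>\<^bsub>A\<^esub> x) \<in> linear_map k A (quot_alg A I)"
  by (rule linear_mapI) (simp_all add: quot_coset_closed quot_ops(1) quot_smult)

end

section \<open>Tensor products of algebras\<close>

definition bilinear ::
  "('k, 'l) ring_scheme \<Rightarrow> ('k, 'a, 'm) module_scheme \<Rightarrow> ('k, 'b, 'n) module_scheme
    \<Rightarrow> ('k, 'u, 'o) module_scheme \<Rightarrow> ('a \<Rightarrow> 'b \<Rightarrow> 'u) \<Rightarrow> bool" where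
  "bilinear k A B U \<beta> \<longleftrightarrow> (\<forall>a\<in>carrier A. \<beta> a \<in> linear_map k B U)
     \<and> (\<forall>b\<in>carrier B. (\<lambda>a. \<beta> a b) \<in> linear_map k A U)"

locale tensor_pair = A: k_algebra k A + B: k_algebra k B
  for k :: "('k, 'l) ring_scheme" and A :: "('k, 'a, 'm) module_scheme"
    and B :: "('k, 'b, 'n) module_scheme"
begin

lemma free_algebra_pair: "free_algebra k (A \<times>\<times> B)"
  by (intro free_algebra.intro A.K.field_axioms DirProd_monoid A.A.monoid_axioms B.A.monoid_axioms)

sublocale P: free_algebra k "A \<times>\<times> B"
  by (rule free_algebra_pair)

abbreviation "FP \<equiv> pair_alg k A B"
abbreviation "T \<equiv> tensor k A B"
abbreviation "N \<equiv> bilin_rels k A B"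
abbreviation "pt \<equiv> pure_tensor k A B"
abbreviation "bv \<equiv> (\<lambda>a b. basis_vec k (a, b))"

sublocale FP: k_algebra k FP
  by (rule P.free_k_algebra)

definition gens :: "('a \<times> 'b \<Rightarrow> 'k) set" where
  "gens = {bv (a \<oplus>\<^bsub>A\<^esub> a') b \<ominus>\<^bsub>FP\<^esub> (bv a b \<oplus>\<^bsub>FP\<^esub> bv a' b) | a a' b.
          a \<in> carrier A \<and> a' \<in> carrier A \<and> b \<in> carrier B}
       \<union> {bv a (b \<oplus>\<^bsub>B\<^esub> b') \<ominus>\<^bsub>FP\<^esub> (bv a b \<oplus>\<^bsub>FP\<^esub> bv a b') | a b b'.
          a \<in> carrier A \<and> b \<in> carrier B \<and> b' \<in> carrier B}
       \<union> {bv (c \<odot>\<^bsub>A\<^esub> a) b \<ominus>\<^bsub>FP\<^esub> c \<odot>\<^bsub>FP\<^esub> bv a b | c a b.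
          c \<in> carrier k \<and> a \<in> carrier A \<and> b \<in> carrier B}
       \<union> {bv a (c \<odot>\<^bsub>B\<^esub> b) \<ominus>\<^bsub>FP\<^esub> c \<odot>\<^bsub>FP\<^esub> bv a b | c a b.
          c \<in> carrier k \<and> a \<in> carrier A \<and> b \<in> carrier B}"

lemma bilin_rels_eq: "N = lspan k FP gens"
  by (simp add: bilin_rels_def gens_def Let_def)

lemma pair_carrier [simp]: "(a, b) \<in> carrier (A \<times>\<times> B) \<longleftrightarrow> a \<in> carrier A \<and> b \<in> carrier B"
  by (simp add: DirProd_def)

lemma bv_closed [simp]: "\<lbrakk>a \<in> carrier A; b \<in> carrier B\<rbrakk> \<Longrightarrow> bv a b \<in> carrier FP"
  by (simp add: P.basis_closed)

lemma bv_mult [simp]: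
  "\<lbrakk>a \<in> carrier A; b \<in> carrier B; a' \<in> carrier A; b' \<in> carrier B\<rbrakk>
    \<Longrightarrow> bv a b \<otimes>\<^bsub>FP\<^esub> bv a' b' = bv (a \<otimes>\<^bsub>A\<^esub> a') (b \<otimes>\<^bsub>B\<^esub> b')"
  by (simp add: P.free_mult_basis)

lemma bv_one: "\<one>\<^bsub>FP\<^esub> = bv \<one>\<^bsub>A\<^esub> \<one>\<^bsub>B\<^esub>"
  by (simp add: P.free_fields(4))

lemma gens_sub: "gens \<subseteq> carrier FP"
  by (auto simp: gens_def)

lemma gensI:
  "\<lbrakk>a \<in> carrier A; a' \<in> carrier A; b \<in> carrier B\<rbrakk>
    \<Longrightarrow> bv (a \<oplus>\<^bsub>A\<^esub> a') b \<ominus>\<^bsub>FP\<^esub> (bv a b \<oplus>\<^bsub>FP\<^esub> bv a' b) \<in> gens"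
  "\<lbrakk>a \<in> carrier A; b \<in> carrier B; b' \<in> carrier B\<rbrakk>
    \<Longrightarrow> bv a (b \<oplus>\<^bsub>B\<^esub> b') \<ominus>\<^bsub>FP\<^esub> (bv a b \<oplus>\<^bsub>FP\<^esub> bv a b') \<in> gens"
  "\<lbrakk>c \<in> carrier k; a \<in> carrier A; b \<in> carrier B\<rbrakk>
    \<Longrightarrow> bv (c \<odot>\<^bsub>A\<^esub> a) b \<ominus>\<^bsub>FP\<^esub> c \<odot>\<^bsub>FP\<^esub> bv a b \<in> gens"
  "\<lbrakk>c \<in> carrier k; a \<in> carrier A; b \<in> carrier B\<rbrakk>
    \<Longrightarrow> bv a (c \<odot>\<^bsub>B\<^esub> b) \<ominus>\<^bsub>FP\<^esub> c \<odot>\<^bsub>FP\<^esub> bv a b \<in> gens"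
  unfolding gens_def by blast+

lemma gens_cases:
  assumes "g \<in> gens"
  obtains (add_left) a a' b where "a \<in> carrier A" "a' \<in> carrier A" "b \<in> carrier B"
      "g = bv (a \<oplus>\<^bsub>A\<^esub> a') b \<ominus>\<^bsub>FP\<^esub> (bv a b \<oplus>\<^bsub>FP\<^esub> bv a' b)"
    | (add_right) a b b' where "a \<in> carrier A" "b \<in> carrier B" "b' \<in> carrier B"
      "g = bv a (b \<oplus>\<^bsub>B\<^esub> b') \<ominus>\<^bsub>FP\<^esub> (bv a b \<oplus>\<^bsub>FP\<^esub> bv a b')"
    | (smult_left) c a b where "c \<in> carrier k" "a \<in> carrier A" "b \<in> carrier B"
      "g = bv (c \<odot>\<^bsub>A\<^esub> a) b \<ominus>\<^bsub>FP\<^esub> c \<odot>\<^bsub>FP\<^esub> bv a b"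
    | (smult_right) c a b where "c \<in> carrier k" "a \<in> carrier A" "b \<in> carrier B"
      "g = bv a (c \<odot>\<^bsub>B\<^esub> b) \<ominus>\<^bsub>FP\<^esub> c \<odot>\<^bsub>FP\<^esub> bv a b"
  using assms unfolding gens_def
  by (elim UnE CollectE exE conjE) (rule that; assumption)+

lemma N_submodule: "submodule N k FP"
  unfolding bilin_rels_eq by (rule FP.lspan_submodule[OF gens_sub])

lemma gens_N: "g \<in> gens \<Longrightarrow> g \<in> N"
  unfolding bilin_rels_eq by (rule hull_inc)

lemma mult_diff:
  assumes "f \<in> carrier FP" "g \<in> carrier FP" "h \<in> carrier FP"
  shows "f \<otimes>\<^bsub>FP\<^esub> (g \<ominus>\<^bsub>FP\<^esub> h) = f \<otimes>\<^bsub>FP\<^esub> g \<ominus>\<^bsub>FP\<^esub> f \<otimes>\<^bsub>FP\<^esub> h"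
    and "(g \<ominus>\<^bsub>FP\<^esub> h) \<otimes>\<^bsub>FP\<^esub> f = g \<otimes>\<^bsub>FP\<^esub> f \<ominus>\<^bsub>FP\<^esub> h \<otimes>\<^bsub>FP\<^esub> f"
  using assms by (simp_all add: a_minus_def FP.A.r_distr FP.A.l_distr FP.A.r_minus FP.A.l_minus)

text \<open>Each of the four kinds of relation is preserved, as the multiplications of
  \<open>A\<close> and \<open>B\<close> are bilinear. This is what makes the span of the relations
  an ideal.\<close>

lemma basis_mult_gens:
  assumes g: "g \<in> gens" and xy: "x \<in> carrier A" "y \<in> carrier B"
  shows "bv x y \<otimes>\<^bsub>FP\<^esub> g \<in> gens" "g \<otimes>\<^bsub>FP\<^esub> bv x y \<in> gens"
proof -
  show "bv x y \<otimes>\<^bsub>FP\<^esub> g \<in> gens"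
    using g xy
    by (cases rule: gens_cases) (simp_all add: mult_diff FP.A.r_distr FP.smult_mult_right
        A.A.r_distr B.A.r_distr A.smult_mult_right B.smult_mult_right gensI)
  show "g \<otimes>\<^bsub>FP\<^esub> bv x y \<in> gens"
    using g xy
    by (cases rule: gens_cases) (simp_all add: mult_diff FP.A.l_distr FP.smult_mult_left
        A.A.l_distr B.A.l_distr A.smult_mult_left B.smult_mult_left gensI)
qed

lemma N_mult:
  assumes "f \<in> carrier FP" and n: "n \<in> N"
  shows "f \<otimes>\<^bsub>FP\<^esub> n \<in> N \<and> n \<otimes>\<^bsub>FP\<^esub> f \<in> N"
proof -
  note nc = FP.submod_sub[OF N_submodule n]
  have lin: "(\<lambda>n. g \<otimes>\<^bsub>FP\<^esub> n) \<in> linear_map k FP FP" "(\<lambda>n. n \<otimes>\<^bsub>FP\<^esub> g) \<in> linear_map k FP FP"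
    if "g \<in> carrier FP" for g
    using that by (auto intro!: linear_mapI simp: FP.A.r_distr FP.A.l_distr FP.smult_mult_right FP.smult_mult_left)
  \<comment> \<open>For a fixed basis vector the claim spreads from the generators to their span by
    linearity; the induction that follows replaces the basis vector by an arbitrary element.\<close>
  have b: "P.e s \<otimes>\<^bsub>FP\<^esub> n \<in> N \<and> n \<otimes>\<^bsub>FP\<^esub> P.e s \<in> N" if s: "s \<in> carrier (A \<times>\<times> B)" for s
  proof -
    obtain x y where xy: "s = (x, y)" "x \<in> carrier A" "y \<in> carrier B" using s by (cases s) auto
    show ?thesis unfolding xy(1)
      using linear_map_lspan[OF FP.k_algebra_axioms FP.k_algebra_axioms lin(1) N_submodule gens_sub, of "bv x y" n]
        linear_map_lspan[OF FP.k_algebra_axioms FP.k_algebra_axioms lin(2) N_submodule gens_sub, of "bv x y" n]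
        basis_mult_gens xy gens_N n by (simp add: bilin_rels_eq)
  qed
  show ?thesis using assms(1)
  proof (induction rule: P.free_induct)
    case zero
    then show ?case using nc FP.submod_zero[OF N_submodule] by simp
  next
    case (add f c s)
    then have e: "P.e s \<in> carrier FP" by (simp add: P.basis_closed)
    show ?case using add b[OF add.hyps(3)] nc e FP.submod[OF N_submodule]
      by (simp add: FP.A.l_distr FP.A.r_distr FP.smult_mult_left FP.smult_mult_right)
  qed
qed

lemma N_ideal: "ideal N FP"
proof (rule idealI)
  show "ring FP" by (rule FP.A.ring_axioms)
  show "subgroup N (add_monoid FP)" using N_submodule by (rule submodule.axioms)
qed (use N_mult in auto)

lemma T_eq: "T = quot_alg FP N"
  by (simp add: tensor_def)

lemma T_k_algebra: "k_algebra k T"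
  unfolding T_eq by (rule quot_k_algebra[OF FP.k_algebra_axioms N_ideal N_submodule])

sublocale T: k_algebra k T
  by (rule T_k_algebra)

lemmas quot = FP.k_algebra_axioms N_ideal N_submodule

lemma pt_eq: "pt a b = N +>\<^bsub>FP\<^esub> bv a b"
  by (simp add: pure_tensor_def)

lemma pt_closed [simp]: "\<lbrakk>a \<in> carrier A; b \<in> carrier B\<rbrakk> \<Longrightarrow> pt a b \<in> carrier T"
  unfolding pt_eq T_eq by (intro quot_coset_closed[OF quot] bv_closed)

lemma pt_rel:
  assumes "x \<ominus>\<^bsub>FP\<^esub> y \<in> gens" "x \<in> carrier FP" "y \<in> carrier FP"
  shows "N +>\<^bsub>FP\<^esub> x = N +>\<^bsub>FP\<^esub> y"
  using quot_coset_eq_iff[OF quot assms(2,3)] gens_N[OF assms(1)] by blast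

lemma pt_add_left:
  "\<lbrakk>a \<in> carrier A; a' \<in> carrier A; b \<in> carrier B\<rbrakk> \<Longrightarrow> pt (a \<oplus>\<^bsub>A\<^esub> a') b = pt a b \<oplus>\<^bsub>T\<^esub> pt a' b"
  unfolding pt_eq T_eq by (simp add: quot_ops[OF quot] pt_rel[OF gensI(1)])

lemma pt_add_right:
  "\<lbrakk>a \<in> carrier A; b \<in> carrier B; b' \<in> carrier B\<rbrakk> \<Longrightarrow> pt a (b \<oplus>\<^bsub>B\<^esub> b') = pt a b \<oplus>\<^bsub>T\<^esub> pt a b'"
  unfolding pt_eq T_eq by (simp add: quot_ops[OF quot] pt_rel[OF gensI(2)])

lemma pt_smult_left:
  "\<lbrakk>c \<in> carrier k; a \<in> carrier A; b \<in> carrier B\<rbrakk> \<Longrightarrow> pt (c \<odot>\<^bsub>A\<^esub> a) b = c \<odot>\<^bsub>T\<^esub> pt a b"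
  unfolding pt_eq T_eq by (simp add: quot_smult[OF quot] pt_rel[OF gensI(3)])

lemma pt_smult_right:
  "\<lbrakk>c \<in> carrier k; a \<in> carrier A; b \<in> carrier B\<rbrakk> \<Longrightarrow> pt a (c \<odot>\<^bsub>B\<^esub> b) = c \<odot>\<^bsub>T\<^esub> pt a b"
  unfolding pt_eq T_eq by (simp add: quot_smult[OF quot] pt_rel[OF gensI(4)])

lemma pt_mult:
  "\<lbrakk>a \<in> carrier A; b \<in> carrier B; a' \<in> carrier A; b' \<in> carrier B\<rbrakk>
    \<Longrightarrow> pt a b \<otimes>\<^bsub>T\<^esub> pt a' b' = pt (a \<otimes>\<^bsub>A\<^esub> a') (b \<otimes>\<^bsub>B\<^esub> b')"
  unfolding pt_eq T_eq by (simp add: quot_ops[OF quot])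

lemma T_one: "\<one>\<^bsub>T\<^esub> = pt \<one>\<^bsub>A\<^esub> \<one>\<^bsub>B\<^esub>"
  unfolding pt_eq T_eq by (simp add: quot_ops[OF quot] bv_one)

lemma pt_bilinear: "bilinear k A B T pt"
  unfolding bilinear_def
  by (intro conjI ballI linear_mapI) (simp_all add: pt_add_left pt_add_right pt_smult_left pt_smult_right)

lemma pt_zero [simp]:
  shows "b \<in> carrier B \<Longrightarrow> pt \<zero>\<^bsub>A\<^esub> b = \<zero>\<^bsub>T\<^esub>" and "a \<in> carrier A \<Longrightarrow> pt a \<zero>\<^bsub>B\<^esub> = \<zero>\<^bsub>T\<^esub>"
  using linear_map_zero[OF A.k_algebra_axioms T_k_algebra] linear_map_zero[OF B.k_algebra_axioms T_k_algebra]
    pt_bilinear unfolding bilinear_def by metis+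

text \<open>The pure case covers zero and scalar multiples: zero is the pure tensor of two zeros,
  and a scalar moves into the left factor.\<close>

lemma tensor_induct [consumes 1, case_names pure add]:
  assumes "t \<in> carrier T"
    and pure: "\<And>a b. \<lbrakk>a \<in> carrier A; b \<in> carrier B\<rbrakk> \<Longrightarrow> P (pt a b)"
    and add: "\<And>s t. \<lbrakk>s \<in> carrier T; t \<in> carrier T; P s; P t\<rbrakk> \<Longrightarrow> P (s \<oplus>\<^bsub>T\<^esub> t)"
  shows "P t"
proof -
  obtain f where f: "f \<in> carrier FP" "t = N +>\<^bsub>FP\<^esub> f"
    using assms(1) unfolding T_eq quot_carrier[OF quot] by blast
  have "P (N +>\<^bsub>FP\<^esub> f)" using f(1)
  proof (induction rule: P.free_induct)
    case zero
    have "N +>\<^bsub>FP\<^esub> \<zero>\<^bsub>FP\<^esub> = \<zero>\<^bsub>T\<^esub>" unfolding T_eq by (rule quot_zero_coset[OF quot, symmetric])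
    also have "\<dots> = pt \<zero>\<^bsub>A\<^esub> \<zero>\<^bsub>B\<^esub>" by simp
    finally show ?case using pure[of "\<zero>\<^bsub>A\<^esub>" "\<zero>\<^bsub>B\<^esub>"] by simp
  next
    case (add f c s)
    obtain x y where xy: "s = (x, y)" "x \<in> carrier A" "y \<in> carrier B" using add.hyps(3) by (cases s) auto
    have "N +>\<^bsub>FP\<^esub> (f \<oplus>\<^bsub>FP\<^esub> c \<odot>\<^bsub>FP\<^esub> P.e s) = (N +>\<^bsub>FP\<^esub> f) \<oplus>\<^bsub>T\<^esub> c \<odot>\<^bsub>T\<^esub> pt x y"
      unfolding T_eq pt_eq using add xy by (simp add: quot_ops[OF quot] quot_smult[OF quot])
    also have "\<dots> = (N +>\<^bsub>FP\<^esub> f) \<oplus>\<^bsub>T\<^esub> pt (c \<odot>\<^bsub>A\<^esub> x) y"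
      using add xy by (simp add: pt_smult_left)
    finally show ?case
      using assms(3)[of "N +>\<^bsub>FP\<^esub> f" "pt (c \<odot>\<^bsub>A\<^esub> x) y"] add xy pure[of "c \<odot>\<^bsub>A\<^esub> x" y]
      by (simp add: T_eq quot_coset_closed[OF quot] pt_closed[unfolded T_eq])
  qed
  then show ?thesis using f(2) by simp
qed

section \<open>The universal property of the tensor product\<close>

context
  fixes U :: "('k, 'u, 'o) module_scheme" and \<beta>
  assumes U: "k_algebra k U" and \<beta>: "bilinear k A B U \<beta>"
begin

interpretation U: k_algebra k U by (rule U)

lemma bilinD:
  "\<lbrakk>a \<in> carrier A; b \<in> carrier B\<rbrakk> \<Longrightarrow> \<beta> a b \<in> carrier U"
  "\<lbrakk>a \<in> carrier A; a' \<in> carrier A; b \<in> carrier B\<rbrakk> \<Longrightarrow> \<beta> (a \<oplus>\<^bsub>A\<^esub> a') b = \<beta> a b \<oplus>\<^bsub>U\<^esub> \<beta> a' b"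
  "\<lbrakk>a \<in> carrier A; b \<in> carrier B; b' \<in> carrier B\<rbrakk> \<Longrightarrow> \<beta> a (b \<oplus>\<^bsub>B\<^esub> b') = \<beta> a b \<oplus>\<^bsub>U\<^esub> \<beta> a b'"
  "\<lbrakk>c \<in> carrier k; a \<in> carrier A; b \<in> carrier B\<rbrakk> \<Longrightarrow> \<beta> (c \<odot>\<^bsub>A\<^esub> a) b = c \<odot>\<^bsub>U\<^esub> \<beta> a b"
  "\<lbrakk>c \<in> carrier k; a \<in> carrier A; b \<in> carrier B\<rbrakk> \<Longrightarrow> \<beta> a (c \<odot>\<^bsub>B\<^esub> b) = c \<odot>\<^bsub>U\<^esub> \<beta> a b"
  using \<beta> by (auto simp: bilinear_def linear_map_def)

abbreviation "\<Phi> \<equiv> P.ext U (\<lambda>p. \<beta> (fst p) (snd p))"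

lemma \<beta>_Pi: "(\<lambda>p. \<beta> (fst p) (snd p)) \<in> carrier (A \<times>\<times> B) \<rightarrow> carrier U"
  using bilinD(1) by auto

lemma \<Phi>_linear: "\<Phi> \<in> linear_map k FP U"
  by (rule P.ext_linear[OF U \<beta>_Pi])

lemma \<Phi>_bv: "\<lbrakk>a \<in> carrier A; b \<in> carrier B\<rbrakk> \<Longrightarrow> \<Phi> (bv a b) = \<beta> a b"
  using P.ext_basis[OF U \<beta>_Pi, of "(a, b)"] by simp

lemma \<Phi>_N:
  assumes "n \<in> N" shows "\<Phi> n = \<zero>\<^bsub>U\<^esub>"
proof -
  note lin = linear_mapD[OF \<Phi>_linear] linear_map_diff[OF FP.k_algebra_axioms U \<Phi>_linear]
  have self: "x \<ominus>\<^bsub>U\<^esub> x = \<zero>\<^bsub>U\<^esub>" if "x \<in> carrier U" for x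
    using that by (simp add: a_minus_def U.V.M.r_neg)
  have "\<Phi> n \<in> {\<zero>\<^bsub>U\<^esub>}"
  proof (rule linear_map_lspan[OF FP.k_algebra_axioms U \<Phi>_linear U.submodule_zero gens_sub])
    show "n \<in> lspan k FP gens" using assms by (simp add: bilin_rels_eq)
    fix g assume "g \<in> gens"
    then show "\<Phi> g \<in> {\<zero>\<^bsub>U\<^esub>}"
      by (cases rule: gens_cases) (simp_all add: lin \<Phi>_bv bilinD self)
  qed
  then show ?thesis by simp
qed

text \<open>Any representative of the class differs from \<open>f\<close> by an element of
  \<open>N\<close>, on which \<Phi> vanishes; so the arbitrary choice made in
  \<open>tensor_lift\<close> is harmless.\<close>

lemma tensor_lift_coset:
  assumes "f \<in> carrier FP"
  shows "tensor_lift k U \<beta> (N +>\<^bsub>FP\<^esub> f) = \<Phi> f"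
proof -
  interpret I: ideal N FP by (rule N_ideal)
  define r where "r = (SOME r. r \<in> N +>\<^bsub>FP\<^esub> f)"
  have "r \<in> N +>\<^bsub>FP\<^esub> f"
    unfolding r_def by (rule someI[of _ f]) (rule I.a_rcos_self[OF assms])
  then obtain n where n: "n \<in> N" "r = n \<oplus>\<^bsub>FP\<^esub> f" by (auto simp: a_r_coset_def')
  have "\<Phi> r = \<Phi> n \<oplus>\<^bsub>U\<^esub> \<Phi> f"
    using n assms FP.submod_sub[OF N_submodule] by (simp add: linear_mapD(2)[OF \<Phi>_linear])
  then have "\<Phi> r = \<Phi> f"
    using \<Phi>_N[OF n(1)] linear_mapD(1)[OF \<Phi>_linear assms] by simp
  then show ?thesis by (simp add: tensor_lift_def r_def[symmetric] P.ext_def)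
qed

lemma tensor_lift_linear: "tensor_lift k U \<beta> \<in> linear_map k T U"
proof (rule linear_mapI)
  note lin = linear_mapD[OF \<Phi>_linear]
  fix s assume "s \<in> carrier T"
  then obtain f where f: "f \<in> carrier FP" "s = N +>\<^bsub>FP\<^esub> f"
    unfolding T_eq quot_carrier[OF quot] by blast
  show "tensor_lift k U \<beta> s \<in> carrier U" using f by (simp add: tensor_lift_coset lin)
  show "tensor_lift k U \<beta> (c \<odot>\<^bsub>T\<^esub> s) = c \<odot>\<^bsub>U\<^esub> tensor_lift k U \<beta> s" if "c \<in> carrier k" for c
    using f that by (simp add: T_eq quot_smult[OF quot] tensor_lift_coset lin)
  fix t assume "t \<in> carrier T"
  then obtain g where g: "g \<in> carrier FP" "t = N +>\<^bsub>FP\<^esub> g"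
    unfolding T_eq quot_carrier[OF quot] by blast
  show "tensor_lift k U \<beta> (s \<oplus>\<^bsub>T\<^esub> t) = tensor_lift k U \<beta> s \<oplus>\<^bsub>U\<^esub> tensor_lift k U \<beta> t"
    using f g by (simp add: T_eq quot_ops[OF quot] tensor_lift_coset lin)
qed

lemma tensor_lift_pt: "\<lbrakk>a \<in> carrier A; b \<in> carrier B\<rbrakk> \<Longrightarrow> tensor_lift k U \<beta> (pt a b) = \<beta> a b"
  by (simp add: pt_eq tensor_lift_coset \<Phi>_bv)

end

lemma tensor_ext:
  assumes "f \<in> linear_map k T U" "g \<in> linear_map k T U" "t \<in> carrier T"
    and "\<And>a b. \<lbrakk>a \<in> carrier A; b \<in> carrier B\<rbrakk> \<Longrightarrow> f (pt a b) = g (pt a b)"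
  shows "f t = g t"
  using assms(3) by (induction rule: tensor_induct)
    (simp_all add: assms(4) linear_mapD[OF assms(1)] linear_mapD[OF assms(2)])

end

section \<open>Slices and subspaces of tensor products\<close>

text \<open>For \<open>f\<close> the counit this is literally the term of the axiom
  \<open>counit_left\<close>, which thus says that slicing the comultiplication of \<open>x\<close>
  by the counit returns \<open>x\<close>; likewise for \<open>rslice\<close> and
  \<open>counit_right\<close>.\<close>

abbreviation lslice where
  "lslice k B f \<equiv> tensor_lift k B (\<lambda>a b. f a \<odot>\<^bsub>B\<^esub> b)"

abbreviation rslice where
  "rslice k A g \<equiv> tensor_lift k A (\<lambda>a b. g b \<odot>\<^bsub>A\<^esub> a)"

text \<open>With the flip, facts about right slices follow from those about left slices, and the
  opposite comultiplication can be formed.\<close>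

definition tensor_swap ::
  "('k, 'l) ring_scheme \<Rightarrow> ('k, 'a, 'm) module_scheme \<Rightarrow> ('k, 'b, 'n) module_scheme
    \<Rightarrow> ('a \<times> 'b \<Rightarrow> 'k) set \<Rightarrow> ('b \<times> 'a \<Rightarrow> 'k) set" where
  "tensor_swap k A B = tensor_lift k (tensor k B A) (\<lambda>a b. pure_tensor k B A b a)"

text \<open>Each vector lies outside the span of the later ones. This triangular form of linear
  independence suits list recursion: a functional can kill the tail and be \<open>1\<close> on the
  head.\<close>

fun indep :: "('k, 'l) ring_scheme \<Rightarrow> ('k, 'a, 'm) module_scheme \<Rightarrow> 'a list \<Rightarrow> bool" where
  "indep k A [] \<longleftrightarrow> True"
| "indep k A (a # as) \<longleftrightarrow> a \<notin> lspan k A (set as) \<and> indep k A as"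

fun tsum :: "('k, 'l) ring_scheme \<Rightarrow> ('k, 'a, 'm) module_scheme \<Rightarrow> ('k, 'b, 'n) module_scheme
    \<Rightarrow> ('a \<times> 'b) list \<Rightarrow> ('a \<times> 'b \<Rightarrow> 'k) set" where
  "tsum k A B [] = \<zero>\<^bsub>tensor k A B\<^esub>"
| "tsum k A B ((a, b) # l) = pure_tensor k A B a b \<oplus>\<^bsub>tensor k A B\<^esub> tsum k A B l"

context tensor_pair
begin

lemma swap_pair: "tensor_pair k B A"
  by (intro tensor_pair.intro A.k_algebra_axioms B.k_algebra_axioms)

lemma bilinearI:
  assumes "k_algebra k U"
    and "\<And>a b. \<lbrakk>a \<in> carrier A; b \<in> carrier B\<rbrakk> \<Longrightarrow> \<beta> a b \<in> carrier U"
    and "\<And>a a' b. \<lbrakk>a \<in> carrier A; a' \<in> carrier A; b \<in> carrier B\<rbrakk> \<Longrightarrow> \<beta> (a \<oplus>\<^bsub>A\<^esub> a') b = \<beta> a b \<oplus>\<^bsub>U\<^esub> \<beta> a' b"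
    and "\<And>a b b'. \<lbrakk>a \<in> carrier A; b \<in> carrier B; b' \<in> carrier B\<rbrakk> \<Longrightarrow> \<beta> a (b \<oplus>\<^bsub>B\<^esub> b') = \<beta> a b \<oplus>\<^bsub>U\<^esub> \<beta> a b'"
    and "\<And>c a b. \<lbrakk>c \<in> carrier k; a \<in> carrier A; b \<in> carrier B\<rbrakk> \<Longrightarrow> \<beta> (c \<odot>\<^bsub>A\<^esub> a) b = c \<odot>\<^bsub>U\<^esub> \<beta> a b"
    and "\<And>c a b. \<lbrakk>c \<in> carrier k; a \<in> carrier A; b \<in> carrier B\<rbrakk> \<Longrightarrow> \<beta> a (c \<odot>\<^bsub>B\<^esub> b) = c \<odot>\<^bsub>U\<^esub> \<beta> a b"
  shows "bilinear k A B U \<beta>"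
  unfolding bilinear_def by (intro conjI ballI linear_mapI) (simp_all add: assms(2-6))

lemma lslice_bilinear: "f \<in> functional k A \<Longrightarrow> bilinear k A B B (\<lambda>a b. f a \<odot>\<^bsub>B\<^esub> b)"
  by (rule bilinearI[OF B.k_algebra_axioms]) (simp_all add: functionalD B.V.smult_l_distr
      B.V.smult_r_distr B.V.smult_assoc1[symmetric] A.K.m_comm)

lemma rslice_bilinear: "g \<in> functional k B \<Longrightarrow> bilinear k A B A (\<lambda>a b. g b \<odot>\<^bsub>A\<^esub> a)"
  by (rule bilinearI[OF A.k_algebra_axioms]) (simp_all add: functionalD A.V.smult_l_distr
      A.V.smult_r_distr A.V.smult_assoc1[symmetric] A.K.m_comm)

lemma lslice_linear: "f \<in> functional k A \<Longrightarrow> lslice k B f \<in> linear_map k T B"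
  by (rule tensor_lift_linear[OF B.k_algebra_axioms lslice_bilinear])

lemma rslice_linear: "g \<in> functional k B \<Longrightarrow> rslice k A g \<in> linear_map k T A"
  by (rule tensor_lift_linear[OF A.k_algebra_axioms rslice_bilinear])

lemma lslice_pt:
  "\<lbrakk>f \<in> functional k A; a \<in> carrier A; b \<in> carrier B\<rbrakk> \<Longrightarrow> lslice k B f (pt a b) = f a \<odot>\<^bsub>B\<^esub> b"
  by (rule tensor_lift_pt[OF B.k_algebra_axioms lslice_bilinear])

lemma rslice_pt:
  "\<lbrakk>g \<in> functional k B; a \<in> carrier A; b \<in> carrier B\<rbrakk> \<Longrightarrow> rslice k A g (pt a b) = g b \<odot>\<^bsub>A\<^esub> a"
  by (rule tensor_lift_pt[OF A.k_algebra_axioms rslice_bilinear])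

lemma swap_bilinear: "bilinear k A B (tensor k B A) (\<lambda>a b. pure_tensor k B A b a)"
proof -
  interpret S: tensor_pair k B A by (rule swap_pair)
  show ?thesis
    by (rule bilinearI[OF S.T_k_algebra]) (simp_all add: S.pt_add_left S.pt_add_right S.pt_smult_left S.pt_smult_right)
qed

lemma swap_linear: "tensor_swap k A B \<in> linear_map k T (tensor k B A)"
  unfolding tensor_swap_def
  by (rule tensor_lift_linear[OF tensor_pair.T_k_algebra[OF swap_pair] swap_bilinear])

lemma swap_pt:
  "\<lbrakk>a \<in> carrier A; b \<in> carrier B\<rbrakk> \<Longrightarrow> tensor_swap k A B (pt a b) = pure_tensor k B A b a"
  unfolding tensor_swap_def
  by (rule tensor_lift_pt[OF tensor_pair.T_k_algebra[OF swap_pair] swap_bilinear])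

lemma swap_swap:
  assumes "t \<in> carrier T" shows "tensor_swap k B A (tensor_swap k A B t) = t"
proof -
  interpret S: tensor_pair k B A by (rule swap_pair)
  show ?thesis
    using tensor_ext[OF linear_map_comp[OF swap_linear S.swap_linear] linear_map_id assms]
    by (simp add: swap_pt S.swap_pt)
qed

lemma lslice_swap:
  assumes "t \<in> carrier T" "g \<in> functional k B"
  shows "lslice k A g (tensor_swap k A B t) = rslice k A g t"
proof -
  interpret S: tensor_pair k B A by (rule swap_pair)
  show ?thesis
    by (rule tensor_ext[OF linear_map_comp[OF swap_linear S.lslice_linear] rslice_linear assms(1)])
      (simp_all add: assms swap_pt S.lslice_pt rslice_pt)
qed

lemma rslice_swap:
  assumes "t \<in> carrier T" "g \<in> functional k A"
  shows "rslice k B g (tensor_swap k A B t) = lslice k B g t"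
proof -
  interpret S: tensor_pair k B A by (rule swap_pair)
  show ?thesis
    by (rule tensor_ext[OF linear_map_comp[OF swap_linear S.rslice_linear] lslice_linear assms(1)])
      (simp_all add: assms swap_pt S.rslice_pt lslice_pt)
qed

lemma swap_mult:
  assumes "s \<in> carrier T" "t \<in> carrier T"
  shows "tensor_swap k A B (s \<otimes>\<^bsub>T\<^esub> t) = tensor_swap k A B s \<otimes>\<^bsub>tensor k B A\<^esub> tensor_swap k A B t"
proof -
  interpret S: tensor_pair k B A by (rule swap_pair)
  note lin = linear_mapD[OF swap_linear]
  show ?thesis using assms(1)
  proof (induction rule: tensor_induct)
    case (pure a b)
    show ?case using assms(2)
      by (induction rule: tensor_induct) (use pure in
        \<open>simp_all add: swap_pt pt_mult S.pt_mult T.A.r_distr S.T.A.r_distr lin\<close>)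
  next
    case (add s t)
    then show ?case using assms(2) by (simp add: T.A.l_distr S.T.A.l_distr lin)
  qed
qed

lemma swap_one: "tensor_swap k A B \<one>\<^bsub>T\<^esub> = \<one>\<^bsub>tensor k B A\<^esub>"
  using tensor_pair.T_one[OF swap_pair] by (simp add: T_one swap_pt)

section \<open>Subspaces spanned by pure tensors\<close>

lemma tensor_sub_eq: "tensor_sub k A B V W = lspan k T {pt v w | v w. v \<in> V \<and> w \<in> W}"
  by (simp add: tensor_sub_def)

lemma tensor_sub_gens: "\<lbrakk>V \<subseteq> carrier A; W \<subseteq> carrier B\<rbrakk> \<Longrightarrow> {pt v w | v w. v \<in> V \<and> w \<in> W} \<subseteq> carrier T"
  by (auto simp: subset_iff)

lemma tensor_sub_submodule:
  "\<lbrakk>V \<subseteq> carrier A; W \<subseteq> carrier B\<rbrakk> \<Longrightarrow> submodule (tensor_sub k A B V W) k T"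
  unfolding tensor_sub_eq by (intro T.lspan_submodule tensor_sub_gens)

lemma tensor_sub_pt: "\<lbrakk>v \<in> V; w \<in> W\<rbrakk> \<Longrightarrow> pt v w \<in> tensor_sub k A B V W"
  unfolding tensor_sub_eq by (rule hull_inc) blast

lemma tensor_sub_closed: "\<lbrakk>V \<subseteq> carrier A; W \<subseteq> carrier B; t \<in> tensor_sub k A B V W\<rbrakk> \<Longrightarrow> t \<in> carrier T"
  using T.submod_sub[OF tensor_sub_submodule] by blast

lemma tensor_sub_mono:
  "\<lbrakk>V \<subseteq> V'; W \<subseteq> W'\<rbrakk> \<Longrightarrow> tensor_sub k A B V W \<subseteq> tensor_sub k A B V' W'"
  unfolding tensor_sub_eq by (rule hull_mono) blast

lemma tensor_sub_induct:
  assumes "t \<in> tensor_sub k A B V W" "V \<subseteq> carrier A" "W \<subseteq> carrier B"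
    and "P \<zero>\<^bsub>T\<^esub>"
    and "\<And>v w. \<lbrakk>v \<in> V; w \<in> W\<rbrakk> \<Longrightarrow> P (pt v w)"
    and "\<And>s t. \<lbrakk>s \<in> carrier T; t \<in> carrier T; P s; P t\<rbrakk> \<Longrightarrow> P (s \<oplus>\<^bsub>T\<^esub> t)"
    and "\<And>c t. \<lbrakk>c \<in> carrier k; t \<in> carrier T; P t\<rbrakk> \<Longrightarrow> P (c \<odot>\<^bsub>T\<^esub> t)"
  shows "P t"
  by (rule T.lspan_induct[OF assms(1)[unfolded tensor_sub_eq] tensor_sub_gens[OF assms(2,3)], of P])
    ((use assms(5) in blast) | (rule assms(4,6,7); assumption))+

lemma tensor_sub_linear:
  assumes "k_algebra k U" "f \<in> linear_map k T U" "submodule M k U" "V \<subseteq> carrier A" "W \<subseteq> carrier B"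
    and "\<And>v w. \<lbrakk>v \<in> V; w \<in> W\<rbrakk> \<Longrightarrow> f (pt v w) \<in> M" "t \<in> tensor_sub k A B V W"
  shows "f t \<in> M"
  by (rule linear_map_lspan[OF T_k_algebra assms(1-3) tensor_sub_gens[OF assms(4,5)] _
        assms(7)[unfolded tensor_sub_eq]]) (use assms(6) in auto)

lemma lslice_tensor_sub:
  assumes "submodule W k B" "V \<subseteq> carrier A" "f \<in> functional k A" "t \<in> tensor_sub k A B V W"
  shows "lslice k B f t \<in> W"
  by (rule tensor_sub_linear[OF B.k_algebra_axioms lslice_linear[OF assms(3)] assms(1,2) _ _ assms(4)])
    (use assms B.submod_sub[OF assms(1)] in \<open>auto simp: lslice_pt subset_iff functionalD B.submod_smult\<close>)

lemma rslice_tensor_sub: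
  assumes "submodule V k A" "W \<subseteq> carrier B" "f \<in> functional k B" "t \<in> tensor_sub k A B V W"
  shows "rslice k A f t \<in> V"
  by (rule tensor_sub_linear[OF A.k_algebra_axioms rslice_linear[OF assms(3)] assms(1) _ assms(2) _ assms(4)])
    (use assms A.submod_sub[OF assms(1)] in \<open>auto simp: rslice_pt subset_iff functionalD A.submod_smult\<close>)

lemma swap_tensor_sub:
  assumes "V \<subseteq> carrier A" "W \<subseteq> carrier B" "t \<in> tensor_sub k A B V W"
  shows "tensor_swap k A B t \<in> tensor_sub k B A W V"
proof -
  interpret S: tensor_pair k B A by (rule swap_pair)
  show ?thesis
    by (rule tensor_sub_linear[OF S.T_k_algebra swap_linear S.tensor_sub_submodule assms(1,2) _ assms(3)])
      (use assms in \<open>auto simp: swap_pt subset_iff S.tensor_sub_pt\<close>)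
qed

lemma tensor_sub_mult:
  assumes "V \<subseteq> carrier A" "W \<subseteq> carrier B" "V' \<subseteq> carrier A" "W' \<subseteq> carrier B"
    and "M \<subseteq> carrier A" "N' \<subseteq> carrier B"
    and "\<And>x y. \<lbrakk>x \<in> V; y \<in> V'\<rbrakk> \<Longrightarrow> x \<otimes>\<^bsub>A\<^esub> y \<in> M" "\<And>x y. \<lbrakk>x \<in> W; y \<in> W'\<rbrakk> \<Longrightarrow> x \<otimes>\<^bsub>B\<^esub> y \<in> N'"
    and s: "s \<in> tensor_sub k A B V W" and t: "t \<in> tensor_sub k A B V' W'"
  shows "s \<otimes>\<^bsub>T\<^esub> t \<in> tensor_sub k A B M N'"
proof -
  note M = tensor_sub_submodule[OF assms(5,6)] and sc = tensor_sub_closed[OF assms(1,2)]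
    and tc = tensor_sub_closed[OF assms(3,4)]
  have r: "(\<lambda>t. x \<otimes>\<^bsub>T\<^esub> t) \<in> linear_map k T T" if "x \<in> carrier T" for x
    using that by (intro linear_mapI) (simp_all add: T.A.r_distr T.smult_mult_right)
  have l: "(\<lambda>x. x \<otimes>\<^bsub>T\<^esub> t) \<in> linear_map k T T"
    using tc[OF t] by (intro linear_mapI) (simp_all add: T.A.l_distr T.smult_mult_left)
  have "pt v w \<otimes>\<^bsub>T\<^esub> t \<in> tensor_sub k A B M N'" if vw: "v \<in> V" "w \<in> W" for v w
  proof (rule tensor_sub_linear[OF T_k_algebra r M assms(3,4) _ t])
    show "pt v w \<in> carrier T" using vw assms by (intro pt_closed) auto
    fix v' w' assume v': "v' \<in> V'" "w' \<in> W'"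
    have "pt v w \<otimes>\<^bsub>T\<^esub> pt v' w' = pt (v \<otimes>\<^bsub>A\<^esub> v') (w \<otimes>\<^bsub>B\<^esub> w')"
      using vw v' assms(1-4) by (intro pt_mult) auto
    then show "pt v w \<otimes>\<^bsub>T\<^esub> pt v' w' \<in> tensor_sub k A B M N'"
      using tensor_sub_pt assms(7,8) vw v' by simp
  qed
  then show ?thesis
    by (rule tensor_sub_linear[OF T_k_algebra l M assms(1,2) _ s])
qed

section \<open>Tensors as finite sums of pure tensors with independent first components\<close>

lemma tsum_closed: "set l \<subseteq> carrier A \<times> carrier B \<Longrightarrow> tsum k A B l \<in> carrier T"
  by (induction l) auto

lemma tsum_append:
  "set (l @ l') \<subseteq> carrier A \<times> carrier B \<Longrightarrow> tsum k A B (l @ l') = tsum k A B l \<oplus>\<^bsub>T\<^esub> tsum k A B l'"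
  by (induction l) (auto simp: tsum_closed T.V.M.a_assoc)

lemma ex_tsum:
  assumes "t \<in> carrier T" obtains l where "set l \<subseteq> carrier A \<times> carrier B" "t = tsum k A B l"
proof -
  have "\<exists>l. set l \<subseteq> carrier A \<times> carrier B \<and> t = tsum k A B l"
    using assms
  proof (induction rule: tensor_induct)
    case (pure a b)
    then show ?case by (intro exI[of _ "[(a, b)]"]) auto
  next
    case (add s t)
    then obtain l l' where "set l \<subseteq> carrier A \<times> carrier B" "s = tsum k A B l"
      "set l' \<subseteq> carrier A \<times> carrier B" "t = tsum k A B l'" by blast
    then show ?case by (intro exI[of _ "l @ l'"]) (auto simp: tsum_append)
  qed
  then show ?thesis using that by blast
qed

text \<open>If \<open>a\<close> is a combination of first components already present, then
  \<open>a \<otimes> b\<close> can be distributed over the existing terms by changing second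
  components only.\<close>

lemma tsum_absorb:
  assumes l: "set l \<subseteq> carrier A \<times> carrier B" and a: "a \<in> lspan k A (fst ` set l)" and b: "b \<in> carrier B"
  shows "\<exists>l'. set l' \<subseteq> carrier A \<times> carrier B \<and> map fst l' = map fst l
    \<and> tsum k A B l' = pt a b \<oplus>\<^bsub>T\<^esub> tsum k A B l"
proof -
  \<comment> \<open>The claim is quantified over all \<open>b\<close> and all lists with the same
    first components: in the additive case it is applied twice, the second time to the list produced
    by the first application.\<close>
  define Q where "Q a \<longleftrightarrow> (\<forall>b\<in>carrier B. \<forall>m. set m \<subseteq> carrier A \<times> carrier B \<and> map fst m = map fst l \<longrightarrow>
    (\<exists>l'. set l' \<subseteq> carrier A \<times> carrier B \<and> map fst l' = map fst l
    \<and> tsum k A B l' = pt a b \<oplus>\<^bsub>T\<^esub> tsum k A B m))" for a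
  have sub: "fst ` set l \<subseteq> carrier A" using l by auto
  have "Q a"
  proof (rule A.lspan_induct[OF a sub, of Q])
    show "Q \<zero>\<^bsub>A\<^esub>" using tsum_closed by (auto simp: Q_def)
  next
    fix x assume x: "x \<in> fst ` set l"
    show "Q x" unfolding Q_def
    proof (intro ballI allI impI)
      fix b m assume b: "b \<in> carrier B" and m: "set m \<subseteq> carrier A \<times> carrier B \<and> map fst m = map fst l"
      then have "x \<in> set (map fst m)" using x by simp
      then obtain y where "(x, y) \<in> set m" by auto
      then obtain us vs where uv: "m = us @ (x, y) # vs" by (auto simp: in_set_conv_decomp)
      have c: "x \<in> carrier A" "y \<in> carrier B" "set us \<subseteq> carrier A \<times> carrier B" "set vs \<subseteq> carrier A \<times> carrier B"
        using m uv by auto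
      have "tsum k A B (us @ (x, b \<oplus>\<^bsub>B\<^esub> y) # vs) = pt x b \<oplus>\<^bsub>T\<^esub> tsum k A B m"
        using c b by (simp add: uv tsum_append tsum_closed pt_add_right T.V.M.a_ac)
      then show "\<exists>l'. set l' \<subseteq> carrier A \<times> carrier B \<and> map fst l' = map fst l
        \<and> tsum k A B l' = pt x b \<oplus>\<^bsub>T\<^esub> tsum k A B m"
        using m c b uv by (intro exI[of _ "us @ (x, b \<oplus>\<^bsub>B\<^esub> y) # vs"]) auto
    qed
  next
    fix x y assume xy: "x \<in> carrier A" "y \<in> carrier A" "Q x" "Q y"
    show "Q (x \<oplus>\<^bsub>A\<^esub> y)" unfolding Q_def
    proof (intro ballI allI impI)
      fix b m assume b: "b \<in> carrier B" and m: "set m \<subseteq> carrier A \<times> carrier B \<and> map fst m = map fst l"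
      obtain l1 where l1: "set l1 \<subseteq> carrier A \<times> carrier B \<and> map fst l1 = map fst l"
        "tsum k A B l1 = pt y b \<oplus>\<^bsub>T\<^esub> tsum k A B m" using xy(4) b m unfolding Q_def by blast
      obtain l2 where l2: "set l2 \<subseteq> carrier A \<times> carrier B \<and> map fst l2 = map fst l"
        "tsum k A B l2 = pt x b \<oplus>\<^bsub>T\<^esub> tsum k A B l1" using xy(3) b l1(1) unfolding Q_def by blast
      have "tsum k A B l2 = pt (x \<oplus>\<^bsub>A\<^esub> y) b \<oplus>\<^bsub>T\<^esub> tsum k A B m"
        using l2 l1 xy b m by (simp add: pt_add_left tsum_closed T.V.M.a_assoc)
      then show "\<exists>l'. set l' \<subseteq> carrier A \<times> carrier B \<and> map fst l' = map fst l
        \<and> tsum k A B l' = pt (x \<oplus>\<^bsub>A\<^esub> y) b \<oplus>\<^bsub>T\<^esub> tsum k A B m" using l2(1) by blast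
    qed
  next
    fix c x assume cx: "c \<in> carrier k" "x \<in> carrier A" "Q x"
    show "Q (c \<odot>\<^bsub>A\<^esub> x)" unfolding Q_def
    proof (intro ballI allI impI)
      fix b m assume b: "b \<in> carrier B" and m: "set m \<subseteq> carrier A \<times> carrier B \<and> map fst m = map fst l"
      have "c \<odot>\<^bsub>B\<^esub> b \<in> carrier B" using cx b by simp
      moreover have "pt (c \<odot>\<^bsub>A\<^esub> x) b = pt x (c \<odot>\<^bsub>B\<^esub> b)" using cx b by (simp add: pt_smult_left pt_smult_right)
      ultimately show "\<exists>l'. set l' \<subseteq> carrier A \<times> carrier B \<and> map fst l' = map fst l
        \<and> tsum k A B l' = pt (c \<odot>\<^bsub>A\<^esub> x) b \<oplus>\<^bsub>T\<^esub> tsum k A B m"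
        using cx(3) m unfolding Q_def by metis
    qed
  qed
  then show ?thesis using l b unfolding Q_def by blast
qed

text \<open>A term whose first component depends on the later ones is absorbed by them; every other
  term is kept. First components are only dropped, never altered, and \<open>slices_both\<close>
  relies on this.\<close>

lemma tsum_indep:
  assumes "set l \<subseteq> carrier A \<times> carrier B"
  shows "\<exists>l'. set l' \<subseteq> carrier A \<times> carrier B \<and> fst ` set l' \<subseteq> fst ` set l \<and> indep k A (map fst l')
    \<and> tsum k A B l' = tsum k A B l"
  using assms
proof (induction l)
  case Nil
  then show ?case by (intro exI[of _ "[]"]) auto
next
  case (Cons p l)
  obtain a b where p: "p = (a, b)" by (cases p)
  obtain m where m: "set m \<subseteq> carrier A \<times> carrier B" "fst ` set m \<subseteq> fst ` set l" "indep k A (map fst m)"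
    "tsum k A B m = tsum k A B l" using Cons by auto
  show ?case
  proof (cases "a \<in> lspan k A (fst ` set m)")
    case True
    obtain m' where m': "set m' \<subseteq> carrier A \<times> carrier B" "map fst m' = map fst m"
      "tsum k A B m' = pt a b \<oplus>\<^bsub>T\<^esub> tsum k A B m"
      using tsum_absorb[OF m(1) True, of b] Cons.prems p by auto
    have "fst ` set m' = fst ` set m" using m'(2) by (metis list.set_map)
    then show ?thesis using m m' p by (intro exI[of _ m']) auto
  next
    case False
    then show ?thesis using m p Cons.prems by (intro exI[of _ "(a, b) # m"]) auto
  qed
qed

text \<open>A functional that is \<open>1\<close> on the first vector and kills the span of the
  others slices out the second component of the head, which therefore lies in \<open>W\<close>.
  Removing the head changes every slice by an element of \<open>W\<close>, and the tail follows by
  induction.\<close>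

lemma indep_slices:
  assumes "set l \<subseteq> carrier A \<times> carrier B" "indep k A (map fst l)" "submodule W k B"
    and "\<And>f. f \<in> functional k A \<Longrightarrow> lslice k B f (tsum k A B l) \<in> W"
  shows "snd ` set l \<subseteq> W"
  using assms(1,2,4)
proof (induction l)
  case (Cons p l)
  obtain a b where p: "p = (a, b)" by (cases p)
  have c: "a \<in> carrier A" "b \<in> carrier B" "set l \<subseteq> carrier A \<times> carrier B" using Cons.prems p by auto
  note tc = tsum_closed[OF c(3)]
  have sub: "fst ` set l \<subseteq> carrier A" using c by auto
  have "a \<notin> lspan k A (fst ` set l)" using Cons.prems p by simp
  then obtain f where f: "f \<in> functional k A" "\<And>x. x \<in> lspan k A (fst ` set l) \<Longrightarrow> f x = \<zero>\<^bsub>k\<^esub>" "f a = \<one>\<^bsub>k\<^esub>"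
    using A.ex_functional[OF A.lspan_submodule[OF sub] c(1)] by blast
  have "lslice k B f (tsum k A B m) = \<zero>\<^bsub>B\<^esub>" if "set m \<subseteq> set l" for m
    using that
  proof (induction m)
    case Nil
    then show ?case using linear_map_zero[OF T_k_algebra B.k_algebra_axioms lslice_linear[OF f(1)]] by simp
  next
    case (Cons q m)
    obtain x y where q: "q = (x, y)" by (cases q)
    have xy: "x \<in> carrier A" "y \<in> carrier B" "set m \<subseteq> carrier A \<times> carrier B" "x \<in> fst ` set l"
      using Cons.prems c q by force+
    have "f x = \<zero>\<^bsub>k\<^esub>" using f(2) hull_inc[OF xy(4)] by metis
    then show ?case using q xy Cons tsum_closed[OF xy(3)]
      by (simp add: linear_mapD[OF lslice_linear[OF f(1)]] lslice_pt f(1))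
  qed
  then have "lslice k B f (tsum k A B (p # l)) = b"
    using p c tc f(3) by (simp add: linear_mapD[OF lslice_linear[OF f(1)]] lslice_pt f(1))
  then have b: "b \<in> W" using Cons.prems(3)[OF f(1)] by simp
  have "lslice k B g (tsum k A B l) \<in> W" if g: "g \<in> functional k A" for g
  proof (rule B.submod_add_cancel[OF assms(3)])
    show "g a \<odot>\<^bsub>B\<^esub> b \<in> W" using B.submod_smult[OF assms(3)] b g c by (simp add: functionalD)
    show "lslice k B g (tsum k A B l) \<in> carrier B" using linear_mapD(1)[OF lslice_linear[OF g] tc] .
    show "g a \<odot>\<^bsub>B\<^esub> b \<oplus>\<^bsub>B\<^esub> lslice k B g (tsum k A B l) \<in> W"
      using Cons.prems(3)[OF g] p c tc by (simp add: linear_mapD[OF lslice_linear[OF g]] lslice_pt g)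
  qed
  then show ?case using Cons b c p by auto
qed auto

lemma tsum_tensor_sub:
  assumes "V \<subseteq> carrier A" "W \<subseteq> carrier B" "set l \<subseteq> V \<times> W"
  shows "tsum k A B l \<in> tensor_sub k A B V W"
  using assms(3)
  by (induction l) (use T.submod[OF tensor_sub_submodule[OF assms(1,2)]] in \<open>auto simp: tensor_sub_pt\<close>)

text \<open>Once a tensor is written with independent first components, its left slices control the
  second components one by one.\<close>

lemma slices_lsub:
  assumes "t \<in> carrier T" "submodule W k B" "\<And>f. f \<in> functional k A \<Longrightarrow> lslice k B f t \<in> W"
  shows "\<exists>l. set l \<subseteq> carrier A \<times> W \<and> t = tsum k A B l"
proof -
  obtain l where l: "set l \<subseteq> carrier A \<times> carrier B" "t = tsum k A B l" using ex_tsum[OF assms(1)] by blast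
  obtain m where m: "set m \<subseteq> carrier A \<times> carrier B" "indep k A (map fst m)" "tsum k A B m = t"
    using tsum_indep[OF l(1)] l(2) by auto
  have "snd ` set m \<subseteq> W" by (rule indep_slices[OF m(1,2) assms(2)]) (simp add: m assms)
  then have "set m \<subseteq> carrier A \<times> W" using m(1) by force
  then show ?thesis using m(3) by blast
qed

lemma slices_zero:
  assumes "t \<in> carrier T" "\<And>f. f \<in> functional k A \<Longrightarrow> lslice k B f t = \<zero>\<^bsub>B\<^esub>"
  shows "t = \<zero>\<^bsub>T\<^esub>"
proof -
  obtain l where l: "set l \<subseteq> carrier A \<times> {\<zero>\<^bsub>B\<^esub>}" "t = tsum k A B l"
    using slices_lsub[OF assms(1) B.submodule_zero] assms(2) by (metis singletonI)
  have "tsum k A B l = \<zero>\<^bsub>T\<^esub>" using l(1) by (induction l) auto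
  then show ?thesis using l by simp
qed

lemma slices_eqI:
  assumes "s \<in> carrier T" "t \<in> carrier T" "\<And>f. f \<in> functional k A \<Longrightarrow> lslice k B f s = lslice k B f t"
  shows "s = t"
proof -
  have "s \<ominus>\<^bsub>T\<^esub> t = \<zero>\<^bsub>T\<^esub>"
  proof (rule slices_zero)
    fix f assume f: "f \<in> functional k A"
    note lin = lslice_linear[OF f]
    have "lslice k B f (s \<ominus>\<^bsub>T\<^esub> t) = lslice k B f s \<ominus>\<^bsub>B\<^esub> lslice k B f t"
      by (rule linear_map_diff[OF T_k_algebra B.k_algebra_axioms lin assms(1,2)])
    then show "lslice k B f (s \<ominus>\<^bsub>T\<^esub> t) = \<zero>\<^bsub>B\<^esub>"
      using assms(3)[OF f] linear_mapD(1)[OF lin assms(2)] by (simp add: a_minus_def B.V.M.r_neg)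
  qed (use assms in simp)
  then show ?thesis using assms by simp
qed

text \<open>Over a field, \<open>A \<otimes> W\<close> and \<open>V \<otimes> B\<close> intersect in
  \<open>V \<otimes> W\<close>. The left slices put the second components into \<open>W\<close>.
  After the flip these are thinned out to independent ones, still in \<open>W\<close>, and the right
  slices put the other components into \<open>V\<close>.\<close>

lemma slices_both:
  assumes "t \<in> carrier T" "submodule V k A" "submodule W k B"
    and "\<And>f. f \<in> functional k A \<Longrightarrow> lslice k B f t \<in> W"
    and "\<And>f. f \<in> functional k B \<Longrightarrow> rslice k A f t \<in> V"
  shows "t \<in> tensor_sub k A B V W"
proof -
  interpret S: tensor_pair k B A by (rule swap_pair)
  note Vs = A.submod_sub[OF assms(2)] and Ws = B.submod_sub[OF assms(3)]
  obtain l where l: "set l \<subseteq> carrier A \<times> W" "t = tsum k A B l"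
    using slices_lsub[OF assms(1,3,4)] by blast
  define m where "m = map (\<lambda>(a, b). (b, a)) l"
  have "tensor_swap k A B (tsum k A B l) = tsum k B A (map (\<lambda>(a, b). (b, a)) l)"
    using l(1)
  proof (induction l)
    case Nil
    then show ?case using linear_map_zero[OF T_k_algebra S.T_k_algebra swap_linear] by simp
  next
    case (Cons p l)
    obtain a b where p: "p = (a, b)" by (cases p)
    have "set l \<subseteq> carrier A \<times> carrier B" using Cons.prems Ws by auto
    then show ?case using Cons p Ws by (simp add: linear_mapD[OF swap_linear] swap_pt tsum_closed)
  qed
  then have sw: "tensor_swap k A B t = tsum k B A m" by (simp add: l(2) m_def)
  have m: "set m \<subseteq> carrier B \<times> carrier A" "fst ` set m \<subseteq> W" using l(1) Ws by (auto simp: m_def)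
  obtain m' where m': "set m' \<subseteq> carrier B \<times> carrier A" "fst ` set m' \<subseteq> fst ` set m"
    "indep k B (map fst m')" "tsum k B A m' = tsum k B A m" using S.tsum_indep[OF m(1)] by blast
  have "snd ` set m' \<subseteq> V"
    by (rule S.indep_slices[OF m'(1,3) assms(2)])
      (use assms(1,5) in \<open>simp add: m'(4) sw[symmetric] lslice_swap\<close>)
  then have "set m' \<subseteq> W \<times> V" using m'(2) m(2) by force
  then have "tensor_swap k A B t \<in> tensor_sub k B A W V"
    unfolding sw m'(4)[symmetric] by (intro S.tsum_tensor_sub) (use Vs Ws in auto)
  then have "tensor_swap k B A (tensor_swap k A B t) \<in> tensor_sub k A B V W"
    by (intro S.swap_tensor_sub) (use Vs Ws in auto)
  then show ?thesis using swap_swap[OF assms(1)] by simp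
qed

lemma lslice_mult_one:
  assumes "f \<in> functional k A" "t \<in> carrier T" "b \<in> carrier B"
  shows "lslice k B f (t \<otimes>\<^bsub>T\<^esub> pt \<one>\<^bsub>A\<^esub> b) = lslice k B f t \<otimes>\<^bsub>B\<^esub> b"
    and "lslice k B f (pt \<one>\<^bsub>A\<^esub> b \<otimes>\<^bsub>T\<^esub> t) = b \<otimes>\<^bsub>B\<^esub> lslice k B f t"
proof -
  note s = linear_mapD[OF lslice_linear[OF assms(1)]] lslice_pt[OF assms(1)] pt_mult functionalD[OF assms(1)]
  show "lslice k B f (t \<otimes>\<^bsub>T\<^esub> pt \<one>\<^bsub>A\<^esub> b) = lslice k B f t \<otimes>\<^bsub>B\<^esub> b"
    using assms(2) by (induction rule: tensor_induct)
      (use assms(3) in \<open>simp_all add: s T.A.l_distr B.A.l_distr B.smult_mult_left\<close>)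
  show "lslice k B f (pt \<one>\<^bsub>A\<^esub> b \<otimes>\<^bsub>T\<^esub> t) = b \<otimes>\<^bsub>B\<^esub> lslice k B f t"
    using assms(2) by (induction rule: tensor_induct)
      (use assms(3) in \<open>simp_all add: s T.A.r_distr B.A.r_distr B.smult_mult_right\<close>)
qed

lemma rslice_mult_one:
  assumes "f \<in> functional k B" "t \<in> carrier T" "a \<in> carrier A"
  shows "rslice k A f (t \<otimes>\<^bsub>T\<^esub> pt a \<one>\<^bsub>B\<^esub>) = rslice k A f t \<otimes>\<^bsub>A\<^esub> a"
    and "rslice k A f (pt a \<one>\<^bsub>B\<^esub> \<otimes>\<^bsub>T\<^esub> t) = a \<otimes>\<^bsub>A\<^esub> rslice k A f t"
proof -
  note s = linear_mapD[OF rslice_linear[OF assms(1)]] rslice_pt[OF assms(1)] pt_mult functionalD[OF assms(1)]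
  show "rslice k A f (t \<otimes>\<^bsub>T\<^esub> pt a \<one>\<^bsub>B\<^esub>) = rslice k A f t \<otimes>\<^bsub>A\<^esub> a"
    using assms(2) by (induction rule: tensor_induct)
      (use assms(3) in \<open>simp_all add: s T.A.l_distr A.A.l_distr A.smult_mult_left\<close>)
  show "rslice k A f (pt a \<one>\<^bsub>B\<^esub> \<otimes>\<^bsub>T\<^esub> t) = a \<otimes>\<^bsub>A\<^esub> rslice k A f t"
    using assms(2) by (induction rule: tensor_induct)
      (use assms(3) in \<open>simp_all add: s T.A.r_distr A.A.r_distr A.smult_mult_right\<close>)
qed

lemma rslice_hom:
  assumes f: "f \<in> functional k B" "f \<in> ring_hom B k" and "s \<in> carrier T" "t \<in> carrier T"
  shows "rslice k A f (s \<otimes>\<^bsub>T\<^esub> t) = rslice k A f s \<otimes>\<^bsub>A\<^esub> rslice k A f t"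
proof -
  note l = linear_mapD[OF rslice_linear[OF f(1)]] rslice_pt[OF f(1)] pt_mult functionalD[OF f(1)]
    ring_hom_mult[OF f(2)]
  show ?thesis using assms(3)
  proof (induction rule: tensor_induct)
    case (pure a b)
    show ?case using assms(4)
      by (induction rule: tensor_induct) (use pure in \<open>simp_all add: l T.A.r_distr A.A.r_distr
        A.smult_mult_left A.smult_mult_right A.V.smult_assoc1[symmetric] A.K.m_comm\<close>)
  next
    case (add s u)
    then show ?case using assms(4) by (simp add: l T.A.l_distr A.A.l_distr)
  qed
qed

end

section \<open>Tensor products of maps\<close>

lemma tensor_map_linear:
  assumes "tensor_pair k A B" "tensor_pair k A' B'" "f \<in> linear_map k A A'" "g \<in> linear_map k B B'"
  shows "tensor_map k A' B' f g \<in> linear_map k (tensor k A B) (tensor k A' B')"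
    and "\<lbrakk>a \<in> carrier A; b \<in> carrier B\<rbrakk>
      \<Longrightarrow> tensor_map k A' B' f g (pure_tensor k A B a b) = pure_tensor k A' B' (f a) (g b)"
proof -
  interpret P: tensor_pair k A B by fact
  interpret Q: tensor_pair k A' B' by fact
  note l = linear_mapD[OF assms(3)] linear_mapD[OF assms(4)]
  have b: "bilinear k A B (tensor k A' B') (\<lambda>x y. pure_tensor k A' B' (f x) (g y))"
    by (rule P.bilinearI[OF Q.T_k_algebra])
      (simp_all add: l Q.pt_add_left Q.pt_add_right Q.pt_smult_left Q.pt_smult_right)
  show "tensor_map k A' B' f g \<in> linear_map k (tensor k A B) (tensor k A' B')"
    unfolding tensor_map_def by (rule P.tensor_lift_linear[OF Q.T_k_algebra b])
  show "tensor_map k A' B' f g (pure_tensor k A B a b) = pure_tensor k A' B' (f a) (g b)"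
    if "a \<in> carrier A" "b \<in> carrier B"
    unfolding tensor_map_def by (rule P.tensor_lift_pt[OF Q.T_k_algebra b that])
qed

lemma tensor_map_mult:
  assumes "tensor_pair k A B" "tensor_pair k A' B'" "f \<in> linear_map k A A'" "g \<in> linear_map k B B'"
    and "f \<in> ring_hom A A'" "g \<in> ring_hom B B'"
  shows "tensor_map k A' B' f g \<in> ring_hom (tensor k A B) (tensor k A' B')"
proof -
  interpret P: tensor_pair k A B by fact
  interpret Q: tensor_pair k A' B' by fact
  note m = tensor_map_linear[OF assms(1-4)]
  note l = linear_mapD[OF m(1)] m(2) linear_mapD(1)[OF assms(3)] linear_mapD(1)[OF assms(4)]
    ring_hom_mult[OF assms(5)] ring_hom_mult[OF assms(6)] P.pt_mult Q.pt_mult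
  let ?m = "tensor_map k A' B' f g"
  show ?thesis
  proof (rule ring_hom_memI)
    fix s t assume s: "s \<in> carrier (tensor k A B)" and t: "t \<in> carrier (tensor k A B)"
    show "?m (s \<otimes>\<^bsub>tensor k A B\<^esub> t) = ?m s \<otimes>\<^bsub>tensor k A' B'\<^esub> ?m t" using s
    proof (induction rule: P.tensor_induct)
      case (pure a b)
      show ?case using t
        by (induction rule: P.tensor_induct) (use pure in \<open>simp_all add: l P.T.A.r_distr Q.T.A.r_distr\<close>)
    next
      case (add s u)
      then show ?case using t by (simp add: l P.T.A.l_distr Q.T.A.l_distr)
    qed
  qed (simp_all add: l P.T_one Q.T_one ring_hom_one[OF assms(5)] ring_hom_one[OF assms(6)])
qed

section \<open>Hopf algebras\<close>

text \<open>The inner lift is linear in the class \<open>s\<close> because it is a lift; its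
  linearity in \<open>c\<close> is checked on pure tensors and extended over \<open>s\<close> by
  induction. So the outer map is again the lift of a bilinear map.\<close>

lemma tensor_assoc:
  assumes A: "k_algebra k A" and B: "k_algebra k B" and C: "k_algebra k C"
  shows "tensor_assoc k A B C \<in> linear_map k (tensor k (tensor k A B) C) (tensor k A (tensor k B C))"
    and "\<lbrakk>a \<in> carrier A; b \<in> carrier B; c \<in> carrier C\<rbrakk> \<Longrightarrow>
      tensor_assoc k A B C (pure_tensor k (tensor k A B) C (pure_tensor k A B a b) c)
      = pure_tensor k A (tensor k B C) a (pure_tensor k B C b c)"
proof -
  interpret AB: tensor_pair k A B by (intro tensor_pair.intro A B)
  interpret BC: tensor_pair k B C by (intro tensor_pair.intro B C)
  interpret ABC: tensor_pair k "tensor k A B" C by (intro tensor_pair.intro AB.T_k_algebra C)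
  interpret A_BC: tensor_pair k A "tensor k B C" by (intro tensor_pair.intro A BC.T_k_algebra)
  let ?U = "tensor k A (tensor k B C)"
  let ?g = "\<lambda>s c. tensor_lift k ?U (\<lambda>a b. A_BC.pt a (BC.pt b c)) s"
  have bil: "bilinear k A B ?U (\<lambda>a b. A_BC.pt a (BC.pt b c))" if "c \<in> carrier C" for c
    by (rule AB.bilinearI[OF A_BC.T_k_algebra]) (use that in \<open>simp_all add: A_BC.pt_add_left A_BC.pt_add_right
      A_BC.pt_smult_left A_BC.pt_smult_right BC.pt_add_left BC.pt_smult_left\<close>)
  note lin = linear_mapD[OF AB.tensor_lift_linear[OF A_BC.T_k_algebra bil]]
  note lpt = AB.tensor_lift_pt[OF A_BC.T_k_algebra bil]
  have bil2: "bilinear k (tensor k A B) C ?U ?g"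
  proof (rule ABC.bilinearI[OF A_BC.T_k_algebra])
    fix s c c' assume s: "s \<in> carrier (tensor k A B)" and c: "c \<in> carrier C" "c' \<in> carrier C"
    show "?g s (c \<oplus>\<^bsub>C\<^esub> c') = ?g s c \<oplus>\<^bsub>?U\<^esub> ?g s c'"
      using s
    proof (induction rule: AB.tensor_induct)
      case (pure a b)
      then show ?case using c by (simp add: lpt BC.pt_add_right A_BC.pt_add_right)
    next
      case (add s t)
      then show ?case using c by (simp add: lin A_BC.T.V.M.a_ac)
    qed
  next
    fix d s c assume d: "d \<in> carrier k" and s: "s \<in> carrier (tensor k A B)" and c: "c \<in> carrier C"
    show "?g s (d \<odot>\<^bsub>C\<^esub> c) = d \<odot>\<^bsub>?U\<^esub> ?g s c"
      using s
    proof (induction rule: AB.tensor_induct)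
      case (pure a b)
      then show ?case using c d by (simp add: lpt BC.pt_smult_right A_BC.pt_smult_right)
    next
      case (add s t)
      then show ?case using c d by (simp add: lin A_BC.T.V.smult_r_distr)
    qed
  qed (simp_all add: lin)
  show "tensor_assoc k A B C \<in> linear_map k (tensor k (tensor k A B) C) ?U"
    unfolding tensor_assoc_def by (rule ABC.tensor_lift_linear[OF A_BC.T_k_algebra bil2])
  show "tensor_assoc k A B C (ABC.pt (AB.pt a b) c) = A_BC.pt a (BC.pt b c)"
    if "a \<in> carrier A" "b \<in> carrier B" "c \<in> carrier C"
    unfolding tensor_assoc_def using that
    by (simp add: ABC.tensor_lift_pt[OF A_BC.T_k_algebra bil2] lpt)
qed

sublocale hopf_algebra \<subseteq> TP: tensor_pair k H H
  by (intro tensor_pair.intro k_algebra_axioms)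

lemma (in k_algebra) mult_map_bilinear:
  assumes "g \<in> linear_map k A A"
  shows "bilinear k A A A (\<lambda>a b. g a \<otimes>\<^bsub>A\<^esub> b)" "bilinear k A A A (\<lambda>a b. a \<otimes>\<^bsub>A\<^esub> g b)"
proof -
  interpret P: tensor_pair k A A by (intro tensor_pair.intro k_algebra_axioms)
  note g = linear_mapD[OF assms]
  show "bilinear k A A A (\<lambda>a b. g a \<otimes>\<^bsub>A\<^esub> b)" "bilinear k A A A (\<lambda>a b. a \<otimes>\<^bsub>A\<^esub> g b)"
    by (rule P.bilinearI[OF k_algebra_axioms];
        simp add: g A.l_distr A.r_distr smult_mult_left smult_mult_right)+
qed

lemma (in k_algebra) subalgD:
  assumes "subalg k A C"
  shows "submodule C k A" "subring C A" "C \<subseteq> carrier A" "\<one>\<^bsub>A\<^esub> \<in> C"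
    and "\<lbrakk>x \<in> C; y \<in> C\<rbrakk> \<Longrightarrow> x \<otimes>\<^bsub>A\<^esub> y \<in> C"
    and "x \<in> C \<Longrightarrow> x \<in> carrier A"
  using assms subringE[of C A] by (auto simp: subalg_def)

section \<open>Slices of the comultiplication and sliced forms of coassociativity\<close>

context hopf_algebra
begin

abbreviation "HH \<equiv> tensor k H H"
abbreviation "tp \<equiv> pure_tensor k H H"
abbreviation "D \<equiv> comul H"
abbreviation "eps \<equiv> counit H"
abbreviation "S \<equiv> antipode H"
abbreviation "dual \<equiv> functional k H"
abbreviation "lsl \<equiv> lslice k H"
abbreviation "rsl \<equiv> rslice k H"
abbreviation "tsub \<equiv> tensor_sub k H H"

text \<open>In Sweedler's notation \<open>L f x\<close> is
  \<open>\<Sum> f(x\<^sub>1) x\<^sub>2\<close> and \<open>R f x\<close> is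
  \<open>\<Sum> x\<^sub>1 f(x\<^sub>2)\<close>: these are the two actions of the dual on
  \<open>H\<close>.\<close>

definition L :: "('a \<Rightarrow> 'k) \<Rightarrow> 'a \<Rightarrow> 'a" where "L f x = lsl f (D x)"
definition R :: "('a \<Rightarrow> 'k) \<Rightarrow> 'a \<Rightarrow> 'a" where "R f x = rsl f (D x)"

lemmas D = linear_mapD[OF comul_linear] ring_hom_mult[OF comul_hom] ring_hom_one[OF comul_hom]

lemma D_zero: "D \<zero>\<^bsub>H\<^esub> = \<zero>\<^bsub>HH\<^esub>"
  by (rule linear_map_zero[OF k_algebra_axioms TP.T_k_algebra comul_linear])

lemma eps_functional: "eps \<in> dual"
  using counit_linear ring_hom_closed[OF counit_hom] ring_hom_add[OF counit_hom]
  by (simp add: functional_def)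

lemmas eps = functionalD[OF eps_functional] ring_hom_mult[OF counit_hom] ring_hom_one[OF counit_hom]
  functional_zero[OF eps_functional]

lemma one_not_zero: "\<one>\<^bsub>H\<^esub> \<noteq> \<zero>\<^bsub>H\<^esub>"
  using eps(5,6) K.one_not_zero by metis

lemma L_linear: "f \<in> dual \<Longrightarrow> L f \<in> linear_map k H H"
  unfolding L_def[abs_def] by (rule linear_map_comp[OF comul_linear TP.lslice_linear])

lemma R_linear: "f \<in> dual \<Longrightarrow> R f \<in> linear_map k H H"
  unfolding R_def[abs_def] by (rule linear_map_comp[OF comul_linear TP.rslice_linear])

lemma R_eps: "x \<in> carrier H \<Longrightarrow> R eps x = x"
  unfolding R_def by (rule counit_right)

interpretation HT: tensor_pair k H HH
  by (intro tensor_pair.intro k_algebra_axioms TP.T_k_algebra)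

interpretation TH: tensor_pair k HH H
  by (intro tensor_pair.intro k_algebra_axioms TP.T_k_algebra)

text \<open>Coassociativity is an identity in a triple tensor product. A linear map \<open>M\<close>
  into \<open>H \<otimes> H\<close> turns it into an identity between linear images of
  \<open>D x\<close>; \<open>F\<close> and \<open>G\<close> name the two outcomes. Slicing the
  first, second or third factor yields the three lemmas that follow.\<close>

lemma coassoc_sliced:
  assumes M: "M \<in> linear_map k (tensor k H HH) HH"
    and F: "F \<in> linear_map k HH HH" and G: "G \<in> linear_map k HH HH"
    and F_pt: "\<And>a c t. \<lbrakk>a \<in> carrier H; c \<in> carrier H\<rbrakk> \<Longrightarrow>
      M (tensor_assoc k H H H (TH.pt (D a) c)) = F (tp a c)"
    and G_pt: "\<And>a b. \<lbrakk>a \<in> carrier H; b \<in> carrier H\<rbrakk> \<Longrightarrow> M (HT.pt a (D b)) = G (tp a b)"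
    and x: "x \<in> carrier H"
  shows "F (D x) = G (D x)"
proof -
  note as = tensor_assoc[OF k_algebra_axioms k_algebra_axioms k_algebra_axioms]
  note m1 = tensor_map_linear[OF TP.tensor_pair_axioms TH.tensor_pair_axioms comul_linear linear_map_id]
  note m2 = tensor_map_linear[OF TP.tensor_pair_axioms HT.tensor_pair_axioms linear_map_id comul_linear]
  have Dx: "D x \<in> carrier HH" using x by (simp add: D)
  have "F (D x) = M (tensor_assoc k H H H (tensor_map k HH H D id (D x)))"
    by (rule TP.tensor_ext[OF F linear_map_comp[OF m1(1) linear_map_comp[OF as(1) M]] Dx])
      (simp add: m1(2) F_pt)
  also have "\<dots> = M (tensor_map k H HH id D (D x))" by (simp add: coassoc x)
  also have "\<dots> = G (D x)"
    by (rule TP.tensor_ext[OF linear_map_comp[OF m2(1) M] G Dx]) (simp add: m2(2) G_pt)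
  finally show ?thesis .
qed

text \<open>Here \<open>f\<close> is applied to the first of the three factors; both sides are
  \<open>\<Sum> f(x\<^sub>1) x\<^sub>2 \<otimes> x\<^sub>3\<close>.\<close>

lemma coassoc_left:
  assumes f: "f \<in> dual" and x: "x \<in> carrier H"
  shows "D (L f x) = tensor_map k H H (L f) id (D x)"
  unfolding L_def[of f x]
proof (rule coassoc_sliced[symmetric])
  note as = tensor_assoc[OF k_algebra_axioms k_algebra_axioms k_algebra_axioms]
  note m = tensor_map_linear[OF TP.tensor_pair_axioms TP.tensor_pair_axioms L_linear[OF f] linear_map_id]
  note l = TP.lslice_linear[OF f] and hl = HT.lslice_linear[OF f]
  show "lslice k HH f \<in> linear_map k (tensor k H HH) HH" by (rule hl)
  show "tensor_map k H H (L f) id \<in> linear_map k HH HH" by (rule m(1))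
  show "(\<lambda>t. D (lsl f t)) \<in> linear_map k HH HH" by (rule linear_map_comp[OF l comul_linear])
  fix a c assume a: "a \<in> carrier H" and c: "c \<in> carrier H"
  have "lslice k HH f (tensor_assoc k H H H (TH.pt t c)) = tp (lsl f t) c" if "t \<in> carrier HH" for t
    using that by (induction rule: TP.tensor_induct) (use c f in
      \<open>simp_all add: TH.pt_add_left as linear_mapD[OF as(1)] linear_mapD[OF hl] linear_mapD[OF l]
        HT.lslice_pt TP.lslice_pt TP.pt_add_left TP.pt_smult_left functionalD\<close>)
  then show "lslice k HH f (tensor_assoc k H H H (TH.pt (D a) c)) = tensor_map k H H (L f) id (tp a c)"
    using a c by (simp add: m(2) L_def D)
next
  fix a b assume "a \<in> carrier H" "b \<in> carrier H"
  then show "lslice k HH f (HT.pt a (D b)) = D (lsl f (tp a b))"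
    using f by (simp add: HT.lslice_pt TP.lslice_pt D functionalD)
qed (rule x)

text \<open>Here \<open>f\<close> is applied to the second factor; both sides are
  \<open>\<Sum> x\<^sub>1 f(x\<^sub>2) \<otimes> x\<^sub>3\<close>.\<close>

lemma coassoc_middle:
  assumes f: "f \<in> dual" and x: "x \<in> carrier H"
  shows "tensor_map k H H (R f) id (D x) = tensor_map k H H id (L f) (D x)"
proof (rule coassoc_sliced)
  note as = tensor_assoc[OF k_algebra_axioms k_algebra_axioms k_algebra_axioms]
  note m = tensor_map_linear[OF TP.tensor_pair_axioms TP.tensor_pair_axioms R_linear[OF f] linear_map_id]
  note m' = tensor_map_linear[OF TP.tensor_pair_axioms TP.tensor_pair_axioms linear_map_id L_linear[OF f]]
  define M where "M = tensor_map k H H id (lsl f)"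
  note M = tensor_map_linear[OF HT.tensor_pair_axioms TP.tensor_pair_axioms linear_map_id TP.lslice_linear[OF f],
      folded M_def, unfolded id_apply]
  note r = TP.rslice_linear[OF f]
  show "M \<in> linear_map k (tensor k H HH) HH" by (rule M(1))
  show "tensor_map k H H (R f) id \<in> linear_map k HH HH" by (rule m(1))
  show "tensor_map k H H id (L f) \<in> linear_map k HH HH" by (rule m'(1))
  fix a c assume a: "a \<in> carrier H" and c: "c \<in> carrier H"
  have "M (tensor_assoc k H H H (TH.pt t c)) = tp (rsl f t) c"
    if "t \<in> carrier HH" for t
    using that by (induction rule: TP.tensor_induct) (use c f in
      \<open>simp_all add: TH.pt_add_left as linear_mapD[OF as(1)] linear_mapD[OF M(1)] M(2) linear_mapD[OF r]
        TP.lslice_pt TP.rslice_pt TP.pt_add_left TP.pt_smult_left TP.pt_smult_right functionalD\<close>)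
  then show "M (tensor_assoc k H H H (TH.pt (D a) c))
    = tensor_map k H H (R f) id (tp a c)"
    using a c by (simp add: m(2) R_def D)
  show "M (HT.pt a (D c)) = tensor_map k H H id (L f) (tp a c)"
    using a c by (simp add: M(2) m'(2) D L_def)
qed (rule x)

text \<open>Here \<open>f\<close> is applied to the third factor; both sides are
  \<open>\<Sum> x\<^sub>1 \<otimes> x\<^sub>2 f(x\<^sub>3)\<close>.\<close>

lemma coassoc_right:
  assumes f: "f \<in> dual" and x: "x \<in> carrier H"
  shows "D (R f x) = tensor_map k H H id (R f) (D x)"
  unfolding R_def[of f x]
proof (rule coassoc_sliced)
  note as = tensor_assoc[OF k_algebra_axioms k_algebra_axioms k_algebra_axioms]
  note m' = tensor_map_linear[OF TP.tensor_pair_axioms TP.tensor_pair_axioms linear_map_id R_linear[OF f]]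
  define M where "M = tensor_map k H H id (rsl f)"
  note M = tensor_map_linear[OF HT.tensor_pair_axioms TP.tensor_pair_axioms linear_map_id TP.rslice_linear[OF f],
      folded M_def, unfolded id_apply]
  note r = TP.rslice_linear[OF f]
  show "M \<in> linear_map k (tensor k H HH) HH" by (rule M(1))
  show "(\<lambda>t. D (rsl f t)) \<in> linear_map k HH HH" by (rule linear_map_comp[OF r comul_linear])
  show "tensor_map k H H id (R f) \<in> linear_map k HH HH" by (rule m'(1))
  fix a c assume a: "a \<in> carrier H" and c: "c \<in> carrier H"
  have "M (tensor_assoc k H H H (TH.pt t c)) = f c \<odot>\<^bsub>HH\<^esub> t"
    if "t \<in> carrier HH" for t
    using that by (induction rule: TP.tensor_induct) (use c f in
      \<open>simp_all add: TH.pt_add_left as linear_mapD[OF as(1)] linear_mapD[OF M(1)] M(2)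
        TP.rslice_pt TP.pt_smult_right functionalD TP.T.V.smult_r_distr\<close>)
  then show "M (tensor_assoc k H H H (TH.pt (D a) c)) = D (rsl f (tp a c))"
    using a c f by (simp add: D TP.rslice_pt functionalD)
  show "M (HT.pt a (D c)) = tensor_map k H H id (R f) (tp a c)"
    using a c by (simp add: M(2) m'(2) D R_def)
qed (rule x)

abbreviation "mulS \<equiv> tensor_lift k H (\<lambda>a b. S a \<otimes>\<^bsub>H\<^esub> b)"
abbreviation "mulS' \<equiv> tensor_lift k H (\<lambda>a b. a \<otimes>\<^bsub>H\<^esub> S b)"

lemmas S = linear_mapD[OF antipode_linear]

lemmas mulS_bilinear = mult_map_bilinear(1)[OF antipode_linear]
lemmas mulS'_bilinear = mult_map_bilinear(2)[OF antipode_linear]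
lemmas mulS_linear = TP.tensor_lift_linear[OF k_algebra_axioms mulS_bilinear]
lemmas mulS'_linear = TP.tensor_lift_linear[OF k_algebra_axioms mulS'_bilinear]
lemmas mulS_tp = TP.tensor_lift_pt[OF k_algebra_axioms mulS_bilinear]
lemmas mulS'_tp = TP.tensor_lift_pt[OF k_algebra_axioms mulS'_bilinear]

lemma mulS_mult:
  assumes "t \<in> carrier HH" "b \<in> carrier H"
  shows "mulS (t \<otimes>\<^bsub>HH\<^esub> tp \<one>\<^bsub>H\<^esub> b) = mulS t \<otimes>\<^bsub>H\<^esub> b"
  using assms(1) by (induction rule: TP.tensor_induct)
    (use assms(2) in \<open>simp_all add: linear_mapD[OF mulS_linear] mulS_tp TP.pt_mult TP.T.A.l_distr
      A.l_distr S A.m_assoc\<close>)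

section \<open>Hopf subalgebras and right coideals\<close>

lemma hopf_subD:
  assumes "hopf_subalgebra k H C"
  shows "subalg k H C" "x \<in> C \<Longrightarrow> D x \<in> tsub C C" "x \<in> C \<Longrightarrow> S x \<in> C"
    and "\<lbrakk>x \<in> C; f \<in> dual\<rbrakk> \<Longrightarrow> L f x \<in> C" "\<lbrakk>x \<in> C; f \<in> dual\<rbrakk> \<Longrightarrow> R f x \<in> C"
proof -
  show 1: "subalg k H C" "x \<in> C \<Longrightarrow> D x \<in> tsub C C" "x \<in> C \<Longrightarrow> S x \<in> C"
    using assms by (auto simp: hopf_subalgebra_def)
  note s = subalgD[OF 1(1)]
  show "\<lbrakk>x \<in> C; f \<in> dual\<rbrakk> \<Longrightarrow> L f x \<in> C" "\<lbrakk>x \<in> C; f \<in> dual\<rbrakk> \<Longrightarrow> R f x \<in> C"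
    unfolding L_def R_def
    using TP.lslice_tensor_sub[OF s(1,3) _ 1(2)] TP.rslice_tensor_sub[OF s(1,3) _ 1(2)] by blast+
qed

lemma hopf_subI:
  assumes "subalg k H C" "\<And>x. x \<in> C \<Longrightarrow> S x \<in> C"
    and "\<And>x f. \<lbrakk>x \<in> C; f \<in> dual\<rbrakk> \<Longrightarrow> L f x \<in> C" "\<And>x f. \<lbrakk>x \<in> C; f \<in> dual\<rbrakk> \<Longrightarrow> R f x \<in> C"
  shows "hopf_subalgebra k H C"
proof -
  note s = subalgD[OF assms(1)]
  have "D x \<in> tsub C C" if "x \<in> C" for x
    by (rule TP.slices_both[OF _ s(1) s(1)])
      (use that assms(3,4) s(6) in \<open>auto simp: D L_def R_def\<close>)
  then show ?thesis unfolding hopf_subalgebra_def using assms by auto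
qed

lemma subalg_Int: "\<lbrakk>subalg k H B; subalg k H C\<rbrakk> \<Longrightarrow> subalg k H (B \<inter> C)"
  unfolding subalg_def using A.subring_inter submodule_Int by auto

lemma hopf_sub_Int:
  assumes "hopf_subalgebra k H B" "hopf_subalgebra k H C"
  shows "hopf_subalgebra k H (B \<inter> C)"
  by (rule hopf_subI[OF subalg_Int]) (use hopf_subD[OF assms(1)] hopf_subD[OF assms(2)] in auto)

lemma k_inverse:
  assumes "c \<in> carrier k" "c \<noteq> \<zero>\<^bsub>k\<^esub>"
  shows "inv\<^bsub>k\<^esub> c \<in> carrier k" "inv\<^bsub>k\<^esub> c \<otimes>\<^bsub>k\<^esub> c = \<one>\<^bsub>k\<^esub>"
  using assms K.field_Units by (auto intro: K.Units_inv_closed K.Units_l_inv)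

lemma submod_smultD:
  assumes "submodule N k H" "c \<in> carrier k" "c \<noteq> \<zero>\<^bsub>k\<^esub>" "x \<in> carrier H" "c \<odot>\<^bsub>H\<^esub> x \<in> N"
  shows "x \<in> N"
proof -
  note i = k_inverse[OF assms(2,3)]
  have "x = inv\<^bsub>k\<^esub> c \<odot>\<^bsub>H\<^esub> (c \<odot>\<^bsub>H\<^esub> x)" using i assms by (simp add: V.smult_assoc1[symmetric])
  then show ?thesis using submod_smult[OF assms(1) i(1) assms(5)] by simp
qed

text \<open>From \<open>\<epsilon>(r) 1 = \<Sum> r\<^sub>1 S(r\<^sub>2)\<close>: the counit of an element of a right ideal and right coideal lies
  in it, and the counit cannot vanish on a nonzero right coideal.\<close>

lemma right_coideal_one:
  assumes C: "hopf_subalgebra k H C" and J: "submodule J k H" "J \<subseteq> C" "r \<in> J" "r \<noteq> \<zero>\<^bsub>H\<^esub>"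
    and JR: "\<And>r f. \<lbrakk>r \<in> J; f \<in> dual\<rbrakk> \<Longrightarrow> R f r \<in> J"
    and JC: "\<And>r c. \<lbrakk>r \<in> J; c \<in> C\<rbrakk> \<Longrightarrow> r \<otimes>\<^bsub>H\<^esub> c \<in> J"
  shows "\<one>\<^bsub>H\<^esub> \<in> J"
proof -
  note c = hopf_subD[OF C] and s = subalgD[OF hopf_subD(1)[OF C]]
  have Js: "J \<subseteq> carrier H" using submod_sub[OF J(1)] by blast
  \<comment> \<open>The coideal condition puts the right slices of \<open>D x\<close> into
    \<open>J\<close>, and \<open>C\<close> contains the left ones; so \<open>D x\<close> lies in
    \<open>J \<otimes> C\<close>. Multiplying out \<open>id \<otimes> S\<close> then stays in the
    right ideal \<open>J\<close>.\<close>
  have Dr: "D x \<in> tsub J C" if "x \<in> J" for x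
    by (rule TP.slices_both[OF _ J(1) s(1)])
      (use that JR Js J(2) c(4) in \<open>auto simp: D L_def R_def\<close>)
  have eps_J: "eps x \<odot>\<^bsub>H\<^esub> \<one>\<^bsub>H\<^esub> \<in> J" if "x \<in> J" for x
  proof -
    have "mulS' (D x) \<in> J"
      by (rule TP.tensor_sub_linear[OF k_algebra_axioms mulS'_linear J(1) Js s(3) _ Dr[OF that]])
        (use Js s(3) JC c(3) in \<open>auto simp: mulS'_tp subset_iff\<close>)
    then show ?thesis using antipode_right that Js by auto
  qed
  \<comment> \<open>Otherwise \<open>r\<close>, which is the left counit slice of \<open>D r\<close>
    in \<open>J \<otimes> C\<close>, would be zero.\<close>
  have "\<exists>x\<in>J. eps x \<noteq> \<zero>\<^bsub>k\<^esub>"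
  proof (rule ccontr)
    assume "\<not> (\<exists>x\<in>J. eps x \<noteq> \<zero>\<^bsub>k\<^esub>)"
    then have "lsl eps (D r) \<in> {\<zero>\<^bsub>H\<^esub>}"
      by (intro TP.tensor_sub_linear[OF k_algebra_axioms TP.lslice_linear[OF eps_functional]
            submodule_zero Js s(3) _ Dr[OF J(3)]])
        (use Js s(3) in \<open>auto simp: TP.lslice_pt eps_functional subset_iff\<close>)
    then show False using counit_left J(3,4) Js by auto
  qed
  then obtain x where x: "x \<in> J" "eps x \<noteq> \<zero>\<^bsub>k\<^esub>" by blast
  show ?thesis
    by (rule submod_smultD[OF J(1) _ x(2) _ eps_J[OF x(1)]]) (use x Js eps in auto)
qed

end

section \<open>Skew polynomial filtrations\<close>

text \<open>\<open>fil H R x n\<close> consists of the left polynomials in \<open>x\<close> of degree less than \<open>n\<close>.\<close>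

fun fil :: "('a, 'm) ring_scheme \<Rightarrow> 'a set \<Rightarrow> 'a \<Rightarrow> nat \<Rightarrow> 'a set" where
  "fil H R x 0 = {\<zero>\<^bsub>H\<^esub>}"
| "fil H R x (Suc n) = {r \<otimes>\<^bsub>H\<^esub> x [^]\<^bsub>H\<^esub> n \<oplus>\<^bsub>H\<^esub> u | r u. r \<in> R \<and> u \<in> fil H R x n}"

lemma fil_cong:
  assumes "\<zero>\<^bsub>H\<^esub> = \<zero>\<^bsub>H'\<^esub>" "add H = add H'" "monoid.mult H = monoid.mult H'" "\<one>\<^bsub>H\<^esub> = \<one>\<^bsub>H'\<^esub>"
  shows "fil H R x n = fil H' R x n"
proof -
  have "x [^]\<^bsub>H\<^esub> m = x [^]\<^bsub>H'\<^esub> m" for m :: nat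
    by (simp add: nat_pow_def assms)
  then show ?thesis by (induction n) (auto simp: assms)
qed

declare fil.simps(2) [simp del]

lemma ex1_eq: "\<lbrakk>\<exists>!c. P c; P a; P b\<rbrakk> \<Longrightarrow> a = b"
  by blast

text \<open>Only the commutation rule is required: the image of \<open>x\<close> in a quotient
  satisfies it before anything is known about the independence of its powers.\<close>

locale skew_gen = ring H for H (structure) +
  fixes Q x
  assumes Q: "subring Q H" and x [simp]: "x \<in> carrier H"
    and comm: "r \<in> Q \<Longrightarrow> \<exists>s\<in>Q. \<exists>u\<in>Q. x \<otimes> r = s \<otimes> x \<oplus> u"
begin

abbreviation "F n \<equiv> fil H Q x n"

lemmas Q_sub = subringE(1)[OF Q, THEN subsetD]
lemmas Qs = subringE(2,3,5-7)[OF Q]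

lemma Q_zero: "\<zero> \<in> Q"
  by (rule subringE(2)[OF Q])

lemma Q_diff: "\<lbrakk>r \<in> Q; s \<in> Q\<rbrakk> \<Longrightarrow> r \<ominus> s \<in> Q"
  by (simp add: a_minus_def Qs)

lemma FI: "\<lbrakk>r \<in> Q; u \<in> F n\<rbrakk> \<Longrightarrow> r \<otimes> x [^] n \<oplus> u \<in> F (Suc n)"
  by (auto simp: fil.simps(2))

lemma F_closed: "u \<in> F n \<Longrightarrow> u \<in> carrier H"
  by (induction n arbitrary: u) (auto simp: Q_sub fil.simps(2))

lemma F_zero: "\<zero> \<in> F n"
proof (induction n)
  case (Suc n)
  then show ?case using FI[OF Q_zero Suc] by simp
qed simp

lemma F_Suc: "u \<in> F n \<Longrightarrow> u \<in> F (Suc n)"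
  using FI[OF Q_zero, of u n] by (simp add: F_closed)

lemma F_mono: "\<lbrakk>m \<le> n; u \<in> F m\<rbrakk> \<Longrightarrow> u \<in> F n"
  by (induction rule: dec_induct) (use F_Suc in blast)+

lemma F_add: "\<lbrakk>u \<in> F n; v \<in> F n\<rbrakk> \<Longrightarrow> u \<oplus> v \<in> F n"
proof (induction n arbitrary: u v)
  case (Suc n)
  then obtain r a s b where *: "r \<in> Q" "a \<in> F n" "u = r \<otimes> x [^] n \<oplus> a" "s \<in> Q" "b \<in> F n"
    "v = s \<otimes> x [^] n \<oplus> b" by (auto simp: fil.simps(2))
  then have "u \<oplus> v = (r \<oplus> s) \<otimes> x [^] n \<oplus> (a \<oplus> b)"
    by (simp add: Q_sub F_closed l_distr a_ac)
  then show ?case using FI[of "r \<oplus> s" "a \<oplus> b"] * Suc.IH Qs by simp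
qed simp

lemma F_lmult: "\<lbrakk>r \<in> Q; u \<in> F n\<rbrakk> \<Longrightarrow> r \<otimes> u \<in> F n"
proof (induction n arbitrary: u)
  case (Suc n)
  then obtain s a where *: "s \<in> Q" "a \<in> F n" "u = s \<otimes> x [^] n \<oplus> a" by (auto simp: fil.simps(2))
  then have "r \<otimes> u = (r \<otimes> s) \<otimes> x [^] n \<oplus> r \<otimes> a"
    using Suc.prems by (simp add: Q_sub F_closed r_distr m_assoc)
  then show ?case using FI[of "r \<otimes> s" "r \<otimes> a"] * Suc Qs by simp
qed (simp add: Q_sub)

lemma F_neg: "u \<in> F n \<Longrightarrow> \<ominus> u \<in> F n"
  using F_lmult[of "\<ominus> \<one>" u n] Qs by (simp add: F_closed l_minus)

lemma F_diff: "\<lbrakk>u \<in> F n; v \<in> F n\<rbrakk> \<Longrightarrow> u \<ominus> v \<in> F n"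
  by (simp add: a_minus_def F_add F_neg)

lemma F_cancel: "\<lbrakk>u \<in> F n; v \<in> carrier H; v \<oplus> u \<in> F n\<rbrakk> \<Longrightarrow> v \<in> F n"
proof -
  assume *: "u \<in> F n" "v \<in> carrier H" "v \<oplus> u \<in> F n"
  have "v = (v \<oplus> u) \<ominus> u" using *(2) F_closed[OF *(1)] by algebra
  then show "v \<in> F n" using F_diff[OF *(3,1)] by simp
qed

lemma F_one: "F (Suc 0) = Q"
  by (auto simp: Q_sub fil.simps(2)) (use Q_sub in force)

lemma F_term: "r \<in> Q \<Longrightarrow> r \<otimes> x [^] n \<in> F (Suc n)"
  using FI[OF _ F_zero, of r n] by (simp add: Q_sub)

lemma F_pow: "x [^] n \<in> F (Suc n)"
  using F_term[OF Qs(2), of n] by simp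

text \<open>A relation, since without freeness the coefficient is not determined by
  \<open>a\<close>; it may also be zero. Even zero may have a nonzero coefficient, which is
  exploited in \<open>quotient_free\<close>.\<close>

definition lead :: "nat \<Rightarrow> 'a \<Rightarrow> 'a \<Rightarrow> bool" where
  "lead n a r \<longleftrightarrow> r \<in> Q \<and> (\<exists>u\<in>F n. a = r \<otimes> x [^] n \<oplus> u)"

lemma leadI: "\<lbrakk>r \<in> Q; u \<in> F n; a = r \<otimes> x [^] n \<oplus> u\<rbrakk> \<Longrightarrow> lead n a r"
  by (auto simp: lead_def)

lemma F_Suc_lead: "a \<in> F (Suc n) \<longleftrightarrow> (\<exists>r. lead n a r)"
  by (auto simp: lead_def fil.simps(2))

lemma lead_closed: "lead n a r \<Longrightarrow> a \<in> carrier H"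
  using F_Suc_lead F_closed by blast

lemma lead_add_F: "\<lbrakk>lead n a r; u \<in> F n\<rbrakk> \<Longrightarrow> lead n (a \<oplus> u) r"
  unfolding lead_def by (auto simp: Q_sub F_closed a_assoc intro!: F_add)

lemma lead_lmult: "\<lbrakk>s \<in> Q; lead n a r\<rbrakk> \<Longrightarrow> lead n (s \<otimes> a) (s \<otimes> r)"
  unfolding lead_def by (auto simp: Q_sub F_closed r_distr m_assoc Qs intro!: F_lmult)

lemma x_lead:
  assumes "r \<in> Q" "s \<in> Q" "w \<in> Q" "x \<otimes> r = s \<otimes> x \<oplus> w" and u: "u \<in> F (Suc n)" "u = r \<otimes> x [^] n \<oplus> v" "v \<in> F n"
    and v: "x \<otimes> v \<in> F (Suc n)"
  shows "lead (Suc n) (x \<otimes> u) s"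
proof (rule leadI)
  have p: "x [^] Suc n = x \<otimes> x [^] n" by (rule nat_pow_Suc2) simp
  have "x \<otimes> u = (x \<otimes> r) \<otimes> x [^] n \<oplus> x \<otimes> v"
    unfolding assms(6) using Q_sub[OF assms(1)] F_closed[OF assms(7)] by (simp add: r_distr m_assoc)
  also have "\<dots> = s \<otimes> x [^] Suc n \<oplus> (w \<otimes> x [^] n \<oplus> x \<otimes> v)"
    unfolding assms(4) p using assms(2,3) F_closed[OF assms(7)]
    by (simp add: Q_sub l_distr m_assoc a_assoc)
  finally show "x \<otimes> u = s \<otimes> x [^] Suc n \<oplus> (w \<otimes> x [^] n \<oplus> x \<otimes> v)" .
  show "w \<otimes> x [^] n \<oplus> x \<otimes> v \<in> F (Suc n)" using F_add[OF F_term v] assms by simp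
qed (use assms in simp)

lemma x_F: "u \<in> F n \<Longrightarrow> x \<otimes> u \<in> F (Suc n)"
proof (induction n arbitrary: u)
  case (Suc n)
  then obtain r v where *: "r \<in> Q" "v \<in> F n" "u = r \<otimes> x [^] n \<oplus> v" by (auto simp: fil.simps(2))
  obtain s w where sw: "s \<in> Q" "w \<in> Q" "x \<otimes> r = s \<otimes> x \<oplus> w" using comm[OF *(1)] by blast
  have "lead (Suc n) (x \<otimes> u) s" by (rule x_lead[OF *(1) sw Suc.prems *(3,2) Suc.IH[OF *(2)]])
  then show ?case using F_Suc_lead by blast
qed (use F_zero[of "Suc 0"] in simp)

text \<open>The last conjunct transports nonvanishing of coefficients when \<open>x r\<close> determines \<open>r\<close>.\<close>

lemma pow_comm:
  assumes "r \<in> Q"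
  shows "\<exists>s. lead n (x [^] n \<otimes> r) s \<and> ((\<forall>r\<in>Q. x \<otimes> r \<in> Q \<longrightarrow> r = \<zero>) \<longrightarrow> r \<noteq> \<zero> \<longrightarrow> s \<noteq> \<zero>)"
proof (induction n)
  case 0
  show ?case by (intro exI[of _ r] conjI leadI[of _ \<zero>]) (use assms Q_sub in auto)
next
  case (Suc n)
  then obtain s where s: "lead n (x [^] n \<otimes> r) s"
    "(\<forall>r\<in>Q. x \<otimes> r \<in> Q \<longrightarrow> r = \<zero>) \<Longrightarrow> r \<noteq> \<zero> \<Longrightarrow> s \<noteq> \<zero>" by blast
  then obtain u where u: "s \<in> Q" "u \<in> F n" "x [^] n \<otimes> r = s \<otimes> x [^] n \<oplus> u" by (auto simp: lead_def)
  obtain t w where t: "t \<in> Q" "w \<in> Q" "x \<otimes> s = t \<otimes> x \<oplus> w" using comm[OF u(1)] by blast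
  have p: "x [^] Suc n \<otimes> r = x \<otimes> (x [^] n \<otimes> r)"
    using nat_pow_Suc2[OF x, of n] assms by (simp add: m_assoc Q_sub del: nat_pow_Suc)
  have "lead (Suc n) (x [^] Suc n \<otimes> r) t"
    unfolding p by (rule x_lead[OF u(1) t _ u(3,2) x_F[OF u(2)]]) (use s(1) F_Suc_lead in blast)
  moreover have "t \<noteq> \<zero>" if "\<forall>r\<in>Q. x \<otimes> r \<in> Q \<longrightarrow> r = \<zero>" "r \<noteq> \<zero>"
  proof
    assume "t = \<zero>"
    then have "x \<otimes> s \<in> Q" using t Q_sub by simp
    then show False using that s(2) u(1) by blast
  qed
  ultimately show ?case by blast
qed

lemma F_pow_mult: "u \<in> F n \<Longrightarrow> u \<otimes> x [^] m \<in> F (n + m)"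
proof (induction n arbitrary: u)
  case (Suc n)
  then obtain r v where *: "r \<in> Q" "v \<in> F n" "u = r \<otimes> x [^] n \<oplus> v" by (auto simp: fil.simps(2))
  then have "u \<otimes> x [^] m = r \<otimes> x [^] (n + m) \<oplus> v \<otimes> x [^] m"
    by (simp add: Q_sub F_closed l_distr m_assoc nat_pow_mult)
  then show ?case using FI[OF *(1) Suc.IH[OF *(2)]] by simp
qed (simp add: F_zero)

lemma pow_F: "v \<in> F n \<Longrightarrow> x [^] m \<otimes> v \<in> F (m + n)"
proof (induction m)
  case (Suc m)
  have "x [^] Suc m \<otimes> v = x \<otimes> (x [^] m \<otimes> v)"
    using nat_pow_Suc2[OF x, of m] Suc.prems by (simp add: m_assoc F_closed del: nat_pow_Suc)
  then show ?case using x_F[OF Suc.IH[OF Suc.prems]] by simp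
qed (simp add: F_closed)

text \<open>Degrees at most \<open>m - 1\<close> and \<open>n\<close> add up to at most
  \<open>m + n - 1\<close>; the successor on one side avoids the subtraction.\<close>

lemma F_mult_F: "\<lbrakk>u \<in> F m; v \<in> F (Suc n)\<rbrakk> \<Longrightarrow> u \<otimes> v \<in> F (m + n)"
proof (induction m arbitrary: u)
  case (Suc m)
  then obtain r w where *: "r \<in> Q" "w \<in> F m" "u = r \<otimes> x [^] m \<oplus> w" by (auto simp: fil.simps(2))
  have "u \<otimes> v = r \<otimes> (x [^] m \<otimes> v) \<oplus> w \<otimes> v"
    using * Suc.prems(2) by (simp add: Q_sub F_closed[of v] F_closed[of w] l_distr m_assoc)
  moreover have "r \<otimes> (x [^] m \<otimes> v) \<in> F (Suc m + n)"
    using F_lmult[OF *(1) pow_F[OF Suc.prems(2), of m]] by simp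
  moreover have "w \<otimes> v \<in> F (Suc m + n)" using Suc.IH[OF *(2) Suc.prems(2)] F_Suc by simp
  ultimately show ?case using F_add by simp
qed (simp add: F_closed[of v "Suc n"] F_zero)

text \<open>Moving \<open>x^m\<close> past \<open>s\<close> replaces \<open>s\<close> by its
  \<open>m\<close>-fold twist \<open>t\<close>, so the coefficient of the product is
  \<open>r t\<close>. When the twist is injective, \<open>t\<close> is nonzero along with
  \<open>s\<close>, and over a domain degrees add.\<close>

lemma lead_mult:
  assumes a: "lead m a r" and b: "lead n b s"
  shows "\<exists>t\<in>Q. lead (m + n) (a \<otimes> b) (r \<otimes> t) \<and> ((\<forall>r\<in>Q. x \<otimes> r \<in> Q \<longrightarrow> r = \<zero>) \<longrightarrow> s \<noteq> \<zero> \<longrightarrow> t \<noteq> \<zero>)"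
proof -
  obtain u where u: "r \<in> Q" "u \<in> F m" "a = r \<otimes> x [^] m \<oplus> u" using a by (auto simp: lead_def)
  obtain v where v: "s \<in> Q" "v \<in> F n" "b = s \<otimes> x [^] n \<oplus> v" using b by (auto simp: lead_def)
  obtain t where t: "lead m (x [^] m \<otimes> s) t" "(\<forall>r\<in>Q. x \<otimes> r \<in> Q \<longrightarrow> r = \<zero>) \<Longrightarrow> s \<noteq> \<zero> \<Longrightarrow> t \<noteq> \<zero>"
    using pow_comm[OF v(1)] by blast
  then obtain w where w: "t \<in> Q" "w \<in> F m" "x [^] m \<otimes> s = t \<otimes> x [^] m \<oplus> w" by (auto simp: lead_def)
  note c = Q_sub[OF u(1)] F_closed[OF u(2)] Q_sub[OF v(1)] F_closed[OF v(2)] Q_sub[OF w(1)] F_closed[OF w(2)]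
    lead_closed[OF b]
  define rest where "rest = r \<otimes> (w \<otimes> x [^] n) \<oplus> r \<otimes> (x [^] m \<otimes> v) \<oplus> u \<otimes> b"
  have "a \<otimes> b = r \<otimes> ((x [^] m \<otimes> s) \<otimes> x [^] n) \<oplus> r \<otimes> (x [^] m \<otimes> v) \<oplus> u \<otimes> b"
    using c by (simp add: u(3) l_distr) (simp add: v(3) r_distr m_assoc)
  also have "\<dots> = (r \<otimes> t) \<otimes> x [^] (m + n) \<oplus> rest"
    unfolding w(3) rest_def using c by (simp add: l_distr r_distr m_assoc nat_pow_mult a_assoc)
  finally have eq: "a \<otimes> b = (r \<otimes> t) \<otimes> x [^] (m + n) \<oplus> rest" .
  have "rest \<in> F (m + n)"
    unfolding rest_def using b F_Suc_lead F_lmult[OF u(1)] F_pow_mult[OF w(2)] pow_F[OF v(2)]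
    by (intro F_add F_mult_F[OF u(2)]) auto
  then have "lead (m + n) (a \<otimes> b) (r \<otimes> t)" using leadI eq u w Qs by blast
  then show ?thesis using t(2) w(1) by blast
qed

lemma ex_lead:
  assumes "a \<in> F n" "a \<noteq> \<zero>"
  shows "\<exists>m<n. \<exists>r. r \<noteq> \<zero> \<and> lead m a r"
  using assms
proof (induction n)
  case (Suc n)
  then obtain r where r: "lead n a r" using F_Suc_lead by blast
  show ?case
  proof (cases "r = \<zero>")
    case True
    then have "a \<in> F n" using r by (auto simp: lead_def F_closed)
    then show ?thesis using Suc by (meson less_Suc_eq)
  qed (use r in blast)
qed simp

lemma F_rmult: "\<lbrakk>u \<in> F n; r \<in> Q\<rbrakk> \<Longrightarrow> u \<otimes> r \<in> F n"
  using F_mult_F[of u n r 0] F_one by simp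

end

text \<open>\<open>free\<close> is the left linear independence of the powers of \<open>x\<close>.
  \<open>inj\<close> is the injectivity of the twist, phrased without naming the twist:
  \<open>x r\<close> lies in \<open>Q\<close> when its coefficient at \<open>x\<close>
  vanishes.\<close>

locale skew_free = skew_gen +
  assumes free: "\<lbrakk>r \<in> Q; r \<otimes> x [^] (n::nat) \<in> F n\<rbrakk> \<Longrightarrow> r = \<zero>"
    and inj: "\<lbrakk>r \<in> Q; x \<otimes> r \<in> Q\<rbrakk> \<Longrightarrow> r = \<zero>"
begin

lemma lead_F_zero: "\<lbrakk>lead n a r; a \<in> F n\<rbrakk> \<Longrightarrow> r = \<zero>"
  using F_cancel free Q_sub unfolding lead_def by (metis m_closed nat_pow_closed x)

lemma lead_unique: "\<lbrakk>lead n a r; lead n a s\<rbrakk> \<Longrightarrow> r = s"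
proof -
  assume *: "lead n a r" "lead n a s"
  then obtain u v where uv: "r \<in> Q" "u \<in> F n" "a = r \<otimes> x [^] n \<oplus> u" "s \<in> Q" "v \<in> F n"
    "a = s \<otimes> x [^] n \<oplus> v" by (auto simp: lead_def)
  note c = Q_sub[OF uv(1)] Q_sub[OF uv(4)] F_closed[OF uv(2)] F_closed[OF uv(5)] nat_pow_closed[OF x, of n]
  have "(r \<ominus> s) \<otimes> x [^] n = (r \<otimes> x [^] n \<oplus> u) \<ominus> (s \<otimes> x [^] n \<oplus> v) \<oplus> (v \<ominus> u)"
    using c by algebra
  also have "\<dots> = v \<ominus> u" using c uv(3,6) by (simp add: a_minus_def r_neg)
  finally have "r \<ominus> s = \<zero>" using free[OF Q_diff[OF uv(1,4)]] F_diff[OF uv(5,2)] by metis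
  then show "r = s" using c by simp
qed

lemma lead_mult_dom:
  assumes "lead m a r" "lead n b s" "r \<noteq> \<zero>" "s \<noteq> \<zero>"
    and dom: "\<And>r s. \<lbrakk>r \<in> Q; s \<in> Q; r \<otimes> s = \<zero>\<rbrakk> \<Longrightarrow> r = \<zero> \<or> s = \<zero>"
  shows "\<exists>t. t \<noteq> \<zero> \<and> lead (m + n) (a \<otimes> b) t"
  using lead_mult[OF assms(1,2)] assms(3,4) dom inj assms(1) unfolding lead_def[of m] by metis

lemma domain_fil:
  assumes dom: "\<And>r s. \<lbrakk>r \<in> Q; s \<in> Q; r \<otimes> s = \<zero>\<rbrakk> \<Longrightarrow> r = \<zero> \<or> s = \<zero>"
    and "a \<in> F m" "b \<in> F n" "a \<otimes> b = \<zero>"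
  shows "a = \<zero> \<or> b = \<zero>"
proof (rule ccontr)
  assume "\<not> ?thesis"
  then obtain m' n' r s where "r \<noteq> \<zero>" "lead m' a r" "s \<noteq> \<zero>" "lead n' b s"
    using ex_lead[OF assms(2)] ex_lead[OF assms(3)] by blast
  then obtain t where "t \<noteq> \<zero>" "lead (m' + n') (a \<otimes> b) t" using lead_mult_dom[OF _ _ _ _ dom] by blast
  then show False using lead_F_zero assms(4) F_zero by metis
qed

text \<open>Degrees add over a domain, and \<open>1\<close> has degree zero, so both factors have
  degree zero.\<close>

lemma left_inverse_fil:
  assumes dom: "\<And>r s. \<lbrakk>r \<in> Q; s \<in> Q; r \<otimes> s = \<zero>\<rbrakk> \<Longrightarrow> r = \<zero> \<or> s = \<zero>"
    and "\<one> \<noteq> \<zero>" "a \<in> F m" "b \<in> F n" "a \<otimes> b = \<one>"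
  shows "a \<in> Q" "b \<in> Q"
proof -
  have "a \<noteq> \<zero>" "b \<noteq> \<zero>" using assms F_closed[OF assms(3)] F_closed[OF assms(4)] by auto
  then obtain m' n' r s where *: "r \<noteq> \<zero>" "lead m' a r" "s \<noteq> \<zero>" "lead n' b s"
    using ex_lead[OF assms(3)] ex_lead[OF assms(4)] by blast
  then obtain t where t: "t \<noteq> \<zero>" "lead (m' + n') (a \<otimes> b) t" using lead_mult_dom[OF _ _ _ _ dom] by blast
  have "m' + n' = 0"
  proof (rule ccontr)
    assume "m' + n' \<noteq> 0"
    then have "\<one> \<in> F (m' + n')" using F_mono[of "Suc 0" "m' + n'" \<one>] F_one Qs by (simp add: Suc_leI)
    then show False using lead_F_zero t assms(5) by metis
  qed
  then show "a \<in> Q" "b \<in> Q" using *(2,4) F_Suc_lead F_one by force+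
qed

end

subsection \<open>Ore extensions\<close>

lemma (in k_algebra) subalg_k_algebra:
  assumes "subalg k A C" shows "k_algebra k (A\<lparr>carrier := C\<rparr>)"
proof -
  note s = subalgD[OF assms]
  have "module k (A\<lparr>carrier := C\<rparr>)"
    by (rule submodule.submodule_is_module[OF s(1) V.module_axioms])
  moreover have "ring (A\<lparr>carrier := C\<rparr>)" by (rule A.subring_is_ring[OF s(2)])
  ultimately show ?thesis
    unfolding k_algebra_def k_algebra_axioms_def
    using K.field_axioms s(6) smult_mult_left smult_mult_right by auto
qed

context k_algebra
begin

lemma finsum_fil:
  assumes "skew_gen A Q x" "\<And>i. c i \<in> Q"
  shows "(\<Oplus>\<^bsub>A\<^esub>i\<in>{..<n}. c i \<otimes>\<^bsub>A\<^esub> x [^]\<^bsub>A\<^esub> i) \<in> fil A Q x n"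
proof -
  interpret skew_gen A Q x by fact
  have "(\<Oplus>\<^bsub>A\<^esub>i\<in>{..<Suc n}. c i \<otimes>\<^bsub>A\<^esub> x [^]\<^bsub>A\<^esub> i) = c n \<otimes>\<^bsub>A\<^esub> x [^]\<^bsub>A\<^esub> n \<oplus>\<^bsub>A\<^esub> (\<Oplus>\<^bsub>A\<^esub>i\<in>{..<n}. c i \<otimes>\<^bsub>A\<^esub> x [^]\<^bsub>A\<^esub> i)" for n
    unfolding lessThan_Suc using Q_sub[OF assms(2)] by (subst V.M.finsum_insert) auto
  then show ?thesis by (induction n) (use assms(2) in \<open>simp_all add: FI\<close>)
qed

lemma fil_finsum:
  assumes "skew_gen A Q x" "h \<in> fil A Q x n"
  shows "\<exists>c. (\<forall>i. c i \<in> Q) \<and> (\<forall>i\<ge>n. c i = \<zero>\<^bsub>A\<^esub>) \<and> h = (\<Oplus>\<^bsub>A\<^esub>i\<in>{..<n}. c i \<otimes>\<^bsub>A\<^esub> x [^]\<^bsub>A\<^esub> i)"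
proof -
  interpret skew_gen A Q x by fact
  show ?thesis using assms(2)
  proof (induction n arbitrary: h)
    case 0
    then show ?case by (intro exI[of _ "\<lambda>i. \<zero>\<^bsub>A\<^esub>"]) (use Q_zero in auto)
  next
    case (Suc n)
    then obtain r u where ru: "r \<in> Q" "u \<in> fil A Q x n" "h = r \<otimes>\<^bsub>A\<^esub> x [^]\<^bsub>A\<^esub> n \<oplus>\<^bsub>A\<^esub> u" by (auto simp: fil.simps(2))
    obtain c where c: "\<forall>i. c i \<in> Q" "\<forall>i\<ge>n. c i = \<zero>\<^bsub>A\<^esub>" "u = (\<Oplus>\<^bsub>A\<^esub>i\<in>{..<n}. c i \<otimes>\<^bsub>A\<^esub> x [^]\<^bsub>A\<^esub> i)"
      using Suc.IH[OF ru(2)] by blast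
    have "(\<Oplus>\<^bsub>A\<^esub>i\<in>{..<Suc n}. (c(n := r)) i \<otimes>\<^bsub>A\<^esub> x [^]\<^bsub>A\<^esub> i)
      = r \<otimes>\<^bsub>A\<^esub> x [^]\<^bsub>A\<^esub> n \<oplus>\<^bsub>A\<^esub> (\<Oplus>\<^bsub>A\<^esub>i\<in>{..<n}. (c(n := r)) i \<otimes>\<^bsub>A\<^esub> x [^]\<^bsub>A\<^esub> i)"
      unfolding lessThan_Suc using c(1) ru(1) Q_sub by (subst V.M.finsum_insert) auto
    also have "(\<Oplus>\<^bsub>A\<^esub>i\<in>{..<n}. (c(n := r)) i \<otimes>\<^bsub>A\<^esub> x [^]\<^bsub>A\<^esub> i) = u"
      unfolding c(3) by (rule V.M.finsum_cong') (use c(1) Q_sub in auto)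
    finally have "h = (\<Oplus>\<^bsub>A\<^esub>i\<in>{..<Suc n}. (c(n := r)) i \<otimes>\<^bsub>A\<^esub> x [^]\<^bsub>A\<^esub> i)" using ru(3) by simp
    then show ?case using c ru by (intro exI[of _ "c(n := r)"]) auto
  qed
qed

lemma finsum_supp:
  fixes c :: "nat \<Rightarrow> 'a"
  assumes "x \<in> carrier A" "\<And>i. c i \<in> carrier A" "\<And>i. i \<ge> n \<Longrightarrow> c i = \<zero>\<^bsub>A\<^esub>"
  shows "(\<Oplus>\<^bsub>A\<^esub>i\<in>{i. c i \<noteq> \<zero>\<^bsub>A\<^esub>}. c i \<otimes>\<^bsub>A\<^esub> x [^]\<^bsub>A\<^esub> i) = (\<Oplus>\<^bsub>A\<^esub>i\<in>{..<n}. c i \<otimes>\<^bsub>A\<^esub> x [^]\<^bsub>A\<^esub> i)"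
proof (rule V.M.add.finprod_mono_neutral_cong_left)
  show "{i. c i \<noteq> \<zero>\<^bsub>A\<^esub>} \<subseteq> {..<n}"
  proof
    fix i assume "i \<in> {i. c i \<noteq> \<zero>\<^bsub>A\<^esub>}"
    then have "\<not> n \<le> i" using assms(3)[of i] by blast
    then show "i \<in> {..<n}" by simp
  qed
qed (use assms in auto)

text \<open>The automorphism \<sigma> and the derivation \<delta> do not appear, as both are
  recovered from the unique normal form of \<open>x r\<close>. The second conjunct is the
  surjectivity of \<sigma>.\<close>

definition ore_cond :: "'a set \<Rightarrow> 'a \<Rightarrow> bool" where
  "ore_cond Q x \<longleftrightarrow> skew_free A Q x \<and> (\<forall>s\<in>Q. \<exists>r\<in>Q. \<exists>u\<in>Q. x \<otimes>\<^bsub>A\<^esub> r = s \<otimes>\<^bsub>A\<^esub> x \<oplus>\<^bsub>A\<^esub> u)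
    \<and> carrier A = (\<Union>n. fil A Q x n)"

lemma ore_extensionD:
  assumes "ore_extension k A Q"
  shows "\<exists>x. ore_cond Q x"
proof -
  let ?Q = "A\<lparr>carrier := Q\<rparr>"
  have sub: "subalg k A Q" using assms by (simp add: ore_extension_def)
  obtain x \<sigma> \<delta> where x: "x \<in> carrier A" and \<sigma>: "\<sigma> \<in> algebra_auto k ?Q" and \<delta>: "\<delta> \<in> skew_derivation k ?Q \<sigma>"
    and rep: "\<And>h. h \<in> carrier A \<Longrightarrow> \<exists>!c. (\<forall>i::nat. c i \<in> Q) \<and> finite {i. c i \<noteq> \<zero>\<^bsub>A\<^esub>} \<and>
           h = (\<Oplus>\<^bsub>A\<^esub>i\<in>{i. c i \<noteq> \<zero>\<^bsub>A\<^esub>}. c i \<otimes>\<^bsub>A\<^esub> x [^]\<^bsub>A\<^esub> i)"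
    and comm0: "\<And>r. r \<in> Q \<Longrightarrow> x \<otimes>\<^bsub>A\<^esub> r = \<sigma> r \<otimes>\<^bsub>A\<^esub> x \<oplus>\<^bsub>A\<^esub> \<delta> r"
    using assms unfolding ore_extension_def by auto
  note s = subalgD[OF sub]
  have \<sigma>Q: "bij_betw \<sigma> Q Q" "\<And>r. r \<in> Q \<Longrightarrow> \<sigma> r \<in> Q"
    using \<sigma> by (auto simp: algebra_auto_def ring_iso_def bij_betw_def)
  have \<delta>Q: "r \<in> Q \<Longrightarrow> \<delta> r \<in> Q" for r
    using \<delta> by (auto simp: skew_derivation_def linear_map_def)
  have zQ: "\<zero>\<^bsub>A\<^esub> \<in> Q" by (rule submod_zero[OF s(1)])
  have "\<sigma> \<zero>\<^bsub>A\<^esub> = \<zero>\<^bsub>A\<^esub>"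
    using linear_map_zero[OF subalg_k_algebra[OF sub] subalg_k_algebra[OF sub], of \<sigma>] \<sigma>
    by (simp add: algebra_auto_def)
  then have \<sigma>0: "r = \<zero>\<^bsub>A\<^esub>" if "r \<in> Q" "\<sigma> r = \<zero>\<^bsub>A\<^esub>" for r
    using that \<sigma>Q(1) zQ unfolding bij_betw_def inj_on_def by metis
  have comm': "\<exists>s\<in>Q. \<exists>u\<in>Q. x \<otimes>\<^bsub>A\<^esub> r = s \<otimes>\<^bsub>A\<^esub> x \<oplus>\<^bsub>A\<^esub> u" if "r \<in> Q" for r
    using comm0[OF that] \<sigma>Q(2)[OF that] \<delta>Q[OF that] by blast
  interpret skew_gen A Q x
    by (intro skew_gen.intro skew_gen_axioms.intro A.ring_axioms s(2) x comm')
  have free: "r = \<zero>\<^bsub>A\<^esub>" if r: "r \<in> Q" "r \<otimes>\<^bsub>A\<^esub> x [^]\<^bsub>A\<^esub> n \<in> fil A Q x n" for r and n :: nat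
  proof -
    obtain c where c: "\<forall>i. c i \<in> Q" "\<forall>i\<ge>n. c i = \<zero>\<^bsub>A\<^esub>"
      "r \<otimes>\<^bsub>A\<^esub> x [^]\<^bsub>A\<^esub> n = (\<Oplus>\<^bsub>A\<^esub>i\<in>{..<n}. c i \<otimes>\<^bsub>A\<^esub> x [^]\<^bsub>A\<^esub> i)"
      using fil_finsum[OF skew_gen_axioms r(2)] by blast
    \<comment> \<open>A relation \<open>r x^n = \<Sum> c\<^sub>i x^i\<close> becomes a
      representation of zero with coefficient \<open>-r\<close> at \<open>n\<close>; comparison with
      the zero sequence gives \<open>r = 0\<close>.\<close>
    define d where "d = c(n := \<ominus>\<^bsub>A\<^esub> r)"
    have d: "d i \<in> Q" for i using c(1) r(1) Qs by (simp add: d_def)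
    have "(\<Oplus>\<^bsub>A\<^esub>i\<in>{..<Suc n}. d i \<otimes>\<^bsub>A\<^esub> x [^]\<^bsub>A\<^esub> i) = d n \<otimes>\<^bsub>A\<^esub> x [^]\<^bsub>A\<^esub> n \<oplus>\<^bsub>A\<^esub> (\<Oplus>\<^bsub>A\<^esub>i\<in>{..<n}. d i \<otimes>\<^bsub>A\<^esub> x [^]\<^bsub>A\<^esub> i)"
      unfolding lessThan_Suc using Q_sub[OF d] by (subst V.M.finsum_insert) auto
    also have "(\<Oplus>\<^bsub>A\<^esub>i\<in>{..<n}. d i \<otimes>\<^bsub>A\<^esub> x [^]\<^bsub>A\<^esub> i) = r \<otimes>\<^bsub>A\<^esub> x [^]\<^bsub>A\<^esub> n"
      unfolding c(3) by (rule V.M.finsum_cong') (use c(1) Q_sub in \<open>auto simp: d_def\<close>)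
    also have "d n \<otimes>\<^bsub>A\<^esub> x [^]\<^bsub>A\<^esub> n \<oplus>\<^bsub>A\<^esub> r \<otimes>\<^bsub>A\<^esub> x [^]\<^bsub>A\<^esub> n = \<zero>\<^bsub>A\<^esub>"
      using Q_sub[OF r(1)] by (simp add: d_def A.l_minus V.M.l_neg)
    finally have sum: "(\<Oplus>\<^bsub>A\<^esub>i\<in>{..<Suc n}. d i \<otimes>\<^bsub>A\<^esub> x [^]\<^bsub>A\<^esub> i) = \<zero>\<^bsub>A\<^esub>" .
    have dn: "d i = \<zero>\<^bsub>A\<^esub>" if "i \<ge> Suc n" for i using c(2) that by (simp add: d_def)
    have "(\<Oplus>\<^bsub>A\<^esub>i\<in>{i. d i \<noteq> \<zero>\<^bsub>A\<^esub>}. d i \<otimes>\<^bsub>A\<^esub> x [^]\<^bsub>A\<^esub> i) = \<zero>\<^bsub>A\<^esub>"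
      using finsum_supp[OF x Q_sub[OF d] dn] sum by simp
    moreover have "finite {i. d i \<noteq> \<zero>\<^bsub>A\<^esub>}"
      by (rule finite_subset[OF _ finite_lessThan[of "Suc n"]]) (use dn not_le in blast)
    ultimately have "d = (\<lambda>i. \<zero>\<^bsub>A\<^esub>)"
      using ex1_eq[OF rep[OF V.M.zero_closed], of d "\<lambda>i. \<zero>\<^bsub>A\<^esub>"] d zQ by simp
    then have "\<ominus>\<^bsub>A\<^esub> r = \<zero>\<^bsub>A\<^esub>" by (simp add: d_def fun_upd_def fun_eq_iff) metis
    then show ?thesis using V.M.r_neg[OF Q_sub[OF r(1)]] Q_sub[OF r(1)] by simp
  qed
  interpret skew_free A Q x
  proof
    fix r assume r: "r \<in> Q" "x \<otimes>\<^bsub>A\<^esub> r \<in> Q"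
    \<comment> \<open>\<open>x r = \<sigma>(r) x + \<delta>(r)\<close> lies in \<open>Q\<close> only
      if \<sigma>(r) vanishes, by freeness in degree one; and \<sigma> has zero kernel.\<close>
    have "lead 1 (x \<otimes>\<^bsub>A\<^esub> r) (\<sigma> r)"
      by (rule leadI[of _ "\<delta> r"]) (use \<sigma>Q \<delta>Q comm0 r F_one x in auto)
    then have "\<sigma> r \<otimes>\<^bsub>A\<^esub> x [^]\<^bsub>A\<^esub> (1::nat) \<in> fil A Q x 1"
      using F_cancel[of _ 1] r(2) F_one Q_sub x unfolding lead_def One_nat_def by (metis A.m_closed A.nat_pow_closed)
    then have "\<sigma> r = \<zero>\<^bsub>A\<^esub>" using free \<sigma>Q r by blast
    then show "r = \<zero>\<^bsub>A\<^esub>" using \<sigma>0 r by blast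
  qed (use free in blast)
  have "\<exists>r\<in>Q. \<exists>u\<in>Q. x \<otimes>\<^bsub>A\<^esub> r = s \<otimes>\<^bsub>A\<^esub> x \<oplus>\<^bsub>A\<^esub> u" if sQ: "s \<in> Q" for s
  proof -
    obtain r where "r \<in> Q" "s = \<sigma> r" using sQ \<sigma>Q(1) by (auto simp: bij_betw_def)
    then show ?thesis using comm0 \<delta>Q by blast
  qed
  moreover have "h \<in> (\<Union>n. fil A Q x n)" if h: "h \<in> carrier A" for h
  proof -
    obtain c where c: "\<forall>i::nat. c i \<in> Q" "finite {i. c i \<noteq> \<zero>\<^bsub>A\<^esub>}"
      "h = (\<Oplus>\<^bsub>A\<^esub>i\<in>{i. c i \<noteq> \<zero>\<^bsub>A\<^esub>}. c i \<otimes>\<^bsub>A\<^esub> x [^]\<^bsub>A\<^esub> i)" using rep[OF h] by blast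
    obtain n where n: "\<forall>i\<in>{i. c i \<noteq> \<zero>\<^bsub>A\<^esub>}. i < n" using c(2) finite_nat_set_iff_bounded by blast
    have "h = (\<Oplus>\<^bsub>A\<^esub>i\<in>{..<n}. c i \<otimes>\<^bsub>A\<^esub> x [^]\<^bsub>A\<^esub> i)"
      unfolding c(3) by (rule finsum_supp[OF x]) (use c(1) Q_sub n not_le in blast)+
    then show ?thesis using finsum_fil[OF skew_gen_axioms, of c n] c(1) by auto
  qed
  moreover have "(\<Union>n. fil A Q x n) \<subseteq> carrier A" using F_closed by blast
  ultimately have "ore_cond Q x" unfolding ore_cond_def using skew_free_axioms by blast
  then show ?thesis by blast
qed

lemma ore_extensionI:
  assumes oc: "ore_cond Q x" and sub: "subalg k A Q"
  shows "ore_extension k A Q"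
proof -
  let ?Q = "A\<lparr>carrier := Q\<rparr>"
  note s = subalgD[OF sub]
  interpret skew_free A Q x using oc by (simp add: ore_cond_def)
  have l1: "lead 1 (s \<otimes>\<^bsub>A\<^esub> x \<oplus>\<^bsub>A\<^esub> u) s" if "s \<in> Q" "u \<in> Q" for s u
    by (rule leadI[of _ u]) (use that F_one in auto)
  have uniq: "s = s'" if "s \<in> Q" "u \<in> Q" "s' \<in> Q" "u' \<in> Q"
    "s \<otimes>\<^bsub>A\<^esub> x \<oplus>\<^bsub>A\<^esub> u = s' \<otimes>\<^bsub>A\<^esub> x \<oplus>\<^bsub>A\<^esub> u'" for s u s' u'
    using lead_unique l1 that by metis
  \<comment> \<open>\<sigma> and \<delta> are read off from the normal form of \<open>x r\<close>,
    unique by freeness. Each law for them then amounts to exhibiting one normal form and applying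
    \<open>\<sigma>I\<close>.\<close>
  define \<sigma> where "\<sigma> r = (THE s. s \<in> Q \<and> (\<exists>u\<in>Q. x \<otimes>\<^bsub>A\<^esub> r = s \<otimes>\<^bsub>A\<^esub> x \<oplus>\<^bsub>A\<^esub> u))" for r
  define \<delta> where "\<delta> r = x \<otimes>\<^bsub>A\<^esub> r \<ominus>\<^bsub>A\<^esub> \<sigma> r \<otimes>\<^bsub>A\<^esub> x" for r
  have \<sigma>I: "\<sigma> r = s \<and> \<delta> r = u" if "r \<in> Q" "s \<in> Q" "u \<in> Q" "x \<otimes>\<^bsub>A\<^esub> r = s \<otimes>\<^bsub>A\<^esub> x \<oplus>\<^bsub>A\<^esub> u" for r s u
  proof -
    have "\<sigma> r = s" unfolding \<sigma>_def by (rule the_equality) (use that uniq in metis)+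
    moreover have "s \<otimes>\<^bsub>A\<^esub> x \<oplus>\<^bsub>A\<^esub> u \<ominus>\<^bsub>A\<^esub> s \<otimes>\<^bsub>A\<^esub> x = u"
      using that Q_sub by (simp add: a_minus_def V.M.a_ac V.M.r_neg1 V.M.r_neg2 V.M.r_neg)
    ultimately show ?thesis unfolding \<delta>_def that(4) by simp
  qed
  have \<sigma>\<delta>: "\<sigma> r \<in> Q \<and> \<delta> r \<in> Q \<and> x \<otimes>\<^bsub>A\<^esub> r = \<sigma> r \<otimes>\<^bsub>A\<^esub> x \<oplus>\<^bsub>A\<^esub> \<delta> r" if "r \<in> Q" for r
    using comm[OF that] \<sigma>I[OF that] by metis
  note sd = \<sigma>\<delta>[THEN conjunct1] \<sigma>\<delta>[THEN conjunct2, THEN conjunct1] \<sigma>\<delta>[THEN conjunct2, THEN conjunct2]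
  note c = Q_sub Q_sub[OF sd(1)] Q_sub[OF sd(2)]
  have add: "\<sigma> (r \<oplus>\<^bsub>A\<^esub> r') = \<sigma> r \<oplus>\<^bsub>A\<^esub> \<sigma> r' \<and> \<delta> (r \<oplus>\<^bsub>A\<^esub> r') = \<delta> r \<oplus>\<^bsub>A\<^esub> \<delta> r'" if r: "r \<in> Q" "r' \<in> Q" for r r'
    by (rule \<sigma>I) (use r Qs sd c in \<open>simp_all add: A.l_distr A.r_distr V.M.a_ac\<close>)
  have smult: "\<sigma> (a \<odot>\<^bsub>A\<^esub> r) = a \<odot>\<^bsub>A\<^esub> \<sigma> r \<and> \<delta> (a \<odot>\<^bsub>A\<^esub> r) = a \<odot>\<^bsub>A\<^esub> \<delta> r"
    if "a \<in> carrier k" "r \<in> Q" for a r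
    by (rule \<sigma>I) (use that sd c submod_smult[OF s(1)] in
      \<open>simp_all add: smult_mult_left smult_mult_right V.smult_r_distr\<close>)
  have mult: "\<sigma> (r \<otimes>\<^bsub>A\<^esub> r') = \<sigma> r \<otimes>\<^bsub>A\<^esub> \<sigma> r' \<and> \<delta> (r \<otimes>\<^bsub>A\<^esub> r') = \<delta> r \<otimes>\<^bsub>A\<^esub> r' \<oplus>\<^bsub>A\<^esub> \<sigma> r \<otimes>\<^bsub>A\<^esub> \<delta> r'"
    if r: "r \<in> Q" "r' \<in> Q" for r r'
  proof (rule \<sigma>I)
    have "x \<otimes>\<^bsub>A\<^esub> (r \<otimes>\<^bsub>A\<^esub> r') = (\<sigma> r \<otimes>\<^bsub>A\<^esub> x \<oplus>\<^bsub>A\<^esub> \<delta> r) \<otimes>\<^bsub>A\<^esub> r'"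
      using r c x by (simp add: A.m_assoc[symmetric] sd(3)[symmetric])
    also have "\<dots> = \<sigma> r \<otimes>\<^bsub>A\<^esub> (x \<otimes>\<^bsub>A\<^esub> r') \<oplus>\<^bsub>A\<^esub> \<delta> r \<otimes>\<^bsub>A\<^esub> r'"
      using r c x by (simp add: A.l_distr A.m_assoc)
    also have "\<dots> = \<sigma> r \<otimes>\<^bsub>A\<^esub> \<sigma> r' \<otimes>\<^bsub>A\<^esub> x \<oplus>\<^bsub>A\<^esub> (\<delta> r \<otimes>\<^bsub>A\<^esub> r' \<oplus>\<^bsub>A\<^esub> \<sigma> r \<otimes>\<^bsub>A\<^esub> \<delta> r')"
      using r c x by (simp add: sd(3) A.r_distr A.m_assoc V.M.a_ac)
    finally show "x \<otimes>\<^bsub>A\<^esub> (r \<otimes>\<^bsub>A\<^esub> r') = \<sigma> r \<otimes>\<^bsub>A\<^esub> \<sigma> r' \<otimes>\<^bsub>A\<^esub> x \<oplus>\<^bsub>A\<^esub> (\<delta> r \<otimes>\<^bsub>A\<^esub> r' \<oplus>\<^bsub>A\<^esub> \<sigma> r \<otimes>\<^bsub>A\<^esub> \<delta> r')" .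
  qed (use r Qs sd in auto)
  have one: "\<sigma> \<one>\<^bsub>A\<^esub> = \<one>\<^bsub>A\<^esub>"
    using \<sigma>I[of "\<one>\<^bsub>A\<^esub>" "\<one>\<^bsub>A\<^esub>" "\<zero>\<^bsub>A\<^esub>"] s(4) Q_zero by simp
  have "bij_betw \<sigma> Q Q"
    unfolding bij_betw_def
  proof
    show "inj_on \<sigma> Q"
    proof (rule inj_onI)
      fix r r' assume r: "r \<in> Q" "r' \<in> Q" "\<sigma> r = \<sigma> r'"
      \<comment> \<open>If \<open>r\<close> and \<open>r'\<close> have the same image under
        \<sigma>, the terms in \<open>x\<close> cancel in \<open>x (r - r')\<close>, which then lies
        in \<open>Q\<close>, and \<open>inj\<close> applies.\<close>
      have "x \<otimes>\<^bsub>A\<^esub> (r \<ominus>\<^bsub>A\<^esub> r') = x \<otimes>\<^bsub>A\<^esub> r \<ominus>\<^bsub>A\<^esub> x \<otimes>\<^bsub>A\<^esub> r'"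
        using r c x by (simp add: a_minus_def A.r_distr A.r_minus)
      also have "\<dots> = (\<sigma> r' \<otimes>\<^bsub>A\<^esub> x \<oplus>\<^bsub>A\<^esub> \<delta> r) \<ominus>\<^bsub>A\<^esub> (\<sigma> r' \<otimes>\<^bsub>A\<^esub> x \<oplus>\<^bsub>A\<^esub> \<delta> r')"
        using r by (simp add: sd(3))
      also have "\<dots> = \<delta> r \<ominus>\<^bsub>A\<^esub> \<delta> r'"
        using r c x by (simp add: a_minus_def V.M.minus_add V.M.a_ac V.M.r_neg V.M.r_neg1 V.M.r_neg2)
      finally have "r \<ominus>\<^bsub>A\<^esub> r' = \<zero>\<^bsub>A\<^esub>" using inj[OF Q_diff[OF r(1,2)]] Q_diff sd r by simp
      then show "r = r'" using r c by simp
    qed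
    show "\<sigma> ` Q = Q"
    proof
      show "Q \<subseteq> \<sigma> ` Q"
      proof
        fix s assume "s \<in> Q"
        then obtain r u where "r \<in> Q" "u \<in> Q" "x \<otimes>\<^bsub>A\<^esub> r = s \<otimes>\<^bsub>A\<^esub> x \<oplus>\<^bsub>A\<^esub> u"
          using oc unfolding ore_cond_def by blast
        then show "s \<in> \<sigma> ` Q" using \<sigma>I \<open>s \<in> Q\<close> by blast
      qed
    qed (use sd in auto)
  qed
  then have auto: "\<sigma> \<in> algebra_auto k ?Q"
    unfolding algebra_auto_def ring_iso_def ring_hom_def linear_map_def
    using sd(1) mult add one smult by auto
  have der: "\<delta> \<in> skew_derivation k ?Q \<sigma>"
    unfolding skew_derivation_def linear_map_def using sd(2) mult add smult by auto
  have rep: "\<exists>!c. (\<forall>i::nat. c i \<in> Q) \<and> finite {i. c i \<noteq> \<zero>\<^bsub>A\<^esub>} \<and>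
           h = (\<Oplus>\<^bsub>A\<^esub>i\<in>{i. c i \<noteq> \<zero>\<^bsub>A\<^esub>}. c i \<otimes>\<^bsub>A\<^esub> x [^]\<^bsub>A\<^esub> i)" if h: "h \<in> carrier A" for h
  proof -
    obtain n where "h \<in> fil A Q x n" using h oc unfolding ore_cond_def by blast
    then obtain c where c: "\<forall>i. c i \<in> Q" "\<forall>i\<ge>n. c i = \<zero>\<^bsub>A\<^esub>" "h = (\<Oplus>\<^bsub>A\<^esub>i\<in>{..<n}. c i \<otimes>\<^bsub>A\<^esub> x [^]\<^bsub>A\<^esub> i)"
      using fil_finsum[OF skew_gen_axioms] by blast
    \<comment> \<open>Equal sums of length \<open>m + 1\<close> have the same leading coefficient;
      cancelling the top terms leaves equal sums of length \<open>m\<close>.\<close>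
    have uniq: "c i = d i" if "\<forall>i. c i \<in> Q" "\<forall>i. d i \<in> Q"
      "(\<Oplus>\<^bsub>A\<^esub>i\<in>{..<m}. c i \<otimes>\<^bsub>A\<^esub> x [^]\<^bsub>A\<^esub> i) = (\<Oplus>\<^bsub>A\<^esub>i\<in>{..<m}. d i \<otimes>\<^bsub>A\<^esub> x [^]\<^bsub>A\<^esub> i)" "i < m" for c d and i m :: nat
      using that(3,4)
    proof (induction m)
      case (Suc m)
      have ex: "(\<Oplus>\<^bsub>A\<^esub>i\<in>{..<Suc m}. e i \<otimes>\<^bsub>A\<^esub> x [^]\<^bsub>A\<^esub> i) = e m \<otimes>\<^bsub>A\<^esub> x [^]\<^bsub>A\<^esub> m \<oplus>\<^bsub>A\<^esub> (\<Oplus>\<^bsub>A\<^esub>i\<in>{..<m}. e i \<otimes>\<^bsub>A\<^esub> x [^]\<^bsub>A\<^esub> i)"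
        if "\<forall>i. e i \<in> Q" for e
        unfolding lessThan_Suc using Q_sub that by (subst V.M.finsum_insert) auto
      have le: "lead m (\<Oplus>\<^bsub>A\<^esub>i\<in>{..<Suc m}. e i \<otimes>\<^bsub>A\<^esub> x [^]\<^bsub>A\<^esub> i) (e m)" if "\<forall>i. e i \<in> Q" for e
        unfolding ex[OF that] by (rule leadI[OF _ finsum_fil[OF skew_gen_axioms]]) (use that in auto)
      have m: "c m = d m" using le[OF that(1)] le[OF that(2)] Suc.prems(1) lead_unique by metis
      have cl: "(\<Oplus>\<^bsub>A\<^esub>i\<in>{..<m}. e i \<otimes>\<^bsub>A\<^esub> x [^]\<^bsub>A\<^esub> i) \<in> carrier A" if "\<forall>i. e i \<in> Q" for e
        using F_closed[OF finsum_fil[OF skew_gen_axioms]] that by blast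
      have "(\<Oplus>\<^bsub>A\<^esub>i\<in>{..<m}. c i \<otimes>\<^bsub>A\<^esub> x [^]\<^bsub>A\<^esub> i) = (\<Oplus>\<^bsub>A\<^esub>i\<in>{..<m}. d i \<otimes>\<^bsub>A\<^esub> x [^]\<^bsub>A\<^esub> i)"
        using Suc.prems(1) unfolding ex[OF that(1)] ex[OF that(2)] m
        using cl[OF that(1)] cl[OF that(2)] that(2) Q_sub x by simp
      then show ?case using Suc m by (cases "i = m") auto
    qed simp
    show ?thesis
    proof (rule ex1I[of _ c])
      have "finite {i. c i \<noteq> \<zero>\<^bsub>A\<^esub>}"
        by (rule finite_subset[of _ "{..<n}"]) (use c(2) not_le in auto)
      then show "(\<forall>i. c i \<in> Q) \<and> finite {i. c i \<noteq> \<zero>\<^bsub>A\<^esub>} \<and>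
           h = (\<Oplus>\<^bsub>A\<^esub>i\<in>{i. c i \<noteq> \<zero>\<^bsub>A\<^esub>}. c i \<otimes>\<^bsub>A\<^esub> x [^]\<^bsub>A\<^esub> i)"
        using c finsum_supp[OF x, of c n] Q_sub by simp
      fix d assume d: "(\<forall>i::nat. d i \<in> Q) \<and> finite {i. d i \<noteq> \<zero>\<^bsub>A\<^esub>} \<and>
           h = (\<Oplus>\<^bsub>A\<^esub>i\<in>{i. d i \<noteq> \<zero>\<^bsub>A\<^esub>}. d i \<otimes>\<^bsub>A\<^esub> x [^]\<^bsub>A\<^esub> i)"
      then obtain m where m: "\<forall>i\<in>{i. d i \<noteq> \<zero>\<^bsub>A\<^esub>}. i < m" using finite_nat_set_iff_bounded by blast
      \<comment> \<open>A common bound for both supports turns the two representations into sums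
        over the same initial segment.\<close>
      define N where "N = max m n"
      have "d i = \<zero>\<^bsub>A\<^esub>" if "i \<ge> N" for i using m that by (force simp: N_def)
      then have "h = (\<Oplus>\<^bsub>A\<^esub>i\<in>{..<N}. d i \<otimes>\<^bsub>A\<^esub> x [^]\<^bsub>A\<^esub> i)"
        using d finsum_supp[OF x, of d N] Q_sub by simp
      moreover have "h = (\<Oplus>\<^bsub>A\<^esub>i\<in>{..<N}. c i \<otimes>\<^bsub>A\<^esub> x [^]\<^bsub>A\<^esub> i)"
        using c finsum_supp[OF x, of c n] finsum_supp[OF x, of c N] Q_sub by (simp add: N_def)
      ultimately have "d i = c i" if "i < N" for i using uniq[of d c N i] d c(1) that by simp
      moreover have "d i = c i" if "i \<ge> N" for i
        using m c(2) that by (force simp: N_def)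
      ultimately show "d = c" by (metis not_le ext)
    qed
  qed
  show ?thesis
    unfolding ore_extension_def using k_algebra_axioms sub x auto der rep sd(3) by blast
qed

end

context k_algebra
begin

lemma subalg_restrict:
  assumes "subalg k A C" "Q \<subseteq> C"
  shows "subalg k (A\<lparr>carrier := C\<rparr>) Q \<longleftrightarrow> subalg k A Q"
proof -
  interpret C: k_algebra k "A\<lparr>carrier := C\<rparr>" by (rule subalg_k_algebra[OF assms(1)])
  have Q: "Q \<subseteq> carrier A" using assms subalgD(3) by blast
  have "subring Q (A\<lparr>carrier := C\<rparr>) \<longleftrightarrow> subring Q A"
    using C.A.subring_iff[of Q] A.subring_iff[of Q] assms Q by simp
  moreover have "submodule Q k (A\<lparr>carrier := C\<rparr>) \<longleftrightarrow> module k (A\<lparr>carrier := Q\<rparr>)"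
    using submodule.submodule_is_module[OF _ C.V.module_axioms, of Q]
      C.V.module_incl_imp_submodule[of Q] assms(2) by fastforce
  moreover have "submodule Q k A \<longleftrightarrow> module k (A\<lparr>carrier := Q\<rparr>)"
    using submodule.submodule_is_module[OF _ V.module_axioms, of Q]
      V.module_incl_imp_submodule[OF Q] by blast
  ultimately show ?thesis by (simp add: subalg_def)
qed

lemma fil_restrict: "fil (A\<lparr>carrier := C\<rparr>) Q x n = fil A Q x n"
  by (rule fil_cong) auto

text \<open>This is \<open>ore_cond\<close> for the algebra with carrier \<open>C\<close>, expressed
  inside the ambient \<open>A\<close>: products, powers and \<open>fil\<close> do not involve the
  carrier. A whole chain can thus be treated in one algebra.\<close>

definition ore_step :: "'a set \<Rightarrow> 'a set \<Rightarrow> 'a \<Rightarrow> bool" where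
  "ore_step C Q x \<longleftrightarrow> subalg k A C \<and> subalg k A Q \<and> skew_free A Q x
    \<and> (\<forall>s\<in>Q. \<exists>r\<in>Q. \<exists>u\<in>Q. x \<otimes>\<^bsub>A\<^esub> r = s \<otimes>\<^bsub>A\<^esub> x \<oplus>\<^bsub>A\<^esub> u) \<and> C = (\<Union>n. fil A Q x n)"

lemma skew_free_iff:
  assumes "ring A'"
  shows "skew_free A' Q x \<longleftrightarrow> subring Q A' \<and> x \<in> carrier A'
    \<and> (\<forall>r\<in>Q. \<exists>s\<in>Q. \<exists>u\<in>Q. x \<otimes>\<^bsub>A'\<^esub> r = s \<otimes>\<^bsub>A'\<^esub> x \<oplus>\<^bsub>A'\<^esub> u)
    \<and> (\<forall>r\<in>Q. \<forall>n::nat. r \<otimes>\<^bsub>A'\<^esub> x [^]\<^bsub>A'\<^esub> n \<in> fil A' Q x n \<longrightarrow> r = \<zero>\<^bsub>A'\<^esub>)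
    \<and> (\<forall>r\<in>Q. x \<otimes>\<^bsub>A'\<^esub> r \<in> Q \<longrightarrow> r = \<zero>\<^bsub>A'\<^esub>)"
    (is "_ \<longleftrightarrow> ?P")
proof
  assume "skew_free A' Q x"
  then interpret skew_free A' Q x .
  show ?P by (intro conjI ballI allI impI Q x comm free inj)
next
  assume ?P
  then show "skew_free A' Q x"
    by (intro skew_free.intro skew_gen.intro skew_gen_axioms.intro skew_free_axioms.intro assms) blast+
qed

lemma ore_step_iff:
  assumes C: "subalg k A C" and Q: "subalg k A Q" "Q \<subseteq> C"
  shows "ore_extension k (A\<lparr>carrier := C\<rparr>) Q \<longleftrightarrow> (\<exists>x. ore_step C Q x)"
proof -
  interpret C: k_algebra k "A\<lparr>carrier := C\<rparr>" by (rule subalg_k_algebra[OF C])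
  have Q': "subalg k (A\<lparr>carrier := C\<rparr>) Q" using subalg_restrict[OF C Q(2)] Q(1) by simp
  have pow: "x [^]\<^bsub>A\<lparr>carrier := C\<rparr>\<^esub> n = x [^]\<^bsub>A\<^esub> n" for x and n :: nat
    by (simp add: nat_pow_def)
  have sf: "skew_free (A\<lparr>carrier := C\<rparr>) Q x \<longleftrightarrow> skew_free A Q x \<and> x \<in> C" for x
    unfolding skew_free_iff[OF A.ring_axioms] skew_free_iff[OF C.A.ring_axioms]
    using subalgD[OF C] C.subalgD[OF Q'] subalgD[OF Q(1)] by (auto simp: pow fil_restrict)
  have xC: "x \<in> C" if "skew_free A Q x" "C = (\<Union>n. fil A Q x n)" for x
  proof -
    interpret skew_free A Q x by fact
    show ?thesis using F_pow[of 1] that(2) by (simp del: fil.simps) blast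
  qed
  have "C.ore_cond Q x \<longleftrightarrow> ore_step C Q x" for x
    unfolding C.ore_cond_def ore_step_def fil_restrict sf using C Q(1) xC by auto
  then show ?thesis using C.ore_extensionD C.ore_extensionI[OF _ Q'] by blast
qed

lemma fil_submodule:
  assumes "skew_gen A Q x" "submodule Q k A"
  shows "submodule (fil A Q x n) k A"
proof -
  interpret skew_gen A Q x by fact
  show ?thesis
  proof (rule submoduleI')
    fix c u assume c: "c \<in> carrier k" and u: "u \<in> F n"
    have "c \<odot>\<^bsub>A\<^esub> u = (c \<odot>\<^bsub>A\<^esub> \<one>\<^bsub>A\<^esub>) \<otimes>\<^bsub>A\<^esub> u" using c F_closed[OF u] by (simp add: smult_mult_left)
    then show "c \<odot>\<^bsub>A\<^esub> u \<in> F n" using F_lmult[OF submod_smult[OF assms(2) c Qs(2)] u] by simp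
  qed (use F_closed F_zero F_add in auto)
qed

text \<open>A property of subsets, so that it applies to \<open>H \<otimes> Q\<close> as a subset of
  \<open>H \<otimes> H\<close> without making it a ring of its own.\<close>

definition dom_set :: "'a set \<Rightarrow> bool" where
  "dom_set M \<longleftrightarrow> (\<forall>a\<in>M. \<forall>b\<in>M. a \<otimes>\<^bsub>A\<^esub> b = \<zero>\<^bsub>A\<^esub> \<longrightarrow> a = \<zero>\<^bsub>A\<^esub> \<or> b = \<zero>\<^bsub>A\<^esub>)"

lemma dom_set_mono: "\<lbrakk>dom_set N; M \<subseteq> N\<rbrakk> \<Longrightarrow> dom_set M"
  unfolding dom_set_def by (meson subsetD)

lemma dom_set_fil:
  assumes "skew_free A Q x" "dom_set Q"
  shows "dom_set (\<Union>n. fil A Q x n)"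
  unfolding dom_set_def
proof (intro ballI impI)
  interpret skew_free A Q x by fact
  fix a b assume "a \<in> (\<Union>n. F n)" "b \<in> (\<Union>n. F n)" "a \<otimes>\<^bsub>A\<^esub> b = \<zero>\<^bsub>A\<^esub>"
  then show "a = \<zero>\<^bsub>A\<^esub> \<or> b = \<zero>\<^bsub>A\<^esub>"
    using domain_fil assms(2) unfolding dom_set_def by blast
qed

end

section \<open>Base change of an Ore extension of Q to one of H \<otimes> Q\<close>

context hopf_algebra
begin

abbreviation "TV V \<equiv> tsub (carrier H) V"

lemma TVD:
  assumes "subalg k H Q"
  shows "submodule (TV Q) k HH" "subring (TV Q) HH" "t \<in> TV Q \<Longrightarrow> t \<in> carrier HH"
    and "\<lbrakk>t \<in> TV Q; f \<in> dual\<rbrakk> \<Longrightarrow> lsl f t \<in> Q"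
    and "\<lbrakk>h \<in> carrier H; r \<in> Q\<rbrakk> \<Longrightarrow> tp h r \<in> TV Q"
    and "\<lbrakk>t \<in> TV Q; t' \<in> TV Q\<rbrakk> \<Longrightarrow> t \<otimes>\<^bsub>HH\<^esub> t' \<in> TV Q"
proof -
  note s = subalgD[OF assms]
  show sub: "submodule (TV Q) k HH" by (rule TP.tensor_sub_submodule[OF subset_refl s(3)])
  show c: "t \<in> TV Q \<Longrightarrow> t \<in> carrier HH" for t by (rule TP.T.submod_sub[OF sub])
  show "\<lbrakk>t \<in> TV Q; f \<in> dual\<rbrakk> \<Longrightarrow> lsl f t \<in> Q"
    by (rule TP.lslice_tensor_sub[OF s(1) subset_refl])
  show p: "\<lbrakk>h \<in> carrier H; r \<in> Q\<rbrakk> \<Longrightarrow> tp h r \<in> TV Q" for h r by (rule TP.tensor_sub_pt)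
  show m: "\<lbrakk>t \<in> TV Q; t' \<in> TV Q\<rbrakk> \<Longrightarrow> t \<otimes>\<^bsub>HH\<^esub> t' \<in> TV Q" for t t'
    by (rule TP.tensor_sub_mult[OF subset_refl s(3) subset_refl s(3) subset_refl s(3)]) (use s(5) in auto)
  show "subring (TV Q) HH"
    by (rule TP.T.A.subringI) (use c m TP.T.submod[OF sub] p s(4) in \<open>auto simp: TP.T_one\<close>)
qed

lemma tp_one_pow: "x \<in> carrier H \<Longrightarrow> tp \<one>\<^bsub>H\<^esub> x [^]\<^bsub>HH\<^esub> (n::nat) = tp \<one>\<^bsub>H\<^esub> (x [^]\<^bsub>H\<^esub> n)"
  by (induction n) (simp_all add: TP.T_one TP.pt_mult)

context
  fixes Q x assumes Q: "subalg k H Q" and sf: "skew_free H Q x"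
begin

interpretation X: skew_free H Q x by (rule sf)

lemma TV_skew_gen: "skew_gen HH (TV Q) (tp \<one>\<^bsub>H\<^esub> x)"
proof (intro skew_gen.intro skew_gen_axioms.intro TP.T.A.ring_axioms TVD(2)[OF Q])
  let ?Y = "tp \<one>\<^bsub>H\<^esub> x"
  show Y: "?Y \<in> carrier HH" by simp
  note c = TVD(3)[OF Q] and m = TP.T.submod[OF TVD(1)[OF Q]]
  fix t assume "t \<in> TV Q"
  then show "\<exists>s\<in>TV Q. \<exists>u\<in>TV Q. ?Y \<otimes>\<^bsub>HH\<^esub> t = s \<otimes>\<^bsub>HH\<^esub> ?Y \<oplus>\<^bsub>HH\<^esub> u"
  proof (rule TP.tensor_sub_induct[OF _ subset_refl subalgD(3)[OF Q]])
    show "\<exists>s\<in>TV Q. \<exists>u\<in>TV Q. ?Y \<otimes>\<^bsub>HH\<^esub> \<zero>\<^bsub>HH\<^esub> = s \<otimes>\<^bsub>HH\<^esub> ?Y \<oplus>\<^bsub>HH\<^esub> u"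
      using m(1) Y by (intro bexI[of _ "\<zero>\<^bsub>HH\<^esub>"]) simp_all
  next
    fix h r assume hr: "h \<in> carrier H" "r \<in> Q"
    obtain s u where su: "s \<in> Q" "u \<in> Q" "x \<otimes>\<^bsub>H\<^esub> r = s \<otimes>\<^bsub>H\<^esub> x \<oplus>\<^bsub>H\<^esub> u" using X.comm[OF hr(2)] by blast
    have "?Y \<otimes>\<^bsub>HH\<^esub> tp h r = tp h s \<otimes>\<^bsub>HH\<^esub> ?Y \<oplus>\<^bsub>HH\<^esub> tp h u"
      using hr su X.Q_sub by (simp add: TP.pt_mult TP.pt_add_right)
    then show "\<exists>s\<in>TV Q. \<exists>u\<in>TV Q. ?Y \<otimes>\<^bsub>HH\<^esub> tp h r = s \<otimes>\<^bsub>HH\<^esub> ?Y \<oplus>\<^bsub>HH\<^esub> u"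
      using TVD(5)[OF Q] hr su by blast
  next
    fix t1 t2 assume t: "t1 \<in> carrier HH" "t2 \<in> carrier HH"
      "\<exists>s\<in>TV Q. \<exists>u\<in>TV Q. ?Y \<otimes>\<^bsub>HH\<^esub> t1 = s \<otimes>\<^bsub>HH\<^esub> ?Y \<oplus>\<^bsub>HH\<^esub> u"
      "\<exists>s\<in>TV Q. \<exists>u\<in>TV Q. ?Y \<otimes>\<^bsub>HH\<^esub> t2 = s \<otimes>\<^bsub>HH\<^esub> ?Y \<oplus>\<^bsub>HH\<^esub> u"
    then obtain s1 u1 s2 u2 where *: "s1 \<in> TV Q" "u1 \<in> TV Q" "?Y \<otimes>\<^bsub>HH\<^esub> t1 = s1 \<otimes>\<^bsub>HH\<^esub> ?Y \<oplus>\<^bsub>HH\<^esub> u1"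
      "s2 \<in> TV Q" "u2 \<in> TV Q" "?Y \<otimes>\<^bsub>HH\<^esub> t2 = s2 \<otimes>\<^bsub>HH\<^esub> ?Y \<oplus>\<^bsub>HH\<^esub> u2" by blast
    have "?Y \<otimes>\<^bsub>HH\<^esub> (t1 \<oplus>\<^bsub>HH\<^esub> t2) = (s1 \<oplus>\<^bsub>HH\<^esub> s2) \<otimes>\<^bsub>HH\<^esub> ?Y \<oplus>\<^bsub>HH\<^esub> (u1 \<oplus>\<^bsub>HH\<^esub> u2)"
      using * t(1,2) Y c by (simp add: TP.T.A.l_distr TP.T.A.r_distr TP.T.V.M.a_ac)
    then show "\<exists>s\<in>TV Q. \<exists>u\<in>TV Q. ?Y \<otimes>\<^bsub>HH\<^esub> (t1 \<oplus>\<^bsub>HH\<^esub> t2) = s \<otimes>\<^bsub>HH\<^esub> ?Y \<oplus>\<^bsub>HH\<^esub> u"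
      using m(2) * by blast
  next
    fix a t assume t: "a \<in> carrier k" "t \<in> carrier HH"
      "\<exists>s\<in>TV Q. \<exists>u\<in>TV Q. ?Y \<otimes>\<^bsub>HH\<^esub> t = s \<otimes>\<^bsub>HH\<^esub> ?Y \<oplus>\<^bsub>HH\<^esub> u"
    then obtain s u where *: "s \<in> TV Q" "u \<in> TV Q" "?Y \<otimes>\<^bsub>HH\<^esub> t = s \<otimes>\<^bsub>HH\<^esub> ?Y \<oplus>\<^bsub>HH\<^esub> u" by blast
    have "?Y \<otimes>\<^bsub>HH\<^esub> (a \<odot>\<^bsub>HH\<^esub> t) = (a \<odot>\<^bsub>HH\<^esub> s) \<otimes>\<^bsub>HH\<^esub> ?Y \<oplus>\<^bsub>HH\<^esub> a \<odot>\<^bsub>HH\<^esub> u"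
      using * t(1,2) Y c by (simp add: TP.T.smult_mult_left TP.T.smult_mult_right TP.T.V.smult_r_distr)
    then show "\<exists>s\<in>TV Q. \<exists>u\<in>TV Q. ?Y \<otimes>\<^bsub>HH\<^esub> (a \<odot>\<^bsub>HH\<^esub> t) = s \<otimes>\<^bsub>HH\<^esub> ?Y \<oplus>\<^bsub>HH\<^esub> u"
      using m(3) * t(1) by blast
  qed
qed

interpretation Y: skew_gen HH "TV Q" "tp \<one>\<^bsub>H\<^esub> x" by (rule TV_skew_gen)

lemma lsl_pow:
  "\<lbrakk>f \<in> dual; t \<in> carrier HH\<rbrakk> \<Longrightarrow>
    lsl f (t \<otimes>\<^bsub>HH\<^esub> tp \<one>\<^bsub>H\<^esub> x [^]\<^bsub>HH\<^esub> (n::nat)) = lsl f t \<otimes>\<^bsub>H\<^esub> x [^]\<^bsub>H\<^esub> n"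
  by (simp add: tp_one_pow TP.lslice_mult_one)

text \<open>A left slice acts on the coefficients in \<open>H \<otimes> Q\<close> and leaves the
  powers of \<open>1 \<otimes> x\<close> alone.\<close>

lemma lsl_fil: "\<lbrakk>f \<in> dual; u \<in> fil HH (TV Q) (tp \<one>\<^bsub>H\<^esub> x) n\<rbrakk> \<Longrightarrow> lsl f u \<in> fil H Q x n"
proof (induction n arbitrary: u)
  case 0
  then show ?case using linear_map_zero[OF TP.T_k_algebra k_algebra_axioms TP.lslice_linear] by simp
next
  case (Suc n)
  then obtain t v where tv: "t \<in> TV Q" "v \<in> fil HH (TV Q) (tp \<one>\<^bsub>H\<^esub> x) n"
    "u = t \<otimes>\<^bsub>HH\<^esub> tp \<one>\<^bsub>H\<^esub> x [^]\<^bsub>HH\<^esub> n \<oplus>\<^bsub>HH\<^esub> v" by (auto simp: fil.simps(2))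
  have "lsl f u = lsl f t \<otimes>\<^bsub>H\<^esub> x [^]\<^bsub>H\<^esub> n \<oplus>\<^bsub>H\<^esub> lsl f v"
    using Suc.prems(1) Y.Q_sub[OF tv(1)] Y.F_closed[OF tv(2)]
    by (simp add: tv(3) linear_mapD[OF TP.lslice_linear] lsl_pow)
  then show ?case using X.FI[OF TVD(4)[OF Q tv(1) Suc.prems(1)] Suc.IH[OF Suc.prems(1) tv(2)]] by simp
qed

text \<open>A tensor vanishes if all its left slices do, and slicing carries a relation over
  \<open>H \<otimes> Q\<close> to one over \<open>Q\<close>, where freeness and injectivity are
  known.\<close>

lemma TV_skew_free: "skew_free HH (TV Q) (tp \<one>\<^bsub>H\<^esub> x)"
proof (intro skew_free.intro TV_skew_gen skew_free_axioms.intro)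
  fix t and n :: nat
  assume t: "t \<in> TV Q" "t \<otimes>\<^bsub>HH\<^esub> tp \<one>\<^bsub>H\<^esub> x [^]\<^bsub>HH\<^esub> n \<in> Y.F n"
  show "t = \<zero>\<^bsub>HH\<^esub>"
  proof (rule TP.slices_zero)
    fix f assume f: "f \<in> dual"
    show "lsl f t = \<zero>\<^bsub>H\<^esub>"
      using X.free[OF TVD(4)[OF Q t(1) f]] lsl_fil[OF f t(2)] lsl_pow[OF f] TVD(3)[OF Q t(1)] by simp
  qed (use t TVD(3)[OF Q] in blast)
next
  fix t assume t: "t \<in> TV Q" "tp \<one>\<^bsub>H\<^esub> x \<otimes>\<^bsub>HH\<^esub> t \<in> TV Q"
  show "t = \<zero>\<^bsub>HH\<^esub>"
  proof (rule TP.slices_zero)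
    fix f assume f: "f \<in> dual"
    have "x \<otimes>\<^bsub>H\<^esub> lsl f t \<in> Q"
      using TVD(4)[OF Q t(2) f] TP.lslice_mult_one(2)[OF f] TVD(3)[OF Q t(1)] by simp
    then show "lsl f t = \<zero>\<^bsub>H\<^esub>" using X.inj[OF TVD(4)[OF Q t(1) f]] by blast
  qed (use t TVD(3)[OF Q] in blast)
qed

text \<open>The pure tensor of \<open>h\<close> and a polynomial is a polynomial with coefficients
  \<open>h \<otimes> r\<close>, and a sum takes the larger of two degree bounds. With
  \<open>TV_skew_free\<close> this makes \<open>H \<otimes> C\<close> an extension of
  \<open>H \<otimes> Q\<close> of the same kind as \<open>C\<close> over \<open>Q\<close>.\<close>

lemma TV_fil: "t \<in> TV (\<Union>n. fil H Q x n) \<Longrightarrow> \<exists>n. t \<in> fil HH (TV Q) (tp \<one>\<^bsub>H\<^esub> x) n"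
proof (erule TP.tensor_sub_induct)
  show "(\<Union>n. fil H Q x n) \<subseteq> carrier H" using X.F_closed by blast
  note sub = TP.T.fil_submodule[OF TV_skew_gen TVD(1)[OF Q]]
  show "\<exists>n. \<zero>\<^bsub>HH\<^esub> \<in> Y.F n" using Y.F_zero by blast
  show "\<exists>n. c \<odot>\<^bsub>HH\<^esub> t \<in> Y.F n" if "c \<in> carrier k" "\<exists>n. t \<in> Y.F n" for c t
    using that TP.T.submod_smult[OF sub] by blast
  fix s t assume "\<exists>n. s \<in> Y.F n" "\<exists>n. t \<in> Y.F n"
  then obtain m n where "s \<in> Y.F m" "t \<in> Y.F n" by blast
  then have "s \<in> Y.F (max m n)" "t \<in> Y.F (max m n)" using Y.F_mono max.cobounded1 max.cobounded2 by blast+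
  then show "\<exists>n. s \<oplus>\<^bsub>HH\<^esub> t \<in> Y.F n" using Y.F_add by blast
next
  fix h a assume h: "h \<in> carrier H" and "a \<in> (\<Union>n. fil H Q x n)"
  then obtain n where "a \<in> fil H Q x n" by blast
  then have "tp h a \<in> Y.F n"
  proof (induction n arbitrary: a)
    case 0
    then show ?case using h by simp
  next
    case (Suc n)
    then obtain r v where rv: "r \<in> Q" "v \<in> fil H Q x n" "a = r \<otimes>\<^bsub>H\<^esub> x [^]\<^bsub>H\<^esub> n \<oplus>\<^bsub>H\<^esub> v" by (auto simp: fil.simps(2))
    have "tp h a = tp h r \<otimes>\<^bsub>HH\<^esub> tp \<one>\<^bsub>H\<^esub> x [^]\<^bsub>HH\<^esub> n \<oplus>\<^bsub>HH\<^esub> tp h v"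
      using h X.Q_sub[OF rv(1)] X.F_closed[OF rv(2)] by (simp add: rv(3) tp_one_pow TP.pt_mult TP.pt_add_right)
    then show ?case using Y.FI[OF TVD(5)[OF Q h rv(1)] Suc.IH[OF rv(2)]] by simp
  qed
  then show "\<exists>n. tp h a \<in> Y.F n" by blast
qed simp

end

section \<open>Chains of Ore extensions: zero divisors and one-sided inverses\<close>

definition ore_chain :: "(nat \<Rightarrow> 'a set) \<Rightarrow> nat \<Rightarrow> bool" where
  "ore_chain C n \<longleftrightarrow> C 0 = scalars k H \<and> C n = carrier H
    \<and> (\<forall>i\<le>n. hopf_subalgebra k H (C i)) \<and> (\<forall>i<n. C i \<subseteq> C (Suc i) \<and> (\<exists>x. ore_step (C (Suc i)) (C i) x))"

lemma ore_chain_iff: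
  "ihoe_of_field k H \<longleftrightarrow> (\<exists>C n. ore_chain C n)"
proof -
  have step: "(\<forall>i<n. C i \<subseteq> C (Suc i) \<and> ore_extension k (H\<lparr>carrier := C (Suc i)\<rparr>) (C i))
    \<longleftrightarrow> (\<forall>i<n. C i \<subseteq> C (Suc i) \<and> (\<exists>x. ore_step (C (Suc i)) (C i) x))"
    if "\<forall>i\<le>n. hopf_subalgebra k H (C i)" for C and n :: nat
  proof -
    have "subalg k H (C i)" if "i \<le> n" for i using \<open>\<forall>i\<le>n. hopf_subalgebra k H (C i)\<close> that hopf_subD(1) by blast
    then show ?thesis by (intro all_cong conj_cong refl ore_step_iff) auto
  qed
  show ?thesis
  proof
    assume "ihoe_of_field k H"
    then obtain n C where c: "C 0 = scalars k H" "C n = carrier H" "\<forall>i\<le>n. hopf_subalgebra k H (C i)"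
      "\<forall>i<n. C i \<subseteq> C (Suc i) \<and> ore_extension k (H\<lparr>carrier := C (Suc i)\<rparr>) (C i)"
      unfolding ihoe_of_field_def ihoe_def ihoe_steps_def by (elim exE conjE) (rule that)
    have "ore_chain C n" unfolding ore_chain_def using c(1-3) c(4)[unfolded step[OF c(3)]] by (intro conjI)
    then show "\<exists>C n. ore_chain C n" by blast
  next
    assume "\<exists>C n. ore_chain C n"
    then obtain C n where c: "C 0 = scalars k H" "C n = carrier H" "\<forall>i\<le>n. hopf_subalgebra k H (C i)"
      "\<forall>i<n. C i \<subseteq> C (Suc i) \<and> (\<exists>x. ore_step (C (Suc i)) (C i) x)"
      unfolding ore_chain_def by (elim exE conjE) (rule that)
    show "ihoe_of_field k H"
      unfolding ihoe_of_field_def ihoe_def ihoe_steps_def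
      using hopf_algebra_axioms c(1-3) c(4)[folded step[OF c(3)]]
      by (intro exI[of _ n] exI[of _ C] conjI)
  qed
qed

lemma scalars_dom: "dom_set (scalars k H)"
  unfolding dom_set_def scalars_def
proof (clarsimp)
  fix c d assume cd: "c \<in> carrier k" "d \<in> carrier k" "d \<odot>\<^bsub>H\<^esub> \<one>\<^bsub>H\<^esub> \<noteq> \<zero>\<^bsub>H\<^esub>"
    "(c \<odot>\<^bsub>H\<^esub> \<one>\<^bsub>H\<^esub>) \<otimes>\<^bsub>H\<^esub> (d \<odot>\<^bsub>H\<^esub> \<one>\<^bsub>H\<^esub>) = \<zero>\<^bsub>H\<^esub>"
  have "c \<otimes>\<^bsub>k\<^esub> d = eps ((c \<odot>\<^bsub>H\<^esub> \<one>\<^bsub>H\<^esub>) \<otimes>\<^bsub>H\<^esub> (d \<odot>\<^bsub>H\<^esub> \<one>\<^bsub>H\<^esub>))" using cd(1,2) by (simp add: eps)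
  also have "\<dots> = \<zero>\<^bsub>k\<^esub>" unfolding cd(4) by (rule eps)
  finally have "c \<otimes>\<^bsub>k\<^esub> d = \<zero>\<^bsub>k\<^esub>" .
  then show "c \<odot>\<^bsub>H\<^esub> \<one>\<^bsub>H\<^esub> = \<zero>\<^bsub>H\<^esub>" using K.integral[of c d] cd by auto
qed

context
  fixes C n assumes chain: "ore_chain C n"
begin

lemma chainD:
  "i \<le> n \<Longrightarrow> hopf_subalgebra k H (C i)" "C 0 = scalars k H" "C n = carrier H"
  "i < n \<Longrightarrow> C i \<subseteq> C (Suc i)" "i < n \<Longrightarrow> \<exists>x. ore_step (C (Suc i)) (C i) x"
  using chain by (auto simp: ore_chain_def)

lemma chain_dom: "i \<le> n \<Longrightarrow> dom_set (C i)"
proof (induction i)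
  case 0
  then show ?case using scalars_dom chainD(2) by simp
next
  case (Suc i)
  then obtain x where x: "ore_step (C (Suc i)) (C i) x" using chainD(5)[of i] by auto
  then show ?case using dom_set_fil[of "C i" x] Suc unfolding ore_step_def by simp
qed

lemma H_dom: "dom_set (carrier H)"
  using chain_dom[of n] chainD(3) by simp

text \<open>At each step of the chain the factors of \<open>1\<close> have degree zero, so
  \<open>a\<close> and \<open>b\<close> descend together to the scalars.\<close>

lemma left_inverse_scalar_aux:
  "\<lbrakk>i \<le> n; a \<in> C i; b \<in> C i; a \<otimes>\<^bsub>H\<^esub> b = \<one>\<^bsub>H\<^esub>\<rbrakk> \<Longrightarrow> b \<in> scalars k H"
proof (induction i)
  case (Suc i)
  then obtain x where x: "skew_free H (C i) x" "C (Suc i) = (\<Union>m. fil H (C i) x m)"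
    using chainD(5)[of i] unfolding ore_step_def by auto
  interpret X: skew_free H "C i" x by (rule x(1))
  obtain l m where lm: "a \<in> X.F l" "b \<in> X.F m" using Suc.prems x(2) by blast
  have dom: "r = \<zero>\<^bsub>H\<^esub> \<or> s = \<zero>\<^bsub>H\<^esub>" if "r \<in> C i" "s \<in> C i" "r \<otimes>\<^bsub>H\<^esub> s = \<zero>\<^bsub>H\<^esub>" for r s
    using chain_dom[of i] Suc.prems(1) that by (auto simp: dom_set_def)
  note li = X.left_inverse_fil[OF dom one_not_zero lm Suc.prems(4)]
  show ?case by (rule Suc.IH[OF Suc_leD[OF Suc.prems(1)] li Suc.prems(4)])
qed (simp add: chainD(2))

text \<open>The counit of a scalar multiple of \<open>1\<close> is the scalar, so the normalisation
  of \<open>b\<close> leaves only \<open>1\<close>. Group-like elements are covered, with the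
  antipode providing \<open>a\<close>.\<close>

lemma left_inverse_one:
  assumes "a \<in> carrier H" "b \<in> carrier H" "a \<otimes>\<^bsub>H\<^esub> b = \<one>\<^bsub>H\<^esub>" "eps b = \<one>\<^bsub>k\<^esub>"
  shows "b = \<one>\<^bsub>H\<^esub>"
proof -
  have "b \<in> scalars k H" using left_inverse_scalar_aux[of n a b] assms chainD(3) by simp
  then obtain c where c: "c \<in> carrier k" "b = c \<odot>\<^bsub>H\<^esub> \<one>\<^bsub>H\<^esub>" by (auto simp: scalars_def)
  then have "c = \<one>\<^bsub>k\<^esub>" using assms(4) by (simp add: eps)
  then show ?thesis using c by simp
qed

text \<open>The induction starts at \<open>H \<otimes> k\<close>, a copy of \<open>H\<close>; that
  \<open>H\<close> is a domain, hence the whole chain, already enters there. Each later step adjoins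
  \<open>1 \<otimes> x\<close> to a domain.\<close>

lemma chain_TV_dom: "i \<le> n \<Longrightarrow> TP.T.dom_set (TV (C i))"
proof (induction i)
  case 0
  have tps: "\<exists>h\<in>carrier H. t = tp h \<one>\<^bsub>H\<^esub>" if "t \<in> TV (C 0)" for t
    using that
  proof (rule TP.tensor_sub_induct[where P = "\<lambda>t. \<exists>h\<in>carrier H. t = tp h \<one>\<^bsub>H\<^esub>", OF _ subset_refl])
    show "C 0 \<subseteq> carrier H" using chainD(2) by (auto simp: scalars_def)
    show "\<exists>h\<in>carrier H. \<zero>\<^bsub>HH\<^esub> = tp h \<one>\<^bsub>H\<^esub>" by (rule bexI[of _ "\<zero>\<^bsub>H\<^esub>"]) auto
    fix h w assume h: "h \<in> carrier H" and "w \<in> C 0"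
    then obtain c where c: "c \<in> carrier k" "w = c \<odot>\<^bsub>H\<^esub> \<one>\<^bsub>H\<^esub>" using chainD(2) by (auto simp: scalars_def)
    then have "tp h w = tp (c \<odot>\<^bsub>H\<^esub> h) \<one>\<^bsub>H\<^esub>" using h by (simp add: TP.pt_smult_left TP.pt_smult_right)
    then show "\<exists>h'\<in>carrier H. tp h w = tp h' \<one>\<^bsub>H\<^esub>" using h c by blast
  next
    fix s t assume "\<exists>h\<in>carrier H. s = tp h \<one>\<^bsub>H\<^esub>" "\<exists>h\<in>carrier H. t = tp h \<one>\<^bsub>H\<^esub>"
    then show "\<exists>h\<in>carrier H. s \<oplus>\<^bsub>HH\<^esub> t = tp h \<one>\<^bsub>H\<^esub>"
      using TP.pt_add_left[OF _ _ A.one_closed] V.M.add.m_closed by metis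
  next
    fix c t assume "c \<in> carrier k" "\<exists>h\<in>carrier H. t = tp h \<one>\<^bsub>H\<^esub>"
    then show "\<exists>h\<in>carrier H. c \<odot>\<^bsub>HH\<^esub> t = tp h \<one>\<^bsub>H\<^esub>"
      using TP.pt_smult_left[OF _ _ A.one_closed] by (metis V.smult_closed)
  qed
  have inj: "h = \<zero>\<^bsub>H\<^esub>" if "h \<in> carrier H" "tp h \<one>\<^bsub>H\<^esub> = \<zero>\<^bsub>HH\<^esub>" for h
  proof -
    have "rsl eps (tp h \<one>\<^bsub>H\<^esub>) = \<zero>\<^bsub>H\<^esub>"
      unfolding that(2) by (rule linear_map_zero[OF TP.T_k_algebra k_algebra_axioms TP.rslice_linear[OF eps_functional]])
    then show ?thesis using that(1) by (simp add: TP.rslice_pt eps_functional eps)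
  qed
  show ?case unfolding TP.T.dom_set_def
  proof (intro ballI impI)
    fix s t assume st: "s \<in> TV (C 0)" "t \<in> TV (C 0)" "s \<otimes>\<^bsub>HH\<^esub> t = \<zero>\<^bsub>HH\<^esub>"
    obtain g h where gh: "g \<in> carrier H" "s = tp g \<one>\<^bsub>H\<^esub>" "h \<in> carrier H" "t = tp h \<one>\<^bsub>H\<^esub>"
      using tps st by meson
    then have "g \<otimes>\<^bsub>H\<^esub> h = \<zero>\<^bsub>H\<^esub>" using st(3) inj[of "g \<otimes>\<^bsub>H\<^esub> h"] by (simp add: TP.pt_mult)
    then have "g = \<zero>\<^bsub>H\<^esub> \<or> h = \<zero>\<^bsub>H\<^esub>" using H_dom gh(1,3) unfolding dom_set_def by blast
    then show "s = \<zero>\<^bsub>HH\<^esub> \<or> t = \<zero>\<^bsub>HH\<^esub>" using gh by (elim disjE) simp_all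
  qed
next
  case (Suc i)
  then obtain x where x: "skew_free H (C i) x" "C (Suc i) = (\<Union>m. fil H (C i) x m)"
    using chainD(5)[of i] unfolding ore_step_def by auto
  have Q: "subalg k H (C i)" using hopf_subD(1) chainD(1)[of i] Suc by simp
  have "TP.T.dom_set (\<Union>n. fil HH (TV (C i)) (tp \<one>\<^bsub>H\<^esub> x) n)"
    by (rule TP.T.dom_set_fil[OF TV_skew_free[OF Q x(1)]]) (use Suc in simp)
  moreover have "TV (C (Suc i)) \<subseteq> (\<Union>n. fil HH (TV (C i)) (tp \<one>\<^bsub>H\<^esub> x) n)"
    using TV_fil[OF Q x(1)] unfolding x(2) by blast
  ultimately show ?case by (rule TP.T.dom_set_mono)
qed

end

end

section \<open>The comultiplication of an Ore variable\<close>

lemma (in k_algebra) add_diff_swap: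
  "\<lbrakk>a \<in> carrier A; b \<in> carrier A; c \<in> carrier A\<rbrakk>
    \<Longrightarrow> b \<oplus>\<^bsub>A\<^esub> c = a \<oplus>\<^bsub>A\<^esub> b \<oplus>\<^bsub>A\<^esub> (c \<ominus>\<^bsub>A\<^esub> a)"
  by algebra

context hopf_algebra
begin

abbreviation "tmap \<equiv> tensor_map k H H"

lemmas tmap_linear = tensor_map_linear(1)[OF TP.tensor_pair_axioms TP.tensor_pair_axioms]
lemmas tmap_tp = tensor_map_linear(2)[OF TP.tensor_pair_axioms TP.tensor_pair_axioms]

lemma tmap_id_mult:
  assumes "f \<in> linear_map k H H" "t \<in> carrier HH" "b \<in> carrier H"
  shows "tmap f id (t \<otimes>\<^bsub>HH\<^esub> tp \<one>\<^bsub>H\<^esub> b) = tmap f id t \<otimes>\<^bsub>HH\<^esub> tp \<one>\<^bsub>H\<^esub> b"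
proof -
  define M where "M = tmap f id"
  note l = linear_mapD[OF tmap_linear[OF assms(1) linear_map_id], folded M_def]
    tmap_tp[OF assms(1) linear_map_id, folded M_def]
  show ?thesis unfolding M_def[symmetric] using assms(2)
    by (induction rule: TP.tensor_induct)
      (use assms(3) in \<open>simp_all add: l TP.pt_mult TP.T.A.l_distr linear_mapD(1)[OF assms(1)]\<close>)
qed

lemma rsl_eps_tmap:
  assumes "f \<in> linear_map k H H" "t \<in> carrier HH"
  shows "rsl eps (tmap f id t) = f (rsl eps t)"
proof -
  note r = TP.rslice_linear[OF eps_functional]
  show ?thesis
    by (rule TP.tensor_ext[OF linear_map_comp[OF tmap_linear[OF assms(1) linear_map_id] r]
          linear_map_comp[OF r assms(1)] assms(2)])
      (simp add: tmap_tp[OF assms(1) linear_map_id] TP.rslice_pt eps_functional eps linear_mapD[OF assms(1)])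
qed

text \<open>Both sides are the value of \<open>eps \<otimes> eps\<close> at
  \<open>t\<close>.\<close>

lemma eps_slices:
  assumes "t \<in> carrier HH" shows "eps (rsl eps t) = eps (lsl eps t)"
  using assms by (induction rule: TP.tensor_induct)
    (simp_all add: TP.rslice_pt TP.lslice_pt eps_functional eps K.m_comm
      linear_mapD[OF TP.rslice_linear[OF eps_functional]] linear_mapD[OF TP.lslice_linear[OF eps_functional]])

end

text \<open>The comultiplication and its opposite are treated simultaneously.\<close>

locale coassoc_hom = hopf_algebra +
  fixes E
  assumes E_hom: "E \<in> ring_hom H HH" and E_linear: "E \<in> linear_map k H HH"
    and E_left: "y \<in> carrier H \<Longrightarrow> lsl eps (E y) = y"
    and E_right: "y \<in> carrier H \<Longrightarrow> rsl eps (E y) = y"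
    and E_sub: "\<lbrakk>hopf_subalgebra k H C; y \<in> C\<rbrakk> \<Longrightarrow> E y \<in> tsub C C"
    and E_coassoc: "\<lbrakk>f \<in> dual; y \<in> carrier H\<rbrakk> \<Longrightarrow> E (lsl f (E y)) = tmap (\<lambda>y. lsl f (E y)) id (E y)"
begin

lemmas E = linear_mapD[OF E_linear] ring_hom_mult[OF E_hom] ring_hom_one[OF E_hom]

lemma E_pow: "y \<in> carrier H \<Longrightarrow> E (y [^]\<^bsub>H\<^esub> (n::nat)) = E y [^]\<^bsub>HH\<^esub> n"
  by (induction n) (simp_all add: E)

lemma E_zero: "E \<zero>\<^bsub>H\<^esub> = \<zero>\<^bsub>HH\<^esub>"
  by (rule linear_map_zero[OF k_algebra_axioms TP.T_k_algebra E_linear])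

context
  fixes C Q x
  assumes C: "hopf_subalgebra k H C" and Q: "hopf_subalgebra k H Q" and step: "ore_step C Q x"
    and dom: "TP.T.dom_set (TV Q)"
begin

lemma sQ: "subalg k H Q" and sf: "skew_free H Q x" and C_eq: "C = (\<Union>n. fil H Q x n)"
  using step by (auto simp: ore_step_def)

interpretation X: skew_free H Q x by (rule sf)
interpretation Y: skew_free HH "TV Q" "tp \<one>\<^bsub>H\<^esub> x" by (rule TV_skew_free[OF sQ sf])

abbreviation "Y \<equiv> tp \<one>\<^bsub>H\<^esub> x"

lemma x_notin: "x \<notin> Q"
proof
  assume "x \<in> Q"
  then have "\<one>\<^bsub>H\<^esub> \<otimes>\<^bsub>H\<^esub> x [^]\<^bsub>H\<^esub> (1::nat) \<in> X.F 1" using X.F_one by simp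
  then show False using X.free[OF X.Qs(2)] one_not_zero by blast
qed

lemma x_C: "x \<in> C"
  using X.F_pow[of 1] unfolding C_eq by auto

lemma E_Q: "r \<in> Q \<Longrightarrow> E r \<in> TV Q"
  using E_sub[OF Q] TP.tensor_sub_mono[OF subalgD(3)[OF sQ] subset_refl] by blast

text \<open>Slicing by the counit is a left inverse of \<open>E\<close>.\<close>

lemma E_nonzero: "\<lbrakk>r \<in> carrier H; r \<noteq> \<zero>\<^bsub>H\<^esub>\<rbrakk> \<Longrightarrow> E r \<noteq> \<zero>\<^bsub>HH\<^esub>"
  using E_left linear_map_zero[OF TP.T_k_algebra k_algebra_axioms TP.lslice_linear[OF eps_functional]] by metis

lemma dom': "\<lbrakk>r \<in> TV Q; s \<in> TV Q; r \<otimes>\<^bsub>HH\<^esub> s = \<zero>\<^bsub>HH\<^esub>\<rbrakk> \<Longrightarrow> r = \<zero>\<^bsub>HH\<^esub> \<or> s = \<zero>\<^bsub>HH\<^esub>"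
  using dom unfolding TP.T.dom_set_def by blast

text \<open>\<open>f \<otimes> id\<close> touches only the first factor, where all of
  \<open>H\<close> is allowed, and so cannot raise the degree in the second.\<close>

lemma tmap_fil:
  assumes f: "f \<in> linear_map k H H" and u: "u \<in> Y.F n"
  shows "tmap f id u \<in> Y.F n"
proof -
  define M where "M = tmap f id"
  note l = tmap_linear[OF f linear_map_id, folded M_def] and p = tmap_tp[OF f linear_map_id, folded M_def]
  show ?thesis unfolding M_def[symmetric] using u
proof (induction n arbitrary: u)
  case 0
  then show ?case
    using linear_map_zero[OF TP.T_k_algebra TP.T_k_algebra l] by simp
next
  case (Suc n)
  then obtain t v where tv: "t \<in> TV Q" "v \<in> Y.F n" "u = t \<otimes>\<^bsub>HH\<^esub> Y [^]\<^bsub>HH\<^esub> n \<oplus>\<^bsub>HH\<^esub> v"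
    by (auto simp: fil.simps(2))
  have "M t \<in> TV Q"
    by (rule TP.tensor_sub_linear[OF TP.T_k_algebra l TVD(1)[OF sQ] subset_refl X.Q_sub[THEN subsetI] _ tv(1)])
      (use X.Q_sub TVD(5)[OF sQ] in \<open>auto simp: p linear_mapD(1)[OF f]\<close>)
  moreover have "M u = M t \<otimes>\<^bsub>HH\<^esub> Y [^]\<^bsub>HH\<^esub> n \<oplus>\<^bsub>HH\<^esub> M v"
    using Y.Q_sub[OF tv(1)] Y.F_closed[OF tv(2)]
    by (simp add: tv(3) linear_mapD(2)[OF l] tp_one_pow tmap_id_mult[OF f, folded M_def])
  ultimately show ?case using Y.FI[OF _ Suc.IH[OF tv(2)]] by simp
qed
qed

text \<open>Top coefficients do not cancel in the domain \<open>H \<otimes> Q\<close>, so the degree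
  of the \<open>m\<close>-th power is exactly \<open>m\<close> times \<open>n\<close>.\<close>

lemma lead_E_pow:
  assumes "Y.lead n (E x) K" "K \<noteq> \<zero>\<^bsub>HH\<^esub>"
  shows "\<exists>t. t \<noteq> \<zero>\<^bsub>HH\<^esub> \<and> Y.lead (m * n) (E x [^]\<^bsub>HH\<^esub> m) t"
proof (induction m)
  case 0
  have "\<one>\<^bsub>HH\<^esub> \<noteq> \<zero>\<^bsub>HH\<^esub>" using E_nonzero[OF A.one_closed one_not_zero] E(5) by simp
  moreover have "Y.lead 0 \<one>\<^bsub>HH\<^esub> \<one>\<^bsub>HH\<^esub>" by (rule Y.leadI[of _ "\<zero>\<^bsub>HH\<^esub>"]) (use Y.Qs in auto)
  ultimately show ?case by auto
next
  case (Suc m)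
  then obtain t where t: "t \<noteq> \<zero>\<^bsub>HH\<^esub>" "Y.lead (m * n) (E x [^]\<^bsub>HH\<^esub> m) t" by blast
  have "\<exists>t. t \<noteq> \<zero>\<^bsub>HH\<^esub> \<and> Y.lead (m * n + n) (E x [^]\<^bsub>HH\<^esub> m \<otimes>\<^bsub>HH\<^esub> E x) t"
    by (rule Y.lead_mult_dom[OF t(2) assms(1) t(1) assms(2)]) (rule dom')
  then show ?case by (simp add: add.commute)
qed

lemma E_fil:
  assumes "Y.lead n (E x) K" "K \<noteq> \<zero>\<^bsub>HH\<^esub>" "n > 0" "u \<in> X.F m"
  shows "E u \<in> Y.F (m * n)"
  using assms(4)
proof (induction m arbitrary: u)
  case 0
  then show ?case by (simp add: E_zero)
next
  case (Suc m)
  then obtain r v where rv: "r \<in> Q" "v \<in> X.F m" "u = r \<otimes>\<^bsub>H\<^esub> x [^]\<^bsub>H\<^esub> m \<oplus>\<^bsub>H\<^esub> v" by (auto simp: fil.simps(2))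
  have "E x [^]\<^bsub>HH\<^esub> m \<in> Y.F (Suc (m * n))" using lead_E_pow[OF assms(1,2)] Y.F_Suc_lead by blast
  \<comment> \<open>The inequality \<open>m n + 1 \<le> (m + 1) n\<close> is where
    \<open>n > 0\<close> is used.\<close>
  then have "E x [^]\<^bsub>HH\<^esub> m \<in> Y.F (Suc m * n)" using Y.F_mono[of "Suc (m * n)" "Suc m * n"] assms(3) by simp
  moreover have "E v \<in> Y.F (Suc m * n)" using Y.F_mono[OF _ Suc.IH[OF rv(2)]] by simp
  moreover have "E u = E r \<otimes>\<^bsub>HH\<^esub> E x [^]\<^bsub>HH\<^esub> m \<oplus>\<^bsub>HH\<^esub> E v"
    using X.Q_sub[OF rv(1)] X.F_closed[OF rv(2)] by (simp add: rv(3) E E_pow)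
  ultimately show ?case using Y.F_add Y.F_lmult[OF E_Q[OF rv(1)]] by simp
qed

text \<open>If \<open>E x\<close> has degree \<open>n\<close> in the second variable, choose a functional \<open>f\<close> for which
  \<open>h = (f \<otimes> id)(E x)\<close> still has degree \<open>n\<close>. Then \<open>E h\<close> has degree \<open>n\<^sup>2\<close>, whereas coassociativity
  bounds it by \<open>n\<close>; hence \<open>n = 1\<close>.\<close>

lemma E_degree_one: "\<exists>K. Y.lead 1 (E x) K"
proof -
  have "E x \<in> TV C"
    using E_sub[OF C x_C] TP.tensor_sub_mono[OF subalgD(3)[OF hopf_subD(1)[OF C]] subset_refl] by blast
  then obtain N where N: "E x \<in> Y.F N" using TV_fil[OF sQ sf] unfolding C_eq by blast
  have "x \<noteq> \<zero>\<^bsub>H\<^esub>" using x_notin X.Q_zero by blast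
  then obtain n K where K: "K \<noteq> \<zero>\<^bsub>HH\<^esub>" "Y.lead n (E x) K" using Y.ex_lead[OF N E_nonzero[OF X.x]] by blast
  \<comment> \<open>In degree zero the counit slice of \<open>E x\<close>, which is
    \<open>x\<close>, would lie in \<open>Q\<close>.\<close>
  have n0: "n \<noteq> 0"
  proof
    assume "n = 0"
    then have "E x \<in> TV Q" using K(2) Y.F_Suc_lead Y.F_one by blast
    then have "lsl eps (E x) \<in> Q" by (rule TVD(4)[OF sQ _ eps_functional])
    then show False using E_left[OF X.x] x_notin by simp
  qed
  have "\<not> 1 < n"
  proof
    assume n1: "1 < n"
    obtain U where U: "K \<in> TV Q" "U \<in> Y.F n" "E x = K \<otimes>\<^bsub>HH\<^esub> Y [^]\<^bsub>HH\<^esub> n \<oplus>\<^bsub>HH\<^esub> U"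
      using K(2) by (auto simp: Y.lead_def)
    note c = Y.Q_sub[OF U(1)] Y.F_closed[OF U(2)]
    obtain f where f: "f \<in> dual" "lsl f K \<noteq> \<zero>\<^bsub>H\<^esub>" using TP.slices_zero[OF c(1)] K(1) by blast
    define r where "r = lsl f K"
    define u where "u = lsl f U"
    have r: "r \<in> Q" "r \<noteq> \<zero>\<^bsub>H\<^esub>" using TVD(4)[OF sQ U(1) f(1)] f(2) by (auto simp: r_def)
    have u: "u \<in> X.F n" unfolding u_def by (rule lsl_fil[OF sQ sf f(1) U(2)])
    have h: "lsl f (E x) = r \<otimes>\<^bsub>H\<^esub> x [^]\<^bsub>H\<^esub> n \<oplus>\<^bsub>H\<^esub> u"
      using c f(1) by (simp add: U(3) linear_mapD[OF TP.lslice_linear] lsl_pow[OF sQ sf] r_def u_def)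
    have l: "(\<lambda>y. lsl f (E y)) \<in> linear_map k H H"
      by (rule linear_map_comp[OF E_linear TP.lslice_linear[OF f(1)]])
    \<comment> \<open>By coassociativity this element is \<open>E x\<close> with a linear map
      applied to the first factor, so its degree in the second is at most \<open>n\<close>.\<close>
    have "E (lsl f (E x)) \<in> Y.F (Suc n)"
      unfolding E_coassoc[OF f(1) X.x] by (rule tmap_fil[OF l]) (use K(2) Y.F_Suc_lead in blast)
    moreover have "Suc n \<le> n * n" using n1 by (induction n) auto
    ultimately have small: "E (lsl f (E x)) \<in> Y.F (n * n)" using Y.F_mono by blast
    obtain t where t: "t \<noteq> \<zero>\<^bsub>HH\<^esub>" "Y.lead (n * n) (E x [^]\<^bsub>HH\<^esub> n) t" using lead_E_pow[OF K(2,1)] by blast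
    have lr: "Y.lead 0 (E r) (E r)"
      by (rule Y.leadI[of _ "\<zero>\<^bsub>HH\<^esub>"]) (use E_Q[OF r(1)] Y.Q_sub in auto)
    have "\<exists>t. t \<noteq> \<zero>\<^bsub>HH\<^esub> \<and> Y.lead (0 + n * n) (E r \<otimes>\<^bsub>HH\<^esub> E x [^]\<^bsub>HH\<^esub> n) t"
      by (rule Y.lead_mult_dom[OF lr t(2) E_nonzero[OF X.Q_sub[OF r(1)] r(2)] t(1)]) (rule dom')
    then obtain t' where t': "t' \<noteq> \<zero>\<^bsub>HH\<^esub>" "Y.lead (n * n) (E r \<otimes>\<^bsub>HH\<^esub> E x [^]\<^bsub>HH\<^esub> n) t'"
      by auto
    have "E (lsl f (E x)) = E r \<otimes>\<^bsub>HH\<^esub> E x [^]\<^bsub>HH\<^esub> n \<oplus>\<^bsub>HH\<^esub> E u"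
      using X.Q_sub[OF r(1)] X.F_closed[OF u] by (simp add: h E E_pow)
    \<comment> \<open>The rest \<open>u\<close> of the slice has degree below \<open>n\<close>, so
      its image has degree below the square of \<open>n\<close> and cannot cancel the top
      term.\<close>
    moreover have "Y.lead (n * n) (E r \<otimes>\<^bsub>HH\<^esub> E x [^]\<^bsub>HH\<^esub> n \<oplus>\<^bsub>HH\<^esub> E u) t'"
      by (rule Y.lead_add_F[OF t'(2) E_fil[OF K(2,1) _ u]]) (use n1 in simp)
    ultimately have "Y.lead (n * n) (E (lsl f (E x))) t'" by simp
    from Y.lead_F_zero[OF this small] show False using t'(1) by simp
  qed
  then have "n = 1" using n0 by simp
  then show ?thesis using K(2) by blast
qed

text \<open>Put \<open>\<phi> = (f \<otimes> id) E\<close>, \<open>r = (f \<otimes> id) K\<close>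
  and \<open>h = (id \<otimes> \<epsilon>) K\<close>. Comparing coefficients of
  \<open>1 \<otimes> x\<close> in the coassociativity law gives
  \<open>E(r) K = (\<phi> \<otimes> id) K\<close> for every \<open>f\<close>. The counit, an algebra
  map, applied to the second factor turns this into \<open>r h = \<phi>(h)\<close>, and these
  equations are the slices of the asserted identity for \<open>h\<close>.\<close>

lemma E_normal:
  obtains K K' where "K \<in> TV Q" "K' \<in> TV Q" "E x = K \<otimes>\<^bsub>HH\<^esub> Y \<oplus>\<^bsub>HH\<^esub> K'"
    "E (rsl eps K) = K \<otimes>\<^bsub>HH\<^esub> tp \<one>\<^bsub>H\<^esub> (rsl eps K)" "eps (rsl eps K) = \<one>\<^bsub>k\<^esub>"
proof -
  obtain K where "Y.lead 1 (E x) K" using E_degree_one by blast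
  then obtain K' where K: "K \<in> TV Q" "K' \<in> TV Q" "E x = K \<otimes>\<^bsub>HH\<^esub> Y \<oplus>\<^bsub>HH\<^esub> K'"
    using Y.F_one by (auto simp: Y.lead_def)
  note c = Y.Q_sub[OF K(1)] Y.Q_sub[OF K(2)]
  define h where "h = rsl eps K"
  have hc: "h \<in> carrier H" unfolding h_def by (rule linear_mapD(1)[OF TP.rslice_linear[OF eps_functional] c(1)])
  have slice: "lsl f (E x) = lsl f K \<otimes>\<^bsub>H\<^esub> x \<oplus>\<^bsub>H\<^esub> lsl f K'" if "f \<in> dual" for f
    using c that by (simp add: K(3) linear_mapD[OF TP.lslice_linear] TP.lslice_mult_one)
  have lead1: "X.lead 1 (r \<otimes>\<^bsub>H\<^esub> x \<oplus>\<^bsub>H\<^esub> s) r" if "r \<in> Q" "s \<in> Q" for r s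
    by (rule X.leadI[of _ s]) (use that X.F_one in auto)
  have leadY: "Y.lead 1 (t \<otimes>\<^bsub>HH\<^esub> Y \<oplus>\<^bsub>HH\<^esub> s) t" if "t \<in> TV Q" "s \<in> TV Q" for t s
    by (rule Y.leadI[of _ s]) (use that Y.F_one in auto)
  \<comment> \<open>Slicing \<open>E x\<close> by the counit returns \<open>x\<close>, whose
    coefficient at \<open>x\<close> is \<open>1\<close>; so the left counit slice of
    \<open>K\<close> is \<open>1\<close>, and \<open>h\<close> has counit \<open>1\<close>.\<close>
  have "X.lead 1 x (lsl eps K)"
    using lead1[OF TVD(4)[OF sQ K(1) eps_functional] TVD(4)[OF sQ K(2) eps_functional]]
      slice[OF eps_functional] E_left[OF X.x] by simp
  moreover have "X.lead 1 x \<one>\<^bsub>H\<^esub>"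
    using lead1[OF X.Qs(2) X.Q_zero] by simp
  ultimately have "lsl eps K = \<one>\<^bsub>H\<^esub>" using X.lead_unique by blast
  then have eps_h: "eps h = \<one>\<^bsub>k\<^esub>" using eps_slices[OF c(1)] by (simp add: h_def eps)
  have "E h = K \<otimes>\<^bsub>HH\<^esub> tp \<one>\<^bsub>H\<^esub> h"
  proof (rule TP.slices_eqI)
    fix f assume f: "f \<in> dual"
    define \<phi> where "\<phi> y = lsl f (E y)" for y
    have l: "\<phi> \<in> linear_map k H H"
      unfolding \<phi>_def by (rule linear_map_comp[OF E_linear TP.lslice_linear[OF f]])
    define r where "r = lsl f K"
    define s where "s = lsl f K'"
    have rs: "r \<in> Q" "s \<in> Q" using TVD(4)[OF sQ K(1) f] TVD(4)[OF sQ K(2) f] by (auto simp: r_def s_def)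
    have "E (lsl f (E x)) = (E r \<otimes>\<^bsub>HH\<^esub> K) \<otimes>\<^bsub>HH\<^esub> Y \<oplus>\<^bsub>HH\<^esub> (E r \<otimes>\<^bsub>HH\<^esub> K' \<oplus>\<^bsub>HH\<^esub> E s)"
      unfolding slice[OF f] r_def[symmetric] s_def[symmetric]
      using X.Q_sub[OF rs(1)] X.Q_sub[OF rs(2)] c
      by (simp add: E, simp add: K(3) E TP.T.A.r_distr TP.T.A.m_assoc TP.T.V.M.a_assoc)
    then have 1: "Y.lead 1 (E (lsl f (E x))) (E r \<otimes>\<^bsub>HH\<^esub> K)"
      using leadY TVD(6)[OF sQ] E_Q rs K(1,2) Y.Qs(5) by simp
    have tQ: "tmap \<phi> id t \<in> TV Q" if "t \<in> TV Q" for t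
      using tmap_fil[OF l, of t 1] Y.F_one that by simp
    have "E (lsl f (E x)) = tmap \<phi> id (E x)"
      using E_coassoc[OF f X.x] by (simp add: \<phi>_def[abs_def])
    also have "\<dots> = tmap \<phi> id K \<otimes>\<^bsub>HH\<^esub> Y \<oplus>\<^bsub>HH\<^esub> tmap \<phi> id K'"
      using c by (simp add: K(3) linear_mapD[OF tmap_linear[OF l linear_map_id]] tmap_id_mult[OF l])
    finally have 2: "Y.lead 1 (E (lsl f (E x))) (tmap \<phi> id K)" using leadY tQ K(1,2) by simp
    have eq: "E r \<otimes>\<^bsub>HH\<^esub> K = tmap \<phi> id K" by (rule Y.lead_unique[OF 1 2])
    have "lsl f (E h) = rsl eps (tmap \<phi> id K)"
      by (simp add: rsl_eps_tmap[OF l c(1)] \<phi>_def h_def)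
    also have "\<dots> = r \<otimes>\<^bsub>H\<^esub> h"
      unfolding eq[symmetric] using X.Q_sub[OF rs(1)] c
      by (simp add: TP.rslice_hom[OF eps_functional counit_hom] E E_right h_def)
    also have "\<dots> = lsl f (K \<otimes>\<^bsub>HH\<^esub> tp \<one>\<^bsub>H\<^esub> h)"
      using c hc f by (simp add: TP.lslice_mult_one r_def)
    finally show "lsl f (E h) = lsl f (K \<otimes>\<^bsub>HH\<^esub> tp \<one>\<^bsub>H\<^esub> h)" .
  qed (use hc c E in auto)
  then show ?thesis using that K eps_h unfolding h_def by blast
qed

end

end

section \<open>Coefficient functionals and the shape of the comultiplication of a variable\<close>

context hopf_algebra
begin

abbreviation "sw \<equiv> tensor_swap k H H"

lemma comul_coassoc_hom: "coassoc_hom k H D"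
proof (intro coassoc_hom.intro hopf_algebra_axioms coassoc_hom_axioms.intro)
  show "D (lsl f (D y)) = tmap (\<lambda>y. lsl f (D y)) id (D y)" if "f \<in> dual" "y \<in> carrier H" for f y
    using coassoc_left[OF that] by (simp add: L_def[abs_def])
qed (use comul_hom comul_linear counit_left counit_right hopf_subD(2) in auto)

text \<open>Left slices of the opposite comultiplication are the maps \<open>R f\<close>; its
  coassociativity law is \<open>coassoc_right\<close> followed by the flip.\<close>

lemma sw_comul_coassoc_hom: "coassoc_hom k H (\<lambda>y. sw (D y))"
proof (intro coassoc_hom.intro hopf_algebra_axioms coassoc_hom_axioms.intro)
  note sl = linear_mapD[OF TP.swap_linear]
  show "(\<lambda>y. sw (D y)) \<in> ring_hom H HH"
    by (rule ring_hom_memI) (simp_all add: D sl TP.swap_mult TP.swap_one)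
  show "(\<lambda>y. sw (D y)) \<in> linear_map k H HH" by (rule linear_map_comp[OF comul_linear TP.swap_linear])
  show "lsl eps (sw (D y)) = y" "rsl eps (sw (D y)) = y" if "y \<in> carrier H" for y
    using that by (simp_all add: TP.lslice_swap TP.rslice_swap D eps_functional counit_left counit_right)
  show "sw (D y) \<in> tsub C C" if "hopf_subalgebra k H C" "y \<in> C" for C y
    using TP.swap_tensor_sub[OF _ _ hopf_subD(2)[OF that]] subalgD(3)[OF hopf_subD(1)[OF that(1)]] by blast
  fix f y assume f: "f \<in> dual" and y: "y \<in> carrier H"
  have eq: "lsl f (sw (D z)) = R f z" if "z \<in> carrier H" for z
    using f that by (simp add: TP.lslice_swap D R_def)
  have l: "(\<lambda>z. lsl f (sw (D z))) \<in> linear_map k H H"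
    by (rule linear_map_comp[OF linear_map_comp[OF comul_linear TP.swap_linear] TP.lslice_linear[OF f]])
  note R = R_linear[OF f]
  have "sw (tmap id (R f) t) = tmap (\<lambda>z. lsl f (sw (D z))) id (sw t)" if "t \<in> carrier HH" for t
    by (rule TP.tensor_ext[OF linear_map_comp[OF tmap_linear[OF linear_map_id R] TP.swap_linear]
          linear_map_comp[OF TP.swap_linear tmap_linear[OF l linear_map_id]] that])
      (use linear_mapD(1)[OF R] in \<open>simp add: tmap_tp[OF linear_map_id R, unfolded id_apply]
        tmap_tp[OF l linear_map_id] TP.swap_pt eq tmap_tp[OF linear_map_id R]\<close>)
  then show "sw (D (lsl f (sw (D y)))) = tmap (\<lambda>y. lsl f (sw (D y))) id (sw (D y))"
    using coassoc_right[OF f y] y eq[OF y] by (simp add: D)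
qed

text \<open>On left polynomials of degree at most \<open>n\<close>, \<psi> is the counit of the
  coefficient at \<open>x^n\<close>, and it is extended somehow to \<open>H\<close>. It is obtained
  as a functional that vanishes on \<open>V\<close>, where the top coefficient has counit zero, and
  is \<open>1\<close> on \<open>x^n\<close>.\<close>

lemma skew_functional:
  assumes "skew_free H Q x" "submodule Q k H"
  obtains \<psi> where "\<psi> \<in> dual" "\<And>u. u \<in> fil H Q x n \<Longrightarrow> \<psi> u = \<zero>\<^bsub>k\<^esub>"
    "\<And>r. r \<in> Q \<Longrightarrow> \<psi> (r \<otimes>\<^bsub>H\<^esub> x [^]\<^bsub>H\<^esub> n) = eps r"
proof -
  interpret X: skew_free H Q x by fact
  note F = submod[OF fil_submodule[OF X.skew_gen_axioms assms(2), of n]]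
  define V where "V = {r \<otimes>\<^bsub>H\<^esub> x [^]\<^bsub>H\<^esub> n \<oplus>\<^bsub>H\<^esub> u | r u. r \<in> Q \<and> eps r = \<zero>\<^bsub>k\<^esub> \<and> u \<in> X.F n}"
  have VI: "r \<otimes>\<^bsub>H\<^esub> x [^]\<^bsub>H\<^esub> n \<oplus>\<^bsub>H\<^esub> u \<in> V" if "r \<in> Q" "eps r = \<zero>\<^bsub>k\<^esub>" "u \<in> X.F n" for r u
    using that unfolding V_def by blast
  have VE: "\<exists>r u. r \<in> Q \<and> eps r = \<zero>\<^bsub>k\<^esub> \<and> u \<in> X.F n \<and> v = r \<otimes>\<^bsub>H\<^esub> x [^]\<^bsub>H\<^esub> n \<oplus>\<^bsub>H\<^esub> u" if "v \<in> V" for v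
    using that unfolding V_def by blast
  have FV: "u \<in> V" if "u \<in> X.F n" for u
    using VI[OF X.Q_zero _ that] X.F_closed[OF that] by (simp add: eps)
  have QV: "r \<otimes>\<^bsub>H\<^esub> x [^]\<^bsub>H\<^esub> n \<in> V" if "r \<in> Q" "eps r = \<zero>\<^bsub>k\<^esub>" for r
    using VI[OF that X.F_zero] X.Q_sub[OF that(1)] by simp
  have V: "submodule V k H"
  proof (rule submoduleI')
    fix v w assume "v \<in> V" "w \<in> V"
    then obtain r u r' u' where *: "r \<in> Q" "eps r = \<zero>\<^bsub>k\<^esub>" "u \<in> X.F n" "v = r \<otimes>\<^bsub>H\<^esub> x [^]\<^bsub>H\<^esub> n \<oplus>\<^bsub>H\<^esub> u"
      "r' \<in> Q" "eps r' = \<zero>\<^bsub>k\<^esub>" "u' \<in> X.F n" "w = r' \<otimes>\<^bsub>H\<^esub> x [^]\<^bsub>H\<^esub> n \<oplus>\<^bsub>H\<^esub> u'" using VE by meson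
    have "v \<oplus>\<^bsub>H\<^esub> w = (r \<oplus>\<^bsub>H\<^esub> r') \<otimes>\<^bsub>H\<^esub> x [^]\<^bsub>H\<^esub> n \<oplus>\<^bsub>H\<^esub> (u \<oplus>\<^bsub>H\<^esub> u')"
      using * X.Q_sub X.F_closed by (simp add: A.l_distr V.M.a_ac)
    then show "v \<oplus>\<^bsub>H\<^esub> w \<in> V" using VI[of "r \<oplus>\<^bsub>H\<^esub> r'" "u \<oplus>\<^bsub>H\<^esub> u'"] * X.Q_sub X.Qs(5) F(2) by (simp add: eps)
  next
    fix c v assume c: "c \<in> carrier k" and "v \<in> V"
    then obtain r u where *: "r \<in> Q" "eps r = \<zero>\<^bsub>k\<^esub>" "u \<in> X.F n" "v = r \<otimes>\<^bsub>H\<^esub> x [^]\<^bsub>H\<^esub> n \<oplus>\<^bsub>H\<^esub> u" using VE by meson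
    have "c \<odot>\<^bsub>H\<^esub> v = (c \<odot>\<^bsub>H\<^esub> r) \<otimes>\<^bsub>H\<^esub> x [^]\<^bsub>H\<^esub> n \<oplus>\<^bsub>H\<^esub> c \<odot>\<^bsub>H\<^esub> u"
      using * c X.Q_sub X.F_closed by (simp add: V.smult_r_distr smult_mult_left)
    then show "c \<odot>\<^bsub>H\<^esub> v \<in> V"
      using VI[OF submod_smult[OF assms(2) c *(1)] _ F(3)[OF c *(3)]] * c X.Q_sub by (simp add: eps)
  next
    show "v \<in> carrier H" if "v \<in> V" for v using VE[OF that] X.Q_sub X.F_closed by auto
    show "\<zero>\<^bsub>H\<^esub> \<in> V" by (rule FV[OF X.F_zero])
  qed
  have "x [^]\<^bsub>H\<^esub> n \<notin> V"
  proof
    assume "x [^]\<^bsub>H\<^esub> n \<in> V"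
    then obtain r u where *: "r \<in> Q" "eps r = \<zero>\<^bsub>k\<^esub>" "u \<in> X.F n" "x [^]\<^bsub>H\<^esub> n = r \<otimes>\<^bsub>H\<^esub> x [^]\<^bsub>H\<^esub> n \<oplus>\<^bsub>H\<^esub> u" using VE by meson
    have "X.lead n (x [^]\<^bsub>H\<^esub> n) \<one>\<^bsub>H\<^esub>" by (rule X.leadI[of _ "\<zero>\<^bsub>H\<^esub>"]) (use X.Qs X.F_zero in auto)
    moreover have "X.lead n (x [^]\<^bsub>H\<^esub> n) r" by (rule X.leadI[OF *(1,3,4)])
    ultimately have "r = \<one>\<^bsub>H\<^esub>" using X.lead_unique by blast
    then show False using *(2) by (simp add: eps)
  qed
  then obtain \<psi> where \<psi>: "\<psi> \<in> dual" "\<And>v. v \<in> V \<Longrightarrow> \<psi> v = \<zero>\<^bsub>k\<^esub>" "\<psi> (x [^]\<^bsub>H\<^esub> n) = \<one>\<^bsub>k\<^esub>"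
    using ex_functional[OF V] by (metis A.nat_pow_closed X.x)
  have "\<psi> (r \<otimes>\<^bsub>H\<^esub> x [^]\<^bsub>H\<^esub> n) = eps r" if r: "r \<in> Q" for r
  proof -
    note rc = X.Q_sub[OF r]
    \<comment> \<open>\<open>s = r - \<epsilon>(r) 1\<close> has counit zero, so only the multiple
      of \<open>x^n\<close> contributes to the value.\<close>
    define s where "s = r \<oplus>\<^bsub>H\<^esub> (\<ominus>\<^bsub>k\<^esub> eps r) \<odot>\<^bsub>H\<^esub> \<one>\<^bsub>H\<^esub>"
    have s: "s \<in> Q" unfolding s_def using r rc X.Qs submod_smult[OF assms(2)] by (simp add: eps)
    have "eps s = \<zero>\<^bsub>k\<^esub>" using rc by (simp add: s_def eps K.r_neg)
    then have "\<psi> (s \<otimes>\<^bsub>H\<^esub> x [^]\<^bsub>H\<^esub> n) = \<zero>\<^bsub>k\<^esub>" using \<psi>(2) QV[OF s] by blast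
    moreover have "r \<otimes>\<^bsub>H\<^esub> x [^]\<^bsub>H\<^esub> n = s \<otimes>\<^bsub>H\<^esub> x [^]\<^bsub>H\<^esub> n \<oplus>\<^bsub>H\<^esub> eps r \<odot>\<^bsub>H\<^esub> x [^]\<^bsub>H\<^esub> n"
      using rc by (simp add: s_def A.l_distr smult_mult_left eps V.smult_l_minus A.l_minus V.M.a_assoc V.M.l_neg)
    ultimately show ?thesis using rc X.Q_sub[OF s] \<psi>(3) by (simp add: functionalD[OF \<psi>(1)] eps)
  qed
  then show ?thesis using that \<psi>(1,2) FV by blast
qed

lemma rsl_tsub_zero:
  assumes "t \<in> tsub V W" "V \<subseteq> carrier H" "W \<subseteq> carrier H" "f \<in> dual" "\<And>w. w \<in> W \<Longrightarrow> f w = \<zero>\<^bsub>k\<^esub>"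
  shows "rsl f t = \<zero>\<^bsub>H\<^esub>"
proof -
  have "rsl f t \<in> {\<zero>\<^bsub>H\<^esub>}"
    by (rule TP.tensor_sub_linear[OF k_algebra_axioms TP.rslice_linear[OF assms(4)] submodule_zero assms(2,3) _ assms(1)])
      (use assms in \<open>auto simp: TP.rslice_pt subset_iff\<close>)
  then show ?thesis by simp
qed

lemma lsl_tsub_zero:
  assumes "t \<in> tsub V W" "V \<subseteq> carrier H" "W \<subseteq> carrier H" "f \<in> dual" "\<And>w. w \<in> V \<Longrightarrow> f w = \<zero>\<^bsub>k\<^esub>"
  shows "lsl f t = \<zero>\<^bsub>H\<^esub>"
proof -
  have "lsl f t \<in> {\<zero>\<^bsub>H\<^esub>}"
    by (rule TP.tensor_sub_linear[OF k_algebra_axioms TP.lslice_linear[OF assms(4)] submodule_zero assms(2,3) _ assms(1)])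
      (use assms in \<open>auto simp: TP.lslice_pt subset_iff\<close>)
  then show ?thesis by simp
qed

lemma tmap_tsub_eq:
  assumes "f \<in> linear_map k HH HH" "g \<in> linear_map k HH HH" "V \<subseteq> carrier H" "W \<subseteq> carrier H"
    and "\<And>v w. \<lbrakk>v \<in> V; w \<in> W\<rbrakk> \<Longrightarrow> f (tp v w) = g (tp v w)" "t \<in> tsub V W"
  shows "f t = g t"
  by (rule TP.tensor_sub_induct[OF assms(6,3,4), of "\<lambda>t. f t = g t"])
    (simp_all add: assms(5) linear_mapD[OF assms(1)] linear_mapD[OF assms(2)]
      linear_map_zero[OF TP.T_k_algebra TP.T_k_algebra assms(1)] linear_map_zero[OF TP.T_k_algebra TP.T_k_algebra assms(2)])

text \<open>\<open>E_normal\<close> is used for the comultiplication and for its opposite. The first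
  gives \<open>D h = K (1 \<otimes> h)\<close>; the antipode makes \<open>h\<close> a right factor
  of \<open>1\<close>, so \<open>h = 1\<close> and \<open>K = 1\<close>. For the coefficient
  \<open>G\<close> of the second, coassociativity in the middle factor gives
  \<open>G = u \<otimes> 1\<close> with \<open>u\<close> group-like, hence \<open>u = 1\<close>.
  Comparing the two forms of \<open>D x\<close> confines the remainder to \<open>Q\<close> on both
  sides.\<close>

lemma comul_variable:
  assumes chain: "ore_chain C n" and i: "i < n" and step: "ore_step (C (Suc i)) (C i) x"
  shows "\<exists>w\<in>tsub (C i) (C i). D x = tp x \<one>\<^bsub>H\<^esub> \<oplus>\<^bsub>HH\<^esub> tp \<one>\<^bsub>H\<^esub> x \<oplus>\<^bsub>HH\<^esub> w"
proof -
  define Q where "Q = C i"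
  have hC: "hopf_subalgebra k H (C (Suc i))" and hQ: "hopf_subalgebra k H Q"
    using chainD(1)[OF chain] i by (auto simp: Q_def)
  have step': "ore_step (C (Suc i)) Q x" using step by (simp add: Q_def)
  have dom: "TP.T.dom_set (TV Q)" using chain_TV_dom[OF chain, of i] i by (simp add: Q_def)
  have sQ: "subalg k H Q" by (rule hopf_subD(1)[OF hQ])
  note qs = subalgD[OF sQ]
  have sf: "skew_free H Q x" using step' by (simp add: ore_step_def)
  interpret X: skew_free H Q x by (rule sf)
  have one: "tp \<one>\<^bsub>H\<^esub> \<one>\<^bsub>H\<^esub> = \<one>\<^bsub>HH\<^esub>" by (simp add: TP.T_one)
  interpret E: coassoc_hom k H D by (rule comul_coassoc_hom)
  obtain K K' where K: "K \<in> TV Q" "K' \<in> TV Q" "D x = K \<otimes>\<^bsub>HH\<^esub> tp \<one>\<^bsub>H\<^esub> x \<oplus>\<^bsub>HH\<^esub> K'"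
    "D (rsl eps K) = K \<otimes>\<^bsub>HH\<^esub> tp \<one>\<^bsub>H\<^esub> (rsl eps K)" "eps (rsl eps K) = \<one>\<^bsub>k\<^esub>"
    using E.E_normal[OF hC hQ step' dom] by blast
  note Kc = TVD(3)[OF sQ K(1)] TVD(3)[OF sQ K(2)]
  define h where "h = rsl eps K"
  have h: "h \<in> carrier H" unfolding h_def by (rule linear_mapD(1)[OF TP.rslice_linear[OF eps_functional] Kc(1)])
  \<comment> \<open>Multiplying out with the antipode on the first factor leaves the right factor
    \<open>h\<close> outside.\<close>
  have "mulS K \<otimes>\<^bsub>H\<^esub> h = mulS (D h)"
    using K(4) Kc(1) h by (simp add: mulS_mult h_def[symmetric])
  also have "\<dots> = \<one>\<^bsub>H\<^esub>" using antipode_left[OF h] K(5) by (simp add: h_def[symmetric])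
  finally have h1: "h = \<one>\<^bsub>H\<^esub>"
    using left_inverse_one[OF chain _ h] linear_mapD(1)[OF mulS_linear Kc(1)] K(5) by (simp add: h_def)
  then have "K = \<one>\<^bsub>HH\<^esub>" using K(4) Kc(1) by (simp add: h_def[symmetric] D one)
  then have Dx: "D x = tp \<one>\<^bsub>H\<^esub> x \<oplus>\<^bsub>HH\<^esub> K'" using K(3) Kc by simp
  interpret E': coassoc_hom k H "\<lambda>y. sw (D y)" by (rule sw_comul_coassoc_hom)
  obtain G G' where G: "G \<in> TV Q" "G' \<in> TV Q" "sw (D x) = G \<otimes>\<^bsub>HH\<^esub> tp \<one>\<^bsub>H\<^esub> x \<oplus>\<^bsub>HH\<^esub> G'"
    "sw (D (rsl eps G)) = G \<otimes>\<^bsub>HH\<^esub> tp \<one>\<^bsub>H\<^esub> (rsl eps G)" "eps (rsl eps G) = \<one>\<^bsub>k\<^esub>"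
    using E'.E_normal[OF hC hQ step' dom] by blast
  note Gc = TVD(3)[OF sQ G(1)] TVD(3)[OF sQ G(2)]
  note sl = linear_mapD[OF TP.swap_linear]
  define G1 where "G1 = sw G"
  define G2 where "G2 = sw G'"
  have G12: "G1 \<in> tsub Q (carrier H)" "G2 \<in> tsub Q (carrier H)"
    unfolding G1_def G2_def by (rule TP.swap_tensor_sub[OF subset_refl qs(3)], fact G)+
  have G12c: "G1 \<in> carrier HH" "G2 \<in> carrier HH" unfolding G1_def G2_def using Gc sl by auto
  have "D x = sw (sw (D x))" by (simp add: TP.swap_swap D)
  also have "\<dots> = G1 \<otimes>\<^bsub>HH\<^esub> tp x \<one>\<^bsub>H\<^esub> \<oplus>\<^bsub>HH\<^esub> G2"
    unfolding G(3) G1_def G2_def using Gc by (simp add: sl TP.swap_mult TP.swap_pt)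
  finally have Dx': "D x = G1 \<otimes>\<^bsub>HH\<^esub> tp x \<one>\<^bsub>H\<^esub> \<oplus>\<^bsub>HH\<^esub> G2" .
  obtain \<psi> where \<psi>: "\<psi> \<in> dual" "\<And>u. u \<in> Q \<Longrightarrow> \<psi> u = \<zero>\<^bsub>k\<^esub>" "\<And>r. r \<in> Q \<Longrightarrow> \<psi> (r \<otimes>\<^bsub>H\<^esub> x) = eps r"
    using skew_functional[OF sf qs(1), of 1] X.F_one by auto
  have DQ: "D r \<in> tsub Q Q" "D r \<in> TV Q" if "r \<in> Q" for r
    using hopf_subD(2)[OF hQ that] TP.tensor_sub_mono[OF qs(3) subset_refl] by auto
  have RQ: "R \<psi> r = \<zero>\<^bsub>H\<^esub>" "L \<psi> r = \<zero>\<^bsub>H\<^esub>" if "r \<in> Q" for r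
    unfolding R_def L_def
    using rsl_tsub_zero[OF DQ(1)[OF that] qs(3,3) \<psi>(1,2)] lsl_tsub_zero[OF DQ(1)[OF that] qs(3,3) \<psi>(1,2)] by auto
  note Rl = R_linear[OF \<psi>(1)] and Ll = L_linear[OF \<psi>(1)]
  \<comment> \<open>In \<open>D(r x) = D(r) (1 \<otimes> x + K')\<close> the part with
    \<open>K'\<close> has second factors in \<open>Q\<close> and is killed; the rest is the right
    counit slice of \<open>D r\<close>.\<close>
  have Rx: "R \<psi> (r \<otimes>\<^bsub>H\<^esub> x) = r" if r: "r \<in> Q" for r
  proof -
    note rc = X.Q_sub[OF r]
    note rsl = linear_mapD[OF TP.rslice_linear[OF \<psi>(1)]]
    have "R \<psi> (r \<otimes>\<^bsub>H\<^esub> x) = rsl \<psi> (D r \<otimes>\<^bsub>HH\<^esub> tp \<one>\<^bsub>H\<^esub> x) \<oplus>\<^bsub>H\<^esub> rsl \<psi> (D r \<otimes>\<^bsub>HH\<^esub> K')"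
      unfolding R_def using rc Kc by (simp add: D, simp add: Dx D rsl TP.T.A.r_distr)
    also have "rsl \<psi> (D r \<otimes>\<^bsub>HH\<^esub> K') = \<zero>\<^bsub>H\<^esub>"
      by (rule rsl_tsub_zero[OF TVD(6)[OF sQ DQ(2)[OF r] K(2)] subset_refl qs(3) \<psi>(1,2)])
    also have "rsl \<psi> (D r \<otimes>\<^bsub>HH\<^esub> tp \<one>\<^bsub>H\<^esub> x) = rsl eps (D r)"
      by (rule TP.tensor_sub_induct[OF DQ(2)[OF r] subset_refl qs(3), of "\<lambda>t. rsl \<psi> (t \<otimes>\<^bsub>HH\<^esub> tp \<one>\<^bsub>H\<^esub> x) = rsl eps t"])
        (use X.Q_sub linear_map_zero[OF TP.T_k_algebra k_algebra_axioms TP.rslice_linear] in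
          \<open>simp_all add: TP.pt_mult TP.rslice_pt \<psi> eps_functional rsl linear_mapD[OF TP.rslice_linear[OF eps_functional]]
            TP.T.A.l_distr TP.T.smult_mult_left\<close>)
    finally show ?thesis using R_eps[OF rc] rc by (simp add: R_def)
  qed
  \<comment> \<open>The two sides are evaluated on different forms of \<open>D x\<close>. On the
    left, in the form with \<open>G1\<close>, the map \<open>R \<psi>\<close> strips
    \<open>x\<close> from the first factors. On the right, in the form
    \<open>1 \<otimes> x + K'\<close>, only \<open>1 \<otimes> x\<close> survives.\<close>
  have "tmap (R \<psi>) id (D x) = tmap id (L \<psi>) (D x)" by (rule coassoc_middle[OF \<psi>(1) X.x])
  moreover have "tmap (R \<psi>) id (D x) = G1"
  proof -
    note l = tmap_linear[OF Rl linear_map_id]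
    have z: "(\<lambda>t. \<zero>\<^bsub>HH\<^esub>) \<in> linear_map k HH HH" by (rule linear_mapI) simp_all
    have rx: "(\<lambda>t. t \<otimes>\<^bsub>HH\<^esub> tp x \<one>\<^bsub>H\<^esub>) \<in> linear_map k HH HH"
      by (rule linear_mapI) (simp_all add: TP.T.A.l_distr TP.T.smult_mult_left)
    have "tmap (R \<psi>) id G2 = \<zero>\<^bsub>HH\<^esub>"
      by (rule tmap_tsub_eq[OF l z qs(3) subset_refl _ G12(2)])
        (use RQ X.Q_sub in \<open>simp add: tmap_tp[OF Rl linear_map_id]\<close>)
    moreover have "tmap (R \<psi>) id (G1 \<otimes>\<^bsub>HH\<^esub> tp x \<one>\<^bsub>H\<^esub>) = id G1"
      by (rule tmap_tsub_eq[OF linear_map_comp[OF rx l] linear_map_id qs(3) subset_refl _ G12(1)])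
        (use Rx X.Q_sub in \<open>simp add: tmap_tp[OF Rl linear_map_id] TP.pt_mult\<close>)
    ultimately show ?thesis unfolding Dx' using G12c by (simp add: linear_mapD[OF l])
  qed
  moreover have "tmap id (L \<psi>) (D x) = tp \<one>\<^bsub>H\<^esub> (L \<psi> x)"
  proof -
    define M where "M = tmap id (L \<psi>)"
    note l = tmap_linear[OF linear_map_id Ll, folded M_def] and p = tmap_tp[OF linear_map_id Ll, folded M_def, unfolded id_apply]
    have z: "(\<lambda>t. \<zero>\<^bsub>HH\<^esub>) \<in> linear_map k HH HH" by (rule linear_mapI) simp_all
    have "M K' = \<zero>\<^bsub>HH\<^esub>"
      by (rule tmap_tsub_eq[OF l z subset_refl qs(3) _ K(2)]) (use RQ X.Q_sub in \<open>simp add: p\<close>)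
    then show ?thesis unfolding Dx M_def[symmetric] using Kc linear_mapD(1)[OF Ll] by (simp add: linear_mapD[OF l] p)
  qed
  ultimately have G1_eq: "G1 = tp \<one>\<^bsub>H\<^esub> (L \<psi> x)" by simp
  define u where "u = L \<psi> x"
  have u: "u \<in> carrier H" unfolding u_def by (rule linear_mapD(1)[OF Ll X.x])
  have "G = sw G1" unfolding G1_def by (simp add: TP.swap_swap Gc)
  then have G_eq: "G = tp u \<one>\<^bsub>H\<^esub>" using u by (simp add: G1_eq u_def[symmetric] TP.swap_pt)
  then have ru: "rsl eps G = u" using u by (simp add: TP.rslice_pt eps_functional eps)
  have "sw (D u) = tp u u" using G(4) u unfolding ru by (simp add: G_eq TP.pt_mult)
  then have "D u = sw (tp u u)" using TP.swap_swap[of "D u"] u by (simp add: D)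
  then have "D u = tp u u" using u by (simp add: TP.swap_pt)
  then have "S u \<otimes>\<^bsub>H\<^esub> u = \<one>\<^bsub>H\<^esub>" using antipode_left[OF u] G(5) u by (simp add: mulS_tp ru)
  then have "u = \<one>\<^bsub>H\<^esub>" using left_inverse_one[OF chain _ u] S(1)[OF u] G(5) by (simp add: ru)
  then have "G1 = \<one>\<^bsub>HH\<^esub>" using G1_eq by (simp add: u_def one)
  then have Dx'': "D x = tp x \<one>\<^bsub>H\<^esub> \<oplus>\<^bsub>HH\<^esub> G2" using Dx' G12c by simp
  \<comment> \<open>The remainder has two expressions: \<open>K' - x \<otimes> 1\<close> shows that
    its left slices lie in \<open>Q\<close>, and \<open>G2 - 1 \<otimes> x\<close> does so for the
    right ones.\<close>
  define w where "w = K' \<ominus>\<^bsub>HH\<^esub> tp x \<one>\<^bsub>H\<^esub>"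
  have wc: "w \<in> carrier HH" unfolding w_def using Kc by simp
  have c: "tp x \<one>\<^bsub>H\<^esub> \<in> carrier HH" "tp \<one>\<^bsub>H\<^esub> x \<in> carrier HH" by simp_all
  have eq: "tp \<one>\<^bsub>H\<^esub> x \<oplus>\<^bsub>HH\<^esub> K' = tp x \<one>\<^bsub>H\<^esub> \<oplus>\<^bsub>HH\<^esub> G2" using Dx Dx'' by simp
  have "w = (tp \<one>\<^bsub>H\<^esub> x \<oplus>\<^bsub>HH\<^esub> K') \<ominus>\<^bsub>HH\<^esub> tp \<one>\<^bsub>H\<^esub> x \<ominus>\<^bsub>HH\<^esub> tp x \<one>\<^bsub>H\<^esub>"
    unfolding w_def using Kc c by (simp add: a_minus_def TP.T.V.M.a_ac TP.T.V.M.r_neg TP.T.V.M.r_neg1 TP.T.V.M.r_neg2)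
  also have "\<dots> = G2 \<ominus>\<^bsub>HH\<^esub> tp \<one>\<^bsub>H\<^esub> x"
    unfolding eq using G12c c by (simp add: a_minus_def TP.T.V.M.a_ac TP.T.V.M.r_neg TP.T.V.M.r_neg1 TP.T.V.M.r_neg2)
  finally have w2: "w = G2 \<ominus>\<^bsub>HH\<^esub> tp \<one>\<^bsub>H\<^esub> x" .
  have wQ: "w \<in> tsub Q Q"
  proof (rule TP.slices_both[OF wc qs(1) qs(1)])
    fix f assume f: "f \<in> dual"
    note l = TP.lslice_linear[OF f] and r = TP.rslice_linear[OF f]
    have "lsl f w = lsl f K' \<ominus>\<^bsub>H\<^esub> f x \<odot>\<^bsub>H\<^esub> \<one>\<^bsub>H\<^esub>"
      unfolding w_def using linear_map_diff[OF TP.T_k_algebra k_algebra_axioms l Kc(2) c(1)] by (simp add: TP.lslice_pt f)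
    then show "lsl f w \<in> Q"
      using submod_diff[OF qs(1) TVD(4)[OF sQ K(2) f] submod_smult[OF qs(1) functionalD(1)[OF f X.x] qs(4)]] by simp
    have "rsl f w = rsl f G2 \<ominus>\<^bsub>H\<^esub> f x \<odot>\<^bsub>H\<^esub> \<one>\<^bsub>H\<^esub>"
      unfolding w2 using linear_map_diff[OF TP.T_k_algebra k_algebra_axioms r G12c(2) c(2)] by (simp add: TP.rslice_pt f)
    then show "rsl f w \<in> Q"
      using submod_diff[OF qs(1) TP.rslice_tensor_sub[OF qs(1) subset_refl f G12(2)]
          submod_smult[OF qs(1) functionalD(1)[OF f X.x] qs(4)]] by simp
  qed
  have "D x = tp x \<one>\<^bsub>H\<^esub> \<oplus>\<^bsub>HH\<^esub> tp \<one>\<^bsub>H\<^esub> x \<oplus>\<^bsub>HH\<^esub> w"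
    unfolding Dx w_def by (rule TP.T.add_diff_swap[OF c Kc(2)])
  then show ?thesis using wQ unfolding Q_def by blast
qed

end

section \<open>Hopf subalgebras\<close>

lemma (in k_algebra) eq_add_diff: "\<lbrakk>a \<in> carrier A; b \<in> carrier A\<rbrakk> \<Longrightarrow> a = b \<oplus>\<^bsub>A\<^esub> (a \<ominus>\<^bsub>A\<^esub> b)"
  by algebra

lemma (in k_algebra) fil_subalg:
  assumes "subalg k A C" "Q \<subseteq> C" "x \<in> C"
  shows "fil A Q x n \<subseteq> C"
proof (induction n)
  case 0
  then show ?case using submod_zero[OF subalgD(1)[OF assms(1)]] by simp
next
  case (Suc n)
  note s = subalgD[OF assms(1)]
  have "x [^]\<^bsub>A\<^esub> (m::nat) \<in> C" for m by (induction m) (use s assms in auto)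
  then show ?case using Suc assms(2) by (auto simp: fil.simps(2) subset_iff intro!: submod_add[OF s(1)] s(5))
qed

text \<open>A commutation rule and the shape of \<open>D x\<close> are all that is assumed, so that
  the expansions below are available in a quotient, where freeness is still to be proved.\<close>

locale primitive_ext = hopf_algebra +
  fixes C Q x w
  assumes C: "subalg k H C" and hQ: "hopf_subalgebra k H Q" and QC: "Q \<subseteq> C" and xC: "x \<in> C"
    and gen: "skew_gen H Q x" and w: "w \<in> tsub Q Q"
    and Dx: "D x = tp x \<one>\<^bsub>H\<^esub> \<oplus>\<^bsub>HH\<^esub> tp \<one>\<^bsub>H\<^esub> x \<oplus>\<^bsub>HH\<^esub> w"
begin

sublocale X: skew_gen H Q x by (rule gen)

lemma sQ: "subalg k H Q" by (rule hopf_subD(1)[OF hQ])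

lemmas q = subalgD[OF sQ] and c = subalgD[OF C]

abbreviation "F n \<equiv> fil H Q x n"

lemma F_sub: "submodule (F n) k H"
  by (rule fil_submodule[OF gen q(1)])

text \<open>For \<open>m = 0\<close> the truncated \<open>m - 1\<close> is \<open>0\<close>, and
  both families contain only zero. The middle term \<open>x^(m-1) \<otimes> x\<close> is in general
  outside: its first factor has degree \<open>m - 1\<close>, one too many for the second family, and
  its second factor is not in \<open>Q\<close>.\<close>

definition Wg where
  "Wg m = {tp v r | v r. v \<in> F m \<and> r \<in> Q} \<union> {tp v d | v d. v \<in> F (m - 1) \<and> d \<in> C}"

definition W where
  "W m = lspan k HH (Wg m)"

lemma Wg_sub: "Wg m \<subseteq> carrier HH"
  using X.F_closed X.Q_sub c(6) by (auto simp: Wg_def)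

lemma W_sub: "submodule (W m) k HH"
  unfolding W_def by (rule TP.T.lspan_submodule[OF Wg_sub])

lemmas Wm = TP.T.submod[OF W_sub]

lemma W_closed: "z \<in> W m \<Longrightarrow> z \<in> carrier HH"
  by (rule TP.T.submod_sub[OF W_sub])

lemma WI:
  "\<lbrakk>v \<in> F m; r \<in> Q\<rbrakk> \<Longrightarrow> tp v r \<in> W m"
  "\<lbrakk>v \<in> F (m - 1); d \<in> C\<rbrakk> \<Longrightarrow> tp v d \<in> W m"
  unfolding W_def by (rule hull_inc, auto simp: Wg_def)+

lemma W_linear:
  assumes "k_algebra k U" "f \<in> linear_map k HH U" "submodule N k U"
    and "\<And>v r. \<lbrakk>v \<in> F m; r \<in> Q\<rbrakk> \<Longrightarrow> f (tp v r) \<in> N"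
    and "\<And>v d. \<lbrakk>v \<in> F (m - 1); d \<in> C\<rbrakk> \<Longrightarrow> f (tp v d) \<in> N" "z \<in> W m"
  shows "f z \<in> N"
  by (rule linear_map_lspan[OF TP.T_k_algebra assms(1-3) Wg_sub _ assms(6)[unfolded W_def]])
    (use assms(4,5) in \<open>auto simp: Wg_def\<close>)

lemma lmult_linear: "t \<in> carrier HH \<Longrightarrow> (\<lambda>z. t \<otimes>\<^bsub>HH\<^esub> z) \<in> linear_map k HH HH"
  by (rule linear_mapI) (simp_all add: TP.T.A.r_distr TP.T.smult_mult_right)

lemma rmult_linear: "t \<in> carrier HH \<Longrightarrow> (\<lambda>z. z \<otimes>\<^bsub>HH\<^esub> t) \<in> linear_map k HH HH"
  by (rule linear_mapI) (simp_all add: TP.T.A.l_distr TP.T.smult_mult_left)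

lemma F_pred: "v \<in> F (m - 1) \<Longrightarrow> v \<in> F m"
  by (rule X.F_mono[of "m - 1"]) simp_all

lemma x_F_pred: "v \<in> F (m - 1) \<Longrightarrow> x \<otimes>\<^bsub>H\<^esub> v \<in> F m"
  using X.x_F[of v "m - 1"] by (cases m) auto

lemma W_x_left: "z \<in> W m \<Longrightarrow> tp x \<one>\<^bsub>H\<^esub> \<otimes>\<^bsub>HH\<^esub> z \<in> W (Suc m)"
  by (rule W_linear[OF TP.T_k_algebra lmult_linear W_sub])
    (use WI[of _ "Suc m"] X.x_F x_F_pred X.F_closed X.Q_sub c(6) in \<open>auto simp: TP.pt_mult\<close>)

lemma W_x_right: "z \<in> W m \<Longrightarrow> tp \<one>\<^bsub>H\<^esub> x \<otimes>\<^bsub>HH\<^esub> z \<in> W (Suc m)"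
  by (rule W_linear[OF TP.T_k_algebra lmult_linear W_sub])
    (use WI(2)[of _ "Suc m"] F_pred X.F_closed X.Q_sub c(5,6) xC QC in \<open>auto simp: TP.pt_mult subset_iff\<close>)

lemma W_tsub:
  assumes "t \<in> tsub Q Q" "z \<in> W m"
  shows "t \<otimes>\<^bsub>HH\<^esub> z \<in> W m"
proof (rule TP.tensor_sub_linear[OF TP.T_k_algebra rmult_linear[OF W_closed[OF assms(2)]] W_sub q(3,3) _ assms(1)])
  fix r s assume rs: "r \<in> Q" "s \<in> Q"
  show "tp r s \<otimes>\<^bsub>HH\<^esub> z \<in> W m"
    by (rule W_linear[OF TP.T_k_algebra lmult_linear W_sub _ _ assms(2)])
      (use rs WI[of _ m] X.F_lmult X.Qs X.F_closed X.Q_sub c(5,6) QC in \<open>auto simp: TP.pt_mult subset_iff\<close>)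
qed

lemma W_Suc: "z \<in> W m \<Longrightarrow> z \<in> W (Suc m)"
  using W_linear[OF TP.T_k_algebra linear_map_id W_sub, of m "Suc m" z] WI[of _ "Suc m"] X.F_Suc F_pred by auto

definition nk where "nk (m :: nat) = [m] \<cdot>\<^bsub>k\<^esub> \<one>\<^bsub>k\<^esub>"

lemma nk_closed [simp]: "nk m \<in> carrier k"
  unfolding nk_def by (rule K.add.nat_pow_closed) simp

lemma nk_Suc: "nk (Suc m) = nk m \<oplus>\<^bsub>k\<^esub> \<one>\<^bsub>k\<^esub>"
  unfolding nk_def add_pow_def by simp

lemma nk_0 [simp]: "nk 0 = \<zero>\<^bsub>k\<^esub>"
  unfolding nk_def add_pow_def by simp

lemma wc: "w \<in> carrier HH"
  by (rule TP.tensor_sub_closed[OF q(3,3) w])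

text \<open>The expansion for \<open>x^m\<close> is multiplied by \<open>D x\<close> from the left.
  Two products contribute to \<open>x^m \<otimes> x\<close>: \<open>x \<otimes> 1\<close> with the
  middle term gives it \<open>m\<close> times, and \<open>1 \<otimes> x\<close> with the leading
  term once. The other products are errors.\<close>

lemma comul_pow:
  "\<exists>z\<in>W m. D (x [^]\<^bsub>H\<^esub> m) = tp (x [^]\<^bsub>H\<^esub> m) \<one>\<^bsub>H\<^esub> \<oplus>\<^bsub>HH\<^esub> nk m \<odot>\<^bsub>HH\<^esub> tp (x [^]\<^bsub>H\<^esub> (m - 1)) x \<oplus>\<^bsub>HH\<^esub> z"
proof (induction m)
  case 0
  show ?case by (rule bexI[of _ "\<zero>\<^bsub>HH\<^esub>"]) (simp_all add: D TP.T_one Wm)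
next
  case (Suc m)
  then obtain z where z: "z \<in> W m"
    "D (x [^]\<^bsub>H\<^esub> m) = tp (x [^]\<^bsub>H\<^esub> m) \<one>\<^bsub>H\<^esub> \<oplus>\<^bsub>HH\<^esub> nk m \<odot>\<^bsub>HH\<^esub> tp (x [^]\<^bsub>H\<^esub> (m - 1)) x \<oplus>\<^bsub>HH\<^esub> z" by blast
  note zc = W_closed[OF z(1)]
  let ?a = "tp x \<one>\<^bsub>H\<^esub>" and ?b = "tp \<one>\<^bsub>H\<^esub> x" and ?p = "x [^]\<^bsub>H\<^esub> m" and ?p' = "x [^]\<^bsub>H\<^esub> (m - 1)"
  define z' where "z' = nk m \<odot>\<^bsub>HH\<^esub> tp ?p' (x \<otimes>\<^bsub>H\<^esub> x) \<oplus>\<^bsub>HH\<^esub> w \<otimes>\<^bsub>HH\<^esub> D ?p \<oplus>\<^bsub>HH\<^esub> ?a \<otimes>\<^bsub>HH\<^esub> z \<oplus>\<^bsub>HH\<^esub> ?b \<otimes>\<^bsub>HH\<^esub> z"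
  have xx: "x [^]\<^bsub>H\<^esub> Suc n = x \<otimes>\<^bsub>H\<^esub> x [^]\<^bsub>H\<^esub> n" for n :: nat by (rule A.nat_pow_Suc2) simp
  \<comment> \<open>For \<open>m = 0\<close> the coefficient is zero; otherwise
    \<open>x^(m-1)\<close> has degree below \<open>m\<close>, as the second family requires at index
    \<open>m + 1\<close>.\<close>
  have p': "nk m \<odot>\<^bsub>HH\<^esub> tp ?p' d \<in> W (Suc m)" if "d \<in> C" for d
  proof (cases m)
    case 0
    then show ?thesis using that c(6) Wm by simp
  next
    case (Suc l)
    then show ?thesis using WI(2)[of ?p' "Suc m" d] that Wm(3) X.F_pow[of l] by simp
  qed
  have Wp: "D ?p \<in> W (Suc m)"
    unfolding z(2) by (intro Wm(2) W_Suc[OF z(1)] p'[OF xC] WI(1)[OF X.F_pow] q(4))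
  have zW: "z' \<in> W (Suc m)"
    unfolding z'_def by (intro Wm(2) W_tsub[OF w Wp] W_x_left[OF z(1)] W_x_right[OF z(1)] p' c(5) xC)
  have mid: "nk m \<odot>\<^bsub>HH\<^esub> tp (x \<otimes>\<^bsub>H\<^esub> ?p') x \<oplus>\<^bsub>HH\<^esub> tp ?p x = nk (Suc m) \<odot>\<^bsub>HH\<^esub> tp ?p x"
  proof (cases m)
    case (Suc l)
    then show ?thesis using xx[of l] by (simp add: nk_Suc TP.T.V.smult_l_distr del: A.nat_pow_Suc)
  qed (simp add: nk_Suc)
  have "D (x [^]\<^bsub>H\<^esub> Suc m) = (?a \<oplus>\<^bsub>HH\<^esub> ?b \<oplus>\<^bsub>HH\<^esub> w) \<otimes>\<^bsub>HH\<^esub> D ?p"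
    unfolding xx using Dx by (simp add: D)
  also have "\<dots> = ?a \<otimes>\<^bsub>HH\<^esub> D ?p \<oplus>\<^bsub>HH\<^esub> ?b \<otimes>\<^bsub>HH\<^esub> D ?p \<oplus>\<^bsub>HH\<^esub> w \<otimes>\<^bsub>HH\<^esub> D ?p"
    using wc by (simp add: D TP.T.A.l_distr)
  also have "?a \<otimes>\<^bsub>HH\<^esub> D ?p = tp (x [^]\<^bsub>H\<^esub> Suc m) \<one>\<^bsub>H\<^esub> \<oplus>\<^bsub>HH\<^esub> nk m \<odot>\<^bsub>HH\<^esub> tp (x \<otimes>\<^bsub>H\<^esub> ?p') x \<oplus>\<^bsub>HH\<^esub> ?a \<otimes>\<^bsub>HH\<^esub> z"
    unfolding xx z(2) using zc by (simp add: TP.T.A.r_distr TP.T.smult_mult_right TP.pt_mult)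
  also have "?b \<otimes>\<^bsub>HH\<^esub> D ?p = tp ?p x \<oplus>\<^bsub>HH\<^esub> nk m \<odot>\<^bsub>HH\<^esub> tp ?p' (x \<otimes>\<^bsub>H\<^esub> x) \<oplus>\<^bsub>HH\<^esub> ?b \<otimes>\<^bsub>HH\<^esub> z"
    unfolding z(2) using zc by (simp add: TP.T.A.r_distr TP.T.smult_mult_right TP.pt_mult)
  also have "(tp (x [^]\<^bsub>H\<^esub> Suc m) \<one>\<^bsub>H\<^esub> \<oplus>\<^bsub>HH\<^esub> nk m \<odot>\<^bsub>HH\<^esub> tp (x \<otimes>\<^bsub>H\<^esub> ?p') x \<oplus>\<^bsub>HH\<^esub> ?a \<otimes>\<^bsub>HH\<^esub> z)
      \<oplus>\<^bsub>HH\<^esub> (tp ?p x \<oplus>\<^bsub>HH\<^esub> nk m \<odot>\<^bsub>HH\<^esub> tp ?p' (x \<otimes>\<^bsub>H\<^esub> x) \<oplus>\<^bsub>HH\<^esub> ?b \<otimes>\<^bsub>HH\<^esub> z) \<oplus>\<^bsub>HH\<^esub> w \<otimes>\<^bsub>HH\<^esub> D ?p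
    = tp (x [^]\<^bsub>H\<^esub> Suc m) \<one>\<^bsub>H\<^esub> \<oplus>\<^bsub>HH\<^esub> (nk m \<odot>\<^bsub>HH\<^esub> tp (x \<otimes>\<^bsub>H\<^esub> ?p') x \<oplus>\<^bsub>HH\<^esub> tp ?p x) \<oplus>\<^bsub>HH\<^esub> z'"
    unfolding z'_def using zc wc by (simp add: D TP.T.V.M.a_ac del: A.nat_pow_Suc)
  finally show ?case unfolding mid using zW by (intro bexI[of _ z']) simp_all
qed

lemma comul_F: "u \<in> F m \<Longrightarrow> D u \<in> W m"
proof (induction m arbitrary: u)
  case 0
  then show ?case by (simp add: D_zero Wm)
next
  case (Suc m)
  then obtain r v where rv: "r \<in> Q" "v \<in> F m" "u = r \<otimes>\<^bsub>H\<^esub> x [^]\<^bsub>H\<^esub> m \<oplus>\<^bsub>H\<^esub> v" by (auto simp: fil.simps(2))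
  obtain z where z: "z \<in> W m"
    "D (x [^]\<^bsub>H\<^esub> m) = tp (x [^]\<^bsub>H\<^esub> m) \<one>\<^bsub>H\<^esub> \<oplus>\<^bsub>HH\<^esub> nk m \<odot>\<^bsub>HH\<^esub> tp (x [^]\<^bsub>H\<^esub> (m - 1)) x \<oplus>\<^bsub>HH\<^esub> z" using comul_pow by blast
  have "nk m \<odot>\<^bsub>HH\<^esub> tp (x [^]\<^bsub>H\<^esub> (m - 1)) x \<in> W (Suc m)"
  proof (cases m)
    case 0
    then show ?thesis using Wm by simp
  next
    case (Suc l)
    then show ?thesis using WI(2)[of "x [^]\<^bsub>H\<^esub> (m - 1)" "Suc m" x] xC Wm(3) X.F_pow[of l] by simp
  qed
  then have "D (x [^]\<^bsub>H\<^esub> m) \<in> W (Suc m)"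
    unfolding z(2) by (intro Wm(2) W_Suc[OF z(1)] WI(1)[OF X.F_pow] q(4))
  then have "D r \<otimes>\<^bsub>HH\<^esub> D (x [^]\<^bsub>H\<^esub> m) \<oplus>\<^bsub>HH\<^esub> D v \<in> W (Suc m)"
    by (intro Wm(2) W_tsub[OF hopf_subD(2)[OF hQ rv(1)]] W_Suc[OF Suc.IH[OF rv(2)]])
  then show ?case using X.Q_sub[OF rv(1)] X.F_closed[OF rv(2)] by (simp add: rv(3) D)
qed

lemma comul_lead:
  assumes "X.lead m b r"
  shows "\<exists>z\<in>W m. D b = D r \<otimes>\<^bsub>HH\<^esub> tp (x [^]\<^bsub>H\<^esub> m) \<one>\<^bsub>H\<^esub>
    \<oplus>\<^bsub>HH\<^esub> nk m \<odot>\<^bsub>HH\<^esub> (D r \<otimes>\<^bsub>HH\<^esub> tp (x [^]\<^bsub>H\<^esub> (m - 1)) x) \<oplus>\<^bsub>HH\<^esub> z"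
proof -
  obtain u where u: "r \<in> Q" "u \<in> F m" "b = r \<otimes>\<^bsub>H\<^esub> x [^]\<^bsub>H\<^esub> m \<oplus>\<^bsub>H\<^esub> u" using assms by (auto simp: X.lead_def)
  obtain z where z: "z \<in> W m"
    "D (x [^]\<^bsub>H\<^esub> m) = tp (x [^]\<^bsub>H\<^esub> m) \<one>\<^bsub>H\<^esub> \<oplus>\<^bsub>HH\<^esub> nk m \<odot>\<^bsub>HH\<^esub> tp (x [^]\<^bsub>H\<^esub> (m - 1)) x \<oplus>\<^bsub>HH\<^esub> z" using comul_pow by blast
  have "D r \<otimes>\<^bsub>HH\<^esub> z \<oplus>\<^bsub>HH\<^esub> D u \<in> W m"
    by (intro Wm(2) W_tsub[OF hopf_subD(2)[OF hQ u(1)] z(1)] comul_F[OF u(2)])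
  moreover have "D b = D r \<otimes>\<^bsub>HH\<^esub> D (x [^]\<^bsub>H\<^esub> m) \<oplus>\<^bsub>HH\<^esub> D u"
    using X.Q_sub[OF u(1)] X.F_closed[OF u(2)] by (simp add: u(3) D)
  then have "D b = D r \<otimes>\<^bsub>HH\<^esub> tp (x [^]\<^bsub>H\<^esub> m) \<one>\<^bsub>H\<^esub>
    \<oplus>\<^bsub>HH\<^esub> nk m \<odot>\<^bsub>HH\<^esub> (D r \<otimes>\<^bsub>HH\<^esub> tp (x [^]\<^bsub>H\<^esub> (m - 1)) x) \<oplus>\<^bsub>HH\<^esub> (D r \<otimes>\<^bsub>HH\<^esub> z \<oplus>\<^bsub>HH\<^esub> D u)"
    unfolding z(2) using X.Q_sub[OF u(1)] X.F_closed[OF u(2)] W_closed[OF z(1)]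
    by (simp add: D TP.T.A.r_distr TP.T.smult_mult_right TP.T.V.M.a_assoc)
  ultimately show ?thesis by blast
qed

lemma lsl_W_zero:
  assumes "f \<in> dual" "\<And>u. u \<in> F m \<Longrightarrow> f u = \<zero>\<^bsub>k\<^esub>" "z \<in> W m" shows "lsl f z = \<zero>\<^bsub>H\<^esub>"
proof -
  have "lsl f z \<in> {\<zero>\<^bsub>H\<^esub>}"
    by (rule W_linear[OF k_algebra_axioms TP.lslice_linear[OF assms(1)] submodule_zero _ _ assms(3)])
      (use assms(1,2) F_pred X.F_closed X.Q_sub c(6) in \<open>auto simp: TP.lslice_pt\<close>)
  then show ?thesis by simp
qed

text \<open>A functional that kills degrees below \<open>m - 1\<close> removes the second family;
  the second components in the first family are in \<open>Q\<close>.\<close>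

lemma lsl_W_Q:
  assumes "f \<in> dual" "\<And>u. u \<in> F (m - 1) \<Longrightarrow> f u = \<zero>\<^bsub>k\<^esub>" "z \<in> W m" shows "lsl f z \<in> Q"
  by (rule W_linear[OF k_algebra_axioms TP.lslice_linear[OF assms(1)] q(1) _ _ assms(3)])
    (use assms(1,2) X.F_closed X.Q_sub c(6) submod_smult[OF q(1)] X.Q_zero in \<open>auto simp: TP.lslice_pt functionalD\<close>)

lemma rsl_W:
  assumes "f \<in> dual" "z \<in> W m" shows "rsl f z \<in> F m"
  by (rule W_linear[OF k_algebra_axioms TP.rslice_linear[OF assms(1)] F_sub _ _ assms(2)])
    (use assms(1) F_pred X.F_closed X.Q_sub c(6) submod_smult[OF F_sub] in \<open>auto simp: TP.rslice_pt functionalD\<close>)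

text \<open>The multiples of \<open>x\<close> by elements of \<open>Q\<close> are taken on the right here; this makes the set of
  coefficients a right module.\<close>

lemma R_x_mult:
  assumes "r \<in> Q" "s \<in> Q" "f \<in> dual"
  shows "\<exists>u\<in>Q. R f (x \<otimes>\<^bsub>H\<^esub> r \<oplus>\<^bsub>H\<^esub> s) = x \<otimes>\<^bsub>H\<^esub> R f r \<oplus>\<^bsub>H\<^esub> u"
proof -
  note rl = TP.rslice_linear[OF assms(3)]
  note Dr = hopf_subD(2)[OF hQ assms(1)]
  have rc: "r \<in> carrier H" "s \<in> carrier H" using assms X.Q_sub by auto
  have Drc: "D r \<in> carrier HH" using rc by (simp add: D)
  define u where "u = rsl f (tp \<one>\<^bsub>H\<^esub> x \<otimes>\<^bsub>HH\<^esub> D r) \<oplus>\<^bsub>H\<^esub> rsl f (w \<otimes>\<^bsub>HH\<^esub> D r) \<oplus>\<^bsub>H\<^esub> R f s"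
  have "rsl f (tp \<one>\<^bsub>H\<^esub> x \<otimes>\<^bsub>HH\<^esub> D r) \<in> Q"
    by (rule TP.tensor_sub_linear[OF k_algebra_axioms linear_map_comp[OF lmult_linear rl] q(1,3,3) _ Dr])
      (use assms(3) X.Q_sub submod_smult[OF q(1)] in \<open>auto simp: TP.pt_mult TP.rslice_pt functionalD\<close>)
  moreover have "rsl f (w \<otimes>\<^bsub>HH\<^esub> D r) \<in> Q"
    by (rule TP.rslice_tensor_sub[OF q(1,3) assms(3) TP.tensor_sub_mult[OF q(3,3,3,3,3,3) _ _ w Dr]]) (use q(5) in auto)
  ultimately have u: "u \<in> Q" unfolding u_def using submod_add[OF q(1)] hopf_subD(5)[OF hQ assms(2,3)] by simp
  have "R f (x \<otimes>\<^bsub>H\<^esub> r \<oplus>\<^bsub>H\<^esub> s) = rsl f (tp x \<one>\<^bsub>H\<^esub> \<otimes>\<^bsub>HH\<^esub> D r) \<oplus>\<^bsub>H\<^esub> u"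
    unfolding R_def u_def using rc Drc wc
    by (simp add: D, simp add: D Dx TP.T.A.l_distr linear_mapD[OF rl] V.M.a_assoc)
  also have "rsl f (tp x \<one>\<^bsub>H\<^esub> \<otimes>\<^bsub>HH\<^esub> D r) = x \<otimes>\<^bsub>H\<^esub> R f r"
    unfolding R_def by (rule TP.rslice_mult_one(2)[OF assms(3) Drc]) simp
  finally show ?thesis using u by blast
qed

end

section \<open>Intersecting a free step with a Hopf subalgebra\<close>

locale primitive_free = primitive_ext +
  assumes sf: "skew_free H Q x" and C_eq: "C = (\<Union>n. fil H Q x n)"
    and surj: "s \<in> Q \<Longrightarrow> \<exists>r\<in>Q. \<exists>u\<in>Q. x \<otimes>\<^bsub>H\<^esub> r = s \<otimes>\<^bsub>H\<^esub> x \<oplus>\<^bsub>H\<^esub> u"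
    and char: "n > 0 \<Longrightarrow> nk n \<noteq> \<zero>\<^bsub>k\<^esub>"
begin

sublocale XF: skew_free H Q x by (rule sf)

context
  fixes B assumes B: "hopf_subalgebra k H B"
begin

lemmas b = subalgD[OF hopf_subD(1)[OF B]]

text \<open>The functional that reads the coefficient at \<open>x^m\<close> kills the middle term
  and the errors of \<open>D y\<close>; the leading term leaves the counit slice of
  \<open>D r\<close>, which is \<open>r\<close>. So \<open>r\<close> is a slice of
  \<open>D y\<close>.\<close>

lemma lead_coeff_B:
  assumes "y \<in> B" "X.lead m y r"
  shows "r \<in> B"
proof -
  obtain \<psi> where \<psi>: "\<psi> \<in> dual" "\<And>u. u \<in> F m \<Longrightarrow> \<psi> u = \<zero>\<^bsub>k\<^esub>"
    "\<And>r. r \<in> Q \<Longrightarrow> \<psi> (r \<otimes>\<^bsub>H\<^esub> x [^]\<^bsub>H\<^esub> m) = eps r" using skew_functional[OF sf q(1)] by blast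
  have r: "r \<in> Q" using assms by (simp add: X.lead_def)
  note rc = X.Q_sub[OF r] and Dr = hopf_subD(2)[OF hQ r]
  note l = linear_mapD[OF TP.lslice_linear[OF \<psi>(1)]] and le = linear_mapD[OF TP.lslice_linear[OF eps_functional]]
  obtain z where z: "z \<in> W m" "D y = D r \<otimes>\<^bsub>HH\<^esub> tp (x [^]\<^bsub>H\<^esub> m) \<one>\<^bsub>H\<^esub>
    \<oplus>\<^bsub>HH\<^esub> nk m \<odot>\<^bsub>HH\<^esub> (D r \<otimes>\<^bsub>HH\<^esub> tp (x [^]\<^bsub>H\<^esub> (m - 1)) x) \<oplus>\<^bsub>HH\<^esub> z" using comul_lead[OF assms(2)] by blast
  have 1: "lsl \<psi> (D r \<otimes>\<^bsub>HH\<^esub> tp (x [^]\<^bsub>H\<^esub> m) \<one>\<^bsub>H\<^esub>) = lsl eps (D r)"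
    by (rule TP.tensor_sub_induct[OF Dr q(3,3), of "\<lambda>t. lsl \<psi> (t \<otimes>\<^bsub>HH\<^esub> tp (x [^]\<^bsub>H\<^esub> m) \<one>\<^bsub>H\<^esub>) = lsl eps t"])
      (use X.Q_sub linear_map_zero[OF TP.T_k_algebra k_algebra_axioms TP.lslice_linear] in
        \<open>simp_all add: TP.pt_mult TP.lslice_pt \<psi> eps_functional l le TP.T.A.l_distr TP.T.smult_mult_left\<close>)
  have 2: "nk m \<odot>\<^bsub>H\<^esub> lsl \<psi> (D r \<otimes>\<^bsub>HH\<^esub> tp (x [^]\<^bsub>H\<^esub> (m - 1)) x) = \<zero>\<^bsub>H\<^esub>"
  proof (cases m)
    case 0
    then show ?thesis using rc by (simp add: D l)
  next
    case (Suc p)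
    have "lsl \<psi> (D r \<otimes>\<^bsub>HH\<^esub> tp (x [^]\<^bsub>H\<^esub> p) x) \<in> {\<zero>\<^bsub>H\<^esub>}"
      by (rule TP.tensor_sub_linear[OF k_algebra_axioms linear_map_comp[OF rmult_linear TP.lslice_linear[OF \<psi>(1)]] submodule_zero q(3,3) _ Dr])
        (use \<psi> X.F_term[of _ p] Suc X.Q_sub in \<open>auto simp: TP.pt_mult TP.lslice_pt\<close>)
    then show ?thesis using Suc by simp
  qed
  have "L \<psi> y = r"
    unfolding L_def z(2) using rc W_closed[OF z(1)] 1 2 lsl_W_zero[OF \<psi>(1,2) z(1)] counit_left[OF rc]
    by (simp add: D l)
  then show ?thesis using hopf_subD(4)[OF B assms(1) \<psi>(1)] by simp
qed

text \<open>When the coefficient at \<open>x^(m-1)\<close> is read instead, the middle term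
  contributes \<open>m r x\<close>. The leading term and the surviving errors have second components
  in \<open>Q\<close> and make up \<open>s\<close>.\<close>

lemma degree_one_B:
  assumes "y \<in> B" "X.lead m y r" "m > 0"
  shows "\<exists>s\<in>Q. (nk m \<odot>\<^bsub>H\<^esub> r) \<otimes>\<^bsub>H\<^esub> x \<oplus>\<^bsub>H\<^esub> s \<in> B"
proof -
  obtain \<psi> where \<psi>: "\<psi> \<in> dual" "\<And>u. u \<in> F (m - 1) \<Longrightarrow> \<psi> u = \<zero>\<^bsub>k\<^esub>"
    "\<And>r. r \<in> Q \<Longrightarrow> \<psi> (r \<otimes>\<^bsub>H\<^esub> x [^]\<^bsub>H\<^esub> (m - 1)) = eps r" using skew_functional[OF sf q(1)] by blast
  have r: "r \<in> Q" using assms by (simp add: X.lead_def)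
  note rc = X.Q_sub[OF r] and Dr = hopf_subD(2)[OF hQ r]
  note l = linear_mapD[OF TP.lslice_linear[OF \<psi>(1)]] and le = linear_mapD[OF TP.lslice_linear[OF eps_functional]]
  obtain z where z: "z \<in> W m" "D y = D r \<otimes>\<^bsub>HH\<^esub> tp (x [^]\<^bsub>H\<^esub> m) \<one>\<^bsub>H\<^esub>
    \<oplus>\<^bsub>HH\<^esub> nk m \<odot>\<^bsub>HH\<^esub> (D r \<otimes>\<^bsub>HH\<^esub> tp (x [^]\<^bsub>H\<^esub> (m - 1)) x) \<oplus>\<^bsub>HH\<^esub> z" using comul_lead[OF assms(2)] by blast
  define s where "s = lsl \<psi> (D r \<otimes>\<^bsub>HH\<^esub> tp (x [^]\<^bsub>H\<^esub> m) \<one>\<^bsub>H\<^esub>) \<oplus>\<^bsub>H\<^esub> lsl \<psi> z"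
  have 1: "lsl \<psi> (D r \<otimes>\<^bsub>HH\<^esub> tp (x [^]\<^bsub>H\<^esub> m) \<one>\<^bsub>H\<^esub>) \<in> Q"
    by (rule TP.tensor_sub_linear[OF k_algebra_axioms linear_map_comp[OF rmult_linear TP.lslice_linear[OF \<psi>(1)]] q(1,3,3) _ Dr])
      (use \<psi> X.Q_sub submod_smult[OF q(1)] in \<open>auto simp: TP.pt_mult TP.lslice_pt functionalD\<close>)
  have s: "s \<in> Q" unfolding s_def using submod_add[OF q(1) 1 lsl_W_Q[OF \<psi>(1,2) z(1)]] by simp
  have 2: "lsl \<psi> (D r \<otimes>\<^bsub>HH\<^esub> tp (x [^]\<^bsub>H\<^esub> (m - 1)) x) = lsl eps (D r) \<otimes>\<^bsub>H\<^esub> x"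
    by (rule TP.tensor_sub_induct[OF Dr q(3,3), of "\<lambda>t. lsl \<psi> (t \<otimes>\<^bsub>HH\<^esub> tp (x [^]\<^bsub>H\<^esub> (m - 1)) x) = lsl eps t \<otimes>\<^bsub>H\<^esub> x"])
      (use X.Q_sub linear_map_zero[OF TP.T_k_algebra k_algebra_axioms TP.lslice_linear] in
        \<open>simp_all add: TP.pt_mult TP.lslice_pt \<psi> \<psi>(3)[unfolded One_nat_def] eps_functional l le TP.T.A.l_distr TP.T.smult_mult_left A.l_distr
          smult_mult_left eps\<close>)
  have "L \<psi> y = (nk m \<odot>\<^bsub>H\<^esub> r) \<otimes>\<^bsub>H\<^esub> x \<oplus>\<^bsub>H\<^esub> s"
    unfolding L_def z(2) s_def using rc W_closed[OF z(1)] 2 counit_left[OF rc]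
    by (simp add: D l smult_mult_left V.M.a_ac)
  then show ?thesis using hopf_subD(4)[OF B assms(1) \<psi>(1)] s by force
qed

text \<open>The counterpart of \<open>skew_functional\<close> in degree one, with coefficients to
  the right of \<open>x\<close>. That \<open>x\<close> is not in \<open>V\<close> now rests on
  \<open>inj\<close>.\<close>

lemma right_coeff_functional:
  obtains \<psi> where "\<psi> \<in> dual" "\<And>r. r \<in> Q \<Longrightarrow> \<psi> r = \<zero>\<^bsub>k\<^esub>" "\<And>r. r \<in> Q \<Longrightarrow> \<psi> (x \<otimes>\<^bsub>H\<^esub> r) = eps r"
proof -
  define V where "V = {x \<otimes>\<^bsub>H\<^esub> r \<oplus>\<^bsub>H\<^esub> u | r u. r \<in> Q \<and> eps r = \<zero>\<^bsub>k\<^esub> \<and> u \<in> Q}"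
  have VI: "x \<otimes>\<^bsub>H\<^esub> r \<oplus>\<^bsub>H\<^esub> u \<in> V" if "r \<in> Q" "eps r = \<zero>\<^bsub>k\<^esub>" "u \<in> Q" for r u
    using that unfolding V_def by blast
  have VE: "\<exists>r u. r \<in> Q \<and> eps r = \<zero>\<^bsub>k\<^esub> \<and> u \<in> Q \<and> v = x \<otimes>\<^bsub>H\<^esub> r \<oplus>\<^bsub>H\<^esub> u" if "v \<in> V" for v
    using that unfolding V_def by blast
  have QV: "u \<in> V" if "u \<in> Q" for u
    using VI[OF X.Q_zero _ that] X.Q_sub[OF that] by (simp add: eps)
  have xV: "x \<otimes>\<^bsub>H\<^esub> r \<in> V" if "r \<in> Q" "eps r = \<zero>\<^bsub>k\<^esub>" for r
    using VI[OF that X.Q_zero] X.Q_sub[OF that(1)] by simp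
  have V: "submodule V k H"
  proof (rule submoduleI')
    fix v v' assume "v \<in> V" "v' \<in> V"
    then obtain r u r' u' where *: "r \<in> Q" "eps r = \<zero>\<^bsub>k\<^esub>" "u \<in> Q" "v = x \<otimes>\<^bsub>H\<^esub> r \<oplus>\<^bsub>H\<^esub> u"
      "r' \<in> Q" "eps r' = \<zero>\<^bsub>k\<^esub>" "u' \<in> Q" "v' = x \<otimes>\<^bsub>H\<^esub> r' \<oplus>\<^bsub>H\<^esub> u'" using VE by meson
    have "v \<oplus>\<^bsub>H\<^esub> v' = x \<otimes>\<^bsub>H\<^esub> (r \<oplus>\<^bsub>H\<^esub> r') \<oplus>\<^bsub>H\<^esub> (u \<oplus>\<^bsub>H\<^esub> u')"
      using * X.Q_sub by (simp add: A.r_distr V.M.a_ac)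
    then show "v \<oplus>\<^bsub>H\<^esub> v' \<in> V" using VI[of "r \<oplus>\<^bsub>H\<^esub> r'" "u \<oplus>\<^bsub>H\<^esub> u'"] * X.Q_sub X.Qs(5) by (simp add: eps)
  next
    fix d v assume d: "d \<in> carrier k" and "v \<in> V"
    then obtain r u where *: "r \<in> Q" "eps r = \<zero>\<^bsub>k\<^esub>" "u \<in> Q" "v = x \<otimes>\<^bsub>H\<^esub> r \<oplus>\<^bsub>H\<^esub> u" using VE by meson
    have "d \<odot>\<^bsub>H\<^esub> v = x \<otimes>\<^bsub>H\<^esub> (d \<odot>\<^bsub>H\<^esub> r) \<oplus>\<^bsub>H\<^esub> d \<odot>\<^bsub>H\<^esub> u"
      using * d X.Q_sub by (simp add: V.smult_r_distr smult_mult_right)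
    then show "d \<odot>\<^bsub>H\<^esub> v \<in> V"
      using VI[OF submod_smult[OF q(1) d *(1)] _ submod_smult[OF q(1) d *(3)]] * d X.Q_sub by (simp add: eps)
  next
    show "v \<in> carrier H" if "v \<in> V" for v using VE[OF that] X.Q_sub by auto
    show "\<zero>\<^bsub>H\<^esub> \<in> V" by (rule QV[OF X.Q_zero])
  qed
  have "x \<notin> V"
  proof
    assume "x \<in> V"
    then obtain r u where *: "r \<in> Q" "eps r = \<zero>\<^bsub>k\<^esub>" "u \<in> Q" "x = x \<otimes>\<^bsub>H\<^esub> r \<oplus>\<^bsub>H\<^esub> u" using VE by meson
    note cc = X.Q_sub[OF *(1)] X.Q_sub[OF *(3)]
    have "x \<otimes>\<^bsub>H\<^esub> (\<one>\<^bsub>H\<^esub> \<ominus>\<^bsub>H\<^esub> r) = x \<ominus>\<^bsub>H\<^esub> x \<otimes>\<^bsub>H\<^esub> r"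
      using cc by (simp add: a_minus_def A.r_distr A.r_minus)
    also have "\<dots> = (x \<otimes>\<^bsub>H\<^esub> r \<oplus>\<^bsub>H\<^esub> u) \<ominus>\<^bsub>H\<^esub> x \<otimes>\<^bsub>H\<^esub> r" using *(4) by simp
    also have "\<dots> = u" using cc by (simp add: a_minus_def V.M.a_ac V.M.r_neg V.M.r_neg1 V.M.r_neg2)
    finally have "\<one>\<^bsub>H\<^esub> \<ominus>\<^bsub>H\<^esub> r = \<zero>\<^bsub>H\<^esub>" using XF.inj[OF X.Q_diff[OF q(4) *(1)]] *(3) by simp
    then have "r = \<one>\<^bsub>H\<^esub>" using cc by simp
    then show False using *(2) by (simp add: eps)
  qed
  then obtain \<psi> where \<psi>: "\<psi> \<in> dual" "\<And>v. v \<in> V \<Longrightarrow> \<psi> v = \<zero>\<^bsub>k\<^esub>" "\<psi> x = \<one>\<^bsub>k\<^esub>"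
    using ex_functional[OF V X.x] by blast
  have "\<psi> (x \<otimes>\<^bsub>H\<^esub> r) = eps r" if r: "r \<in> Q" for r
  proof -
    note rc = X.Q_sub[OF r]
    define s where "s = r \<oplus>\<^bsub>H\<^esub> (\<ominus>\<^bsub>k\<^esub> eps r) \<odot>\<^bsub>H\<^esub> \<one>\<^bsub>H\<^esub>"
    have s: "s \<in> Q" unfolding s_def using r rc X.Qs submod_smult[OF q(1)] by (simp add: eps)
    have "eps s = \<zero>\<^bsub>k\<^esub>" using rc by (simp add: s_def eps K.r_neg)
    then have "\<psi> (x \<otimes>\<^bsub>H\<^esub> s) = \<zero>\<^bsub>k\<^esub>" using \<psi>(2) xV[OF s] by blast
    moreover have "x \<otimes>\<^bsub>H\<^esub> r = x \<otimes>\<^bsub>H\<^esub> s \<oplus>\<^bsub>H\<^esub> eps r \<odot>\<^bsub>H\<^esub> x"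
      using rc by (simp add: s_def A.r_distr smult_mult_right eps V.smult_l_minus A.r_minus V.M.a_assoc V.M.l_neg)
    ultimately show ?thesis using rc X.Q_sub[OF s] \<psi>(3) by (simp add: functionalD[OF \<psi>(1)] eps)
  qed
  then show ?thesis using that \<psi>(1,2) QV by blast
qed

definition RC where
  "RC = {r \<in> Q. \<exists>s\<in>Q. x \<otimes>\<^bsub>H\<^esub> r \<oplus>\<^bsub>H\<^esub> s \<in> B}"

text \<open>In \<open>D(x r + s)\<close> the functional kills all terms whose first components lie
  in \<open>Q\<close>. What remains is \<open>x \<otimes> 1\<close> times \<open>D r\<close>, and
  its slice is \<open>r\<close>.\<close>

lemma RC_B: "r \<in> RC \<Longrightarrow> r \<in> B"
proof -
  assume "r \<in> RC"
  then obtain s where rs: "r \<in> Q" "s \<in> Q" "x \<otimes>\<^bsub>H\<^esub> r \<oplus>\<^bsub>H\<^esub> s \<in> B" by (auto simp: RC_def)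
  obtain \<psi> where \<psi>: "\<psi> \<in> dual" "\<And>r. r \<in> Q \<Longrightarrow> \<psi> r = \<zero>\<^bsub>k\<^esub>" "\<And>r. r \<in> Q \<Longrightarrow> \<psi> (x \<otimes>\<^bsub>H\<^esub> r) = eps r"
    using right_coeff_functional by blast
  note l = linear_mapD[OF TP.lslice_linear[OF \<psi>(1)]] and le = linear_mapD[OF TP.lslice_linear[OF eps_functional]]
  note Dr = hopf_subD(2)[OF hQ rs(1)] and rc = X.Q_sub[OF rs(1)] X.Q_sub[OF rs(2)]
  have Drc: "D r \<in> carrier HH" using rc by (simp add: D)
  have 1: "lsl \<psi> (tp x \<one>\<^bsub>H\<^esub> \<otimes>\<^bsub>HH\<^esub> D r) = lsl eps (D r)"
    by (rule TP.tensor_sub_induct[OF Dr q(3,3), of "\<lambda>t. lsl \<psi> (tp x \<one>\<^bsub>H\<^esub> \<otimes>\<^bsub>HH\<^esub> t) = lsl eps t"])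
      (use X.Q_sub linear_map_zero[OF TP.T_k_algebra k_algebra_axioms TP.lslice_linear] in
        \<open>simp_all add: TP.pt_mult TP.lslice_pt \<psi> eps_functional l le TP.T.A.r_distr TP.T.smult_mult_right\<close>)
  have "lsl \<psi> (tp \<one>\<^bsub>H\<^esub> x \<otimes>\<^bsub>HH\<^esub> D r) \<in> {\<zero>\<^bsub>H\<^esub>}"
    by (rule TP.tensor_sub_linear[OF k_algebra_axioms linear_map_comp[OF lmult_linear TP.lslice_linear[OF \<psi>(1)]] submodule_zero q(3,3) _ Dr])
      (use \<psi> X.Q_sub in \<open>auto simp: TP.pt_mult TP.lslice_pt\<close>)
  then have 2: "lsl \<psi> (tp \<one>\<^bsub>H\<^esub> x \<otimes>\<^bsub>HH\<^esub> D r) = \<zero>\<^bsub>H\<^esub>" by simp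
  have wD: "w \<otimes>\<^bsub>HH\<^esub> D r \<in> tsub Q Q"
    by (rule TP.tensor_sub_mult[OF q(3,3,3,3,3,3) _ _ w Dr]) (use q(5) in auto)
  have "L \<psi> (x \<otimes>\<^bsub>H\<^esub> r \<oplus>\<^bsub>H\<^esub> s) = lsl eps (D r)"
    unfolding L_def using rc Drc wc 1 2 lsl_tsub_zero[OF wD q(3,3) \<psi>(1,2)]
      lsl_tsub_zero[OF hopf_subD(2)[OF hQ rs(2)] q(3,3) \<psi>(1,2)] linear_mapD(1)[OF TP.lslice_linear[OF eps_functional] Drc]
    by (simp add: D, simp add: D Dx TP.T.A.l_distr l)
  then show "r \<in> B" using hopf_subD(4)[OF B rs(3) \<psi>(1)] counit_left[OF rc(1)] by simp
qed

lemma RC_submodule: "submodule RC k H"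
proof (rule submoduleI')
  fix r r' assume "r \<in> RC" "r' \<in> RC"
  then obtain s s' where *: "r \<in> Q" "s \<in> Q" "x \<otimes>\<^bsub>H\<^esub> r \<oplus>\<^bsub>H\<^esub> s \<in> B" "r' \<in> Q" "s' \<in> Q" "x \<otimes>\<^bsub>H\<^esub> r' \<oplus>\<^bsub>H\<^esub> s' \<in> B"
    by (auto simp: RC_def)
  have "(x \<otimes>\<^bsub>H\<^esub> r \<oplus>\<^bsub>H\<^esub> s) \<oplus>\<^bsub>H\<^esub> (x \<otimes>\<^bsub>H\<^esub> r' \<oplus>\<^bsub>H\<^esub> s') = x \<otimes>\<^bsub>H\<^esub> (r \<oplus>\<^bsub>H\<^esub> r') \<oplus>\<^bsub>H\<^esub> (s \<oplus>\<^bsub>H\<^esub> s')"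
    using * X.Q_sub by (simp add: A.r_distr V.M.a_ac)
  then have "x \<otimes>\<^bsub>H\<^esub> (r \<oplus>\<^bsub>H\<^esub> r') \<oplus>\<^bsub>H\<^esub> (s \<oplus>\<^bsub>H\<^esub> s') \<in> B" using submod_add[OF b(1) *(3,6)] by simp
  then show "r \<oplus>\<^bsub>H\<^esub> r' \<in> RC" unfolding RC_def using * X.Qs(5) by blast
next
  fix d r assume d: "d \<in> carrier k" and "r \<in> RC"
  then obtain s where *: "r \<in> Q" "s \<in> Q" "x \<otimes>\<^bsub>H\<^esub> r \<oplus>\<^bsub>H\<^esub> s \<in> B" by (auto simp: RC_def)
  have "d \<odot>\<^bsub>H\<^esub> (x \<otimes>\<^bsub>H\<^esub> r \<oplus>\<^bsub>H\<^esub> s) = x \<otimes>\<^bsub>H\<^esub> (d \<odot>\<^bsub>H\<^esub> r) \<oplus>\<^bsub>H\<^esub> d \<odot>\<^bsub>H\<^esub> s"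
    using * d X.Q_sub by (simp add: V.smult_r_distr smult_mult_right)
  then have "x \<otimes>\<^bsub>H\<^esub> (d \<odot>\<^bsub>H\<^esub> r) \<oplus>\<^bsub>H\<^esub> d \<odot>\<^bsub>H\<^esub> s \<in> B" using submod_smult[OF b(1) d *(3)] by simp
  then show "d \<odot>\<^bsub>H\<^esub> r \<in> RC" unfolding RC_def using submod_smult[OF q(1) d] * by blast
next
  have "x \<otimes>\<^bsub>H\<^esub> \<zero>\<^bsub>H\<^esub> \<oplus>\<^bsub>H\<^esub> \<zero>\<^bsub>H\<^esub> \<in> B" using submod_zero[OF b(1)] by simp
  then show "\<zero>\<^bsub>H\<^esub> \<in> RC" unfolding RC_def using X.Q_zero by blast
qed (auto simp: RC_def X.Q_sub)

text \<open>The right coefficients \<open>RC\<close> of \<open>x\<close> in \<open>B\<close> form a right ideal and right coideal of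
  \<open>B \<inter> Q\<close>; as soon as it is nonzero it contains \<open>1\<close>, so \<open>B\<close> contains a translate of \<open>x\<close>.\<close>

lemma translate_in_B:
  assumes "y \<in> B" "y \<in> C" "y \<notin> Q"
  shows "\<exists>s\<in>Q. x \<oplus>\<^bsub>H\<^esub> s \<in> B"
proof -
  obtain N where N: "y \<in> F N" using assms(2) C_eq by blast
  have "y \<noteq> \<zero>\<^bsub>H\<^esub>" using assms(3) X.Q_zero by blast
  then obtain m r where m: "r \<noteq> \<zero>\<^bsub>H\<^esub>" "X.lead m y r" using X.ex_lead[OF N] by blast
  have m0: "m > 0"
  proof (rule ccontr)
    assume "\<not> m > 0"
    then have "y \<in> Q" using m(2) X.F_Suc_lead[of y 0] X.F_one by auto
    then show False using assms(3) by blast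
  qed
  have r: "r \<in> Q" using m(2) by (simp add: X.lead_def)
  \<comment> \<open>Characteristic zero enters here: the multiple \<open>m r\<close> is still
    nonzero.\<close>
  define r' where "r' = nk m \<odot>\<^bsub>H\<^esub> r"
  have r': "r' \<in> Q" "r' \<noteq> \<zero>\<^bsub>H\<^esub>"
    using submod_smult[OF q(1) nk_closed r] submod_smultD[OF submodule_zero nk_closed char[OF m0] X.Q_sub[OF r]] m(1)
    by (auto simp: r'_def)
  obtain s where s: "s \<in> Q" "r' \<otimes>\<^bsub>H\<^esub> x \<oplus>\<^bsub>H\<^esub> s \<in> B" using degree_one_B[OF assms(1) m(2) m0] by (auto simp: r'_def)
  \<comment> \<open>Surjectivity of the twist moves the coefficient to the right of
    \<open>x\<close>.\<close>
  obtain t u where tu: "t \<in> Q" "u \<in> Q" "x \<otimes>\<^bsub>H\<^esub> t = r' \<otimes>\<^bsub>H\<^esub> x \<oplus>\<^bsub>H\<^esub> u" using surj[OF r'(1)] by blast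
  have "t \<noteq> \<zero>\<^bsub>H\<^esub>"
  proof
    assume "t = \<zero>\<^bsub>H\<^esub>"
    then have "X.lead 1 \<zero>\<^bsub>H\<^esub> r'" using tu r' X.F_one X.Q_sub by (intro X.leadI[of _ u]) auto
    then show False using XF.lead_F_zero X.F_zero r'(2) by blast
  qed
  have "x \<otimes>\<^bsub>H\<^esub> t \<oplus>\<^bsub>H\<^esub> (s \<ominus>\<^bsub>H\<^esub> u) = r' \<otimes>\<^bsub>H\<^esub> x \<oplus>\<^bsub>H\<^esub> s"
    unfolding tu(3) using X.Q_sub r' s tu by (simp add: a_minus_def V.M.a_ac V.M.r_neg V.M.r_neg1 V.M.r_neg2)
  then have t: "t \<in> RC" unfolding RC_def using tu(1) s(2) X.Q_diff[OF s(1) tu(2)] by force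
  have "\<one>\<^bsub>H\<^esub> \<in> RC"
  proof (rule right_coideal_one[OF hopf_sub_Int[OF B hQ] RC_submodule _ t \<open>t \<noteq> \<zero>\<^bsub>H\<^esub>\<close>])
    show "RC \<subseteq> B \<inter> Q" using RC_B by (auto simp: RC_def)
    fix r f assume "r \<in> RC" and f: "f \<in> dual"
    then obtain s where rs: "r \<in> Q" "s \<in> Q" "x \<otimes>\<^bsub>H\<^esub> r \<oplus>\<^bsub>H\<^esub> s \<in> B" by (auto simp: RC_def)
    obtain u where "u \<in> Q" "R f (x \<otimes>\<^bsub>H\<^esub> r \<oplus>\<^bsub>H\<^esub> s) = x \<otimes>\<^bsub>H\<^esub> R f r \<oplus>\<^bsub>H\<^esub> u" using R_x_mult[OF rs(1,2) f] by blast
    then show "R f r \<in> RC" unfolding RC_def using hopf_subD(5)[OF B rs(3) f] hopf_subD(5)[OF hQ rs(1) f] by auto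
  next
    fix r d assume "r \<in> RC" and d: "d \<in> B \<inter> Q"
    then obtain s where rs: "r \<in> Q" "s \<in> Q" "x \<otimes>\<^bsub>H\<^esub> r \<oplus>\<^bsub>H\<^esub> s \<in> B" by (auto simp: RC_def)
    have "(x \<otimes>\<^bsub>H\<^esub> r \<oplus>\<^bsub>H\<^esub> s) \<otimes>\<^bsub>H\<^esub> d = x \<otimes>\<^bsub>H\<^esub> (r \<otimes>\<^bsub>H\<^esub> d) \<oplus>\<^bsub>H\<^esub> s \<otimes>\<^bsub>H\<^esub> d"
      using rs d X.Q_sub by (simp add: A.l_distr A.m_assoc)
    then have "x \<otimes>\<^bsub>H\<^esub> (r \<otimes>\<^bsub>H\<^esub> d) \<oplus>\<^bsub>H\<^esub> s \<otimes>\<^bsub>H\<^esub> d \<in> B" using b(5)[OF rs(3), of d] d by simp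
    then show "r \<otimes>\<^bsub>H\<^esub> d \<in> RC" unfolding RC_def using q(5) rs d by blast
  qed
  then show ?thesis by (auto simp: RC_def)
qed

text \<open>The variable \<open>y = x + s\<close> is a translate of \<open>x\<close>, so its powers
  have leading coefficient \<open>1\<close> with respect to \<open>x\<close>. The coefficients that
  arise for elements of \<open>B\<close> belong to \<open>B\<close>, on the left by
  \<open>lead_coeff_B\<close> and on the right by \<open>RC_B\<close>.\<close>

lemma sub_step:
  assumes "B \<inter> C \<noteq> B \<inter> Q"
  shows "\<exists>y. ore_step (B \<inter> C) (B \<inter> Q) y"
proof -
  obtain y0 where "y0 \<in> B" "y0 \<in> C" "y0 \<notin> Q" using assms QC by blast
  then obtain s where s: "s \<in> Q" "x \<oplus>\<^bsub>H\<^esub> s \<in> B" using translate_in_B by blast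
  note sc = X.Q_sub[OF s(1)]
  define y where "y = x \<oplus>\<^bsub>H\<^esub> s"
  have y: "y \<in> B" "y \<in> C" "y \<in> carrier H"
    using s sc submod_add[OF c(1) xC] QC by (auto simp: y_def)
  have ypow: "X.lead n (y [^]\<^bsub>H\<^esub> n) \<one>\<^bsub>H\<^esub>" for n :: nat
  proof (induction n)
    case 0
    show ?case by (rule X.leadI[of _ "\<zero>\<^bsub>H\<^esub>"]) (use X.Qs in auto)
  next
    case (Suc n)
    then obtain u where u: "u \<in> F n" "y [^]\<^bsub>H\<^esub> n = \<one>\<^bsub>H\<^esub> \<otimes>\<^bsub>H\<^esub> x [^]\<^bsub>H\<^esub> n \<oplus>\<^bsub>H\<^esub> u" by (auto simp: X.lead_def)
    note uc = X.F_closed[OF u(1)]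
    have "y [^]\<^bsub>H\<^esub> Suc n = y \<otimes>\<^bsub>H\<^esub> y [^]\<^bsub>H\<^esub> n" by (rule A.nat_pow_Suc2[OF y(3)])
    also have "\<dots> = x \<otimes>\<^bsub>H\<^esub> y [^]\<^bsub>H\<^esub> n \<oplus>\<^bsub>H\<^esub> s \<otimes>\<^bsub>H\<^esub> y [^]\<^bsub>H\<^esub> n"
      using y(3) sc by (subst (1) y_def) (simp add: A.l_distr)
    also have "x \<otimes>\<^bsub>H\<^esub> y [^]\<^bsub>H\<^esub> n = x [^]\<^bsub>H\<^esub> Suc n \<oplus>\<^bsub>H\<^esub> x \<otimes>\<^bsub>H\<^esub> u"
      unfolding u(2) A.nat_pow_Suc2[OF X.x] using uc by (simp add: A.r_distr)
    finally have eq: "y [^]\<^bsub>H\<^esub> Suc n = \<one>\<^bsub>H\<^esub> \<otimes>\<^bsub>H\<^esub> x [^]\<^bsub>H\<^esub> Suc n \<oplus>\<^bsub>H\<^esub> (x \<otimes>\<^bsub>H\<^esub> u \<oplus>\<^bsub>H\<^esub> s \<otimes>\<^bsub>H\<^esub> y [^]\<^bsub>H\<^esub> n)"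
      using uc sc y(3) by (simp add: V.M.a_assoc del: A.nat_pow_Suc)
    have "y [^]\<^bsub>H\<^esub> n \<in> F (Suc n)" using Suc.IH X.F_Suc_lead by blast
    then have "x \<otimes>\<^bsub>H\<^esub> u \<oplus>\<^bsub>H\<^esub> s \<otimes>\<^bsub>H\<^esub> y [^]\<^bsub>H\<^esub> n \<in> F (Suc n)"
      using X.F_add[OF X.x_F[OF u(1)] X.F_lmult[OF s(1)]] by simp
    then show ?case by (rule X.leadI[OF X.Qs(2) _ eq])
  qed
  have lead_r: "X.lead n (r \<otimes>\<^bsub>H\<^esub> y [^]\<^bsub>H\<^esub> n) r" if "r \<in> Q" for r and n :: nat
    using X.lead_lmult[OF that ypow[of n]] X.Q_sub[OF that] by simp
  let ?B = "B \<inter> Q"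
  have sBQ: "subalg k H ?B" and sBC: "subalg k H (B \<inter> C)"
    using subalg_Int hopf_subD(1)[OF B] C sQ by auto
  have filF: "fil H ?B y n \<subseteq> F n" for n
  proof (induction n)
    case (Suc n)
    show ?case
    proof
      fix v assume "v \<in> fil H ?B y (Suc n)"
      then obtain r u where "r \<in> ?B" "u \<in> fil H ?B y n" "v = r \<otimes>\<^bsub>H\<^esub> y [^]\<^bsub>H\<^esub> n \<oplus>\<^bsub>H\<^esub> u" by (auto simp: fil.simps(2))
      then show "v \<in> F (Suc n)" using X.lead_add_F[OF lead_r] X.F_Suc_lead Suc by blast
    qed
  qed simp
  have Bdiff: "u \<ominus>\<^bsub>H\<^esub> v \<in> B" if "u \<in> B" "v \<in> B" for u v using submod_diff[OF b(1) that] .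
  have skew: "skew_free H ?B y"
    unfolding skew_free_iff[OF A.ring_axioms]
  proof (intro conjI ballI allI impI)
    show "subring ?B H" using subalgD(2)[OF sBQ] .
    show "y \<in> carrier H" by (rule y(3))
  next
    fix r assume r: "r \<in> ?B"
    then have rQ: "r \<in> Q" and rc: "r \<in> carrier H" using X.Q_sub by auto
    obtain t u where tu: "t \<in> Q" "u \<in> Q" "x \<otimes>\<^bsub>H\<^esub> r = t \<otimes>\<^bsub>H\<^esub> x \<oplus>\<^bsub>H\<^esub> u" using X.comm[OF rQ] by blast
    note tc = X.Q_sub[OF tu(1)] X.Q_sub[OF tu(2)]
    define v where "v = u \<oplus>\<^bsub>H\<^esub> s \<otimes>\<^bsub>H\<^esub> r"
    have v: "v \<in> Q" unfolding v_def using X.Qs(4,5) tu s rQ by simp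
    note vc = X.Q_sub[OF v]
    have yr: "y \<otimes>\<^bsub>H\<^esub> r = t \<otimes>\<^bsub>H\<^esub> x \<oplus>\<^bsub>H\<^esub> v"
      using rc sc tc by (simp add: y_def v_def A.l_distr tu(3) V.M.a_assoc)
    have "X.lead 1 (y \<otimes>\<^bsub>H\<^esub> r) t" unfolding yr by (rule X.leadI[of _ v]) (use tu v X.F_one in auto)
    \<comment> \<open>The twisted coefficient \<open>t\<close> is the leading coefficient of
      \<open>y r\<close>, an element of \<open>B\<close>; the remainder \<open>y r - t y\<close> is
      then in \<open>B\<close> and, having degree zero, in \<open>Q\<close>.\<close>
    then have t: "t \<in> B" using lead_coeff_B[of "y \<otimes>\<^bsub>H\<^esub> r"] b(5) y r by blast
    have eq: "y \<otimes>\<^bsub>H\<^esub> r \<ominus>\<^bsub>H\<^esub> t \<otimes>\<^bsub>H\<^esub> y = v \<ominus>\<^bsub>H\<^esub> t \<otimes>\<^bsub>H\<^esub> s"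
      unfolding yr unfolding y_def using vc sc tc
      by (simp add: a_minus_def A.r_distr V.M.minus_add V.M.a_ac V.M.r_neg V.M.r_neg1 V.M.r_neg2)
    have "y \<otimes>\<^bsub>H\<^esub> r \<ominus>\<^bsub>H\<^esub> t \<otimes>\<^bsub>H\<^esub> y \<in> B" using Bdiff b(5) y(1) r t by simp
    then have "y \<otimes>\<^bsub>H\<^esub> r \<ominus>\<^bsub>H\<^esub> t \<otimes>\<^bsub>H\<^esub> y \<in> ?B"
      using X.Q_diff[OF v X.Qs(4)[OF tu(1) s(1)]] eq by simp
    moreover have "y \<otimes>\<^bsub>H\<^esub> r = t \<otimes>\<^bsub>H\<^esub> y \<oplus>\<^bsub>H\<^esub> (y \<otimes>\<^bsub>H\<^esub> r \<ominus>\<^bsub>H\<^esub> t \<otimes>\<^bsub>H\<^esub> y)"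
      by (rule eq_add_diff) (use y(3) rc tc in simp_all)
    ultimately show "\<exists>s\<in>?B. \<exists>u\<in>?B. y \<otimes>\<^bsub>H\<^esub> r = s \<otimes>\<^bsub>H\<^esub> y \<oplus>\<^bsub>H\<^esub> u" using t tu(1) by blast
  next
    fix r and n :: nat assume "r \<in> ?B" "r \<otimes>\<^bsub>H\<^esub> y [^]\<^bsub>H\<^esub> n \<in> fil H ?B y n"
    then show "r = \<zero>\<^bsub>H\<^esub>" using XF.lead_F_zero[OF lead_r] filF by blast
  next
    fix r assume r: "r \<in> ?B" "y \<otimes>\<^bsub>H\<^esub> r \<in> ?B"
    then have rQ: "r \<in> Q" and rc: "r \<in> carrier H" using X.Q_sub by auto
    have "x \<otimes>\<^bsub>H\<^esub> r = y \<otimes>\<^bsub>H\<^esub> r \<ominus>\<^bsub>H\<^esub> s \<otimes>\<^bsub>H\<^esub> r"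
      unfolding y_def using rc sc by (simp add: a_minus_def A.l_distr V.M.a_assoc V.M.r_neg)
    then have "x \<otimes>\<^bsub>H\<^esub> r \<in> Q" using X.Q_diff X.Qs(4) r s rQ by simp
    then show "r = \<zero>\<^bsub>H\<^esub>" by (rule XF.inj[OF rQ])
  qed
  \<comment> \<open>Surjectivity over \<open>Q\<close> supplies \<open>r\<close>; it belongs to
    \<open>B\<close> because it is a right coefficient of \<open>t y\<close>, an element of
    \<open>B\<close>.\<close>
  have surjB: "\<exists>r\<in>?B. \<exists>u\<in>?B. y \<otimes>\<^bsub>H\<^esub> r = t \<otimes>\<^bsub>H\<^esub> y \<oplus>\<^bsub>H\<^esub> u" if t: "t \<in> ?B" for t
  proof -
    have tQ: "t \<in> Q" and tc: "t \<in> carrier H" using t X.Q_sub by auto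
    obtain r u where ru: "r \<in> Q" "u \<in> Q" "x \<otimes>\<^bsub>H\<^esub> r = t \<otimes>\<^bsub>H\<^esub> x \<oplus>\<^bsub>H\<^esub> u" using surj[OF tQ] by blast
    note rc = X.Q_sub[OF ru(1)] X.Q_sub[OF ru(2)]
    have "x \<otimes>\<^bsub>H\<^esub> r \<oplus>\<^bsub>H\<^esub> (t \<otimes>\<^bsub>H\<^esub> s \<ominus>\<^bsub>H\<^esub> u) = t \<otimes>\<^bsub>H\<^esub> y"
      unfolding ru(3) y_def using rc tc sc
      by (simp add: a_minus_def A.r_distr V.M.a_ac V.M.r_neg V.M.r_neg1 V.M.r_neg2)
    then have "x \<otimes>\<^bsub>H\<^esub> r \<oplus>\<^bsub>H\<^esub> (t \<otimes>\<^bsub>H\<^esub> s \<ominus>\<^bsub>H\<^esub> u) \<in> B" using b(5) t y(1) by simp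
    moreover have "t \<otimes>\<^bsub>H\<^esub> s \<ominus>\<^bsub>H\<^esub> u \<in> Q" using X.Q_diff X.Qs(4) tQ s ru by simp
    ultimately have "r \<in> RC" unfolding RC_def using ru(1) by blast
    then have r: "r \<in> ?B" using RC_B ru(1) by blast
    have "y \<otimes>\<^bsub>H\<^esub> r \<ominus>\<^bsub>H\<^esub> t \<otimes>\<^bsub>H\<^esub> y = u \<oplus>\<^bsub>H\<^esub> s \<otimes>\<^bsub>H\<^esub> r \<ominus>\<^bsub>H\<^esub> t \<otimes>\<^bsub>H\<^esub> s"
      unfolding y_def using rc sc tc
      by (simp add: a_minus_def A.l_distr ru(3) A.r_distr V.M.minus_add V.M.a_ac V.M.r_neg V.M.r_neg1 V.M.r_neg2)
    then have "y \<otimes>\<^bsub>H\<^esub> r \<ominus>\<^bsub>H\<^esub> t \<otimes>\<^bsub>H\<^esub> y \<in> Q" using X.Q_diff X.Qs(4,5) ru(1,2) s(1) tQ by simp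
    moreover have "y \<otimes>\<^bsub>H\<^esub> r \<ominus>\<^bsub>H\<^esub> t \<otimes>\<^bsub>H\<^esub> y \<in> B" using Bdiff b(5) y(1) r t by simp
    ultimately have "y \<otimes>\<^bsub>H\<^esub> r \<ominus>\<^bsub>H\<^esub> t \<otimes>\<^bsub>H\<^esub> y \<in> ?B" by simp
    moreover have "y \<otimes>\<^bsub>H\<^esub> r = t \<otimes>\<^bsub>H\<^esub> y \<oplus>\<^bsub>H\<^esub> (y \<otimes>\<^bsub>H\<^esub> r \<ominus>\<^bsub>H\<^esub> t \<otimes>\<^bsub>H\<^esub> y)"
      by (rule eq_add_diff) (use y(3) rc tc in simp_all)
    ultimately show ?thesis using r by blast
  qed
  \<comment> \<open>Subtracting \<open>r y^n\<close>, with \<open>r\<close> the leading coefficient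
    of \<open>v\<close>, stays in \<open>B\<close> and lowers the degree.\<close>
  have cover: "v \<in> fil H ?B y n" if "v \<in> B" "v \<in> F n" for v n
    using that
  proof (induction n arbitrary: v)
    case (Suc n)
    then obtain r where r: "X.lead n v r" using X.F_Suc_lead by blast
    then have rB: "r \<in> ?B" using lead_coeff_B[OF Suc.prems(1)] by (auto simp: X.lead_def)
    note rc = X.Q_sub[of r]
    define v' where "v' = v \<ominus>\<^bsub>H\<^esub> r \<otimes>\<^bsub>H\<^esub> y [^]\<^bsub>H\<^esub> n"
    obtain u where u: "u \<in> F n" "v = r \<otimes>\<^bsub>H\<^esub> x [^]\<^bsub>H\<^esub> n \<oplus>\<^bsub>H\<^esub> u" using r by (auto simp: X.lead_def)
    obtain u' where u': "u' \<in> F n" "r \<otimes>\<^bsub>H\<^esub> y [^]\<^bsub>H\<^esub> n = r \<otimes>\<^bsub>H\<^esub> x [^]\<^bsub>H\<^esub> n \<oplus>\<^bsub>H\<^esub> u'"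
      using lead_r[of r n] rB by (auto simp: X.lead_def)
    have "v' = u \<ominus>\<^bsub>H\<^esub> u'"
      unfolding v'_def u'(2) u(2) using rB rc X.F_closed[OF u(1)] X.F_closed[OF u'(1)]
      by (simp add: a_minus_def V.M.minus_add V.M.a_ac V.M.r_neg V.M.r_neg1 V.M.r_neg2)
    then have v'F: "v' \<in> F n" using X.F_diff[OF u(1) u'(1)] by simp
    have "y [^]\<^bsub>H\<^esub> (m::nat) \<in> B" for m by (induction m) (use b y in auto)
    then have "v' \<in> B" unfolding v'_def using Bdiff Suc.prems(1) b(5) rB by blast
    then have v'fil: "v' \<in> fil H ?B y n" using Suc.IH v'F by blast
    have "v = r \<otimes>\<^bsub>H\<^esub> y [^]\<^bsub>H\<^esub> n \<oplus>\<^bsub>H\<^esub> v'"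
      unfolding v'_def by (rule eq_add_diff) (use y(3) rB rc b(6)[OF Suc.prems(1)] in simp_all)
    then show ?case using rB v'fil by (auto simp: fil.simps(2))
  qed simp
  have "B \<inter> C = (\<Union>n. fil H ?B y n)"
  proof
    show "B \<inter> C \<subseteq> (\<Union>n. fil H ?B y n)" using cover C_eq by blast
    show "(\<Union>n. fil H ?B y n) \<subseteq> B \<inter> C"
      using fil_subalg[OF sBC, of ?B y] QC y by blast
  qed
  then have "ore_step (B \<inter> C) ?B y" unfolding ore_step_def using sBC sBQ skew surjB by blast
  then show ?thesis by blast
qed

end

end

section \<open>Quotients of Ore extensions\<close>

context primitive_ext
begin

context
  assumes surj: "\<And>s. s \<in> Q \<Longrightarrow> \<exists>r\<in>Q. \<exists>u\<in>Q. x \<otimes>\<^bsub>H\<^esub> r = s \<otimes>\<^bsub>H\<^esub> x \<oplus>\<^bsub>H\<^esub> u"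
    and char: "\<And>n. n > 0 \<Longrightarrow> nk n \<noteq> \<zero>\<^bsub>k\<^esub>" and x_notin: "x \<notin> Q"
begin

text \<open>The \<open>n\<close>-fold twist is surjective as well. It is expressed through
  coefficients, since without freeness the twist is not a map.\<close>

lemma pow_surj: "d \<in> Q \<Longrightarrow> \<exists>s\<in>Q. X.lead n (x [^]\<^bsub>H\<^esub> n \<otimes>\<^bsub>H\<^esub> s) d"
proof (induction n arbitrary: d)
  case 0
  then show ?case by (intro bexI[of _ d] X.leadI[of _ "\<zero>\<^bsub>H\<^esub>"]) (use X.Q_sub in auto)
next
  case (Suc n)
  obtain d' w where d': "d' \<in> Q" "w \<in> Q" "x \<otimes>\<^bsub>H\<^esub> d' = d \<otimes>\<^bsub>H\<^esub> x \<oplus>\<^bsub>H\<^esub> w" using surj[OF Suc.prems] by blast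
  obtain s where s: "s \<in> Q" "X.lead n (x [^]\<^bsub>H\<^esub> n \<otimes>\<^bsub>H\<^esub> s) d'" using Suc.IH[OF d'(1)] by blast
  then obtain u where u: "u \<in> F n" "x [^]\<^bsub>H\<^esub> n \<otimes>\<^bsub>H\<^esub> s = d' \<otimes>\<^bsub>H\<^esub> x [^]\<^bsub>H\<^esub> n \<oplus>\<^bsub>H\<^esub> u" by (auto simp: X.lead_def)
  have eq: "x [^]\<^bsub>H\<^esub> Suc n \<otimes>\<^bsub>H\<^esub> s = x \<otimes>\<^bsub>H\<^esub> (x [^]\<^bsub>H\<^esub> n \<otimes>\<^bsub>H\<^esub> s)"
    using A.nat_pow_Suc2[OF X.x, of n] X.Q_sub[OF s(1)] by (simp add: A.m_assoc del: A.nat_pow_Suc)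
  have "X.lead (Suc n) (x [^]\<^bsub>H\<^esub> Suc n \<otimes>\<^bsub>H\<^esub> s) d"
    unfolding eq by (rule X.x_lead[OF d'(1) Suc.prems d'(2,3) _ u(2,1) X.x_F[OF u(1)]]) (use s(2) X.F_Suc_lead in blast)
  then show ?case using s(1) by blast
qed

text \<open>The coefficients \<open>r\<close> with \<open>r x\<^sup>n\<close> of degree below \<open>n\<close> form a right ideal and right coideal of
  \<open>Q\<close>. If one of them were nonzero, then \<open>x\<^sup>n\<close> itself would have degree below \<open>n\<close>, and the term
  \<open>n x\<^sup>n\<^sup>-\<^sup>1 \<otimes> x\<close> of \<open>\<Delta>(x\<^sup>n)\<close> would force \<open>x \<in> Q\<close>.\<close>

lemma quotient_free: "\<lbrakk>r \<in> Q; r \<otimes>\<^bsub>H\<^esub> x [^]\<^bsub>H\<^esub> (n::nat) \<in> F n\<rbrakk> \<Longrightarrow> r = \<zero>\<^bsub>H\<^esub>"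
\<comment> \<open>The induction hypothesis serves at the predecessor of \<open>n\<close>: it
  provides a functional that kills \<open>F p\<close> but not \<open>x^p\<close>.\<close>
proof (induction n arbitrary: r rule: less_induct)
  case (less n)
  show ?case
  proof (cases n)
    case 0
    then show ?thesis using less.prems X.Q_sub by simp
  next
    case (Suc p)
    define J where "J = {r \<in> Q. r \<otimes>\<^bsub>H\<^esub> x [^]\<^bsub>H\<^esub> n \<in> F n}"
    note Fm = submod[OF F_sub[of n]]
    have J: "submodule J k H"
    proof (rule submoduleI')
      show "r \<oplus>\<^bsub>H\<^esub> r' \<in> J" if "r \<in> J" "r' \<in> J" for r r'
        using that X.Qs(5) X.Q_sub Fm(2) by (auto simp: J_def A.l_distr)
      show "d \<odot>\<^bsub>H\<^esub> r \<in> J" if "d \<in> carrier k" "r \<in> J" for d r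
        using that submod_smult[OF q(1)] X.Q_sub Fm(3) by (auto simp: J_def smult_mult_left)
    qed (use X.Q_sub X.Q_zero Fm(1) in \<open>auto simp: J_def\<close>)
    show ?thesis
    proof (rule ccontr)
      assume r0: "r \<noteq> \<zero>\<^bsub>H\<^esub>"
      have "\<one>\<^bsub>H\<^esub> \<in> J"
      proof (rule right_coideal_one[OF hQ J _ _ r0])
        show "J \<subseteq> Q" "r \<in> J" using less.prems by (auto simp: J_def)
        fix r f assume "r \<in> J" and f: "f \<in> dual"
        then have r: "r \<in> Q" "r \<otimes>\<^bsub>H\<^esub> x [^]\<^bsub>H\<^esub> n \<in> F n" by (auto simp: J_def)
        note rc = X.Q_sub[OF r(1)] and Dr = hopf_subD(2)[OF hQ r(1)]
        note l = linear_mapD[OF TP.rslice_linear[OF f]]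
        \<comment> \<open>Zero is written as \<open>r x^n - r x^n\<close> with the second term in
          \<open>F n\<close>. So \<open>r\<close> is a coefficient of zero at \<open>x^n\<close>,
          and \<open>comul_lead\<close> expands \<open>D 0\<close>.\<close>
        have "X.lead n \<zero>\<^bsub>H\<^esub> r"
          by (rule X.leadI[OF r(1) X.F_neg[OF r(2)]]) (use rc in \<open>simp add: V.M.r_neg\<close>)
        then obtain z where z: "z \<in> W n" "D \<zero>\<^bsub>H\<^esub> = D r \<otimes>\<^bsub>HH\<^esub> tp (x [^]\<^bsub>H\<^esub> n) \<one>\<^bsub>H\<^esub>
          \<oplus>\<^bsub>HH\<^esub> nk n \<odot>\<^bsub>HH\<^esub> (D r \<otimes>\<^bsub>HH\<^esub> tp (x [^]\<^bsub>H\<^esub> (n - 1)) x) \<oplus>\<^bsub>HH\<^esub> z" using comul_lead by blast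
        define v where "v = nk n \<odot>\<^bsub>H\<^esub> rsl f (D r \<otimes>\<^bsub>HH\<^esub> tp (x [^]\<^bsub>H\<^esub> p) x) \<oplus>\<^bsub>H\<^esub> rsl f z"
        have "rsl f (D r \<otimes>\<^bsub>HH\<^esub> tp (x [^]\<^bsub>H\<^esub> p) x) \<in> F n"
          by (rule TP.tensor_sub_linear[OF k_algebra_axioms linear_map_comp[OF rmult_linear TP.rslice_linear[OF f]] F_sub q(3,3) _ Dr])
            (use f X.Q_sub Fm(3) X.F_term[of _ p] Suc in \<open>auto simp: TP.pt_mult TP.rslice_pt functionalD\<close>)
        then have v: "v \<in> F n" unfolding v_def using Fm(2,3) rsl_W[OF f z(1)] by simp
        have "rsl f (D \<zero>\<^bsub>H\<^esub>) = \<zero>\<^bsub>H\<^esub>"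
          using linear_map_zero[OF TP.T_k_algebra k_algebra_axioms TP.rslice_linear[OF f]] by (simp add: D_zero)
        moreover have "rsl f (D \<zero>\<^bsub>H\<^esub>) = R f r \<otimes>\<^bsub>H\<^esub> x [^]\<^bsub>H\<^esub> n \<oplus>\<^bsub>H\<^esub> v"
          unfolding z(2) v_def R_def using rc W_closed[OF z(1)] f Suc
          by (simp add: D l TP.rslice_mult_one V.M.a_assoc del: A.nat_pow_Suc)
        ultimately have "R f r \<otimes>\<^bsub>H\<^esub> x [^]\<^bsub>H\<^esub> n \<oplus>\<^bsub>H\<^esub> v \<in> F n" using Fm(1) by simp
        then have "R f r \<otimes>\<^bsub>H\<^esub> x [^]\<^bsub>H\<^esub> n \<in> F n"
          using X.F_cancel[OF v] X.Q_sub[OF hopf_subD(5)[OF hQ r(1) f]] by simp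
        then show "R f r \<in> J" unfolding J_def using hopf_subD(5)[OF hQ r(1) f] by simp
      next
        fix r d assume "r \<in> J" and d: "d \<in> Q"
        then have r: "r \<in> Q" "r \<otimes>\<^bsub>H\<^esub> x [^]\<^bsub>H\<^esub> n \<in> F n" by (auto simp: J_def)
        \<comment> \<open>With \<open>s\<close> chosen so that \<open>d\<close> is its
          \<open>n\<close>-fold twist, \<open>r x^n s\<close> equals \<open>r d x^n\<close> up to
          lower degree.\<close>
        obtain s where s: "s \<in> Q" "X.lead n (x [^]\<^bsub>H\<^esub> n \<otimes>\<^bsub>H\<^esub> s) d" using pow_surj[OF d] by blast
        then obtain u where u: "u \<in> F n" "x [^]\<^bsub>H\<^esub> n \<otimes>\<^bsub>H\<^esub> s = d \<otimes>\<^bsub>H\<^esub> x [^]\<^bsub>H\<^esub> n \<oplus>\<^bsub>H\<^esub> u" by (auto simp: X.lead_def)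
        note cc = X.Q_sub[OF r(1)] X.Q_sub[OF d] X.Q_sub[OF s(1)] X.F_closed[OF u(1)]
        have "(r \<otimes>\<^bsub>H\<^esub> x [^]\<^bsub>H\<^esub> n) \<otimes>\<^bsub>H\<^esub> s = r \<otimes>\<^bsub>H\<^esub> (x [^]\<^bsub>H\<^esub> n \<otimes>\<^bsub>H\<^esub> s)" using cc by (simp add: A.m_assoc)
        also have "\<dots> = (r \<otimes>\<^bsub>H\<^esub> d) \<otimes>\<^bsub>H\<^esub> x [^]\<^bsub>H\<^esub> n \<oplus>\<^bsub>H\<^esub> r \<otimes>\<^bsub>H\<^esub> u"
          unfolding u(2) using cc by (simp add: A.r_distr A.m_assoc)
        finally have "(r \<otimes>\<^bsub>H\<^esub> d) \<otimes>\<^bsub>H\<^esub> x [^]\<^bsub>H\<^esub> n \<oplus>\<^bsub>H\<^esub> r \<otimes>\<^bsub>H\<^esub> u \<in> F n" using X.F_rmult[OF r(2) s(1)] by simp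
        then have "(r \<otimes>\<^bsub>H\<^esub> d) \<otimes>\<^bsub>H\<^esub> x [^]\<^bsub>H\<^esub> n \<in> F n"
          using X.F_cancel[OF X.F_lmult[OF r(1) u(1)]] cc by simp
        then show "r \<otimes>\<^bsub>H\<^esub> d \<in> J" unfolding J_def using q(5) r(1) d by simp
      qed
      then have xn: "x [^]\<^bsub>H\<^esub> n \<in> F n" by (simp add: J_def)
      obtain z where z: "z \<in> W n"
        "D (x [^]\<^bsub>H\<^esub> n) = tp (x [^]\<^bsub>H\<^esub> n) \<one>\<^bsub>H\<^esub> \<oplus>\<^bsub>HH\<^esub> nk n \<odot>\<^bsub>HH\<^esub> tp (x [^]\<^bsub>H\<^esub> (n - 1)) x \<oplus>\<^bsub>HH\<^esub> z" using comul_pow by blast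
      define a where "a = tp (x [^]\<^bsub>H\<^esub> n) \<one>\<^bsub>H\<^esub>"
      define m where "m = nk n \<odot>\<^bsub>HH\<^esub> tp (x [^]\<^bsub>H\<^esub> p) x"
      \<comment> \<open>Since \<open>x^n\<close> has degree below \<open>n\<close>, its
        comultiplication, the leading term and the error all lie in \<open>W n\<close>; hence so
        does the middle term \<open>m\<close>.\<close>
      have aW: "a \<in> W n" unfolding a_def by (rule WI(1)[OF xn q(4)])
      have mc: "m \<in> carrier HH" unfolding m_def by simp
      have "D (x [^]\<^bsub>H\<^esub> n) = a \<oplus>\<^bsub>HH\<^esub> m \<oplus>\<^bsub>HH\<^esub> z" using z(2) Suc by (simp add: a_def m_def)
      also have "\<dots> = a \<oplus>\<^bsub>HH\<^esub> (z \<oplus>\<^bsub>HH\<^esub> m)"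
        using W_closed[OF z(1)] W_closed[OF aW] mc by (simp add: TP.T.V.M.a_ac)
      finally have "a \<oplus>\<^bsub>HH\<^esub> (z \<oplus>\<^bsub>HH\<^esub> m) \<in> W n" using comul_F[OF xn] by simp
      then have "z \<oplus>\<^bsub>HH\<^esub> m \<in> W n" using TP.T.submod_add_cancel[OF W_sub aW] W_closed[OF z(1)] mc by simp
      then have mW: "m \<in> W n" using TP.T.submod_add_cancel[OF W_sub z(1) mc] by simp
      have "x [^]\<^bsub>H\<^esub> p \<notin> F p"
      proof
        assume "x [^]\<^bsub>H\<^esub> p \<in> F p"
        then have "\<one>\<^bsub>H\<^esub> = \<zero>\<^bsub>H\<^esub>" using less.IH[of p "\<one>\<^bsub>H\<^esub>"] q(4) Suc by simp
        then show False using one_not_zero by simp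
      qed
      then obtain f where f: "f \<in> dual" "\<And>v. v \<in> F p \<Longrightarrow> f v = \<zero>\<^bsub>k\<^esub>" "f (x [^]\<^bsub>H\<^esub> p) = \<one>\<^bsub>k\<^esub>"
        using ex_functional[OF F_sub] by (metis A.nat_pow_closed X.x)
      \<comment> \<open>The slice of an element of \<open>W n\<close> by this functional lies in
        \<open>Q\<close>, while the slice of the middle term is the multiple
        \<open>n x\<close>.\<close>
      have "lsl f m \<in> Q" using lsl_W_Q[OF f(1) _ mW] f(2) Suc by simp
      moreover have "lsl f m = nk n \<odot>\<^bsub>H\<^esub> x"
        unfolding m_def using f by (simp add: linear_mapD[OF TP.lslice_linear] TP.lslice_pt)
      ultimately have xQ: "nk n \<odot>\<^bsub>H\<^esub> x \<in> Q" by simp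
      have "nk n \<noteq> \<zero>\<^bsub>k\<^esub>" by (rule char) (simp add: Suc)
      then show False using submod_smultD[OF q(1) nk_closed _ X.x xQ] x_notin by blast
    qed
  qed
qed

text \<open>The elements \<open>r\<close> with \<open>x r\<close> in \<open>Q\<close> form a right
  ideal and right coideal of \<open>Q\<close>; if it were nonzero it would contain \<open>1\<close>,
  and \<open>x\<close> would lie in \<open>Q\<close>.\<close>

lemma quotient_inj:
  assumes r: "r \<in> Q" "x \<otimes>\<^bsub>H\<^esub> r \<in> Q" shows "r = \<zero>\<^bsub>H\<^esub>"
proof (rule ccontr)
  assume r0: "r \<noteq> \<zero>\<^bsub>H\<^esub>"
  define J where "J = {r \<in> Q. x \<otimes>\<^bsub>H\<^esub> r \<in> Q}"
  have J: "submodule J k H"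
  proof (rule submoduleI')
    show "r \<oplus>\<^bsub>H\<^esub> r' \<in> J" if "r \<in> J" "r' \<in> J" for r r'
      using that X.Qs(5) X.Q_sub by (auto simp: J_def A.r_distr)
    show "d \<odot>\<^bsub>H\<^esub> r \<in> J" if "d \<in> carrier k" "r \<in> J" for d r
      using that submod_smult[OF q(1)] X.Q_sub by (auto simp: J_def smult_mult_right)
  qed (use X.Q_sub X.Q_zero in \<open>auto simp: J_def\<close>)
  have "\<one>\<^bsub>H\<^esub> \<in> J"
  proof (rule right_coideal_one[OF hQ J _ _ r0])
    show "J \<subseteq> Q" "r \<in> J" using r by (auto simp: J_def)
    fix r f assume "r \<in> J" and f: "f \<in> dual"
    then have r: "r \<in> Q" "x \<otimes>\<^bsub>H\<^esub> r \<in> Q" by (auto simp: J_def)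
    note rc = X.Q_sub[OF r(1)] and Rc = X.Q_sub[OF hopf_subD(5)[OF hQ r(1) f]]
    \<comment> \<open>\<open>R_x_mult\<close> is applied to the sum of \<open>x r\<close> and
      \<open>-(x r)\<close>, the latter being an admissible term of \<open>Q\<close>; the sum is
      zero, so its slice vanishes.\<close>
    obtain u where u: "u \<in> Q" "R f (x \<otimes>\<^bsub>H\<^esub> r \<oplus>\<^bsub>H\<^esub> \<ominus>\<^bsub>H\<^esub> (x \<otimes>\<^bsub>H\<^esub> r)) = x \<otimes>\<^bsub>H\<^esub> R f r \<oplus>\<^bsub>H\<^esub> u"
      using R_x_mult[OF r(1) X.Qs(3)[OF r(2)] f] by blast
    have "R f \<zero>\<^bsub>H\<^esub> = \<zero>\<^bsub>H\<^esub>" by (rule linear_map_zero[OF k_algebra_axioms k_algebra_axioms R_linear[OF f]])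
    then have "u \<oplus>\<^bsub>H\<^esub> x \<otimes>\<^bsub>H\<^esub> R f r \<in> Q" using u X.Q_zero rc Rc X.Q_sub by (simp add: V.M.r_neg V.M.a_comm)
    then show "R f r \<in> J" unfolding J_def using submod_add_cancel[OF q(1) u(1)] hopf_subD(5)[OF hQ r(1) f] Rc by simp
  next
    fix r d assume "r \<in> J" "d \<in> Q"
    then show "r \<otimes>\<^bsub>H\<^esub> d \<in> J" using q(5) X.Q_sub by (auto simp: J_def A.m_assoc[symmetric])
  qed
  then show False using x_notin by (simp add: J_def)
qed

lemma quotient_skew_free: "skew_free H Q x"
  by (intro skew_free.intro gen skew_free_axioms.intro quotient_free quotient_inj)

end

end

section \<open>The Hopf algebra structures on Hopf subalgebras and quotients\<close>

text \<open>\<open>quot_alg H I\<close> and \<open>quot_hopf k H I\<close> are records of different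
  types with the same algebra fields. Tensor products depend on these fields only, so they are equal
  and not merely isomorphic.\<close>

definition same_alg ::
  "('k, 'a, 'm) module_scheme \<Rightarrow> ('k, 'a, 'n) module_scheme \<Rightarrow> bool" where
  "same_alg A A' \<longleftrightarrow> carrier A = carrier A' \<and> monoid.mult A = monoid.mult A' \<and> \<one>\<^bsub>A\<^esub> = \<one>\<^bsub>A'\<^esub>
    \<and> \<zero>\<^bsub>A\<^esub> = \<zero>\<^bsub>A'\<^esub> \<and> add A = add A' \<and> smult A = smult A'"

lemma same_alg_k_algebra:
  assumes "k_algebra k A" "same_alg A A'"
  shows "k_algebra k A'"
proof -
  interpret A: k_algebra k A by fact
  have s: "carrier A' = carrier A" "monoid.mult A' = monoid.mult A" "\<one>\<^bsub>A'\<^esub> = \<one>\<^bsub>A\<^esub>"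
    "\<zero>\<^bsub>A'\<^esub> = \<zero>\<^bsub>A\<^esub>" "add A' = add A" "smult A' = smult A"
    using assms(2) by (auto simp: same_alg_def)
  show ?thesis
  proof (rule k_algebraI)
    show "ring A'"
    proof (rule ringI)
      show "abelian_group A'"
        by (rule abelian_groupI) (auto simp: s A.V.M.a_ac intro: A.V.M.a_inv_closed A.V.M.l_neg)
      show "Group.monoid A'"
        by (rule monoidI) (auto simp: s A.A.m_assoc)
    qed (auto simp: s A.A.l_distr A.A.r_distr)
  qed (simp_all add: s A.K.field_axioms A.V.smult_l_distr A.V.smult_r_distr A.V.smult_assoc1
      A.smult_mult_left A.smult_mult_right)
qed

lemma tensor_cong:
  assumes "same_alg A A'" "same_alg B B'"
  shows "tensor k A B = tensor k A' B'" "pure_tensor k A B = pure_tensor k A' B'"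
proof -
  have dp: "A \<times>\<times> B = A' \<times>\<times> B'"
    using assms by (simp add: DirProd_def same_alg_def)
  have br: "bilin_rels k A B = bilin_rels k A' B'"
    using assms unfolding bilin_rels_def dp by (simp add: same_alg_def)
  show "tensor k A B = tensor k A' B'" unfolding tensor_def dp br ..
  show "pure_tensor k A B = pure_tensor k A' B'" unfolding pure_tensor_def[abs_def] dp br ..
qed

lemma tensor_map_cong:
  assumes "same_alg A A'" "same_alg B B'"
  shows "tensor_map k A B f g = tensor_map k A' B' f g"
  unfolding tensor_map_def tensor_cong[OF assms] ..

lemma subalg_cong:
  assumes "k_algebra k A" "k_algebra k A'" "same_alg A A'" "subalg k A C"
  shows "subalg k A' C"
proof -
  interpret A: k_algebra k A by fact
  interpret A': k_algebra k A' by fact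
  have s: "carrier A' = carrier A" "monoid.mult A' = monoid.mult A" "\<one>\<^bsub>A'\<^esub> = \<one>\<^bsub>A\<^esub>"
    "\<zero>\<^bsub>A'\<^esub> = \<zero>\<^bsub>A\<^esub>" "add A' = add A" "smult A' = smult A"
    using assms(3) by (auto simp: same_alg_def)
  note c = A.subalgD[OF assms(4)] and m = A.submod[OF A.subalgD(1)[OF assms(4)]]
  have sub: "submodule C k A'" by (rule A'.submoduleI') (use c m in \<open>auto simp: s\<close>)
  have "subring C A'"
    by (rule A'.A.subringI) (use c(3-5) A'.submod[OF sub] in \<open>auto simp: s\<close>)
  then show ?thesis using sub by (simp add: subalg_def)
qed

text \<open>An element of the kernel is written with independent first components. An injective
  \<open>f\<close> preserves their independence, so by \<open>indep_slices\<close> the images under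
  \<open>g\<close> of the second components vanish, and then the components themselves.\<close>

lemma tensor_map_inj:
  assumes P: "tensor_pair k A B" and P': "tensor_pair k A' B'"
    and f: "f \<in> linear_map k A A'" "inj_on f (carrier A)" and g: "g \<in> linear_map k B B'" "inj_on g (carrier B)"
  shows "inj_on (tensor_map k A' B' f g) (carrier (tensor k A B))"
proof -
  interpret P: tensor_pair k A B by fact
  interpret P': tensor_pair k A' B' by fact
  let ?m = "tensor_map k A' B' f g"
  note ml = tensor_map_linear[OF P P' f(1) g(1)] and fl = linear_mapD[OF f(1)] and gl = linear_mapD[OF g(1)]
  have ts: "?m (tsum k A B l) = tsum k A' B' (map (\<lambda>(a, b). (f a, g b)) l)"
    if "set l \<subseteq> carrier A \<times> carrier B" for l
    using that
  proof (induction l)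
    case Nil
    then show ?case using linear_map_zero[OF P.T_k_algebra P'.T_k_algebra ml(1)] by simp
  next
    case (Cons p l)
    then show ?case by (cases p) (simp add: linear_mapD[OF ml(1)] ml(2) P.tsum_closed)
  qed
  have ind: "indep k A' (map f as)" if "indep k A as" "set as \<subseteq> carrier A" for as
    using that
  proof (induction as)
    case (Cons a as)
    have sub: "submodule (f ` lspan k A (set as)) k A'"
      by (rule submodule_image[OF P.A.k_algebra_axioms P'.A.k_algebra_axioms f(1) P.A.lspan_submodule]) (use Cons in auto)
    have "f a \<notin> lspan k A' (f ` set as)"
    proof
      assume "f a \<in> lspan k A' (f ` set as)"
      moreover have "lspan k A' (f ` set as) \<subseteq> f ` lspan k A (set as)"
        by (rule P'.A.lspan_le[OF sub]) (auto intro: hull_inc)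
      ultimately obtain u where u: "u \<in> lspan k A (set as)" "f a = f u" by blast
      then have "a = u" using inj_onD[OF f(2)] P.A.lspan_sub[of "set as" u] Cons.prems by simp
      then show False using u(1) Cons.prems by simp
    qed
    then show ?case using Cons by simp
  qed simp
  have ker: "t = \<zero>\<^bsub>tensor k A B\<^esub>" if t: "t \<in> carrier (tensor k A B)" "?m t = \<zero>\<^bsub>tensor k A' B'\<^esub>" for t
  proof -
    obtain l0 where "set l0 \<subseteq> carrier A \<times> carrier B" "t = tsum k A B l0" using P.ex_tsum[OF t(1)] by blast
    then obtain l where l: "set l \<subseteq> carrier A \<times> carrier B" "indep k A (map fst l)" "t = tsum k A B l"
      using P.tsum_indep by metis
    define l' where "l' = map (\<lambda>(a, b). (f a, g b)) l"
    have fst_l': "map fst l' = map f (map fst l)" by (simp add: l'_def case_prod_beta)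
    have "snd ` set l' \<subseteq> {\<zero>\<^bsub>B'\<^esub>}"
    proof (rule P'.indep_slices[OF _ _ P'.B.submodule_zero])
      show "set l' \<subseteq> carrier A' \<times> carrier B'" using l(1) fl(1) gl(1) by (auto simp: l'_def)
      show "indep k A' (map fst l')" unfolding fst_l' by (rule ind[OF l(2)]) (use l(1) in auto)
      fix h assume h: "h \<in> functional k A'"
      have "tsum k A' B' l' = \<zero>\<^bsub>tensor k A' B'\<^esub>" using ts[OF l(1)] t(2) l(3) by (simp add: l'_def)
      then show "lslice k B' h (tsum k A' B' l') \<in> {\<zero>\<^bsub>B'\<^esub>}"
        using linear_map_zero[OF P'.T_k_algebra P'.B.k_algebra_axioms P'.lslice_linear[OF h]] by simp
    qed
    then have gb: "g b = \<zero>\<^bsub>B'\<^esub>" if "(a, b) \<in> set l" for a b using that by (force simp: l'_def)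
    have b0: "b = \<zero>\<^bsub>B\<^esub>" if "(a, b) \<in> set l" for a b
      using inj_onD[OF g(2), of b "\<zero>\<^bsub>B\<^esub>"] gb[OF that] l(1) that
        linear_map_zero[OF P.B.k_algebra_axioms P'.B.k_algebra_axioms g(1)] by auto
    have "tsum k A B m = \<zero>\<^bsub>tensor k A B\<^esub>" if "set m \<subseteq> set l" for m
      using that
    proof (induction m)
      case (Cons p m)
      obtain a b where p: "p = (a, b)" by (cases p)
      then show ?case using Cons l(1) b0[of a b] by auto
    qed simp
    then show ?thesis using l(3) by simp
  qed
  show ?thesis
  proof (rule inj_onI)
    fix s t assume st: "s \<in> carrier (tensor k A B)" "t \<in> carrier (tensor k A B)" "?m s = ?m t"
    have "?m (s \<ominus>\<^bsub>tensor k A B\<^esub> t) = \<zero>\<^bsub>tensor k A' B'\<^esub>"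
      using linear_map_diff[OF P.T_k_algebra P'.T_k_algebra ml(1) st(1,2)] st(3) linear_mapD(1)[OF ml(1) st(2)]
      by (simp add: a_minus_def P'.T.V.M.r_neg)
    then have "s \<ominus>\<^bsub>tensor k A B\<^esub> t = \<zero>\<^bsub>tensor k A B\<^esub>" using ker st by simp
    then show "s = t" using st by simp
  qed
qed

text \<open>Neither side is assumed to satisfy the axioms of a Hopf algebra: they are transported from the
  source to the target along a surjection, and from the target to the source along an injection.\<close>

locale coalg_map = A: k_algebra k A + B: k_algebra k B
  for k :: "('k, 'l) ring_scheme" and A :: "('k, 'a, 'm) hopf_scheme"
    and B :: "('k, 'b, 'n) hopf_scheme" +
  fixes f
  assumes comul_A: "comul A \<in> linear_map k A (tensor k A A)"
    and comul_B: "comul B \<in> linear_map k B (tensor k B B)"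
    and counit_A: "counit A \<in> functional k A" and counit_B: "counit B \<in> functional k B"
    and antipode_A: "antipode A \<in> linear_map k A A" and antipode_B: "antipode B \<in> linear_map k B B"
    and f_linear: "f \<in> linear_map k A B" and f_hom: "f \<in> ring_hom A B"
    and f_comul: "x \<in> carrier A \<Longrightarrow> tensor_map k B B f f (comul A x) = comul B (f x)"
    and f_counit: "x \<in> carrier A \<Longrightarrow> counit B (f x) = counit A x"
    and f_antipode: "x \<in> carrier A \<Longrightarrow> antipode B (f x) = f (antipode A x)"
begin

sublocale AA: tensor_pair k A A by (intro tensor_pair.intro A.k_algebra_axioms)
sublocale BB: tensor_pair k B B by (intro tensor_pair.intro B.k_algebra_axioms)

abbreviation "ff \<equiv> tensor_map k B B f f"
definition "fff \<equiv> tensor_map k B (tensor k B B) f ff"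

lemmas f = linear_mapD[OF f_linear]
lemmas f_mult = ring_hom_mult[OF f_hom] and f_one = ring_hom_one[OF f_hom]
lemmas ff_linear = tensor_map_linear(1)[OF AA.tensor_pair_axioms BB.tensor_pair_axioms f_linear f_linear]
lemmas ff_pt = tensor_map_linear(2)[OF AA.tensor_pair_axioms BB.tensor_pair_axioms f_linear f_linear]
lemmas ff_hom = tensor_map_mult[OF AA.tensor_pair_axioms BB.tensor_pair_axioms f_linear f_linear f_hom f_hom]

interpretation A3: tensor_pair k A "tensor k A A" by (intro tensor_pair.intro A.k_algebra_axioms AA.T_k_algebra)
interpretation A3': tensor_pair k "tensor k A A" A by (intro tensor_pair.intro A.k_algebra_axioms AA.T_k_algebra)
interpretation B3: tensor_pair k B "tensor k B B" by (intro tensor_pair.intro B.k_algebra_axioms BB.T_k_algebra)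
interpretation B3': tensor_pair k "tensor k B B" B by (intro tensor_pair.intro B.k_algebra_axioms BB.T_k_algebra)

lemmas fff_linear = tensor_map_linear(1)[OF A3.tensor_pair_axioms B3.tensor_pair_axioms f_linear ff_linear, folded fff_def]
lemmas fff_pt = tensor_map_linear(2)[OF A3.tensor_pair_axioms B3.tensor_pair_axioms f_linear ff_linear, folded fff_def]

lemma fff_inj:
  assumes "inj_on f (carrier A)"
  shows "inj_on ff (carrier (tensor k A A))" "inj_on fff (carrier (tensor k A (tensor k A A)))"
proof -
  show i: "inj_on ff (carrier (tensor k A A))"
    by (rule tensor_map_inj[OF AA.tensor_pair_axioms BB.tensor_pair_axioms f_linear assms f_linear assms])
  show "inj_on fff (carrier (tensor k A (tensor k A A)))"
    unfolding fff_def
    by (rule tensor_map_inj[OF A3.tensor_pair_axioms B3.tensor_pair_axioms f_linear assms ff_linear i])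
qed

lemma fff_assoc:
  assumes "s \<in> carrier (tensor k A A)" "c \<in> carrier A"
  shows "fff (tensor_assoc k A A A (A3'.pt s c)) = tensor_assoc k B B B (B3'.pt (ff s) (f c))"
proof -
  note aa = tensor_assoc[OF A.k_algebra_axioms A.k_algebra_axioms A.k_algebra_axioms]
  note bb = tensor_assoc[OF B.k_algebra_axioms B.k_algebra_axioms B.k_algebra_axioms]
  have l: "(\<lambda>s. A3'.pt s c) \<in> linear_map k (tensor k A A) A3'.T"
    using assms(2) by (intro linear_mapI) (simp_all add: A3'.pt_add_left A3'.pt_smult_left)
  have r: "(\<lambda>s. B3'.pt s (f c)) \<in> linear_map k (tensor k B B) B3'.T"
    using assms(2) by (intro linear_mapI) (simp_all add: f B3'.pt_add_left B3'.pt_smult_left)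
  show ?thesis
    by (rule AA.tensor_ext[OF linear_map_comp[OF linear_map_comp[OF l aa(1)] fff_linear]
        linear_map_comp[OF linear_map_comp[OF ff_linear r] bb(1)] assms(1)])
      (simp add: aa(2) bb(2) fff_pt ff_pt f assms(2))
qed

lemma fff_comul_left:
  assumes t: "t \<in> carrier (tensor k A A)"
  shows "fff (tensor_assoc k A A A (tensor_map k (tensor k A A) A (comul A) id t))
    = tensor_assoc k B B B (tensor_map k (tensor k B B) B (comul B) id (ff t))"
proof -
  note aa = tensor_assoc[OF A.k_algebra_axioms A.k_algebra_axioms A.k_algebra_axioms]
  note bb = tensor_assoc[OF B.k_algebra_axioms B.k_algebra_axioms B.k_algebra_axioms]
  note ca = tensor_map_linear[OF AA.tensor_pair_axioms A3'.tensor_pair_axioms comul_A linear_map_id]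
  note cb = tensor_map_linear[OF BB.tensor_pair_axioms B3'.tensor_pair_axioms comul_B linear_map_id]
  show ?thesis
    by (rule AA.tensor_ext[OF linear_map_comp[OF linear_map_comp[OF ca(1) aa(1)] fff_linear]
        linear_map_comp[OF linear_map_comp[OF ff_linear cb(1)] bb(1)] t])
      (simp add: ca(2) cb(2) ff_pt f fff_assoc linear_mapD[OF comul_A] f_comul)
qed

lemma fff_comul_right:
  assumes t: "t \<in> carrier (tensor k A A)"
  shows "fff (tensor_map k A (tensor k A A) id (comul A) t) = tensor_map k B (tensor k B B) id (comul B) (ff t)"
proof -
  note ca = tensor_map_linear[OF AA.tensor_pair_axioms A3.tensor_pair_axioms linear_map_id comul_A]
  note cb = tensor_map_linear[OF BB.tensor_pair_axioms B3.tensor_pair_axioms linear_map_id comul_B]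
  show ?thesis
    by (rule AA.tensor_ext[OF linear_map_comp[OF ca(1) fff_linear] linear_map_comp[OF ff_linear cb(1)] t])
      (simp add: ca(2) cb(2) ff_pt f fff_pt linear_mapD[OF comul_A] f_comul)
qed

lemma f_slices:
  assumes t: "t \<in> carrier (tensor k A A)"
  shows "f (lslice k A (counit A) t) = lslice k B (counit B) (ff t)"
    and "f (rslice k A (counit A) t) = rslice k B (counit B) (ff t)"
  by (rule AA.tensor_ext[OF linear_map_comp[OF AA.lslice_linear[OF counit_A] f_linear]
        linear_map_comp[OF ff_linear BB.lslice_linear[OF counit_B]] t],
      simp add: AA.lslice_pt[OF counit_A] BB.lslice_pt[OF counit_B] ff_pt f f_counit functionalD[OF counit_A])
    (rule AA.tensor_ext[OF linear_map_comp[OF AA.rslice_linear[OF counit_A] f_linear]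
        linear_map_comp[OF ff_linear BB.rslice_linear[OF counit_B]] t],
      simp add: AA.rslice_pt[OF counit_A] BB.rslice_pt[OF counit_B] ff_pt f f_counit functionalD[OF counit_A])

lemma f_mult_antipode:
  assumes t: "t \<in> carrier (tensor k A A)"
  shows "f (tensor_lift k A (\<lambda>a b. antipode A a \<otimes>\<^bsub>A\<^esub> b) t)
      = tensor_lift k B (\<lambda>a b. antipode B a \<otimes>\<^bsub>B\<^esub> b) (ff t)"
    and "f (tensor_lift k A (\<lambda>a b. a \<otimes>\<^bsub>A\<^esub> antipode A b) t)
      = tensor_lift k B (\<lambda>a b. a \<otimes>\<^bsub>B\<^esub> antipode B b) (ff t)"
proof -
  note ma = A.mult_map_bilinear[OF antipode_A] and mb = B.mult_map_bilinear[OF antipode_B]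
  note lin = AA.tensor_lift_linear[OF A.k_algebra_axioms] BB.tensor_lift_linear[OF B.k_algebra_axioms]
  note s = AA.tensor_lift_pt[OF A.k_algebra_axioms] BB.tensor_lift_pt[OF B.k_algebra_axioms] ma mb
    ff_pt f f_antipode f_mult linear_mapD[OF antipode_A]
  show "f (tensor_lift k A (\<lambda>a b. antipode A a \<otimes>\<^bsub>A\<^esub> b) t)
      = tensor_lift k B (\<lambda>a b. antipode B a \<otimes>\<^bsub>B\<^esub> b) (ff t)"
    by (rule AA.tensor_ext[OF linear_map_comp[OF lin(1)[OF ma(1)] f_linear]
          linear_map_comp[OF ff_linear lin(2)[OF mb(1)]] t]) (simp add: s)
  show "f (tensor_lift k A (\<lambda>a b. a \<otimes>\<^bsub>A\<^esub> antipode A b) t)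
      = tensor_lift k B (\<lambda>a b. a \<otimes>\<^bsub>B\<^esub> antipode B b) (ff t)"
    by (rule AA.tensor_ext[OF linear_map_comp[OF lin(1)[OF ma(2)] f_linear]
          linear_map_comp[OF ff_linear lin(2)[OF mb(2)]] t]) (simp add: s)
qed

lemmas transport = fff_comul_left fff_comul_right f_slices f_mult_antipode
lemmas comul_A_closed = linear_mapD(1)[OF comul_A]

text \<open>By naturality each axiom at \<open>f x\<close> is the image of the axiom at
  \<open>x\<close>.\<close>

lemma hopf_surj:
  assumes "hopf_algebra k A" and surj: "f ` carrier A = carrier B"
  shows "hopf_algebra k B"
proof -
  interpret H: hopf_algebra k A by fact
  have ex: "\<exists>x\<in>carrier A. y = f x" if "y \<in> carrier B" for y using that surj by blast
  note fc = f_comul[symmetric] and t = transport[OF comul_A_closed, symmetric]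
  show ?thesis
  proof (intro hopf_algebra.intro hopf_algebra_axioms.intro B.k_algebra_axioms comul_B antipode_B)
    show "comul B \<in> ring_hom B BB.T"
    proof (rule ring_hom_memI)
      fix y z assume "y \<in> carrier B" "z \<in> carrier B"
      then obtain x u where xu: "x \<in> carrier A" "y = f x" "u \<in> carrier A" "z = f u" using ex by meson
      then have "comul B (y \<otimes>\<^bsub>B\<^esub> z) = ff (comul A (x \<otimes>\<^bsub>A\<^esub> u))" by (simp add: f_mult f_comul)
      then show "comul B (y \<otimes>\<^bsub>B\<^esub> z) = comul B y \<otimes>\<^bsub>BB.T\<^esub> comul B z"
        using xu by (simp add: H.D ring_hom_mult[OF ff_hom] f_comul)
    next
      show "comul B \<one>\<^bsub>B\<^esub> = \<one>\<^bsub>BB.T\<^esub>"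
        using f_comul[of "\<one>\<^bsub>A\<^esub>"] by (simp add: H.D ring_hom_one[OF ff_hom] f_one)
    qed (simp_all add: linear_mapD[OF comul_B])
    show "counit B \<in> ring_hom B k"
    proof (rule ring_hom_memI)
      fix y z assume yz: "y \<in> carrier B" "z \<in> carrier B"
      then obtain x u where xu: "x \<in> carrier A" "y = f x" "u \<in> carrier A" "z = f u" using ex by meson
      have "counit B (f (x \<otimes>\<^bsub>A\<^esub> u)) = counit A (x \<otimes>\<^bsub>A\<^esub> u)"
        using xu by (intro f_counit) simp
      then have "counit B (y \<otimes>\<^bsub>B\<^esub> z) = counit A (x \<otimes>\<^bsub>A\<^esub> u)" using xu by (simp add: f_mult)
      then show "counit B (y \<otimes>\<^bsub>B\<^esub> z) = counit B y \<otimes>\<^bsub>k\<^esub> counit B z"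
        using xu by (simp add: H.eps f_counit)
    next
      show "counit B \<one>\<^bsub>B\<^esub> = \<one>\<^bsub>k\<^esub>" using f_counit[of "\<one>\<^bsub>A\<^esub>"] by (simp add: H.eps f_one)
    qed (simp_all add: functionalD[OF counit_B])
    show "counit B (c \<odot>\<^bsub>B\<^esub> x) = c \<otimes>\<^bsub>k\<^esub> counit B x" if "c \<in> carrier k" "x \<in> carrier B" for c x
      using that by (rule functionalD[OF counit_B])
  next
    fix y assume "y \<in> carrier B"
    then obtain x where x: "x \<in> carrier A" and y: "y = f x" using ex by blast
    have e: "f (counit A x \<odot>\<^bsub>A\<^esub> \<one>\<^bsub>A\<^esub>) = counit B (f x) \<odot>\<^bsub>B\<^esub> \<one>\<^bsub>B\<^esub>"
      using x by (simp add: f f_one f_counit H.eps)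
    show "tensor_assoc k B B B (tensor_map k BB.T B (comul B) id (comul B y))
        = tensor_map k B BB.T id (comul B) (comul B y)"
      unfolding y fc[OF x] t(1,2)[OF x] H.coassoc[OF x] ..
    show "lslice k B (counit B) (comul B y) = y"
      unfolding y fc[OF x] t(3)[OF x] H.counit_left[OF x] ..
    show "rslice k B (counit B) (comul B y) = y"
      unfolding y fc[OF x] t(4)[OF x] H.counit_right[OF x] ..
    show "tensor_lift k B (\<lambda>a b. antipode B a \<otimes>\<^bsub>B\<^esub> b) (comul B y) = counit B y \<odot>\<^bsub>B\<^esub> \<one>\<^bsub>B\<^esub>"
      unfolding y fc[OF x] t(5)[OF x] H.antipode_left[OF x] e ..
    show "tensor_lift k B (\<lambda>a b. a \<otimes>\<^bsub>B\<^esub> antipode B b) (comul B y) = counit B y \<odot>\<^bsub>B\<^esub> \<one>\<^bsub>B\<^esub>"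
      unfolding y fc[OF x] t(6)[OF x] H.antipode_right[OF x] e ..
  qed
qed

text \<open>The two sides of each axiom agree after applying \<open>f\<close>, \<open>ff\<close> or
  \<open>fff\<close>, according to whether they lie in the simple, double or triple tensor power;
  all three maps are injective.\<close>

lemma hopf_inj:
  assumes "hopf_algebra k B" and inj: "inj_on f (carrier A)"
  shows "hopf_algebra k A"
proof -
  interpret H: hopf_algebra k B by fact
  note t = transport[OF comul_A_closed]
  note i = inj_onD[OF inj] inj_onD[OF fff_inj(1)[OF inj]] inj_onD[OF fff_inj(2)[OF inj]]
  note c = linear_mapD[OF comul_A] and ec = functionalD[OF counit_A]
  note ca = tensor_map_linear(1)[OF AA.tensor_pair_axioms A3'.tensor_pair_axioms comul_A linear_map_id]
  note ca' = tensor_map_linear(1)[OF AA.tensor_pair_axioms A3.tensor_pair_axioms linear_map_id comul_A]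
  note aa = tensor_assoc(1)[OF A.k_algebra_axioms A.k_algebra_axioms A.k_algebra_axioms]
  note cl = linear_mapD(1)[OF ca] linear_mapD(1)[OF ca'] linear_mapD(1)[OF aa]
    linear_mapD(1)[OF AA.lslice_linear[OF counit_A]] linear_mapD(1)[OF AA.rslice_linear[OF counit_A]]
    linear_mapD(1)[OF AA.tensor_lift_linear[OF A.k_algebra_axioms]] A.mult_map_bilinear[OF antipode_A]
  show ?thesis
  proof (intro hopf_algebra.intro hopf_algebra_axioms.intro A.k_algebra_axioms comul_A antipode_A)
    show "comul A \<in> ring_hom A AA.T"
    proof (rule ring_hom_memI)
      fix x y assume xy: "x \<in> carrier A" "y \<in> carrier A"
      show "comul A (x \<otimes>\<^bsub>A\<^esub> y) = comul A x \<otimes>\<^bsub>AA.T\<^esub> comul A y"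
        by (rule i(2)) (use xy c f in \<open>simp_all add: f_comul ring_hom_mult[OF ff_hom] f_mult H.D\<close>)
    next
      show "comul A \<one>\<^bsub>A\<^esub> = \<one>\<^bsub>AA.T\<^esub>"
        by (rule i(2)) (simp_all add: f_comul ring_hom_one[OF ff_hom] f_one H.D c)
    qed (simp_all add: c)
    show "counit A \<in> ring_hom A k"
    proof (rule ring_hom_memI)
      fix x y assume xy: "x \<in> carrier A" "y \<in> carrier A"
      then show "counit A (x \<otimes>\<^bsub>A\<^esub> y) = counit A x \<otimes>\<^bsub>k\<^esub> counit A y"
        by (simp add: f_mult H.eps f flip: f_counit)
    next
      show "counit A \<one>\<^bsub>A\<^esub> = \<one>\<^bsub>k\<^esub>" by (simp add: H.eps f_one flip: f_counit)
    qed (simp_all add: ec)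
    show "counit A (c \<odot>\<^bsub>A\<^esub> x) = c \<otimes>\<^bsub>k\<^esub> counit A x" if "c \<in> carrier k" "x \<in> carrier A" for c x
      using that by (rule ec)
  next
    fix x assume x: "x \<in> carrier A"
    have fx: "f x \<in> carrier B" using x by (rule f)
    have e: "f (counit A x \<odot>\<^bsub>A\<^esub> \<one>\<^bsub>A\<^esub>) = counit B (f x) \<odot>\<^bsub>B\<^esub> \<one>\<^bsub>B\<^esub>"
      using x by (simp add: f f_one f_counit ec)
    show "tensor_assoc k A A A (tensor_map k AA.T A (comul A) id (comul A x))
        = tensor_map k A AA.T id (comul A) (comul A x)"
      by (rule i(3)) (simp_all add: x t f_comul cl c H.coassoc[OF fx])
    show "lslice k A (counit A) (comul A x) = x"
      by (rule i(1)) (simp_all add: x t f_comul cl c H.counit_left[OF fx])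
    show "rslice k A (counit A) (comul A x) = x"
      by (rule i(1)) (simp_all add: x t f_comul cl c H.counit_right[OF fx])
    show "tensor_lift k A (\<lambda>a b. antipode A a \<otimes>\<^bsub>A\<^esub> b) (comul A x) = counit A x \<odot>\<^bsub>A\<^esub> \<one>\<^bsub>A\<^esub>"
      by (rule i(1)) (simp_all add: x t f_comul cl c ec e H.antipode_left[OF fx])
    show "tensor_lift k A (\<lambda>a b. a \<otimes>\<^bsub>A\<^esub> antipode A b) (comul A x) = counit A x \<odot>\<^bsub>A\<^esub> \<one>\<^bsub>A\<^esub>"
      by (rule i(1)) (simp_all add: x t f_comul cl c ec e H.antipode_right[OF fx])
  qed
qed

lemma hopf_sub_image:
  assumes "hopf_subalgebra k A C"
  shows "hopf_subalgebra k B (f ` C)"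
proof -
  have C: "subalg k A C" "comul A ` C \<subseteq> tensor_sub k A A C C" "antipode A ` C \<subseteq> C"
    using assms by (auto simp: hopf_subalgebra_def)
  note c = A.subalgD[OF C(1)]
  have sub: "submodule (f ` C) k B"
    by (rule submodule_image[OF A.k_algebra_axioms B.k_algebra_axioms f_linear c(1)])
  have "subring (f ` C) B"
  proof (rule B.A.subringI)
    show "f ` C \<subseteq> carrier B" using B.submod_sub[OF sub] by blast
    show "\<one>\<^bsub>B\<^esub> \<in> f ` C" using c(4) f_one by force
    show "\<ominus>\<^bsub>B\<^esub> y \<in> f ` C" if "y \<in> f ` C" for y using that by (rule B.submod_neg[OF sub])
    show "y \<oplus>\<^bsub>B\<^esub> z \<in> f ` C" if "y \<in> f ` C" "z \<in> f ` C" for y z using that by (rule B.submod_add[OF sub])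
    fix y z assume "y \<in> f ` C" "z \<in> f ` C"
    then obtain u v where uv: "u \<in> C" "v \<in> C" "y = f u" "z = f v" by blast
    then have "y \<otimes>\<^bsub>B\<^esub> z = f (u \<otimes>\<^bsub>A\<^esub> v)" using c(6) by (simp add: f_mult)
    then show "y \<otimes>\<^bsub>B\<^esub> z \<in> f ` C" using c(5) uv by blast
  qed
  moreover have "comul B (f x) \<in> tensor_sub k B B (f ` C) (f ` C)" if x: "x \<in> C" for x
  proof -
    have fC: "f ` C \<subseteq> carrier B" using B.submod_sub[OF sub] by blast
    have "ff (comul A x) \<in> tensor_sub k B B (f ` C) (f ` C)"
      by (rule AA.tensor_sub_linear[OF BB.T_k_algebra ff_linear BB.tensor_sub_submodule[OF fC fC] c(3,3)])
        (use C(2) x c(6) in \<open>auto simp: ff_pt intro!: BB.tensor_sub_pt\<close>)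
    then show ?thesis using f_comul c(6)[OF x] by simp
  qed
  moreover have "antipode B (f x) \<in> f ` C" if x: "x \<in> C" for x
    using C(3) x c(6)[OF x] by (auto simp: f_antipode)
  ultimately show ?thesis using sub by (auto simp: hopf_subalgebra_def subalg_def)
qed

lemma ff_tensor_sub:
  assumes "C \<subseteq> carrier A" "C' \<subseteq> carrier A"
  shows "tensor_sub k B B (f ` C) (f ` C') \<subseteq> ff ` tensor_sub k A A C C'"
  unfolding BB.tensor_sub_eq
proof (rule BB.T.lspan_le)
  show "submodule (ff ` tensor_sub k A A C C') k BB.T"
    by (rule submodule_image[OF AA.T_k_algebra BB.T_k_algebra ff_linear AA.tensor_sub_submodule[OF assms]])
  have "BB.pt (f u) (f v) \<in> ff ` tensor_sub k A A C C'" if "u \<in> C" "v \<in> C'" for u v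
  proof (rule image_eqI)
    show "BB.pt (f u) (f v) = ff (AA.pt u v)" using that assms by (simp add: ff_pt subset_iff)
  qed (rule AA.tensor_sub_pt[OF that])
  then show "{BB.pt v w |v w. v \<in> f ` C \<and> w \<in> f ` C'} \<subseteq> ff ` tensor_sub k A A C C'" by blast
qed

text \<open>The comultiplication of an element of \<open>C\<close> has the same image under
  \<open>ff\<close> as some element of \<open>C \<otimes> C\<close>, and by injectivity it is that
  element.\<close>

lemma hopf_sub_preimage:
  assumes inj: "inj_on f (carrier A)" and C: "subalg k A C" and "hopf_subalgebra k B (f ` C)"
  shows "hopf_subalgebra k A C"
proof -
  note c = A.subalgD[OF C]
  have fC: "comul B ` f ` C \<subseteq> tensor_sub k B B (f ` C) (f ` C)" "antipode B ` f ` C \<subseteq> f ` C"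
    using assms(3) by (auto simp: hopf_subalgebra_def)
  have "comul A x \<in> tensor_sub k A A C C" if x: "x \<in> C" for x
  proof -
    have "ff (comul A x) \<in> tensor_sub k B B (f ` C) (f ` C)" using fC(1) f_comul c(6) x by auto
    then obtain t where t: "t \<in> tensor_sub k A A C C" "ff (comul A x) = ff t"
      using ff_tensor_sub[OF c(3,3)] by blast
    have "comul A x = t"
      by (rule inj_onD[OF fff_inj(1)[OF inj] t(2) comul_A_closed[OF c(6)[OF x]] AA.tensor_sub_closed[OF c(3,3) t(1)]])
    then show ?thesis using t(1) by simp
  qed
  moreover have "antipode A x \<in> C" if x: "x \<in> C" for x
  proof -
    have "antipode B (f x) \<in> f ` C" using fC(2) x by blast
    then have "f (antipode A x) \<in> f ` C" unfolding f_antipode[OF c(6)[OF x]] .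
    then obtain y where y: "y \<in> C" "f (antipode A x) = f y" by blast
    have "antipode A x = y"
      by (rule inj_onD[OF inj y(2) linear_mapD(1)[OF antipode_A c(6)[OF x]] c(6)[OF y(1)]])
    then show ?thesis using y(1) by simp
  qed
  ultimately show ?thesis using C by (auto simp: hopf_subalgebra_def)
qed

lemma scalars_image: "f ` scalars k A = scalars k B"
proof -
  have "f (c \<odot>\<^bsub>A\<^esub> \<one>\<^bsub>A\<^esub>) = c \<odot>\<^bsub>B\<^esub> \<one>\<^bsub>B\<^esub>" if "c \<in> carrier k" for c using that by (simp add: f f_one)
  then show ?thesis by (auto simp: scalars_def image_image cong: image_cong)
qed

end

section \<open>The quotient by a Hopf ideal\<close>

context hopf_algebra
begin

context
  fixes I assumes I: "hopf_ideal k H I"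
begin

private abbreviation "Qt \<equiv> quot_alg H I"
private abbreviation "G \<equiv> quot_hopf k H I"
private abbreviation "\<pi> x \<equiv> I +>\<^bsub>H\<^esub> x"

lemma hopf_idealD:
  "ideal I H" "submodule I k H" "i \<in> I \<Longrightarrow> D i \<in> tsub I (carrier H) <+>\<^bsub>HH\<^esub> tsub (carrier H) I"
  "i \<in> I \<Longrightarrow> eps i = \<zero>\<^bsub>k\<^esub>" "i \<in> I \<Longrightarrow> S i \<in> I"
  using I by (auto simp: hopf_ideal_def)

private lemmas Q = k_algebra_axioms hopf_idealD(1,2)

lemma quot_same_alg: "same_alg Qt G"
  by (simp add: same_alg_def quot_hopf_def Let_def)

lemma quot_hopf_k_algebra: "k_algebra k G"
  by (rule same_alg_k_algebra[OF quot_k_algebra[OF Q] quot_same_alg])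

interpretation G: k_algebra k G by (rule quot_hopf_k_algebra)
interpretation GG: tensor_pair k G G by (intro tensor_pair.intro quot_hopf_k_algebra)

lemma quot_proj_linear: "\<pi> \<in> linear_map k H G"
  using quot_linear[OF Q] quot_same_alg by (simp add: linear_map_def same_alg_def)

lemma quot_proj_hom: "\<pi> \<in> ring_hom H G"
  using linear_mapD[OF quot_proj_linear] quot_ops(2,3)[OF Q] quot_same_alg
  by (intro ring_hom_memI) (simp_all add: same_alg_def)

lemma quot_proj_surj: "\<pi> ` carrier H = carrier G"
  using quot_carrier[OF Q] quot_same_alg by (simp add: same_alg_def)

lemma quot_proj_eq_zero: "x \<in> I \<Longrightarrow> \<pi> x = \<zero>\<^bsub>G\<^esub>"
  using quot_coset_eq_iff[OF Q, of x "\<zero>\<^bsub>H\<^esub>"] submod_sub[OF Q(3)] submod_diff[OF Q(3) _ submod_zero[OF Q(3)]]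
    quot_zero_coset[OF Q] quot_same_alg by (simp add: same_alg_def)

lemma quot_representative:
  assumes x: "x \<in> carrier H" and y: "y = (SOME y. y \<in> \<pi> x)"
  shows "y \<in> carrier H" "y \<ominus>\<^bsub>H\<^esub> x \<in> I"
proof -
  interpret I: ideal I H by (rule Q(2))
  have yx: "y \<in> \<pi> x" unfolding y by (rule someI[of _ x]) (rule I.a_rcos_self[OF x])
  then obtain i where i: "i \<in> I" "y = i \<oplus>\<^bsub>H\<^esub> x" by (auto simp: a_r_coset_def')
  note ic = submod_sub[OF Q(3) i(1)]
  show "y \<in> carrier H" using i ic x by simp
  have "y \<ominus>\<^bsub>H\<^esub> x = i" unfolding i(2) using ic x by (simp add: a_minus_def V.M.a_assoc V.M.r_neg)
  then show "y \<ominus>\<^bsub>H\<^esub> x \<in> I" using i(1) by simp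
qed

text \<open>A linear map that vanishes on \<open>I\<close> does not see the choice of representative
  made in \<open>quot_hopf\<close>; this serves for the comultiplication and the antipode.\<close>

lemma quot_descend:
  assumes U: "k_algebra k U" and g: "g \<in> linear_map k H U" and zero: "\<And>i. i \<in> I \<Longrightarrow> g i = \<zero>\<^bsub>U\<^esub>" and x: "x \<in> carrier H"
  shows "g (SOME y. y \<in> \<pi> x) = g x"
proof -
  interpret U: k_algebra k U by (rule U)
  define y where "y = (SOME y. y \<in> \<pi> x)"
  note r = quot_representative[OF x y_def]
  have "g (y \<ominus>\<^bsub>H\<^esub> x) = g y \<ominus>\<^bsub>U\<^esub> g x" by (rule linear_map_diff[OF k_algebra_axioms U g r(1) x])
  then have "g y \<ominus>\<^bsub>U\<^esub> g x = \<zero>\<^bsub>U\<^esub>" using zero[OF r(2)] by simp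
  then show ?thesis using linear_mapD(1)[OF g] r(1) x by (simp add: y_def)
qed

lemma quot_comul:
  assumes x: "x \<in> carrier H" shows "comul G (\<pi> x) = tensor_map k G G \<pi> \<pi> (D x)"
proof -
  define M where "M = tensor_map k G G \<pi> \<pi>"
  note m = tensor_map_linear[OF TP.tensor_pair_axioms GG.tensor_pair_axioms quot_proj_linear quot_proj_linear, folded M_def]
  note pl = linear_mapD[OF quot_proj_linear]
  have Is: "I \<subseteq> carrier H" using submod_sub[OF Q(3)] by blast
  \<comment> \<open>\<open>\<pi> \<otimes> \<pi>\<close> kills \<open>I \<otimes> H\<close> and
    \<open>H \<otimes> I\<close>, hence the comultiplication of every element of
    \<open>I\<close>.\<close>
  have M0: "M t = \<zero>\<^bsub>GG.T\<^esub>" if "t \<in> tsub I (carrier H) <+>\<^bsub>HH\<^esub> tsub (carrier H) I" for t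
  proof -
    obtain a b where ab: "a \<in> tsub I (carrier H)" "b \<in> tsub (carrier H) I" "t = a \<oplus>\<^bsub>HH\<^esub> b"
      using \<open>t \<in> _\<close> by (auto simp: set_add_def')
    have "M a \<in> {\<zero>\<^bsub>GG.T\<^esub>}"
      by (rule TP.tensor_sub_linear[OF GG.T_k_algebra m(1) GG.T.submodule_zero Is subset_refl _ ab(1)])
        (use Is in \<open>auto simp: m(2) quot_proj_eq_zero pl subset_iff\<close>)
    moreover have "M b \<in> {\<zero>\<^bsub>GG.T\<^esub>}"
      by (rule TP.tensor_sub_linear[OF GG.T_k_algebra m(1) GG.T.submodule_zero subset_refl Is _ ab(2)])
        (use Is in \<open>auto simp: m(2) quot_proj_eq_zero pl subset_iff\<close>)
    ultimately show ?thesis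
      using TP.tensor_sub_closed[OF Is subset_refl ab(1)] TP.tensor_sub_closed[OF subset_refl Is ab(2)]
      by (simp add: ab(3) linear_mapD[OF m(1)])
  qed
  have "comul G (\<pi> x) = tensor_map k Qt Qt \<pi> \<pi> (D (SOME y. y \<in> \<pi> x))"
    by (simp add: quot_hopf_def Let_def)
  also have "tensor_map k Qt Qt \<pi> \<pi> = M"
    unfolding M_def by (rule tensor_map_cong[OF quot_same_alg quot_same_alg])
  also have "M (D (SOME y. y \<in> \<pi> x)) = M (D x)"
    by (rule quot_descend[OF GG.T_k_algebra linear_map_comp[OF comul_linear m(1)] _ x]) (rule M0[OF hopf_idealD(3)])
  finally show ?thesis by (simp add: M_def)
qed

lemma quot_counit:
  assumes x: "x \<in> carrier H" shows "counit G (\<pi> x) = eps x"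
proof -
  define y where "y = (SOME y. y \<in> \<pi> x)"
  note r = quot_representative[OF x y_def]
  have "y = x \<oplus>\<^bsub>H\<^esub> (y \<ominus>\<^bsub>H\<^esub> x)" by (rule eq_add_diff[OF r(1) x])
  then have "eps y = eps x \<oplus>\<^bsub>k\<^esub> eps (y \<ominus>\<^bsub>H\<^esub> x)" using eps(2)[OF x submod_sub[OF Q(3) r(2)]] by simp
  then show ?thesis using hopf_idealD(4)[OF r(2)] eps(1)[OF x] by (simp add: quot_hopf_def Let_def y_def)
qed

lemma quot_antipode:
  assumes x: "x \<in> carrier H" shows "antipode G (\<pi> x) = \<pi> (S x)"
proof -
  have "\<pi> (S (SOME y. y \<in> \<pi> x)) = \<pi> (S x)"
    by (rule quot_descend[OF quot_hopf_k_algebra linear_map_comp[OF antipode_linear quot_proj_linear] _ x])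
      (rule quot_proj_eq_zero[OF hopf_idealD(5)])
  then show ?thesis by (simp add: quot_hopf_def Let_def)
qed

lemma quot_coalg_map: "coalg_map k H G \<pi>"
proof -
  note pl = linear_mapD[OF quot_proj_linear]
  note m = tensor_map_linear(1)[OF TP.tensor_pair_axioms GG.tensor_pair_axioms quot_proj_linear quot_proj_linear]
  have ex: "\<exists>x\<in>carrier H. y = \<pi> x" if "y \<in> carrier G" for y using that quot_proj_surj by blast
  \<comment> \<open>Linearity on the quotient is inherited from the composite with the surjective
    projection.\<close>
  have lin: "g' \<in> linear_map k G U" if g: "g \<in> linear_map k H U" and g': "\<And>x. x \<in> carrier H \<Longrightarrow> g' (\<pi> x) = g x"
    for g' g and U :: "('k, 'u, 'v) module_scheme"
  proof (rule linear_mapI)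
    fix y assume "y \<in> carrier G"
    then obtain x where x: "x \<in> carrier H" "y = \<pi> x" using ex by blast
    show "g' y \<in> carrier U" using x by (simp add: g' linear_mapD[OF g])
    show "g' (c \<odot>\<^bsub>G\<^esub> y) = c \<odot>\<^bsub>U\<^esub> g' y" if "c \<in> carrier k" for c
      using g'[of "c \<odot>\<^bsub>H\<^esub> x"] x that by (simp add: g' pl linear_mapD[OF g])
    fix z assume "z \<in> carrier G"
    then obtain u where u: "u \<in> carrier H" "z = \<pi> u" using ex by blast
    show "g' (y \<oplus>\<^bsub>G\<^esub> z) = g' y \<oplus>\<^bsub>U\<^esub> g' z"
      using g'[of "x \<oplus>\<^bsub>H\<^esub> u"] x u by (simp add: g' pl linear_mapD[OF g])
  qed
  show ?thesis
  proof (intro coalg_map.intro coalg_map_axioms.intro k_algebra_axioms quot_hopf_k_algebra comul_linear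
      eps_functional antipode_linear quot_proj_linear quot_proj_hom)
    show "comul G \<in> linear_map k G GG.T"
      by (rule lin[OF linear_map_comp[OF comul_linear m]]) (rule quot_comul)
    show "antipode G \<in> linear_map k G G"
      by (rule lin[OF linear_map_comp[OF antipode_linear quot_proj_linear]]) (rule quot_antipode)
    show "counit G \<in> functional k G"
      unfolding functional_def
    proof (intro CollectI conjI ballI funcsetI)
      fix y assume "y \<in> carrier G"
      then obtain x where x: "x \<in> carrier H" "y = \<pi> x" using ex by blast
      show "counit G y \<in> carrier k" using x by (simp add: quot_counit eps)
      show "counit G (c \<odot>\<^bsub>G\<^esub> y) = c \<otimes>\<^bsub>k\<^esub> counit G y" if "c \<in> carrier k" for c
        using quot_counit[of "c \<odot>\<^bsub>H\<^esub> x"] x that by (simp add: quot_counit pl eps)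
      fix z assume "z \<in> carrier G"
      then obtain u where u: "u \<in> carrier H" "z = \<pi> u" using ex by blast
      show "counit G (y \<oplus>\<^bsub>G\<^esub> z) = counit G y \<oplus>\<^bsub>k\<^esub> counit G z"
        using quot_counit[of "x \<oplus>\<^bsub>H\<^esub> u"] x u by (simp add: quot_counit pl eps)
    qed
  qed (simp_all add: quot_comul quot_counit quot_antipode)
qed

lemma quot_hopf_algebra: "hopf_algebra k G"
  by (rule coalg_map.hopf_surj[OF quot_coalg_map hopf_algebra_axioms quot_proj_surj])

end

section \<open>A Hopf subalgebra with its own comultiplication\<close>

context
  fixes B assumes B: "hopf_subalgebra k H B"
begin

private abbreviation "B' \<equiv> H\<lparr>carrier := B\<rparr>"
private abbreviation "Bh \<equiv> sub_hopf k H B"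

private lemmas b = subalgD[OF hopf_subD(1)[OF B]]

lemma sub_same_alg: "same_alg B' Bh"
  by (simp add: same_alg_def sub_hopf_def Let_def)

lemma sub_ops:
  "carrier Bh = B" "monoid.mult Bh = monoid.mult H" "\<one>\<^bsub>Bh\<^esub> = \<one>\<^bsub>H\<^esub>" "\<zero>\<^bsub>Bh\<^esub> = \<zero>\<^bsub>H\<^esub>"
  "add Bh = add H" "smult Bh = smult H" "counit Bh = eps" "antipode Bh = S"
  by (simp_all add: sub_hopf_def Let_def)

lemma sub_hopf_k_algebra: "k_algebra k Bh"
  by (rule same_alg_k_algebra[OF subalg_k_algebra[OF hopf_subD(1)[OF B]] sub_same_alg])

interpretation Bh: k_algebra k Bh by (rule sub_hopf_k_algebra)
interpretation BB: tensor_pair k Bh Bh by (intro tensor_pair.intro sub_hopf_k_algebra)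

lemma sub_incl_linear: "id \<in> linear_map k Bh H"
  by (rule linear_mapI) (simp_all add: sub_ops b)

text \<open>The inverse taken in \<open>sub_hopf\<close> is meaningful because the map
  \<open>M\<close> from \<open>B \<otimes> B\<close> to \<open>H \<otimes> H\<close> induced by the
  inclusion is injective, and its image contains \<open>D x\<close> for
  \<open>x \<in> B\<close>.\<close>

lemma sub_coalg_map: "coalg_map k Bh H id"
proof -
  define M where "M = tensor_map k H H id id"
  note m = tensor_map_linear[OF BB.tensor_pair_axioms TP.tensor_pair_axioms sub_incl_linear sub_incl_linear, folded M_def]
  note ml = linear_mapD[OF m(1)]
  have inj: "inj_on M (carrier BB.T)"
    unfolding M_def by (rule tensor_map_inj[OF BB.tensor_pair_axioms TP.tensor_pair_axioms sub_incl_linear _ sub_incl_linear]) simp_all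
  have img: "tsub B B \<subseteq> M ` carrier BB.T"
    unfolding TP.tensor_sub_eq
  proof (rule TP.T.lspan_le)
    show "submodule (M ` carrier BB.T) k HH"
      by (rule submodule_image[OF BB.T_k_algebra TP.T_k_algebra m(1) BB.T.submodule_carrier])
    have "tp u v \<in> M ` carrier BB.T" if "u \<in> B" "v \<in> B" for u v
      by (rule image_eqI[of _ _ "BB.pt u v"]) (use that in \<open>simp_all add: m(2) sub_ops\<close>)
    then show "{tp v w |v w. v \<in> B \<and> w \<in> B} \<subseteq> M ` carrier BB.T" by blast
  qed
  have cm: "comul Bh x \<in> carrier BB.T" "M (comul Bh x) = D x" if x: "x \<in> B" for x
  proof -
    have e: "comul Bh x = inv_into (carrier BB.T) M (D x)"
      unfolding M_def tensor_cong[OF sub_same_alg sub_same_alg, symmetric] by (simp add: sub_hopf_def Let_def)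
    have "D x \<in> M ` carrier BB.T" using img hopf_subD(2)[OF B x] by blast
    then show "comul Bh x \<in> carrier BB.T" "M (comul Bh x) = D x"
      unfolding e by (rule inv_into_into, rule f_inv_into_f)
  qed
  show ?thesis
  proof (intro coalg_map.intro coalg_map_axioms.intro k_algebra_axioms sub_hopf_k_algebra comul_linear
      eps_functional antipode_linear sub_incl_linear)
    show "comul Bh \<in> linear_map k Bh BB.T"
    proof (rule linear_mapI)
      fix x assume x: "x \<in> carrier Bh"
      show "comul Bh x \<in> carrier BB.T" using x cm by (simp add: sub_ops)
      show "comul Bh (c \<odot>\<^bsub>Bh\<^esub> x) = c \<odot>\<^bsub>BB.T\<^esub> comul Bh x" if "c \<in> carrier k" for c
        by (rule inj_onD[OF inj])
          (use x that submod_smult[OF b(1)] in \<open>simp_all add: ml cm sub_ops D b(6)\<close>)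
      fix y assume y: "y \<in> carrier Bh"
      show "comul Bh (x \<oplus>\<^bsub>Bh\<^esub> y) = comul Bh x \<oplus>\<^bsub>BB.T\<^esub> comul Bh y"
        by (rule inj_onD[OF inj])
          (use x y submod_add[OF b(1)] in \<open>simp_all add: ml cm sub_ops D b(6)\<close>)
    qed
    show "counit Bh \<in> functional k Bh"
      unfolding functional_def by (auto simp: sub_ops eps b(6))
    show "antipode Bh \<in> linear_map k Bh Bh"
      by (rule linear_mapI) (auto simp: sub_ops S b(6) hopf_subD(3)[OF B])
    show "id \<in> ring_hom Bh H"
      by (rule ring_hom_memI) (simp_all add: sub_ops b(6))
    show "tensor_map k H H id id (comul Bh x) = D (id x)" if "x \<in> carrier Bh" for x
      using cm(2)[of x] that by (simp add: M_def sub_ops)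
  qed (simp_all add: sub_ops)
qed

lemma sub_hopf_algebra: "hopf_algebra k Bh"
  by (rule coalg_map.hopf_inj[OF sub_coalg_map hopf_algebra_axioms]) simp

lemma sub_hopf_subalgebra:
  assumes "hopf_subalgebra k H C" "C \<subseteq> B"
  shows "hopf_subalgebra k Bh C"
proof (rule coalg_map.hopf_sub_preimage[OF sub_coalg_map])
  have "subalg k B' C" using subalg_restrict[OF hopf_subD(1)[OF B] assms(2)] hopf_subD(1)[OF assms(1)] by simp
  then show "subalg k Bh C"
    by (rule subalg_cong[OF subalg_k_algebra[OF hopf_subD(1)[OF B]] sub_hopf_k_algebra sub_same_alg])
qed (use assms in simp_all)

lemma sub_scalars: "scalars k Bh = scalars k H"
  by (simp add: scalars_def sub_ops)

lemma sub_ore_step: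
  assumes C: "hopf_subalgebra k H C" "C \<subseteq> B" and Q: "hopf_subalgebra k H Q" and step: "ore_step C Q x"
  shows "k_algebra.ore_step k Bh C Q x"
proof -
  have sf: "skew_free H Q x" and C_eq: "C = (\<Union>n. fil H Q x n)" using step by (auto simp: ore_step_def)
  interpret X: skew_free H Q x by (rule sf)
  have QC: "Q \<subseteq> C" using C_eq X.F_one by blast
  have "x \<in> X.F (Suc (Suc 0))" using X.F_pow[of "Suc 0"] by simp
  then have xB: "x \<in> B" using C_eq C(2) by blast
  have sC: "subalg k Bh C" and sQ: "subalg k Bh Q"
    using sub_hopf_subalgebra[OF C] sub_hopf_subalgebra[OF Q] QC C(2) by (auto simp: hopf_subalgebra_def)
  have f: "fil Bh Q x n = fil H Q x n" for n by (rule fil_cong) (simp_all add: sub_ops)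
  have pow: "x [^]\<^bsub>Bh\<^esub> n = x [^]\<^bsub>H\<^esub> n" for n :: nat by (simp add: nat_pow_def sub_ops)
  have "skew_free Bh Q x"
    using sf Bh.subalgD(2)[OF sQ] xB
    unfolding skew_free_iff[OF A.ring_axioms] skew_free_iff[OF Bh.A.ring_axioms] f pow sub_ops by blast
  then show ?thesis
    using sC sQ step unfolding Bh.ore_step_def ore_step_def f sub_ops by blast
qed

end

text \<open>Intersections and images of a chain satisfy this weaker condition. A chain without
  repetitions that ends in \<open>C j\<close> is built by recursion on \<open>j\<close>.\<close>

lemma ihoe_of_fieldI:
  assumes "C 0 = scalars k H" "C n = carrier H" "\<And>i. i \<le> n \<Longrightarrow> hopf_subalgebra k H (C i)"
    and "\<And>i. i < n \<Longrightarrow> C (Suc i) = C i \<or> (\<exists>x. ore_step (C (Suc i)) (C i) x)"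
  shows "ihoe_of_field k H"
proof -
  have "\<exists>C' m. C' 0 = scalars k H \<and> C' m = C j \<and> (\<forall>i\<le>m. hopf_subalgebra k H (C' i))
    \<and> (\<forall>i<m. C' i \<subseteq> C' (Suc i) \<and> (\<exists>x. ore_step (C' (Suc i)) (C' i) x))" if "j \<le> n" for j
    using that
  proof (induction j)
    case 0
    show ?case using assms(1) assms(3)[of 0] by (intro exI[of _ C] exI[of _ 0]) simp
  next
    case (Suc j)
    then obtain C' m where c: "C' 0 = scalars k H" "C' m = C j" "\<And>i. i \<le> m \<Longrightarrow> hopf_subalgebra k H (C' i)"
      "\<And>i. i < m \<Longrightarrow> C' i \<subseteq> C' (Suc i) \<and> (\<exists>x. ore_step (C' (Suc i)) (C' i) x)" by auto
    show ?case
    proof (cases "C (Suc j) = C j")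
      case True
      then show ?thesis using c by (intro exI[of _ C'] exI[of _ m]) simp
    next
      case False
      then obtain x where x: "ore_step (C (Suc j)) (C j) x" using assms(4)[of j] Suc.prems by auto
      then interpret X: skew_free H "C j" x by (simp add: ore_step_def)
      have sub: "C j \<subseteq> C (Suc j)" using x X.F_one unfolding ore_step_def by blast
      define C'' where "C'' = C'(Suc m := C (Suc j))"
      have "hopf_subalgebra k H (C'' i)" if "i \<le> Suc m" for i
        using that c(3)[of i] assms(3)[OF Suc.prems] by (cases "i = Suc m") (auto simp: C''_def)
      moreover have "C'' i \<subseteq> C'' (Suc i) \<and> (\<exists>x. ore_step (C'' (Suc i)) (C'' i) x)" if "i < Suc m" for i
        using that c(4)[of i] c(2) x sub by (cases "i = m") (auto simp: C''_def)
      ultimately show ?thesis using c(1) by (intro exI[of _ C''] exI[of _ "Suc m"]) (auto simp: C''_def)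
    qed
  qed
  from this[of n] show ?thesis unfolding ore_chain_iff ore_chain_def using assms(2) by simp
qed

end

context coalg_map
begin

lemma f_pow: "x \<in> carrier A \<Longrightarrow> f (x [^]\<^bsub>A\<^esub> (n::nat)) = f x [^]\<^bsub>B\<^esub> n"
  by (induction n) (simp_all add: f_one f_mult)

lemma fil_image:
  assumes "skew_gen A Q x"
  shows "fil B (f ` Q) (f x) n = f ` fil A Q x n"
proof -
  interpret X: skew_gen A Q x by fact
  have f0: "f \<zero>\<^bsub>A\<^esub> = \<zero>\<^bsub>B\<^esub>" by (rule linear_map_zero[OF A.k_algebra_axioms B.k_algebra_axioms f_linear])
  show ?thesis
  proof (induction n)
    case (Suc n)
    have e: "f (r \<otimes>\<^bsub>A\<^esub> x [^]\<^bsub>A\<^esub> n \<oplus>\<^bsub>A\<^esub> u) = f r \<otimes>\<^bsub>B\<^esub> f x [^]\<^bsub>B\<^esub> n \<oplus>\<^bsub>B\<^esub> f u"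
      if "r \<in> Q" "u \<in> X.F n" for r u
      using X.Q_sub[OF that(1)] X.F_closed[OF that(2)] by (simp add: f f_mult f_pow)
    show ?case
    proof (intro equalityI subsetI)
      fix y assume "y \<in> fil B (f ` Q) (f x) (Suc n)"
      then obtain r u where ru: "r \<in> Q" "u \<in> X.F n" "y = f r \<otimes>\<^bsub>B\<^esub> f x [^]\<^bsub>B\<^esub> n \<oplus>\<^bsub>B\<^esub> f u"
        unfolding fil.simps(2) Suc by blast
      show "y \<in> f ` X.F (Suc n)" unfolding ru(3) e[OF ru(1,2), symmetric] by (rule imageI[OF X.FI[OF ru(1,2)]])
    next
      fix y assume "y \<in> f ` X.F (Suc n)"
      then obtain r u where ru: "r \<in> Q" "u \<in> X.F n" "y = f (r \<otimes>\<^bsub>A\<^esub> x [^]\<^bsub>A\<^esub> n \<oplus>\<^bsub>A\<^esub> u)"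
        unfolding fil.simps(2) by blast
      show "y \<in> fil B (f ` Q) (f x) (Suc n)"
        unfolding fil.simps(2) Suc ru(3) e[OF ru(1,2)] using ru(1,2) by blast
    qed
  qed (simp add: f0)
qed

lemma image_ore_step:
  assumes "hopf_algebra k B" and P: "primitive_free k A C Q x w" and hC: "hopf_subalgebra k A C"
  shows "f ` C = f ` Q \<or> (\<exists>y. k_algebra.ore_step k B (f ` C) (f ` Q) y)"
proof (cases "f x \<in> f ` Q")
  interpret P: primitive_free k A C Q x w by (rule P)
  have hQ: "hopf_subalgebra k B (f ` Q)" by (rule hopf_sub_image[OF P.hQ])
  have sub: "subalg k B (f ` Q)" "subalg k B (f ` C)"
    using hQ hopf_sub_image[OF hC] by (auto simp: hopf_subalgebra_def)
  note q = B.subalgD[OF sub(1)]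
  have C_eq: "f ` C = (\<Union>n. fil B (f ` Q) (f x) n)"
    unfolding fil_image[OF P.gen] P.C_eq by (simp add: image_UN)
  {
    case True
    have "fil B (f ` Q) (f x) n \<subseteq> f ` Q" for n
      by (rule B.fil_subalg[OF sub(1) subset_refl True])
    then have "f ` C \<subseteq> f ` Q" unfolding C_eq by blast
    then show ?thesis using P.QC by blast
  next
    case False
    interpret K: hopf_algebra k B by fact
    have gen: "skew_gen B (f ` Q) (f x)"
    proof (intro skew_gen.intro skew_gen_axioms.intro B.A.ring_axioms q(2))
      show "f x \<in> carrier B" by (simp add: f)
      fix r assume "r \<in> f ` Q"
      then obtain r' where r': "r' \<in> Q" "r = f r'" by blast
      obtain s u where su: "s \<in> Q" "u \<in> Q" "x \<otimes>\<^bsub>A\<^esub> r' = s \<otimes>\<^bsub>A\<^esub> x \<oplus>\<^bsub>A\<^esub> u" using P.X.comm[OF r'(1)] by blast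
      have "f x \<otimes>\<^bsub>B\<^esub> r = f (x \<otimes>\<^bsub>A\<^esub> r')" using r' P.X.Q_sub by (simp add: f_mult)
      also have "\<dots> = f s \<otimes>\<^bsub>B\<^esub> f x \<oplus>\<^bsub>B\<^esub> f u"
        unfolding su(3) using su(1,2) P.X.Q_sub by (simp add: f f_mult)
      finally have "f x \<otimes>\<^bsub>B\<^esub> r = f s \<otimes>\<^bsub>B\<^esub> f x \<oplus>\<^bsub>B\<^esub> f u" .
      then show "\<exists>s\<in>f ` Q. \<exists>u\<in>f ` Q. f x \<otimes>\<^bsub>B\<^esub> r = s \<otimes>\<^bsub>B\<^esub> f x \<oplus>\<^bsub>B\<^esub> u" using su by blast
    qed
    have surj: "\<exists>r\<in>f ` Q. \<exists>u\<in>f ` Q. f x \<otimes>\<^bsub>B\<^esub> r = s \<otimes>\<^bsub>B\<^esub> f x \<oplus>\<^bsub>B\<^esub> u" if s: "s \<in> f ` Q" for s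
    proof -
      obtain s' where s': "s' \<in> Q" "s = f s'" using s by blast
      obtain r u where ru: "r \<in> Q" "u \<in> Q" "x \<otimes>\<^bsub>A\<^esub> r = s' \<otimes>\<^bsub>A\<^esub> x \<oplus>\<^bsub>A\<^esub> u" using P.surj[OF s'(1)] by blast
      have "f x \<otimes>\<^bsub>B\<^esub> f r = f (x \<otimes>\<^bsub>A\<^esub> r)" using ru(1) P.X.Q_sub by (simp add: f_mult)
      also have "\<dots> = s \<otimes>\<^bsub>B\<^esub> f x \<oplus>\<^bsub>B\<^esub> f u"
        unfolding ru(3) using s' ru(2) P.X.Q_sub by (simp add: f f_mult)
      finally have "f x \<otimes>\<^bsub>B\<^esub> f r = s \<otimes>\<^bsub>B\<^esub> f x \<oplus>\<^bsub>B\<^esub> f u" .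
      then show ?thesis using ru by blast
    qed
    have fQ: "f ` Q \<subseteq> carrier B" by (rule q(3))
    have w: "ff w \<in> tensor_sub k B B (f ` Q) (f ` Q)"
      by (rule AA.tensor_sub_linear[OF BB.T_k_algebra ff_linear BB.tensor_sub_submodule[OF fQ fQ] P.q(3,3) _ P.w])
        (use P.X.Q_sub in \<open>auto simp: ff_pt intro!: BB.tensor_sub_pt\<close>)
    have "comul B (f x) = BB.pt (f x) \<one>\<^bsub>B\<^esub> \<oplus>\<^bsub>BB.T\<^esub> BB.pt \<one>\<^bsub>B\<^esub> (f x) \<oplus>\<^bsub>BB.T\<^esub> ff w"
      using P.wc by (simp add: linear_mapD[OF ff_linear] ff_pt f_one P.Dx flip: f_comul)
    then interpret R: primitive_ext k B "f ` C" "f ` Q" "f x" "ff w"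
      using P.QC P.xC by (intro primitive_ext.intro primitive_ext_axioms.intro K.hopf_algebra_axioms sub(2) hQ gen w) blast+
    have "skew_free B (f ` Q) (f x)"
    proof (rule R.quotient_skew_free[OF surj _ False])
      \<comment> \<open>The multiple of \<open>1\<close> is formed in the common field
        \<open>k\<close>, so it remains nonzero in the quotient.\<close>
      show "R.nk n \<noteq> \<zero>\<^bsub>k\<^esub>" if "n > 0" for n using P.char[OF that] by (simp add: R.nk_def P.nk_def)
    qed
    then show ?thesis using sub surj C_eq unfolding B.ore_step_def by blast
  }
qed

end

theorem theorem1p1:
  fixes k :: "('k, 'l) ring_scheme" and H :: "('k, 'a, 'm) hopf_scheme"
  assumes "field k"
    and "\<forall>n::nat. n > 0 \<longrightarrow> [n] \<cdot>\<^bsub>k\<^esub> \<one>\<^bsub>k\<^esub> \<noteq> \<zero>\<^bsub>k\<^esub>"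
    and "ihoe_of_field k H"
  shows "(\<forall>B. hopf_subalgebra k H B \<longrightarrow> ihoe_of_field k (sub_hopf k H B)) \<and>
    (\<forall>I. hopf_ideal k H I \<longrightarrow> ihoe_of_field k (quot_hopf k H I))"
proof -
  interpret H: hopf_algebra k H
    using assms(3) by (auto simp: ihoe_of_field_def ihoe_def ihoe_steps_def)
  obtain C n where chain: "H.ore_chain C n" using assms(3) H.ore_chain_iff by blast
  note c = H.chainD[OF chain]
  have ex: "\<exists>x w. primitive_free k H (C (Suc i)) (C i) x w" if i: "i < n" for i
  proof -
    obtain x where x: "H.ore_step (C (Suc i)) (C i) x" using c(5)[OF i] by blast
    obtain w where w: "w \<in> H.tsub (C i) (C i)" "H.D x = H.tp x \<one>\<^bsub>H\<^esub> \<oplus>\<^bsub>H.HH\<^esub> H.tp \<one>\<^bsub>H\<^esub> x \<oplus>\<^bsub>H.HH\<^esub> w"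
      using H.comul_variable[OF chain i x] by blast
    have sf: "skew_free H (C i) x" and C_eq: "C (Suc i) = (\<Union>n. fil H (C i) x n)"
      and surj: "\<And>s. s \<in> C i \<Longrightarrow> \<exists>r\<in>C i. \<exists>u\<in>C i. x \<otimes>\<^bsub>H\<^esub> r = s \<otimes>\<^bsub>H\<^esub> x \<oplus>\<^bsub>H\<^esub> u"
      using x by (auto simp: H.ore_step_def)
    interpret X: skew_free H "C i" x by (rule sf)
    \<comment> \<open>Index two, because \<open>F\<close> bounds the degree strictly.\<close>
    have "x \<in> X.F (Suc (Suc 0))" using X.F_pow[of "Suc 0"] by simp
    then have "x \<in> C (Suc i)" using C_eq by blast
    then interpret P: primitive_ext k H "C (Suc i)" "C i" x w
      using i c(1)[of i] c(1)[of "Suc i"] c(4)[of i] w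
      by (intro primitive_ext.intro primitive_ext_axioms.intro H.hopf_algebra_axioms X.skew_gen_axioms H.hopf_subD(1)) auto
    have "primitive_free k H (C (Suc i)) (C i) x w"
      by (intro primitive_free.intro P.primitive_ext_axioms primitive_free_axioms.intro sf C_eq surj)
        (use assms(2) in \<open>simp_all add: P.nk_def\<close>)
    then show ?thesis by blast
  qed
  show ?thesis
  proof (intro conjI allI impI)
    fix B assume B: "hopf_subalgebra k H B"
    interpret Bh: hopf_algebra k "sub_hopf k H B" by (rule H.sub_hopf_algebra[OF B])
    have hs: "hopf_subalgebra k H (B \<inter> C i)" if "i \<le> n" for i
      using H.hopf_sub_Int[OF B c(1)[OF that]] .
    show "ihoe_of_field k (sub_hopf k H B)"
    proof (rule Bh.ihoe_of_fieldI[of "\<lambda>i. B \<inter> C i" n])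
      have "scalars k H \<subseteq> B"
        using H.subalgD(4)[OF H.hopf_subD(1)[OF B]] H.submod_smult[OF H.subalgD(1)[OF H.hopf_subD(1)[OF B]]]
        by (auto simp: scalars_def)
      then show "B \<inter> C 0 = scalars k (sub_hopf k H B)" using c(2) H.sub_scalars[OF B] by auto
      show "B \<inter> C n = carrier (sub_hopf k H B)"
        using c(3) H.subalgD(3)[OF H.hopf_subD(1)[OF B]] H.sub_ops(1)[OF B] by auto
      show "hopf_subalgebra k (sub_hopf k H B) (B \<inter> C i)" if "i \<le> n" for i
        by (rule H.sub_hopf_subalgebra[OF B hs[OF that]]) simp
      fix i assume i: "i < n"
      obtain x w where "primitive_free k H (C (Suc i)) (C i) x w" using ex[OF i] by blast
      then interpret P: primitive_free k H "C (Suc i)" "C i" x w .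
      have "\<exists>x. Bh.ore_step (B \<inter> C (Suc i)) (B \<inter> C i) x" if "B \<inter> C (Suc i) \<noteq> B \<inter> C i"
        \<comment> \<open>\<open>sub_step\<close> produces the Ore extension inside
          \<open>H\<close>; \<open>sub_ore_step\<close> restates it for the Hopf algebra structure
          on \<open>B\<close>.\<close>
        using P.sub_step[OF B that] H.sub_ore_step[OF B hs[of "Suc i"] _ hs[of i]] i by auto
      then show "B \<inter> C (Suc i) = B \<inter> C i \<or> (\<exists>x. Bh.ore_step (B \<inter> C (Suc i)) (B \<inter> C i) x)" by blast
    qed
  next
    fix I assume I: "hopf_ideal k H I"
    define \<pi> where "\<pi> = (\<lambda>x. I +>\<^bsub>H\<^esub> x)"
    interpret G: hopf_algebra k "quot_hopf k H I" by (rule H.quot_hopf_algebra[OF I])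
    interpret f: coalg_map k H "quot_hopf k H I" \<pi> unfolding \<pi>_def by (rule H.quot_coalg_map[OF I])
    show "ihoe_of_field k (quot_hopf k H I)"
    proof (rule G.ihoe_of_fieldI[of "\<lambda>i. \<pi> ` C i" n])
      show "\<pi> ` C 0 = scalars k (quot_hopf k H I)" unfolding c(2) by (rule f.scalars_image)
      show "\<pi> ` C n = carrier (quot_hopf k H I)" unfolding c(3) \<pi>_def by (rule H.quot_proj_surj[OF I])
      show "hopf_subalgebra k (quot_hopf k H I) (\<pi> ` C i)" if "i \<le> n" for i
        by (rule f.hopf_sub_image[OF c(1)[OF that]])
      fix i assume i: "i < n"
      obtain x w where P: "primitive_free k H (C (Suc i)) (C i) x w" using ex[OF i] by blast
      show "\<pi> ` C (Suc i) = \<pi> ` C i \<or> (\<exists>x. G.ore_step (\<pi> ` C (Suc i)) (\<pi> ` C i) x)"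
        by (rule f.image_ore_step[OF G.hopf_algebra_axioms P c(1)]) (use i in simp)
    qed
  qed
qed

end
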